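(* There is a universal constant $c>0$ such that the following holds for every integer $n\geq 3$ and every $\delta>0$. Let $K\subset\mathbb{R}^n$ be a convex body with $0$ in its interior. Assume that $d_{BM}(K\cap E, K\cap F)<1+\delta$ for all linear $2$-dimensional subspaces $E,F\subset\mathbb{R}^n$. Then $$d_{BM}(K,B^n)<1+c\,n^{2n^2}\delta^{1/6}.$$
   Context: A convex body in a finite-dimensional real vector space is a compact convex set with non-empty interior; $K\cap E$ is regarded as a convex body in the $2$-dimensional space $E$. $B^n$ is the Euclidean unit ball in $\mathbb{R}^n$. For convex bodies $K\subset V$, $L\subset W$ in real vector spaces of the same finite dimension, the (affine, multiplicative) Banach--Mazur distance is $$d_{BM}(K,L)=\inf\{\lambda>0:\ K\subset TL\subset\lambda K+z\ \text{for some affine map } T:W\to V \text{ and some } z\in V\}.$$ *)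

theory Defs
  imports "HOL-Analysis.Analysis" "HOL-Analysis.Finite_Function_Topology"
begin

(* R^n for a dimension n that is a term rather than a type: the vectors supported on the first n
   coordinates in the space of finitely supported real sequences. The library gives that space the
   l1 norm. On each subspace Rn n this norm induces the usual topology of R^n, but it is not the
   Euclidean norm, so the ball below is not stated with cball. *)
definition Rn :: "nat \<Rightarrow> (nat \<Rightarrow>\<^sub>0 real) set" where
  "Rn n = {x. Poly_Mapping.keys x \<subseteq> {..<n}}"

definition euclidean_unit_ball :: "nat \<Rightarrow> (nat \<Rightarrow>\<^sub>0 real) set" where
  "euclidean_unit_ball n = {x \<in> Rn n. L2_set (Poly_Mapping.lookup x) {..<n} \<le> 1}"

(* The interior of a set relative to a subspace V, since V has empty interior in the ambient type. *)
abbreviation interior_in :: "'a::real_normed_vector set \<Rightarrow> 'a set \<Rightarrow> 'a set" where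
  "interior_in V K \<equiv> (top_of_set V) interior_of K"

definition convex_body_in :: "'a::real_normed_vector set \<Rightarrow> 'a set \<Rightarrow> bool" where
  "convex_body_in V K \<longleftrightarrow> K \<subseteq> V \<and> compact K \<and> convex K \<and> interior_in V K \<noteq> {}"

definition affine_map_between ::
    "'b::real_vector set \<Rightarrow> 'a::real_vector set \<Rightarrow> ('b \<Rightarrow> 'a) \<Rightarrow> bool" where
  "affine_map_between W V T \<longleftrightarrow> T ` W \<subseteq> V \<and>
     (\<forall>x\<in>W. \<forall>y\<in>W. \<forall>t. T ((1 - t) *\<^sub>R x + t *\<^sub>R y) = (1 - t) *\<^sub>R T x + t *\<^sub>R T y)"

(* Affine, multiplicative Banach-Mazur distance of K in V and L in W. It is meant for convex bodies
   in subspaces V and W of the same finite dimension, where the infimum is over a nonempty set. *)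
definition banach_mazur_dist ::
    "'a::real_vector set \<Rightarrow> 'a set \<Rightarrow> 'b::real_vector set \<Rightarrow> 'b set \<Rightarrow> real" where
  "banach_mazur_dist V K W L =
     Inf {l. l > 0 \<and> (\<exists>T z. affine_map_between W V T \<and> z \<in> V \<and>
                K \<subseteq> T ` L \<and> T ` L \<subseteq> (\<lambda>x. l *\<^sub>R x + z) ` K)}"

end

theory Submission
  imports Defs
begin

text \<open>A linear bijection normalizes a planar body so that its centroid and its pseudovariance (the mean of
  \<open>(z - g)\<^sup>2\<close>) vanish; this is unique up to similarity. Let \<open>\<Phi>\<^sub>k\<close> be the \<open>k\<close>-th Fourier coefficient of
  the support function of the normalized body. Rotating the body by \<open>t\<close> multiplies \<open>\<Phi>\<^sub>k\<close> by \<open>cis (- k t)\<close>, so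
  over the rectangle of orthonormal frames of planes in a 3-dimensional space, whose two horizontal edges
  turn one plane in opposite senses, \<open>\<Phi>\<^sub>k\<close> of the section has no continuous logarithm for \<open>k \<ge> 1\<close>: some
  section has \<open>\<Phi>\<^sub>k = 0\<close>. The vanishing of \<open>\<Phi>\<^sub>k\<close> is affinely invariant and every section is
  \<open>(1 + \<delta>)\<close>-close to that one, so all coefficients of index \<open>k \<ge> 1\<close> of every section are \<open>O(\<delta>)\<close>.
  As support functions are Lipschitz, each section is \<open>(1 + O(sqrt \<delta>))\<close>-close to an ellipse.

  If every section is \<open>(1 + e\<^sup>3)\<close>-close to an ellipse, some defining function of the boundary, built from
  the gauge and positive near a chosen centre, is \<open>O(e)\<close>-close to a quadratic polynomial on each segment
  of the body. Such a function is close to one quadratic polynomial on the whole body, by interpolation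
  along lines that successively kill coordinates, and a superlevel set of that polynomial is the ellipsoid.\<close>

section \<open>Finitely supported sequences\<close>

text \<open>The exponent 1/6 is 1/2 times 1/3. The factor 1/2 is lost in the plane: the sections
  found for different k need not coincide, so no single section is known to be an ellipse. What
  remains is a bound of order \<delta> uniform in k, and for a Lipschitz function this yields only
  order \<open>sqrt \<delta>\<close> in the supremum norm. The factor 1/3 is lost in space: only
  planes through 0 are controlled, and 0 may lie arbitrarily close to the boundary. If 0 has depth
  s, the ellipses of different planes can be normalized by a common value at 0, at the price of a
  factor 1/s. If 0 is almost on the boundary, they are normalized instead by a functional that
  almost supports the body at 0, at the price of an error of order \<open>sqrt s\<close>. With
  sections elliptic up to \<open>e ^ 3\<close>, the threshold \<open>s = e ^ 2\<close> makes both
  errors of order e. Bodies are brought into bounded position by bases chosen greedily in the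
  difference body. This keeps all constants explicit: a power of n times an exponential in n, which
  \<open>n ^ (2 * n\<^sup>2)\<close> absorbs.\<close>

lemma lookup_scaleR_pm: "Poly_Mapping.lookup (a *\<^sub>R x) i = a * Poly_Mapping.lookup x i" for x :: "nat \<Rightarrow>\<^sub>0 real"
  by (simp add: scaleR_poly_mapping_def)

lemma linear_lookup_pm: "linear (\<lambda>x :: nat \<Rightarrow>\<^sub>0 real. Poly_Mapping.lookup x i)"
  by (intro linearI) (auto simp: lookup_scaleR_pm lookup_add)

abbreviation unit_pm :: "nat \<Rightarrow> nat \<Rightarrow>\<^sub>0 real" where "unit_pm i \<equiv> Poly_Mapping.single i 1"

lemma Rn_iff: "x \<in> Rn n \<longleftrightarrow> (\<forall>i\<ge>n. Poly_Mapping.lookup x i = 0)"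
  unfolding Rn_def by (auto simp: subset_iff in_keys_iff) (meson not_le)

lemma subspace_Rn: "subspace (Rn n)"
  unfolding subspace_def by (auto simp: Rn_iff lookup_scaleR_pm lookup_add)

lemma unit_pm_Rn: "i < n \<Longrightarrow> unit_pm i \<in> Rn n"
  by (auto simp: Rn_iff lookup_single when_def)

lemma norm_Rn: "x \<in> Rn n \<Longrightarrow> norm x = (\<Sum>i<n. \<bar>Poly_Mapping.lookup x i\<bar>)"
  unfolding norm_poly_mapping_def dist_poly_mapping_def
  by (rule sum.mono_neutral_cong_left) (auto simp: Rn_def in_keys_iff)

lemma lookup_sum_unit:
  "Poly_Mapping.lookup (\<Sum>i<n. c i *\<^sub>R unit_pm i) j = (if j < n then c j else 0)"
proof -
  have "Poly_Mapping.lookup (\<Sum>i<n. c i *\<^sub>R unit_pm i) j = (\<Sum>i<n. c i * Poly_Mapping.lookup (unit_pm i) j)"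
    by (subst linear_sum[OF linear_lookup_pm]) (simp add: lookup_scaleR_pm)
  also have "\<dots> = (\<Sum>i<n. if i = j then c j else 0)"
    by (rule sum.cong) (auto simp: lookup_single when_def)
  finally show ?thesis by (simp)
qed

lemma Rn_expand: "x \<in> Rn n \<Longrightarrow> (\<Sum>i<n. Poly_Mapping.lookup x i *\<^sub>R unit_pm i) = x"
  by (rule poly_mapping_eqI) (auto simp: lookup_sum_unit Rn_iff)

lemma sum_unit_Rn: "(\<Sum>i<n. c i *\<^sub>R unit_pm i) \<in> Rn n"
  by (simp add: Rn_iff lookup_sum_unit)

lemma abs_lookup_le_norm: "\<bar>Poly_Mapping.lookup x i\<bar> \<le> norm x" for x :: "nat \<Rightarrow>\<^sub>0 real"
proof (cases "i \<in> Poly_Mapping.keys x")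
  case True
  then show ?thesis
    unfolding norm_poly_mapping_def dist_poly_mapping_def
    using member_le_sum[of i "Poly_Mapping.keys x" "\<lambda>n. dist (Poly_Mapping.lookup x n) 0"] by simp
qed (simp add: in_keys_iff)

lemma bounded_linear_lookup: "bounded_linear (\<lambda>x :: nat \<Rightarrow>\<^sub>0 real. Poly_Mapping.lookup x i)"
  by (rule bounded_linear_intro[of _ 1])
     (auto simp: lookup_scaleR_pm lookup_add abs_lookup_le_norm)

lemma closed_Rn: "closed (Rn n)"
proof -
  have "Rn n = (\<Inter>i\<in>{n..}. {x. Poly_Mapping.lookup x i = 0})" by (auto simp: Rn_iff)
  moreover have "closed {x. Poly_Mapping.lookup x i = (0::real)}" for i :: nat
    by (intro closed_Collect_eq continuous_intros linear_continuous_on bounded_linear_lookup)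
  ultimately show ?thesis by auto
qed

lemma Rn_0: "Rn 0 = {0}"
  by (auto simp: Rn_def)

lemma Rn_mono: "m \<le> n \<Longrightarrow> Rn m \<subseteq> Rn n"
  by (auto simp: Rn_iff)

lemma Rn_SucI: "x \<in> Rn (Suc n) \<Longrightarrow> Poly_Mapping.lookup x n = 0 \<Longrightarrow> x \<in> Rn n"
  unfolding Rn_iff by (metis le_eq_less_or_eq Suc_leI)

text \<open>A greedy substitute for an Auerbach basis. The last vector \<open>e\<close> maximizes
  the last coordinate on \<open>D\<close>; the others come from the slice
  \<open>D \<inter> Rn n\<close>. Removing from \<open>x\<close> its component along
  \<open>e\<close> leaves twice a point of the slice, so every dimension doubles the bound on the
  coefficients.\<close>

lemma symmetric_body_basis:
  assumes "D \<subseteq> Rn n" "compact D" "convex D" "\<And>x. x \<in> D \<Longrightarrow> -x \<in> D"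
    and "\<And>i. i < n \<Longrightarrow> \<exists>t>0. t *\<^sub>R unit_pm i \<in> D"
  shows "\<exists>d c. (\<forall>i<n. d i \<in> D \<and> linear (c i)) \<and> (\<forall>i<n. \<forall>j<n. c i (d j) = (if i = j then 1 else 0 :: real)) \<and>
     (\<forall>x\<in>Rn n. (\<Sum>i<n. c i x *\<^sub>R d i) = x) \<and> (\<forall>x\<in>D. \<forall>i<n. \<bar>c i x\<bar> \<le> 2 ^ n)"
  using assms
proof (induction n arbitrary: D)
  case 0
  then show ?case by (auto simp: Rn_0)
next
  case (Suc n)
  let ?l = "\<lambda>x. Poly_Mapping.lookup x n :: real"
  have "D \<noteq> {}" using Suc.prems(5)[of 0] by auto
  then obtain e where e: "e \<in> D" "\<And>x. x \<in> D \<Longrightarrow> ?l x \<le> ?l e"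
    using continuous_attains_sup[OF Suc.prems(2), of ?l] linear_continuous_on[OF bounded_linear_lookup] by blast
  obtain t where t: "t > 0" "t *\<^sub>R unit_pm n \<in> D" using Suc.prems(5)[of n] by auto
  have le: "?l e > 0" using e(2)[OF t(2)] t(1) by (simp add: lookup_scaleR_pm)
  have abs_le: "\<bar>?l x\<bar> \<le> ?l e" if "x \<in> D" for x
    using e(2)[OF that] e(2)[OF Suc.prems(4)[OF that]] by (simp add: abs_le_iff)
  let ?D = "D \<inter> Rn n"
  have "\<exists>d c. (\<forall>i<n. d i \<in> ?D \<and> linear (c i)) \<and> (\<forall>i<n. \<forall>j<n. c i (d j) = (if i = j then 1 else 0 :: real)) \<and>
     (\<forall>x\<in>Rn n. (\<Sum>i<n. c i x *\<^sub>R d i) = x) \<and> (\<forall>x\<in>?D. \<forall>i<n. \<bar>c i x\<bar> \<le> 2 ^ n)"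
  proof (rule Suc.IH)
    show "compact ?D" using Suc.prems(2) closed_Rn by auto
    show "convex ?D" using Suc.prems(3) subspace_Rn by (simp add: convex_Int subspace_imp_convex)
    show "-x \<in> ?D" if "x \<in> ?D" for x using that Suc.prems(4) subspace_neg[OF subspace_Rn] by auto
    show "\<exists>t>0. t *\<^sub>R unit_pm i \<in> ?D" if "i < n" for i
      using Suc.prems(5)[of i] that unit_pm_Rn[OF that] subspace_scale[OF subspace_Rn] by fastforce
  qed auto
  then obtain d c where dc: "\<forall>i<n. d i \<in> ?D \<and> linear (c i)"
    and cd': "\<forall>i<n. \<forall>j<n. c i (d j) = (if i = j then 1 else 0 :: real)"
    and ex: "\<forall>x\<in>Rn n. (\<Sum>i<n. c i x *\<^sub>R d i) = x" and bd': "\<forall>x\<in>?D. \<forall>i<n. \<bar>c i x\<bar> \<le> 2 ^ n"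
    by (elim exE conjE) (rule that)
  have d: "\<And>i. i < n \<Longrightarrow> d i \<in> ?D" and c: "\<And>i. i < n \<Longrightarrow> linear (c i)" using dc by blast+
  have cd: "\<And>i j. i < n \<Longrightarrow> j < n \<Longrightarrow> c i (d j) = (if i = j then 1 else 0 :: real)" using cd' by blast
  have bd: "\<And>x i. x \<in> ?D \<Longrightarrow> i < n \<Longrightarrow> \<bar>c i x\<bar> \<le> 2 ^ n" using bd' by blast
  define cn where "cn = (\<lambda>x. ?l x / ?l e)"
  define r where "r = (\<lambda>x. x - cn x *\<^sub>R e)"
  have cnl: "linear cn" unfolding cn_def
    by (intro linearI) (auto simp: lookup_scaleR_pm lookup_add add_divide_distrib)
  have rl: "linear r" unfolding r_def
    by (intro linearI) (simp_all add: linear_add[OF cnl] linear_scale[OF cnl] algebra_simps)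
  have rR: "r x \<in> Rn n" if "x \<in> Rn (Suc n)" for x
  proof (rule Rn_SucI)
    show "r x \<in> Rn (Suc n)" unfolding r_def using that e(1) Suc.prems(1)
      by (auto intro!: subspace_diff subspace_scale subspace_Rn)
    show "?l (r x) = 0" using le by (simp add: r_def cn_def lookup_scaleR_pm lookup_minus)
  qed
  have cn0: "cn x = 0" if "x \<in> Rn n" for x using that by (auto simp: cn_def Rn_iff)
  have cne: "cn e = 1" using le by (simp add: cn_def)
  have cn1: "\<bar>cn x\<bar> \<le> 1" if "x \<in> D" for x using abs_le[OF that] le by (simp add: cn_def)
  define d' where "d' = (\<lambda>i. if i = n then e else d i)"
  define c' where "c' = (\<lambda>i. if i = n then cn else c i \<circ> r)"
  show ?case
  proof (intro exI[of _ d'] exI[of _ c'] conjI allI impI ballI)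
    fix i assume i: "i < Suc n"
    show "d' i \<in> D" using i d e by (auto simp: d'_def)
    show "linear (c' i)" using i c cnl rl by (auto simp: c'_def intro: linear_compose)
    fix j assume j: "j < Suc n"
    show "c' i (d' j) = (if i = j then 1 else 0)"
      using i j cd[of i j] d[of j] cne cn0[of "d j"] linear_0[OF c[of i]]
      by (auto simp: c'_def d'_def r_def)
  next
    fix x assume x: "x \<in> Rn (Suc n)"
    have "(\<Sum>i<n. c' i x *\<^sub>R d' i) = (\<Sum>i<n. c i (r x) *\<^sub>R d i)"
      by (rule sum.cong) (auto simp: c'_def d'_def)
    also have "\<dots> = r x" using ex rR[OF x] by blast
    finally show "(\<Sum>i<Suc n. c' i x *\<^sub>R d' i) = x" by (simp add: c'_def d'_def r_def)
  next
    fix x i assume x: "x \<in> D" and i: "i < Suc n"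
    have xR: "x \<in> Rn (Suc n)" using x Suc.prems by auto
    \<comment> \<open>By maximality of \<open>e\<close> the factor lies in [-1, 1], so this point
      lies between \<open>e\<close> and \<open>- e\<close>. Its average with \<open>x\<close> is
      half of \<open>r x\<close>.\<close>
    have ce: "(- cn x) *\<^sub>R e \<in> D"
    proof -
      have "(- cn x) *\<^sub>R e = ((1 - cn x)/2) *\<^sub>R e + ((1 + cn x)/2) *\<^sub>R (- e)"
        by (simp flip: scaleR_minus_left scaleR_left_distrib) (simp add: field_simps)
      moreover have "\<dots> \<in> D" using Suc.prems(3) e(1) Suc.prems(4)[OF e(1)] cn1[OF x]
        by (intro convexD) (auto simp: abs_le_iff field_simps)
      ultimately show ?thesis by simp
    qed
    have h: "(1/2) *\<^sub>R r x \<in> ?D"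
    proof
      have "(1/2) *\<^sub>R r x = (1/2) *\<^sub>R x + (1/2) *\<^sub>R ((- cn x) *\<^sub>R e)" by (simp add: r_def algebra_simps)
      then show "(1/2) *\<^sub>R r x \<in> D" using convexD[OF Suc.prems(3) x ce, of "1/2" "1/2"] by simp
      show "(1/2) *\<^sub>R r x \<in> Rn n" using rR[OF xR] by (intro subspace_scale subspace_Rn)
    qed
    show "\<bar>c' i x\<bar> \<le> 2 ^ Suc n"
    proof (cases "i = n")
      case True
      then show ?thesis using order_trans[OF cn1[OF x] one_le_power[of "2::real" "Suc n"]] by (simp add: c'_def)
    next
      case False
      then have "i < n" using i by auto
      then show ?thesis using bd[OF h, of i] c[of i] by (simp add: c'_def linear_scale[OF c[of i]] abs_mult)
    qed
  qed
qed

section \<open>Functions that are nearly quadratic on segments\<close>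

definition quadratic_on_segments :: "real \<Rightarrow> ('a::real_vector \<Rightarrow> real) \<Rightarrow> 'a set \<Rightarrow> bool" where
  "quadratic_on_segments \<theta> F S \<longleftrightarrow>
     (\<forall>x\<in>S. \<forall>y\<in>S. \<exists>a b c. \<forall>t\<in>{0..1}. \<bar>F (x + t *\<^sub>R (y - x)) - (a + b * t + c * t\<^sup>2)\<bar> \<le> \<theta>)"

definition quadratic_polynomial :: "('a::real_vector \<Rightarrow> real) \<Rightarrow> bool" where
  "quadratic_polynomial q \<longleftrightarrow> (\<exists>c L B. linear L \<and> bilinear B \<and> q = (\<lambda>x. c + L x + B x x))"

lemma quadratic_polynomial_on_line:
  assumes "quadratic_polynomial q"
  shows "\<exists>a b c. \<forall>t. q (x + t *\<^sub>R d) = a + b * t + c * t\<^sup>2"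
proof -
  obtain c0 L B where L: "linear L" and B: "bilinear B" and q: "q = (\<lambda>x. c0 + L x + B x x)"
    using assms unfolding quadratic_polynomial_def by blast
  have "q (x + t *\<^sub>R d) = (c0 + L x + B x x) + (L d + B x d + B d x) * t + B d d * t\<^sup>2" for t
    unfolding q
    by (simp add: linear_add[OF L] linear_scale[OF L] bilinear_ladd[OF B] bilinear_radd[OF B]
        bilinear_lmul[OF B] bilinear_rmul[OF B] algebra_simps power2_eq_square)
  then show ?thesis by blast
qed

lemma quadratic_on_segments_diff:
  assumes F: "quadratic_on_segments \<theta> F S" and q: "quadratic_polynomial q"
  shows "quadratic_on_segments \<theta> (\<lambda>x. F x - q x) S"
  unfolding quadratic_on_segments_def
proof (intro ballI)
  fix x y assume "x \<in> S" "y \<in> S"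
  then obtain a b c where 1: "\<forall>t\<in>{0..1}. \<bar>F (x + t *\<^sub>R (y - x)) - (a + b * t + c * t\<^sup>2)\<bar> \<le> \<theta>"
    using F unfolding quadratic_on_segments_def by blast
  obtain a' b' c' where 2: "\<forall>t. q (x + t *\<^sub>R (y - x)) = a' + b' * t + c' * t\<^sup>2"
    using quadratic_polynomial_on_line[OF q] by blast
  have "\<forall>t\<in>{0..1}. \<bar>F (x + t *\<^sub>R (y - x)) - q (x + t *\<^sub>R (y - x)) - ((a - a') + (b - b') * t + (c - c') * t\<^sup>2)\<bar> \<le> \<theta>"
    using 1 2 by (simp add: algebra_simps)
  then show "\<exists>a b c. \<forall>t\<in>{0..1}. \<bar>F (x + t *\<^sub>R (y - x)) - q (x + t *\<^sub>R (y - x)) - (a + b * t + c * t\<^sup>2)\<bar> \<le> \<theta>"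
    by blast
qed

text \<open>The weights are exact for 1, t and t^2, so they are Lagrange weights that evaluate a
  quadratic at \<open>t0\<close> from three other values. Passing from \<open>F\<close> to its
  quadratic costs \<open>\<theta>\<close> at each node, amplified by \<open>W\<close>, and
  \<open>\<theta>\<close> once more at \<open>t0\<close>.\<close>

lemma quadratic_on_segments_interpolation:
  assumes F: "quadratic_on_segments \<theta> F S" and "p + lo *\<^sub>R d \<in> S" "p + hi *\<^sub>R d \<in> S" "lo < hi"
    and "t0 \<in> {lo..hi}" "t1 \<in> {lo..hi}" "t2 \<in> {lo..hi}" "t3 \<in> {lo..hi}"
    and w: "w1 + w2 + w3 = 1" "w1 * t1 + w2 * t2 + w3 * t3 = t0" "w1 * t1\<^sup>2 + w2 * t2\<^sup>2 + w3 * t3\<^sup>2 = t0\<^sup>2"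
    and W: "\<bar>w1\<bar> + \<bar>w2\<bar> + \<bar>w3\<bar> \<le> W"
    and m: "\<bar>F (p + t1 *\<^sub>R d)\<bar> \<le> m" "\<bar>F (p + t2 *\<^sub>R d)\<bar> \<le> m" "\<bar>F (p + t3 *\<^sub>R d)\<bar> \<le> m"
  shows "\<bar>F (p + t0 *\<^sub>R d)\<bar> \<le> W * m + (1 + W) * \<theta>"
proof -
  define x where "x = p + lo *\<^sub>R d"
  define y where "y = p + hi *\<^sub>R d"
  obtain a b c where abc: "\<forall>t\<in>{0..1}. \<bar>F (x + t *\<^sub>R (y - x)) - (a + b * t + c * t\<^sup>2)\<bar> \<le> \<theta>"
    using F assms(2,3) unfolding quadratic_on_segments_def x_def y_def by blast
  define s where "s = (\<lambda>t. (t - lo) / (hi - lo))"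
  have pt: "p + t *\<^sub>R d = x + s t *\<^sub>R (y - x)" for t
  proof -
    have "s t *\<^sub>R (y - x) = (s t * (hi - lo)) *\<^sub>R d" by (simp add: x_def y_def algebra_simps)
    also have "s t * (hi - lo) = t - lo" using \<open>lo < hi\<close> by (simp add: s_def)
    finally show ?thesis by (simp add: x_def algebra_simps)
  qed
  define P where "P = (\<lambda>t. a + b * s t + c * (s t)\<^sup>2)"
  have near: "\<bar>F (p + t *\<^sub>R d) - P t\<bar> \<le> \<theta>" if "t \<in> {lo..hi}" for t
  proof -
    have "s t \<in> {0..1}" using that \<open>lo < hi\<close> by (simp add: s_def field_simps)
    then show ?thesis using abc unfolding pt P_def by blast
  qed
  define \<alpha> where "\<alpha> = 1 / (hi - lo)"
  define \<beta> where "\<beta> = - lo * \<alpha>"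
  have s: "s t = \<alpha> * t + \<beta>" for t
    by (simp add: s_def \<alpha>_def \<beta>_def diff_divide_distrib)
  have Pt: "P t = (a + b * \<beta> + c * \<beta>\<^sup>2) + (b * \<alpha> + 2 * c * \<alpha> * \<beta>) * t + c * \<alpha>\<^sup>2 * t\<^sup>2" for t
    unfolding P_def s by (simp add: algebra_simps power2_eq_square)
  have gen: "w1 * (A + B * t1 + C * t1\<^sup>2) + w2 * (A + B * t2 + C * t2\<^sup>2) + w3 * (A + B * t3 + C * t3\<^sup>2)
     = A + B * t0 + C * t0\<^sup>2" for A B C
  proof -
    have "w1 * (A + B * t1 + C * t1\<^sup>2) + w2 * (A + B * t2 + C * t2\<^sup>2) + w3 * (A + B * t3 + C * t3\<^sup>2)
      = A * (w1 + w2 + w3) + B * (w1 * t1 + w2 * t2 + w3 * t3) + C * (w1 * t1\<^sup>2 + w2 * t2\<^sup>2 + w3 * t3\<^sup>2)"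
      by (simp add: algebra_simps)
    then show ?thesis by (simp add: w)
  qed
  have PP: "P t0 = w1 * P t1 + w2 * P t2 + w3 * P t3"
    unfolding Pt using gen by simp
  have th: "\<theta> \<ge> 0" using near[OF assms(5)] by linarith
  have mt: "m + \<theta> \<ge> 0" using m th by linarith
  have b: "\<bar>w * P t\<bar> \<le> \<bar>w\<bar> * (m + \<theta>)" if "t \<in> {lo..hi}" "\<bar>F (p + t *\<^sub>R d)\<bar> \<le> m" for w t
  proof -
    have "\<bar>P t\<bar> \<le> m + \<theta>" using near[OF that(1)] that(2) by linarith
    then show ?thesis by (simp add: abs_mult mult_left_mono)
  qed
  have "\<bar>P t0\<bar> \<le> (\<bar>w1\<bar> + \<bar>w2\<bar> + \<bar>w3\<bar>) * (m + \<theta>)"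
    unfolding PP using b[OF assms(6) m(1), of w1] b[OF assms(7) m(2), of w2] b[OF assms(8) m(3), of w3]
    by (simp only: distrib_right) linarith
  also have "\<dots> \<le> W * (m + \<theta>)" using W mt by (rule mult_right_mono)
  finally show ?thesis using near[OF assms(5)] by (simp add: algebra_simps)
qed

text \<open>There are as many nodes as coefficients of a quadratic polynomial, and the coefficients
  are solved for one at a time: the points \<open>unit_pm i\<close> and \<open>- unit_pm i\<close>
  give the linear and diagonal terms, the midpoints the mixed ones.\<close>

lemma quadratic_interpolant_exists:
  fixes F :: "(nat \<Rightarrow>\<^sub>0 real) \<Rightarrow> real"
  shows "\<exists>q. quadratic_polynomial q \<and> q 0 = F 0 \<and>
    (\<forall>i<n. q (unit_pm i) = F (unit_pm i) \<and> q (- unit_pm i) = F (- unit_pm i)) \<and>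
    (\<forall>i<n. \<forall>j<i. q ((1/2) *\<^sub>R (unit_pm i + unit_pm j)) = F ((1/2) *\<^sub>R (unit_pm i + unit_pm j)))"
proof -
  define a where "a = (\<lambda>i. (F (unit_pm i) - F (- unit_pm i)) / 2)"
  define b where "b = (\<lambda>i. (F (unit_pm i) + F (- unit_pm i)) / 2 - F 0)"
  \<comment> \<open>A triangular matrix instead of a symmetric one: at the midpoint for
    \<open>j < i\<close> the only mixed term is \<open>M i j\<close>.\<close>
  define M where "M = (\<lambda>i j. if i = j then b i else if j < i then
     4 * (F ((1/2) *\<^sub>R (unit_pm i + unit_pm j)) - F 0 - (a i + a j) / 2) - b i - b j else 0)"
  define L where "L = (\<lambda>x. \<Sum>i<n. a i * Poly_Mapping.lookup x i)"
  define B where "B = (\<lambda>x y. \<Sum>i<n. \<Sum>j<n. M i j * Poly_Mapping.lookup x i * Poly_Mapping.lookup y j)"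
  define q where "q = (\<lambda>x. F 0 + L x + B x x)"
  have L: "linear L" unfolding L_def
    by (intro linearI) (simp_all add: lookup_scaleR_pm lookup_add algebra_simps sum.distrib sum_distrib_left)
  have B: "bilinear B" unfolding B_def bilinear_def
    by (intro allI conjI linearI) (simp_all add: lookup_scaleR_pm lookup_add algebra_simps sum.distrib sum_distrib_left)
  have qq: "quadratic_polynomial q" unfolding quadratic_polynomial_def q_def using L B by blast
  have Lu: "L (unit_pm i) = a i" if "i < n" for i
  proof -
    have "L (unit_pm i) = (\<Sum>k<n. if k = i then a i else 0)"
      unfolding L_def by (rule sum.cong) (auto simp: lookup_single when_def)
    then show ?thesis using that by simp
  qed
  have Bu: "B (unit_pm i) (unit_pm j) = M i j" if "i < n" "j < n" for i j
  proof -
    have "B (unit_pm i) (unit_pm j) = (\<Sum>k<n. \<Sum>l<n. if l = j then (if k = i then M i j else 0) else 0)"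
      unfolding B_def by (intro sum.cong) (auto simp: lookup_single when_def)
    also have "\<dots> = (\<Sum>k<n. (if k = i then M i j else 0))" using that by simp
    finally show ?thesis using that by simp
  qed
  show ?thesis
  proof (intro exI[of _ q] conjI qq allI impI)
    show "q 0 = F 0" by (simp add: q_def linear_0[OF L] bilinear_lzero[OF B])
  next
    fix i assume i: "i < n"
    show "q (unit_pm i) = F (unit_pm i)"
      using i by (simp add: q_def Lu Bu M_def a_def b_def field_simps)
    show "q (- unit_pm i) = F (- unit_pm i)"
      using i by (simp add: q_def linear_neg[OF L] bilinear_lneg[OF B] bilinear_rneg[OF B] Lu Bu M_def a_def b_def field_simps del: single_uminus)
    fix j assume j: "j < i"
    then show "q ((1/2) *\<^sub>R (unit_pm i + unit_pm j)) = F ((1/2) *\<^sub>R (unit_pm i + unit_pm j))"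
      using i by (simp add: q_def linear_add[OF L] linear_scale[OF L] bilinear_ladd[OF B] bilinear_radd[OF B]
        bilinear_lmul[OF B] bilinear_rmul[OF B] Lu Bu M_def) (simp add: field_simps)
  qed
qed

lemma norm_unit_comb_le: "norm (s *\<^sub>R unit_pm i + t *\<^sub>R unit_pm j) \<le> \<bar>s\<bar> + \<bar>t\<bar>"
proof -
  have 1: "norm (unit_pm i) = 1" for i
    by (simp add: norm_poly_mapping_def dist_poly_mapping_def)
  show ?thesis using norm_triangle_ineq[of "s *\<^sub>R unit_pm i" "t *\<^sub>R unit_pm j"] by (simp add: 1)
qed

text \<open>\<open>G\<close> stands for the difference of a function and its quadratic interpolant.
  Smallness spreads from the nodes to the axes, then to the coordinate planes, then to larger
  supports; each time a segment is used that carries three points where \<open>G\<close> is already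
  known to be small.\<close>

locale quadratic_with_zero_nodes =
  fixes n :: nat and \<theta> :: real and G :: "(nat \<Rightarrow>\<^sub>0 real) \<Rightarrow> real"
  assumes Q: "quadratic_on_segments \<theta> G (cball 0 2 \<inter> Rn n)"
    and G0: "G 0 = 0" and Gp: "i < n \<Longrightarrow> G (unit_pm i) = 0" and Gm: "i < n \<Longrightarrow> G (- unit_pm i) = 0"
    and Gd: "i < n \<Longrightarrow> j < n \<Longrightarrow> i \<noteq> j \<Longrightarrow> G ((1/2) *\<^sub>R (unit_pm i + unit_pm j)) = 0"
    and th: "\<theta> \<ge> 0"
begin

lemma comb_in: "i < n \<Longrightarrow> j < n \<Longrightarrow> \<bar>s\<bar> + \<bar>t\<bar> \<le> 2 \<Longrightarrow> s *\<^sub>R unit_pm i + t *\<^sub>R unit_pm j \<in> cball 0 2 \<inter> Rn n"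
  using norm_unit_comb_le[of s i t j] unit_pm_Rn[of i n] unit_pm_Rn[of j n]
  by (auto intro!: subspace_add subspace_scale subspace_Rn)

text \<open>Interpolation from -1, 0 and 1. The range up to 2, where the weights sum to at most 7,
  is needed for the endpoints of the segments in \<open>quadrant_bound\<close>.\<close>

lemma axis_bound: assumes "i < n" "\<bar>t\<bar> \<le> 2" shows "\<bar>G (t *\<^sub>R unit_pm i)\<bar> \<le> 8 * \<theta>"
proof -
  have "\<bar>G (0 + t *\<^sub>R unit_pm i)\<bar> \<le> 7 * 0 + (1 + 7) * \<theta>"
  proof (rule quadratic_on_segments_interpolation[OF Q, of 0 "-2" "unit_pm i" 2 t "-1" 0 1 "t*(t-1)/2" "1-t\<^sup>2" "t*(t+1)/2"])
    show "0 + (-2) *\<^sub>R unit_pm i \<in> cball 0 2 \<inter> Rn n" "0 + 2 *\<^sub>R unit_pm i \<in> cball 0 2 \<inter> Rn n"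
      using comb_in[of i i "-2" 0] comb_in[of i i 2 0] assms(1) by auto
    have t2: "t\<^sup>2 \<le> 4" using abs_le_square_iff[of t 2] assms(2) by simp
    have "\<bar>t*(t-1)/2\<bar> + \<bar>t*(t+1)/2\<bar> \<le> (\<bar>t\<bar>*\<bar>t - 1\<bar> + \<bar>t\<bar>*\<bar>t+1\<bar>)/2" by (simp add: abs_mult)
    also have "\<dots> = \<bar>t\<bar> * (\<bar>t - 1\<bar> + \<bar>t+1\<bar>) / 2" by (simp add: algebra_simps)
    also have "\<dots> \<le> (if \<bar>t\<bar> \<le> 1 then \<bar>t\<bar> else t\<^sup>2)"
      by (auto simp: abs_if power2_eq_square algebra_simps split: if_splits)
    finally have *: "\<bar>t*(t-1)/2\<bar> + \<bar>t*(t+1)/2\<bar> \<le> (if \<bar>t\<bar> \<le> 1 then \<bar>t\<bar> else t\<^sup>2)" .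
    have "\<bar>1 - t\<^sup>2\<bar> \<le> (if \<bar>t\<bar> \<le> 1 then 1 else t\<^sup>2 - 1)"
      using abs_le_square_iff[of t 1] by (auto simp: abs_if)
    then show "\<bar>t*(t-1)/2\<bar> + \<bar>1-t\<^sup>2\<bar> + \<bar>t*(t+1)/2\<bar> \<le> 7" using * t2 by (auto split: if_splits)
  qed (use assms Gp[OF assms(1)] Gm[OF assms(1)] G0 in \<open>auto simp: power2_eq_square field_simps\<close>)
  then show ?thesis by simp
qed

lemma weights_unit: fixes t :: real assumes "\<bar>t\<bar> \<le> 1" shows "\<bar>t*(t-1)/2\<bar> + \<bar>1-t\<^sup>2\<bar> + \<bar>t*(t+1)/2\<bar> \<le> 5/4"
proof -
  have "\<bar>t*(t-1)/2\<bar> = \<bar>t\<bar> * (1 - t) / 2" "\<bar>t*(t+1)/2\<bar> = \<bar>t\<bar> * (1 + t)/2" using assms by (auto simp: abs_mult)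
  moreover have "\<bar>1 - t\<^sup>2\<bar> = 1 - \<bar>t\<bar>\<^sup>2" using abs_le_square_iff[of t 1] assms by (auto simp: abs_if)
  moreover have "(\<bar>t\<bar> - 1/2)\<^sup>2 \<ge> 0" by simp
  then have "\<bar>t\<bar> - \<bar>t\<bar>\<^sup>2 \<le> 1/4" by (simp only: power2_diff) (simp add: power2_eq_square)
  moreover have "\<bar>t\<bar> * (1 - t) / 2 + \<bar>t\<bar> * (1 + t)/2 = \<bar>t\<bar>" by (simp add: field_simps)
  ultimately show ?thesis by linarith
qed

text \<open>Through a point of the open triangle passes a segment with endpoints
  \<open>2 * y1\<close> and \<open>2 * y2\<close> on the two axes whose midpoint lies on the line
  \<open>y1 + y2 = 1\<close>. The ends are covered by \<open>axis_bound\<close>; the midpoint lies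
  on the segment between two unit vectors, which carries three nodes.\<close>

lemma quadrant_bound:
  assumes ij: "i < n" "j < n" "i \<noteq> j" and x: "x1 \<ge> 0" "x2 \<ge> 0" "x1 + x2 \<le> 1"
  shows "\<bar>G (x1 *\<^sub>R unit_pm i + x2 *\<^sub>R unit_pm j)\<bar> \<le> 13 * \<theta>"
proof -
  let ?e = "unit_pm i" and ?f = "unit_pm j"
  have anti: "\<bar>G (y1 *\<^sub>R ?e + y2 *\<^sub>R ?f)\<bar> \<le> 3 * \<theta>" if "y1 \<ge> 0" "y2 \<ge> 0" "y1 + y2 = 1" for y1 y2
  proof -
    let ?p = "(1/2) *\<^sub>R (?e + ?f)" and ?d = "(1/2) *\<^sub>R (?e - ?f)"
    have e: "?p + t *\<^sub>R ?d = ((1 + t)/2) *\<^sub>R ?e + ((1 - t)/2) *\<^sub>R ?f" for t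
      by (simp add: algebra_simps add_divide_distrib diff_divide_distrib)
    define t where "t = y1 - y2"
    have t: "\<bar>t\<bar> \<le> 1" "y1 = (1 + t)/2" "y2 = (1 - t)/2" using that by (auto simp: t_def)
    have "\<bar>G (?p + t *\<^sub>R ?d)\<bar> \<le> 5/4 * 0 + (1 + 5/4) * \<theta>"
    proof (rule quadratic_on_segments_interpolation[OF Q, of ?p "-1" ?d 1 t "-1" 0 1 "t*(t-1)/2" "1-t\<^sup>2" "t*(t+1)/2"])
      show "?p + (-1) *\<^sub>R ?d \<in> cball 0 2 \<inter> Rn n" "?p + 1 *\<^sub>R ?d \<in> cball 0 2 \<inter> Rn n"
        unfolding e using comb_in[OF ij(1,2), of 0 1] comb_in[OF ij(1,2), of 1 0] by simp_all
      show "\<bar>G (?p + (-1) *\<^sub>R ?d)\<bar> \<le> 0" "\<bar>G (?p + 1 *\<^sub>R ?d)\<bar> \<le> 0" unfolding e using Gp ij by simp_all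
      show "\<bar>G (?p + 0 *\<^sub>R ?d)\<bar> \<le> 0" using Gd[OF ij] by simp
      show "\<bar>t*(t-1)/2\<bar> + \<bar>1-t\<^sup>2\<bar> + \<bar>t*(t+1)/2\<bar> \<le> 5/4" by (rule weights_unit[OF t(1)])
    qed (use t in \<open>auto simp: power2_eq_square field_simps\<close>)
    then show ?thesis unfolding e t(2,3)[symmetric] using th by simp
  qed
  show ?thesis
  proof (cases "x1 = 0 \<or> x2 = 0")
    case True
    then show ?thesis using axis_bound[OF ij(1), of x1] axis_bound[OF ij(2), of x2] x th by auto
  next
    case False
    then have pos: "x1 > 0" "x2 > 0" using x by auto
    \<comment> \<open>The equation \<open>x1 / (1 + t) + x2 / (1 - t) = 1\<close> with denominators
      cleared: it says that the midpoint is on the antidiagonal.\<close>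
    have "\<exists>t\<ge>0. t \<le> 1 \<and> (1 - t\<^sup>2) - x1 * (1 - t) - x2 * (1 + t) = 0"
      by (rule IVT2) (use x pos in \<open>auto intro!: continuous_intros\<close>)
    then obtain t where t: "t \<ge> 0" "t \<le> 1" and teq: "(1 - t\<^sup>2) - x1 * (1 - t) - x2 * (1 + t) = 0" by blast
    have "t \<noteq> 1" using teq pos by auto
    then have t1: "t < 1" using t by simp
    define y1 where "y1 = x1 / (1 + t)"
    define y2 where "y2 = x2 / (1 - t)"
    have y: "y1 \<ge> 0" "y2 \<ge> 0" "x1 = (1 + t) * y1" "x2 = (1 - t) * y2"
      using x t t1 by (auto simp: y1_def y2_def)
    have "(1 - t\<^sup>2) * (1 - y1 - y2) = (1 - t\<^sup>2) - ((1 + t) * y1) * (1 - t) - ((1 - t) * y2) * (1 + t)"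
      by (simp add: algebra_simps power2_eq_square)
    also have "\<dots> = 0" using teq y(3,4) by simp
    finally have "(1 - t\<^sup>2) * (1 - y1 - y2) = 0" .
    moreover have "1 - t\<^sup>2 \<noteq> 0" using t t1 abs_square_eq_1[of t] by auto
    ultimately have ys: "y1 + y2 = 1" by auto
    let ?p = "y1 *\<^sub>R ?e + y2 *\<^sub>R ?f" and ?d = "y1 *\<^sub>R ?e - y2 *\<^sub>R ?f"
    have e: "?p + s *\<^sub>R ?d = ((1 + s) * y1) *\<^sub>R ?e + ((1 - s) * y2) *\<^sub>R ?f" for s
      by (simp add: algebra_simps)
    have "\<bar>G (?p + t *\<^sub>R ?d)\<bar> \<le> 5/4 * (8 * \<theta>) + (1 + 5/4) * \<theta>"
    proof (rule quadratic_on_segments_interpolation[OF Q, of ?p "-1" ?d 1 t "-1" 0 1 "t*(t-1)/2" "1-t\<^sup>2" "t*(t+1)/2"])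
      show "?p + (-1) *\<^sub>R ?d \<in> cball 0 2 \<inter> Rn n" "?p + 1 *\<^sub>R ?d \<in> cball 0 2 \<inter> Rn n"
        unfolding e using comb_in[OF ij(1,2), of 0 "2*y2"] comb_in[OF ij(1,2), of "2*y1" 0] y ys by auto
      show "\<bar>G (?p + (-1) *\<^sub>R ?d)\<bar> \<le> 8 * \<theta>" "\<bar>G (?p + 1 *\<^sub>R ?d)\<bar> \<le> 8 * \<theta>"
        unfolding e using axis_bound[OF ij(1), of "2*y1"] axis_bound[OF ij(2), of "2*y2"] y ys by auto
      show "\<bar>G (?p + 0 *\<^sub>R ?d)\<bar> \<le> 8 * \<theta>" using anti[OF y(1,2) ys] th by simp
      show "\<bar>t*(t-1)/2\<bar> + \<bar>1-t\<^sup>2\<bar> + \<bar>t*(t+1)/2\<bar> \<le> 5/4" by (rule weights_unit) (use t in auto)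
    qed (use t in \<open>auto simp: power2_eq_square field_simps\<close>)
    then show ?thesis unfolding e y(3)[symmetric] y(4)[symmetric] using th by simp
  qed
qed

text \<open>Extrapolation across an axis: the weights at 0, 1, 2 for the value at -1 are 3, -3, 1,
  so 13 becomes 7 times 13 plus 8. The points used reach twice as far, which halves the radius.
  \<open>plane_bound\<close> repeats this in the other coordinate.\<close>

lemma half_plane_bound:
  assumes ij: "i < n" "j < n" "i \<noteq> j" and x: "x2 \<ge> 0" "\<bar>x1\<bar> + x2 \<le> 1/2"
  shows "\<bar>G (x1 *\<^sub>R unit_pm i + x2 *\<^sub>R unit_pm j)\<bar> \<le> 99 * \<theta>"
proof (cases "x1 \<ge> 0")
  case True then show ?thesis using quadrant_bound[OF ij, of x1 x2] x th by auto
next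
  case False
  let ?e = "unit_pm i" and ?f = "unit_pm j"
  let ?p = "x2 *\<^sub>R ?f" and ?d = "(-x1) *\<^sub>R ?e"
  have e: "?p + s *\<^sub>R ?d = (- s * x1) *\<^sub>R ?e + x2 *\<^sub>R ?f" for s by simp
  have "\<bar>G (?p + (-1) *\<^sub>R ?d)\<bar> \<le> 7 * (13 * \<theta>) + (1 + 7) * \<theta>"
  proof (rule quadratic_on_segments_interpolation[OF Q, of ?p "-1" ?d 2 "-1" 0 1 2 3 "-3" 1])
    show "?p + (-1) *\<^sub>R ?d \<in> cball 0 2 \<inter> Rn n" "?p + 2 *\<^sub>R ?d \<in> cball 0 2 \<inter> Rn n"
      unfolding e using x by (intro comb_in ij; auto)+
    show "\<bar>G (?p + 0 *\<^sub>R ?d)\<bar> \<le> 13 * \<theta>" "\<bar>G (?p + 1 *\<^sub>R ?d)\<bar> \<le> 13 * \<theta>" "\<bar>G (?p + 2 *\<^sub>R ?d)\<bar> \<le> 13 * \<theta>"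
      unfolding e using x False by (intro quadrant_bound ij; auto)+
  qed auto
  then show ?thesis unfolding e by simp
qed

lemma plane_bound:
  assumes ij: "i < n" "j < n" "i \<noteq> j" and x: "\<bar>x1\<bar> + \<bar>x2\<bar> \<le> 1/4"
  shows "\<bar>G (x1 *\<^sub>R unit_pm i + x2 *\<^sub>R unit_pm j)\<bar> \<le> 701 * \<theta>"
proof (cases "x2 \<ge> 0")
  case True then show ?thesis using half_plane_bound[OF ij, of x2 x1] x th by auto
next
  case False
  let ?e = "unit_pm i" and ?f = "unit_pm j"
  let ?p = "x1 *\<^sub>R ?e" and ?d = "(-x2) *\<^sub>R ?f"
  have e: "?p + s *\<^sub>R ?d = x1 *\<^sub>R ?e + (- s * x2) *\<^sub>R ?f" for s by simp
  have "\<bar>G (?p + (-1) *\<^sub>R ?d)\<bar> \<le> 7 * (99 * \<theta>) + (1 + 7) * \<theta>"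
  proof (rule quadratic_on_segments_interpolation[OF Q, of ?p "-1" ?d 2 "-1" 0 1 2 3 "-3" 1])
    show "?p + (-1) *\<^sub>R ?d \<in> cball 0 2 \<inter> Rn n" "?p + 2 *\<^sub>R ?d \<in> cball 0 2 \<inter> Rn n"
      unfolding e using x by (intro comb_in ij; auto)+
    show "\<bar>G (?p + 0 *\<^sub>R ?d)\<bar> \<le> 99 * \<theta>" "\<bar>G (?p + 1 *\<^sub>R ?d)\<bar> \<le> 99 * \<theta>" "\<bar>G (?p + 2 *\<^sub>R ?d)\<bar> \<le> 99 * \<theta>"
      unfolding e using x False by (intro half_plane_bound ij; auto)+
  qed auto
  then show ?thesis unfolding e by simp
qed

text \<open>A vector with at least three nonzero coordinates is the value at \<open>t = 0\<close> of a line that loses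
  one of these coordinates at each of \<open>t = -2, -1, 1\<close>.\<close>
lemma support_bound:
  assumes n: "n \<ge> 2"
  shows "S \<subseteq> {..<n} \<Longrightarrow> card S \<le> k + 2 \<Longrightarrow> x \<in> Rn n \<Longrightarrow> (\<And>i. i \<notin> S \<Longrightarrow> Poly_Mapping.lookup x i = 0)
    \<Longrightarrow> norm x \<le> 1/4 * (1/3)^k \<Longrightarrow> \<bar>G x\<bar> \<le> 701 * 2^k * \<theta>"
proof (induction k arbitrary: S x)
  case 0
  obtain i j where ij: "i < n" "j < n" "i \<noteq> j" "S \<subseteq> {i, j}"
  proof -
    have finS: "finite S" using 0(1) finite_subset by blast
    consider "card S = 0" | "card S = 1" | "card S = 2" using 0(2) by linarith
    then show ?thesis
    proof cases
      case 1 then show ?thesis using that[of 0 1] n finS by auto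
    next
      case 2
      then obtain a where "S = {a}" by (auto simp: card_1_singleton_iff)
      then show ?thesis using that[of a "if a = 0 then 1 else 0"] n 0(1) by auto
    next
      case 3
      then obtain a b where "S = {a,b}" "a \<noteq> b" by (auto simp: card_2_iff)
      then show ?thesis using that[of a b] 0(1) by auto
    qed
  qed
  let ?x = "Poly_Mapping.lookup x"
  have xe: "x = ?x i *\<^sub>R unit_pm i + ?x j *\<^sub>R unit_pm j"
    using ij 0(4) by (intro poly_mapping_eqI) (auto simp: lookup_add lookup_scaleR_pm lookup_single when_def)
  have "\<bar>?x i\<bar> + \<bar>?x j\<bar> = (\<Sum>k\<in>{i,j}. \<bar>?x k\<bar>)" using ij by simp
  also have "\<dots> \<le> (\<Sum>k<n. \<bar>?x k\<bar>)" using ij by (intro sum_mono2) auto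
  also have "\<dots> = norm x" using norm_Rn[OF 0(3)] by simp
  finally have "\<bar>?x i\<bar> + \<bar>?x j\<bar> \<le> 1/4" using 0(5) by simp
  from plane_bound[OF ij(1,2,3) this] xe show ?case by simp
next
  case (Suc k)
  have finS: "finite S" using Suc.prems(1) finite_subset by blast
  show ?case
  proof (cases "card S \<ge> 3")
    case False
    have "\<bar>G x\<bar> \<le> 701 * 2^k * \<theta>"
    proof (rule Suc.IH[OF Suc.prems(1) _ Suc.prems(3,4)])
      have "(1/3::real)^Suc k \<le> (1/3)^k" by simp
      then show "norm x \<le> 1/4 * (1/3)^k" using Suc.prems(5) by linarith
    qed (use False in auto)
    moreover have "701 * 2^k * \<theta> \<le> 701 * 2^Suc k * \<theta>" using th by simp
    ultimately show ?thesis by linarith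
  next
    case True
    then obtain T where T: "T \<subseteq> S" "card T = 3" using obtain_subset_with_card_n by metis
    obtain i j l where ijl: "T = {i, j, l}" "i \<noteq> j" "i \<noteq> l" "j \<noteq> l"
      using T(2) by (auto simp: card_3_iff)
    have S: "i \<in> S" "j \<in> S" "l \<in> S" and lt: "i < n" "j < n" "l < n" using T ijl Suc.prems(1) by auto
    let ?x = "Poly_Mapping.lookup x"
    define d where "d = ?x i *\<^sub>R unit_pm i - ?x j *\<^sub>R unit_pm j + (?x l / 2) *\<^sub>R unit_pm l"
    have dR: "d \<in> Rn n" unfolding d_def
      by (intro subspace_add subspace_diff subspace_scale subspace_Rn unit_pm_Rn lt)
    have xd: "x + t *\<^sub>R d \<in> Rn n" for t using dR Suc.prems(3) by (intro subspace_add subspace_scale subspace_Rn)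
    have lk: "Poly_Mapping.lookup (x + t *\<^sub>R d) m = (if m = i then (1 + t) else if m = j then (1 - t) else if m = l then (1 + t / 2) else 1) * ?x m" for t m
      using ijl by (auto simp: d_def lookup_add lookup_minus lookup_scaleR_pm lookup_single when_def algebra_simps)
    \<comment> \<open>The coordinates of \<open>x\<close> are multiplied by \<open>1 + t\<close>,
      \<open>1 - t\<close>, \<open>1 + t / 2\<close> or 1; on [-2, 1] the largest modulus is 3, at
      \<open>t = -2\<close>. This is why the radius shrinks by 1/3 per coordinate.\<close>
    have nrm: "norm (x + t *\<^sub>R d) \<le> 3 * norm x" if "t \<in> {-2..1}" for t
      unfolding norm_Rn[OF xd] norm_Rn[OF Suc.prems(3)] sum_distrib_left
      by (intro sum_mono) (unfold lk abs_mult, intro mult_right_mono, use that in auto)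
    have nx: "norm (x + t *\<^sub>R d) \<le> 1/4 * (1/3)^k" if "t \<in> {-2..1}" for t
      using nrm[OF that] Suc.prems(5) by simp
    have small: "\<bar>G (x + t *\<^sub>R d)\<bar> \<le> 701 * 2^k * \<theta>"
      if t: "t \<in> {-2..1}" and m: "m \<in> S" "Poly_Mapping.lookup (x + t *\<^sub>R d) m = 0" for t m
    proof (rule Suc.IH[of "S - {m}"])
      show "S - {m} \<subseteq> {..<n}" using Suc.prems(1) by auto
      show "card (S - {m}) \<le> k + 2" using m finS Suc.prems(2) by simp
      show "Poly_Mapping.lookup (x + t *\<^sub>R d) a = 0" if "a \<notin> S - {m}" for a
        using that m(2) Suc.prems(4)[of a] S by (cases "a = m") (auto simp: lk)
    qed (use xd nx[OF t] in auto)
    have in2: "x + t *\<^sub>R d \<in> cball 0 2 \<inter> Rn n" if "t \<in> {-2..1}" for t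
    proof -
      have "1/4 * (1/3::real)^k \<le> 1/4" by (simp add: power_le_one)
      then show ?thesis using nx[OF that] xd by auto
    qed
    have sm: "\<bar>G (x + (-2) *\<^sub>R d)\<bar> \<le> 701 * 2^k * \<theta>" "\<bar>G (x + (-1) *\<^sub>R d)\<bar> \<le> 701 * 2^k * \<theta>"
      "\<bar>G (x + 1 *\<^sub>R d)\<bar> \<le> 701 * 2^k * \<theta>"
    proof -
      show "\<bar>G (x + (-2) *\<^sub>R d)\<bar> \<le> 701 * 2^k * \<theta>"
        by (rule small[of _ l]) (use S ijl lk[of "-2" l] in simp_all)
      show "\<bar>G (x + (-1) *\<^sub>R d)\<bar> \<le> 701 * 2^k * \<theta>"
        by (rule small[of _ i]) (use S ijl lk[of "-1" i] in simp_all)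
      show "\<bar>G (x + 1 *\<^sub>R d)\<bar> \<le> 701 * 2^k * \<theta>"
        by (rule small[of _ j]) (use S ijl lk[of 1 j] in simp_all)
    qed
    \<comment> \<open>The Lagrange weights have total modulus 5/3, below 2, so a factor 2 per
      coordinate also absorbs the additional \<open>\<theta>\<close>.\<close>
    have "\<bar>G (x + 0 *\<^sub>R d)\<bar> \<le> 5/3 * (701 * 2^k * \<theta>) + (1 + 5/3) * \<theta>"
      by (rule quadratic_on_segments_interpolation[OF Q, of x "-2" d 1 0 "-2" "-1" 1 "-1/3" 1 "1/3"])
         (use in2[of "-2"] in2[of 1] sm in auto)
    moreover have "5/3 * (701 * 2^k * \<theta>) + (1 + 5/3) * \<theta> \<le> 701 * 2^Suc k * \<theta>"
    proof -
      have "8/3 * \<theta> \<le> 701 / 3 * 2^k * \<theta>"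
        by (intro mult_right_mono th) (use one_le_power[of "2::real" k] in linarith)
      then show ?thesis by (simp add: algebra_simps)
    qed
    ultimately show ?thesis by simp
  qed
qed

end

text \<open>The difference from the interpolant is small on a ball whose radius decays like
  \<open>(1/3) ^ n\<close>. Along each ray it is extrapolated from the parameters 0,
  \<open>\<tau>\<close> and \<open>2 * \<tau>\<close> to 1 with weights of size
  \<open>2 / \<tau>\<^sup>2\<close>, that is, \<open>128 * R\<^sup>2 * 9 ^ n\<close>. Together with
  the factor \<open>2 ^ n\<close> of \<open>support_bound\<close> this gives
  \<open>18 ^ n\<close>.\<close>

lemma near_quadratic_polynomial:
  fixes F :: "(nat \<Rightarrow>\<^sub>0 real) \<Rightarrow> real"
  assumes n: "n \<ge> 2" and F: "quadratic_on_segments \<theta> F K" and K: "cball 0 2 \<inter> Rn n \<subseteq> K" "K \<subseteq> cball 0 R \<inter> Rn n"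
    and R: "R \<ge> 1" and th: "\<theta> \<ge> 0"
  shows "\<exists>q. quadratic_polynomial q \<and> (\<forall>x\<in>K. \<bar>F x - q x\<bar> \<le> 100000 * R\<^sup>2 * 18 ^ n * \<theta>)"
proof -
  obtain q where q: "quadratic_polynomial q" "q 0 = F 0"
    "\<And>i. i < n \<Longrightarrow> q (unit_pm i) = F (unit_pm i) \<and> q (- unit_pm i) = F (- unit_pm i)"
    "\<And>i j. i < n \<Longrightarrow> j < i \<Longrightarrow> q ((1/2) *\<^sub>R (unit_pm i + unit_pm j)) = F ((1/2) *\<^sub>R (unit_pm i + unit_pm j))"
    using quadratic_interpolant_exists[of F n] by blast
  define G where "G = (\<lambda>x. F x - q x)"
  have GK: "quadratic_on_segments \<theta> G K" unfolding G_def by (rule quadratic_on_segments_diff[OF F q(1)])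
  interpret quadratic_with_zero_nodes n \<theta> G
  proof
    show "quadratic_on_segments \<theta> G (cball 0 2 \<inter> Rn n)" using GK K(1) unfolding quadratic_on_segments_def by blast
    show "G ((1/2) *\<^sub>R (unit_pm i + unit_pm j)) = 0" if "i < n" "j < n" "i \<noteq> j" for i j
      using q(4)[of i j] q(4)[of j i] that by (cases "j < i") (auto simp: G_def add.commute)
  qed (use q th in \<open>auto simp: G_def\<close>)
  define r where "r = 1/4 * (1/3::real)^n"
  define \<tau> where "\<tau> = r / (2 * R)"
  have r: "r > 0" "r \<le> 1/4" by (auto simp: r_def power_le_one)
  have tau: "\<tau> > 0" "2 * \<tau> \<le> 1/4" "2 * \<tau> * R = r"
    using r R by (auto simp: \<tau>_def field_simps)
  have small: "\<bar>G x\<bar> \<le> 701 * 2^n * \<theta>" if "x \<in> Rn n" "norm x \<le> r" for x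
    by (rule support_bound[OF n, of "{..<n}"]) (use that in \<open>auto simp: r_def Rn_iff\<close>)
  have "\<bar>G x\<bar> \<le> 100000 * R\<^sup>2 * 18 ^ n * \<theta>" if x: "x \<in> K" for x
  proof -
    have xR: "x \<in> Rn n" "norm x \<le> R" using x K by auto
    have zK: "0 \<in> K" using K(1) subspace_0[OF subspace_Rn] by auto
    have tx: "\<bar>G (0 + t *\<^sub>R x)\<bar> \<le> 701 * 2^n * \<theta>" if "t \<in> {0..2*\<tau>}" for t
    proof (rule small)
      show "0 + t *\<^sub>R x \<in> Rn n" using xR by (simp add: subspace_scale[OF subspace_Rn])
      have "t * norm x \<le> 2 * \<tau> * R" using that xR R by (intro mult_mono) auto
      then show "norm (0 + t *\<^sub>R x) \<le> r" using tau that by simp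
    qed
    define W where "W = 2 / \<tau>\<^sup>2"
    have "\<bar>G (0 + 1 *\<^sub>R x)\<bar> \<le> W * (701 * 2^n * \<theta>) + (1 + W) * \<theta>"
    proof (rule quadratic_on_segments_interpolation[OF GK, of 0 0 x 1 1 0 \<tau> "2*\<tau>"
          "(1-\<tau>)*(1-2*\<tau>)/(2*\<tau>\<^sup>2)" "-(1-2*\<tau>)/\<tau>\<^sup>2" "(1-\<tau>)/(2*\<tau>\<^sup>2)"])
      have "\<bar>(1-\<tau>)*(1-2*\<tau>)/(2*\<tau>\<^sup>2)\<bar> \<le> 1 / (2*\<tau>\<^sup>2)"
      proof -
        have "\<bar>(1-\<tau>)*(1-2*\<tau>)\<bar> \<le> 1 * 1" unfolding abs_mult using tau by (intro mult_mono) auto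
        then show ?thesis by (simp add: divide_right_mono)
      qed
      moreover have "\<bar>-(1-2*\<tau>)/\<tau>\<^sup>2\<bar> \<le> 1 / \<tau>\<^sup>2" using tau by (simp add: divide_right_mono)
      moreover have "\<bar>(1-\<tau>)/(2*\<tau>\<^sup>2)\<bar> \<le> 1 / (2*\<tau>\<^sup>2)" using tau by (simp add: divide_right_mono)
      moreover have "1 / (2*\<tau>\<^sup>2) + 1/\<tau>\<^sup>2 + 1 / (2*\<tau>\<^sup>2) = W" unfolding W_def using tau by (simp add: field_simps)
      ultimately show "\<bar>(1-\<tau>)*(1-2*\<tau>)/(2*\<tau>\<^sup>2)\<bar> + \<bar>-(1-2*\<tau>)/\<tau>\<^sup>2\<bar> + \<bar>(1-\<tau>)/(2*\<tau>\<^sup>2)\<bar> \<le> W" by linarith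
    qed (use tau zK x tx[of 0] tx[of \<tau>] tx[of "2*\<tau>"] in \<open>auto simp: field_simps power2_eq_square\<close>)
    moreover have W: "W = 128 * R\<^sup>2 * 9^n"
    proof -
      have "(3::real)^n * 3^n = 9^n" by (simp flip: power_mult_distrib)
      then show ?thesis using R by (simp add: W_def \<tau>_def r_def power_divide field_simps power2_eq_square)
    qed
    moreover have "W * (701 * 2^n * \<theta>) + (1 + W) * \<theta> \<le> 100000 * R\<^sup>2 * 18 ^ n * \<theta>"
    proof -
      have "R\<^sup>2 \<ge> 1" using R by simp
      then have W1: "W \<ge> 1" unfolding W using mult_mono[of 1 "128 * R\<^sup>2" 1 "9^n"] by simp
      have "701 * 2^n + 2 \<le> (703::real) * 2^n" using one_le_power[of "2::real" n] by simp
      then have "W * (701 * 2^n + 2) \<le> W * (703 * 2^n)" using W1 by simp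
      also have "\<dots> = 128 * 703 * R\<^sup>2 * (9^n * 2^n)" by (simp add: W)
      also have "(9::real)^n * 2^n = 18^n" by (simp flip: power_mult_distrib)
      finally have "W * (701 * 2^n + 2) \<le> 128 * 703 * R\<^sup>2 * 18^n" .
      also have "\<dots> \<le> 100000 * R\<^sup>2 * 18^n" by (intro mult_right_mono) auto
      finally have "W * (701 * 2^n + 2) * \<theta> \<le> 100000 * R\<^sup>2 * 18^n * \<theta>" using th by (rule mult_right_mono)
      moreover have "W * (701 * 2^n * \<theta>) + (1 + W) * \<theta> \<le> W * (701 * 2^n + 2) * \<theta>"
      proof -
        have "\<theta> \<le> W * \<theta>" using mult_right_mono[OF W1 th] by simp
        then show ?thesis by (simp add: algebra_simps)
      qed
      ultimately show ?thesis by linarith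
    qed
    ultimately show ?thesis by simp
  qed
  then show ?thesis using q(1) unfolding G_def by blast
qed

section \<open>Bodies nearly defined by a quadratic polynomial\<close>

lemma euclidean_unit_ball_iff:
  "y \<in> euclidean_unit_ball n \<longleftrightarrow> y \<in> Rn n \<and> (\<Sum>i<n. (Poly_Mapping.lookup y i)\<^sup>2) \<le> 1"
  by (simp add: euclidean_unit_ball_def L2_set_def)

text \<open>A witness for an upper bound on the infimum. Witnesses can be carried along linear maps;
  the distance itself enters only through \<open>banach_mazur_dist_le\<close>.\<close>

definition bm_within :: "nat \<Rightarrow> (nat \<Rightarrow>\<^sub>0 real) set \<Rightarrow> real \<Rightarrow> bool" where
  "bm_within n K l \<longleftrightarrow> l > 0 \<and> (\<exists>T z. affine_map_between (Rn n) (Rn n) T \<and> z \<in> Rn n \<and>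
     K \<subseteq> T ` euclidean_unit_ball n \<and> T ` euclidean_unit_ball n \<subseteq> (\<lambda>x. l *\<^sub>R x + z) ` K)"

lemma banach_mazur_dist_le:
  "bm_within n K l \<Longrightarrow> banach_mazur_dist (Rn n) K (Rn n) (euclidean_unit_ball n) \<le> l"
  unfolding banach_mazur_dist_def bm_within_def by (rule cInf_lower) (auto intro!: bdd_belowI[of _ 0])

lemma affine_map_linear_plus:
  assumes "linear E" "\<And>x. x \<in> W \<Longrightarrow> E x \<in> V" "c \<in> V" "subspace V"
  shows "affine_map_between W V (\<lambda>y. c + r *\<^sub>R E y)"
  unfolding affine_map_between_def using assms
  by (auto simp: linear_add linear_scale linear_diff algebra_simps intro!: subspace_add subspace_scale)

lemma bm_within_linear_image:
  assumes S: "linear S" "\<And>x. x \<in> Rn n \<Longrightarrow> S x \<in> Rn n" and T: "linear T" "\<And>x. x \<in> Rn n \<Longrightarrow> T x \<in> Rn n"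
    and TS: "\<And>x. x \<in> Rn n \<Longrightarrow> T (S x) = x" and K: "K \<subseteq> Rn n" and bm: "bm_within n (S ` K) l"
  shows "bm_within n K l"
proof -
  obtain U z where l: "l > 0" and U: "affine_map_between (Rn n) (Rn n) U" and z: "z \<in> Rn n"
    and 1: "S ` K \<subseteq> U ` euclidean_unit_ball n" and 2: "U ` euclidean_unit_ball n \<subseteq> (\<lambda>x. l *\<^sub>R x + z) ` S ` K"
    using bm unfolding bm_within_def by blast
  show ?thesis unfolding bm_within_def
  proof (intro conjI exI[of _ "T \<circ> U"] exI[of _ "T z"] l)
    show "affine_map_between (Rn n) (Rn n) (T \<circ> U)"
      using U T unfolding affine_map_between_def by (auto simp: linear_add linear_scale image_subset_iff)
    show "T z \<in> Rn n" using T z by blast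
    show "K \<subseteq> (T \<circ> U) ` euclidean_unit_ball n"
    proof
      fix x assume x: "x \<in> K"
      then obtain y where "y \<in> euclidean_unit_ball n" "S x = U y" using 1 by blast
      then show "x \<in> (T \<circ> U) ` euclidean_unit_ball n" using TS[of x] x K by (intro image_eqI[of _ _ y]) auto
    qed
    show "(T \<circ> U) ` euclidean_unit_ball n \<subseteq> (\<lambda>x. l *\<^sub>R x + T z) ` K"
    proof
      fix w assume "w \<in> (T \<circ> U) ` euclidean_unit_ball n"
      then obtain y where y: "y \<in> euclidean_unit_ball n" "w = T (U y)" by auto
      then obtain x where x: "x \<in> K" "U y = l *\<^sub>R S x + z" using 2 by blast
      have "w = l *\<^sub>R x + T z" using x y TS[of x] K T(1) by (auto simp: linear_add linear_scale)
      then show "w \<in> (\<lambda>x. l *\<^sub>R x + T z) ` K" using x by blast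
    qed
  qed
qed

text \<open>Fallback for large errors. The balls are those of the l1 norm: the l1 unit ball lies in
  the Euclidean one, which lies in \<open>n\<close> times the l1 ball.\<close>

lemma bm_within_crude:
  assumes n: "n > 0" and z: "z \<in> Rn n" and K: "cball z 1 \<inter> Rn n \<subseteq> K" "K \<subseteq> cball z R \<inter> Rn n" and R: "R \<ge> 1"
  shows "bm_within n K (R * real n)"
  unfolding bm_within_def
proof (intro conjI exI[of _ "\<lambda>y. z + R *\<^sub>R y"] exI[of _ "(1 - R * real n) *\<^sub>R z"])
  show "0 < R * real n" using R n by simp
  show "affine_map_between (Rn n) (Rn n) (\<lambda>y. z + R *\<^sub>R y)"
    using affine_map_linear_plus[OF linear_ident _ z subspace_Rn, of "Rn n" R] by simp
  show "(1 - R * real n) *\<^sub>R z \<in> Rn n" by (rule subspace_scale[OF subspace_Rn z])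
  show "K \<subseteq> (\<lambda>y. z + R *\<^sub>R y) ` euclidean_unit_ball n"
  proof
    fix x assume x: "x \<in> K"
    define y where "y = (1/R) *\<^sub>R (x - z)"
    have yR: "y \<in> Rn n" unfolding y_def using x K z by (intro subspace_scale subspace_diff subspace_Rn) auto
    have "norm (x - z) \<le> R" using x K by (auto simp: dist_norm norm_minus_commute)
    then have "norm y \<le> 1" using R by (simp add: y_def)
    then have 1: "(\<Sum>i<n. \<bar>Poly_Mapping.lookup y i\<bar>) \<le> 1" using norm_Rn[OF yR] by simp
    have "(\<Sum>i<n. (Poly_Mapping.lookup y i)\<^sup>2) \<le> (\<Sum>i<n. \<bar>Poly_Mapping.lookup y i\<bar>)"
    proof (rule sum_mono)
      fix i assume "i \<in> {..<n}"
      have "\<bar>Poly_Mapping.lookup y i\<bar> \<le> 1" using abs_lookup_le_norm[of y i] \<open>norm y \<le> 1\<close> by linarith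
      then have "\<bar>Poly_Mapping.lookup y i\<bar>\<^sup>2 \<le> \<bar>Poly_Mapping.lookup y i\<bar>"
        using mult_left_mono[of "\<bar>Poly_Mapping.lookup y i\<bar>" 1 "\<bar>Poly_Mapping.lookup y i\<bar>"] by (simp add: power2_eq_square)
      then show "(Poly_Mapping.lookup y i)\<^sup>2 \<le> \<bar>Poly_Mapping.lookup y i\<bar>" by simp
    qed
    then have "y \<in> euclidean_unit_ball n" using 1 yR by (simp add: euclidean_unit_ball_iff)
    moreover have "x = z + R *\<^sub>R y" using R by (simp add: y_def)
    ultimately show "x \<in> (\<lambda>y. z + R *\<^sub>R y) ` euclidean_unit_ball n" by blast
  qed
  show "(\<lambda>y. z + R *\<^sub>R y) ` euclidean_unit_ball n \<subseteq> (\<lambda>x. (R * real n) *\<^sub>R x + (1 - R * real n) *\<^sub>R z) ` K"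
  proof
    fix w assume "w \<in> (\<lambda>y. z + R *\<^sub>R y) ` euclidean_unit_ball n"
    then obtain y where y: "y \<in> Rn n" "(\<Sum>i<n. (Poly_Mapping.lookup y i)\<^sup>2) \<le> 1" "w = z + R *\<^sub>R y"
      by (auto simp: euclidean_unit_ball_iff)
    have "\<bar>Poly_Mapping.lookup y i\<bar> \<le> 1" if "i < n" for i
    proof -
      have "(Poly_Mapping.lookup y i)\<^sup>2 \<le> 1"
        using member_le_sum[of i "{..<n}" "\<lambda>i. (Poly_Mapping.lookup y i)\<^sup>2"] y(2) that by simp
      then show ?thesis using abs_le_square_iff[of "Poly_Mapping.lookup y i" 1] by simp
    qed
    then have "norm y \<le> real n" unfolding norm_Rn[OF y(1)] using sum_mono[of "{..<n}" "\<lambda>i. \<bar>Poly_Mapping.lookup y i\<bar>" "\<lambda>_. 1"] by simp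
    then have "z + (1 / real n) *\<^sub>R y \<in> cball z 1 \<inter> Rn n" using n z y(1)
      by (auto simp: dist_norm intro!: subspace_add subspace_scale subspace_Rn)
    moreover have "w = (R * real n) *\<^sub>R (z + (1 / real n) *\<^sub>R y) + (1 - R * real n) *\<^sub>R z"
      using n by (simp add: y(3) algebra_simps)
    ultimately show "w \<in> (\<lambda>x. (R * real n) *\<^sub>R x + (1 - R * real n) *\<^sub>R z) ` K" using K(1) by blast
  qed
qed

text \<open>Gram-Schmidt, one coordinate at a time, for a form that is positive only on
  \<open>Rn n\<close>. The new vector \<open>w\<close> keeps last coordinate 1, so subtracting a
  multiple of it brings any vector down to the previous space.\<close>

lemma orthonormal_basis_of_form:
  assumes B: "bilinear B" and sym: "\<And>x y. B x y = B y x" and pos: "\<And>x. x \<in> Rn n \<Longrightarrow> x \<noteq> 0 \<Longrightarrow> B x x > (0::real)"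
  shows "\<exists>b. (\<forall>i<n. b i \<in> Rn n) \<and> (\<forall>i<n. \<forall>j<n. B (b i) (b j) = (if i = j then 1 else 0)) \<and>
    (\<forall>x\<in>Rn n. (\<Sum>i<n. B x (b i) *\<^sub>R b i) = x)"
  using pos
proof (induction n)
  case 0 then show ?case by (simp add: Rn_0)
next
  case (Suc n)
  have "\<exists>b. (\<forall>i<n. b i \<in> Rn n) \<and> (\<forall>i<n. \<forall>j<n. B (b i) (b j) = (if i = j then 1 else 0)) \<and>
    (\<forall>x\<in>Rn n. (\<Sum>i<n. B x (b i) *\<^sub>R b i) = x)"
    using Suc.prems Rn_mono[of n "Suc n"] by (intro Suc.IH) auto
  then obtain b where b: "\<forall>i<n. b i \<in> Rn n" "\<forall>i<n. \<forall>j<n. B (b i) (b j) = (if i = j then 1 else 0)"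
    "\<forall>x\<in>Rn n. (\<Sum>i<n. B x (b i) *\<^sub>R b i) = x" by blast
  have L1: "linear (\<lambda>x. B x y)" for y using B by (simp add: bilinear_def)
  define e where "e = unit_pm n"
  define s where "s = (\<Sum>i<n. B e (b i) *\<^sub>R b i)"
  define w where "w = e - s"
  have sR: "s \<in> Rn n" unfolding s_def using b(1) by (intro subspace_sum subspace_scale subspace_Rn) auto
  have wR: "w \<in> Rn (Suc n)" unfolding w_def e_def
    using sR Rn_mono[of n "Suc n"] by (intro subspace_diff subspace_Rn unit_pm_Rn) auto
  have wn: "Poly_Mapping.lookup w n = 1" using sR by (simp add: w_def e_def lookup_minus Rn_iff)
  then have w0: "w \<noteq> 0" by auto
  have wb: "B w (b j) = 0" if "j < n" for j
  proof -
    have "B s (b j) = (\<Sum>i<n. B e (b i) * B (b i) (b j))"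
      unfolding s_def by (subst linear_sum[OF L1]) (simp add: linear_scale[OF L1])
    also have "\<dots> = (\<Sum>i<n. if i = j then B e (b j) else 0)"
      using b(2) that by (intro sum.cong) auto
    finally show ?thesis using that by (simp add: w_def linear_diff[OF L1])
  qed
  have wb': "B (b j) w = 0" if "j < n" for j using wb[OF that] sym[of "b j" w] by simp
  have ww: "B w w > 0" by (rule Suc.prems[OF wR w0])
  define r where "r = sqrt (B w w)"
  have r: "r > 0" "r * r = B w w" using ww by (auto simp: r_def)
  define b' where "b' = (\<lambda>i. if i = n then (1/r) *\<^sub>R w else b i)"
  show ?case
  proof (intro exI[of _ b'] conjI allI impI ballI)
    fix i assume i: "i < Suc n"
    show "b' i \<in> Rn (Suc n)" using i b(1) wR Rn_mono[of n "Suc n"]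
      by (auto simp: b'_def less_Suc_eq intro!: subspace_scale subspace_Rn)
    fix j assume j: "j < Suc n"
    show "B (b' i) (b' j) = (if i = j then 1 else 0)"
      using i j b(2) wb r sym[of "b i" w] ww
      by (auto simp: b'_def less_Suc_eq bilinear_lmul[OF B] bilinear_rmul[OF B] field_simps)
  next
    fix x assume x: "x \<in> Rn (Suc n)"
    let ?a = "Poly_Mapping.lookup x n"
    let ?y = "x - ?a *\<^sub>R w"
    have y: "?y \<in> Rn n"
      by (rule Rn_SucI) (use x wR wn in \<open>auto simp: lookup_minus lookup_scaleR_pm intro!: subspace_diff subspace_scale subspace_Rn\<close>)
    have "B ?y w = B (\<Sum>i<n. B ?y (b i) *\<^sub>R b i) w" using b(3) y by simp
    also have "\<dots> = 0" by (subst linear_sum[OF L1]) (simp add: linear_scale[OF L1] wb')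
    finally have xw: "B x w = ?a * B w w" by (simp add: linear_diff[OF L1] linear_scale[OF L1])
    have "(\<Sum>i<n. B x (b i) *\<^sub>R b i) = (\<Sum>i<n. B ?y (b i) *\<^sub>R b i)"
      by (rule sum.cong) (auto simp: linear_diff[OF L1] linear_scale[OF L1] wb)
    also have "\<dots> = ?y" using b(3) y by blast
    finally have "(\<Sum>i<n. B x (b i) *\<^sub>R b i) = ?y" .
    moreover have "B x (b' n) *\<^sub>R b' n = ?a *\<^sub>R w"
      using r xw ww by (simp add: b'_def bilinear_rmul[OF B] field_simps)
    ultimately show "(\<Sum>i<Suc n. B x (b' i) *\<^sub>R b' i) = x"
      by (simp add: b'_def)
  qed
qed

text \<open>\<open>B\<close> need not be symmetric, so \<open>- B\<close> is symmetrized to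
  \<open>P\<close>, which has the same values on the diagonal. In \<open>P\<close>-orthonormal
  coordinates half of the linear part is the vector \<open>m\<close>; then \<open>E m\<close> is the
  critical point, and the value there is \<open>M\<close>.\<close>

lemma complete_the_square:
  assumes L: "linear L" and B: "bilinear B" and pos: "\<And>x. x \<in> Rn n \<Longrightarrow> x \<noteq> 0 \<Longrightarrow> B x x < (0::real)"
  shows "\<exists>M c0 E. c0 \<in> Rn n \<and> linear E \<and> (\<forall>y\<in>Rn n. E y \<in> Rn n) \<and> (\<forall>x\<in>Rn n. \<exists>y\<in>Rn n. x = c0 + E y) \<and>
     (\<forall>y\<in>Rn n. c + L (c0 + E y) + B (c0 + E y) (c0 + E y) = M - (\<Sum>i<n. (Poly_Mapping.lookup y i)\<^sup>2))"
proof -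
  define P where "P = (\<lambda>x y. - (B x y + B y x) / 2)"
  have P: "bilinear P" unfolding P_def bilinear_def
    by (intro allI conjI linearI)
       (simp_all add: bilinear_ladd[OF B] bilinear_radd[OF B] bilinear_lmul[OF B] bilinear_rmul[OF B] field_simps)
  have "\<exists>b. (\<forall>i<n. b i \<in> Rn n) \<and> (\<forall>i<n. \<forall>j<n. P (b i) (b j) = (if i = j then 1 else 0)) \<and>
    (\<forall>x\<in>Rn n. (\<Sum>i<n. P x (b i) *\<^sub>R b i) = x)"
    by (rule orthonormal_basis_of_form[OF P]) (use pos in \<open>auto simp: P_def\<close>)
  then obtain b where b: "\<forall>i<n. b i \<in> Rn n" "\<forall>i<n. \<forall>j<n. P (b i) (b j) = (if i = j then 1 else 0)"
    "\<forall>x\<in>Rn n. (\<Sum>i<n. P x (b i) *\<^sub>R b i) = x" by blast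
  define E where "E = (\<lambda>y. \<Sum>i<n. Poly_Mapping.lookup y i *\<^sub>R b i)"
  define m where "m = (\<Sum>i<n. (L (b i) / 2) *\<^sub>R unit_pm i)"
  have mR: "m \<in> Rn n" unfolding m_def by (rule sum_unit_Rn)
  have lm: "Poly_Mapping.lookup m i = L (b i) / 2" if "i < n" for i using that by (simp add: m_def lookup_sum_unit)
  have E: "linear E" unfolding E_def
    by (intro linearI) (simp_all add: lookup_add lookup_scaleR_pm algebra_simps sum.distrib scaleR_sum_right)
  have ER: "E y \<in> Rn n" for y unfolding E_def using b(1) by (intro subspace_sum subspace_scale subspace_Rn) auto
  have PE: "P (E x) (E x) = (\<Sum>i<n. (Poly_Mapping.lookup x i)\<^sup>2)" for x
  proof -
    have "P (E x) (E x) = (\<Sum>(i,j)\<in>{..<n}\<times>{..<n}. Poly_Mapping.lookup x i * Poly_Mapping.lookup x j * P (b i) (b j))"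
      unfolding E_def by (subst bilinear_sum[OF P]) (auto simp: bilinear_lmul[OF P] bilinear_rmul[OF P] intro!: sum.cong)
    also have "\<dots> = (\<Sum>i<n. \<Sum>j<n. if j = i then (Poly_Mapping.lookup x i)\<^sup>2 else 0)"
      unfolding sum.cartesian_product[symmetric] using b(2) by (intro sum.cong) (auto simp: power2_eq_square)
    finally show ?thesis by simp
  qed
  have LE: "L (E x) = (\<Sum>i<n. 2 * Poly_Mapping.lookup x i * Poly_Mapping.lookup m i)" for x
    unfolding E_def by (subst linear_sum[OF L]) (auto simp: linear_scale[OF L] lm intro!: sum.cong)
  have BP: "B x x = - P x x" for x by (simp add: P_def)
  show ?thesis
  proof (intro exI[of _ "c + (\<Sum>i<n. (Poly_Mapping.lookup m i)\<^sup>2)"] exI[of _ "E m"] exI[of _ E] conjI ballI E ER)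
    fix x assume x: "x \<in> Rn n"
    define y where "y = (\<Sum>i<n. P x (b i) *\<^sub>R unit_pm i) - m"
    have "E y + E m = E (\<Sum>i<n. P x (b i) *\<^sub>R unit_pm i)" by (simp add: y_def linear_diff[OF E])
    also have "\<dots> = (\<Sum>i<n. P x (b i) *\<^sub>R b i)" unfolding E_def by (rule sum.cong) (auto simp: lookup_sum_unit)
    also have "\<dots> = x" using b(3) x by blast
    finally show "\<exists>y\<in>Rn n. x = E m + E y"
      by (intro bexI[of _ y]) (auto simp: y_def algebra_simps intro!: subspace_diff subspace_Rn sum_unit_Rn mR)
  next
    fix y assume "y \<in> Rn n"
    have "c + L (E m + E y) + B (E m + E y) (E m + E y) = c + L (E (m + y)) - P (E (m + y)) (E (m + y))"
      by (simp add: linear_add[OF E] BP)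
    also have "\<dots> = c + (\<Sum>i<n. 2 * Poly_Mapping.lookup (m+y) i * Poly_Mapping.lookup m i - (Poly_Mapping.lookup (m+y) i)\<^sup>2)"
      by (simp add: LE PE sum_subtractf)
    also have "\<dots> = c + (\<Sum>i<n. (Poly_Mapping.lookup m i)\<^sup>2 - (Poly_Mapping.lookup y i)\<^sup>2)"
      by (simp add: lookup_add algebra_simps power2_eq_square)
    finally show "c + L (E m + E y) + B (E m + E y) (E m + E y)
      = c + (\<Sum>i<n. (Poly_Mapping.lookup m i)\<^sup>2) - (\<Sum>i<n. (Poly_Mapping.lookup y i)\<^sup>2)"
      by (simp add: sum_subtractf)
  qed
qed

text \<open>\<open>K\<close> is squeezed between \<open>q > \<tau>\<close> and
  \<open>q \<ge> - \<tau>\<close>. Once the quadratic part is negative definite, these superlevel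
  sets are concentric homothetic ellipsoids, and the ratio of their radii is the bound.\<close>

lemma bm_within_of_quadratic:
  assumes K: "K \<subseteq> Rn n" "bounded K" and z: "z \<in> K" and q: "quadratic_polynomial q"
    and ge: "\<And>x. x \<in> K \<Longrightarrow> q x \<ge> - \<tau>"
    and exit: "\<And>x. x \<in> Rn n \<Longrightarrow> x \<notin> K \<Longrightarrow> \<exists>t\<in>{0..1}. q (z + t *\<^sub>R (x - z)) \<le> \<tau>"
    and tau: "\<tau> > 0" and qz: "q z \<ge> 6 * \<tau>"
  shows "bm_within n K (1 + 5 * \<tau> / q z)"
proof -
  obtain c L B where L: "linear L" and B: "bilinear B" and qd: "q = (\<lambda>x. c + L x + B x x)"
    using q unfolding quadratic_polynomial_def by blast
  have zR: "z \<in> Rn n" using z K by auto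
  have qlin: "q (z + t *\<^sub>R v) = q z + t * (L v + B z v + B v z) + t\<^sup>2 * B v v" for t v
    unfolding qd by (simp add: linear_add[OF L] linear_scale[OF L] bilinear_ladd[OF B] bilinear_radd[OF B]
      bilinear_lmul[OF B] bilinear_rmul[OF B] algebra_simps power2_eq_square)
  \<comment> \<open>If \<open>B v v\<close> were nonnegative, then on the side of \<open>v\<close>
    where the linear term is nonnegative \<open>q\<close> would never drop below \<open>q z\<close>.
    That ray leaves the bounded set \<open>K\<close>, against \<open>exit\<close>.\<close>
  have neg: "B v v < 0" if v: "v \<in> Rn n" "v \<noteq> 0" for v
  proof (rule ccontr)
    assume "\<not> B v v < 0"
    then have B0: "B v v \<ge> 0" by simp
    define l where "l = L v + B z v + B v z"
    define s where "s = (if l \<ge> 0 then 1 else -1 :: real)"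
    obtain b where b: "\<And>x. x \<in> K \<Longrightarrow> norm x \<le> b" using K(2) unfolding bounded_iff by blast
    have b0: "b \<ge> 0" using b[OF z] norm_ge_zero order_trans by blast
    define T where "T = (b + norm z + 1) / norm v"
    have T: "T > 0" using v b0 by (auto simp: T_def intro!: divide_pos_pos add_nonneg_pos)
    define x where "x = z + (T * s) *\<^sub>R v"
    have "norm ((T * s) *\<^sub>R v) = b + norm z + 1" using v b0 T unfolding norm_scaleR by (auto simp: s_def T_def abs_mult)
    then have "norm x > b" using norm_triangle_ineq2[of "(T * s) *\<^sub>R v" "- z"] by (simp add: x_def add.commute)
    then have "x \<notin> K" using b by fastforce
    moreover have "x \<in> Rn n" unfolding x_def using zR v by (intro subspace_add subspace_scale subspace_Rn)
    ultimately obtain t where t: "t \<in> {0..1}" "q (z + t *\<^sub>R (x - z)) \<le> \<tau>" using exit by blast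
    have "z + t *\<^sub>R (x - z) = z + (t * T * s) *\<^sub>R v" by (simp add: x_def)
    then have "q (z + t *\<^sub>R (x - z)) = q z + t * T * (s * l) + (t * T * s)\<^sup>2 * B v v"
      using qlin[of "t * T * s" v] by (simp add: l_def mult.assoc)
    moreover have "s * l \<ge> 0" by (simp add: s_def)
    then have "t * T * (s * l) \<ge> 0" using t T by (intro mult_nonneg_nonneg[of "t * T"]) auto
    moreover have "(t * T * s)\<^sup>2 * B v v \<ge> 0" using B0 by simp
    ultimately show False using t(2) qz tau by linarith
  qed
  obtain M c0 E where c0: "c0 \<in> Rn n" and E: "linear E" "\<forall>y\<in>Rn n. E y \<in> Rn n" "\<forall>x\<in>Rn n. \<exists>y\<in>Rn n. x = c0 + E y"
    and qE: "\<forall>y\<in>Rn n. c + L (c0 + E y) + B (c0 + E y) (c0 + E y) = M - (\<Sum>i<n. (Poly_Mapping.lookup y i)\<^sup>2)"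
    using complete_the_square[OF L B neg, where n = n and c = c] by blast
  have qE: "q (c0 + E y) = M - (\<Sum>i<n. (Poly_Mapping.lookup y i)\<^sup>2)" if "y \<in> Rn n" for y
    using qE that unfolding qd by blast
  obtain yz where yz: "yz \<in> Rn n" "z = c0 + E yz" using E(3) zR by blast
  have Mq: "M \<ge> q z" unfolding yz(2) qE[OF yz(1)] by (simp add: sum_nonneg)
  \<comment> \<open>\<open>q\<close> is concave, so on the segment from \<open>z\<close> to
    \<open>x\<close> it stays above \<open>\<tau>\<close> when it does so at both ends.\<close>
  have inK: "x \<in> K" if x: "x \<in> Rn n" "q x > \<tau>" for x
  proof (rule ccontr)
    assume "x \<notin> K"
    then obtain t where t: "t \<in> {0..1}" "q (z + t *\<^sub>R (x - z)) \<le> \<tau>" using exit x by blast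
    define l where "l = L (x - z) + B z (x - z) + B (x - z) z"
    define m where "m = B (x - z) (x - z)"
    have m: "m \<le> 0" using neg[of "x - z"] x zR bilinear_lzero[OF B] subspace_diff[OF subspace_Rn, of x n z]
      by (cases "x = z") (auto simp: m_def less_imp_le)
    have q1: "q x = q z + l + m" using qlin[of 1 "x - z"] by (simp add: l_def m_def)
    have qt: "q (z + t *\<^sub>R (x - z)) = q z + t * l + t\<^sup>2 * m" using qlin[of t "x - z"] by (simp add: l_def m_def)
    have "t\<^sup>2 \<le> t" using t(1) mult_left_mono[of t 1 t] by (simp add: power2_eq_square)
    then have "t\<^sup>2 * m \<ge> t * m" using m by (rule mult_right_mono_neg)
    then have "q (z + t *\<^sub>R (x - z)) \<ge> (1 - t) * q z + t * q x" unfolding qt q1 by (simp add: algebra_simps)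
    moreover have "(1 - t) * q z + t * q x > \<tau>"
      using convex_bound_lt[of "- q z" "- \<tau>" "- q x" "1-t" t] x(2) qz tau t(1) by simp
    ultimately show False using t(2) by linarith
  qed
  \<comment> \<open>Inside the radius \<open>r1\<close> the value is at least
    \<open>2 * \<tau>\<close>; the spare \<open>\<tau>\<close> makes the inequality required by
    \<open>inK\<close> strict.\<close>
  define r1 where "r1 = sqrt (M - 2 * \<tau>)"
  define r2 where "r2 = sqrt (M + \<tau>)"
  define l where "l = r2 / r1"
  have M: "M - 2 * \<tau> > 0" "M > 0" using Mq qz tau by linarith+
  have r: "r1 > 0" "r2 > 0" "r1\<^sup>2 = M - 2 * \<tau>" "r2\<^sup>2 = M + \<tau>" using M tau by (auto simp: r1_def r2_def)
  have l0: "l > 0" using r by (simp add: l_def)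
  have bml: "K \<subseteq> (\<lambda>y. c0 + r2 *\<^sub>R E y) ` euclidean_unit_ball n"
  proof
    fix x assume x: "x \<in> K"
    then obtain y where y: "y \<in> Rn n" "x = c0 + E y" using E(3) K by blast
    have "(\<Sum>i<n. (Poly_Mapping.lookup y i)\<^sup>2) \<le> r2\<^sup>2" using ge[OF x] qE[OF y(1)] y(2) r(4) by simp
    then have "(\<Sum>i<n. (Poly_Mapping.lookup y i)\<^sup>2) / r2\<^sup>2 \<le> 1" using r(2) by (simp add: divide_le_eq)
    then have "(\<Sum>i<n. (Poly_Mapping.lookup ((1/r2) *\<^sub>R y) i)\<^sup>2) \<le> 1"
      by (simp add: lookup_scaleR_pm power_divide flip: sum_divide_distrib)
    then have "(1/r2) *\<^sub>R y \<in> euclidean_unit_ball n"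
      using y by (simp add: euclidean_unit_ball_iff subspace_scale[OF subspace_Rn])
    moreover have "x = c0 + r2 *\<^sub>R E ((1/r2) *\<^sub>R y)" using r y by (simp add: linear_scale[OF E(1)])
    ultimately show "x \<in> (\<lambda>y. c0 + r2 *\<^sub>R E y) ` euclidean_unit_ball n" by blast
  qed
  have bmu: "(\<lambda>y. c0 + r2 *\<^sub>R E y) ` euclidean_unit_ball n \<subseteq> (\<lambda>x. l' *\<^sub>R x + (1 - l') *\<^sub>R c0) ` K" if l': "l' \<ge> l" for l'
  proof
    fix w assume "w \<in> (\<lambda>y. c0 + r2 *\<^sub>R E y) ` euclidean_unit_ball n"
    then obtain y where y: "y \<in> Rn n" "(\<Sum>i<n. (Poly_Mapping.lookup y i)\<^sup>2) \<le> 1" "w = c0 + r2 *\<^sub>R E y"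
      by (auto simp: euclidean_unit_ball_iff)
    define y' where "y' = (r2/l') *\<^sub>R y"
    have y'R: "y' \<in> Rn n" unfolding y'_def by (rule subspace_scale[OF subspace_Rn y(1)])
    have l'0: "l' > 0" using l0 l' by simp
    have "r2 / l' \<le> r1" using l' l'0 r by (simp add: l_def field_simps)
    then have "(r2/l')\<^sup>2 \<le> r1\<^sup>2" using r l'0 by (intro power_mono) auto
    then have "(r2/l')\<^sup>2 * (\<Sum>i<n. (Poly_Mapping.lookup y i)\<^sup>2) \<le> r1\<^sup>2 * 1"
      using y(2) by (intro mult_mono) (auto intro: sum_nonneg)
    then have "(\<Sum>i<n. (Poly_Mapping.lookup y' i)\<^sup>2) \<le> r1\<^sup>2"
      by (simp add: y'_def lookup_scaleR_pm power_mult_distrib power_divide sum_distrib_left)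
    then have "q (c0 + E y') > \<tau>" unfolding qE[OF y'R] r(3) using tau by linarith
    then have "c0 + E y' \<in> K" using inK[OF subspace_add[OF subspace_Rn c0]] E(2) y'R by blast
    moreover have "w = l' *\<^sub>R (c0 + E y') + (1 - l') *\<^sub>R c0"
      using l'0 by (simp add: y(3) y'_def linear_scale[OF E(1)] algebra_simps)
    ultimately show "w \<in> (\<lambda>x. l' *\<^sub>R x + (1 - l') *\<^sub>R c0) ` K" by blast
  qed
  have le: "l \<le> 1 + 5 * \<tau> / q z"
  proof -
    have qz0: "q z > 0" using qz tau by linarith
    define u where "u = 5 * \<tau> / q z"
    have u: "u > 0" "u * q z = 5 * \<tau>" using qz0 tau by (auto simp: u_def)
    have "u * q z \<le> u * M" using u Mq by (intro mult_left_mono) auto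
    then have "u * M \<ge> 5 * \<tau>" using u by simp
    moreover have "u \<le> 5/6" using qz qz0 by (simp add: u_def field_simps)
    then have "2 * \<tau> * u \<le> 2 * \<tau> * (5/6)" using tau by (intro mult_left_mono) auto
    moreover have "(1 + u) * (M - 2 * \<tau>) = M - 2 * \<tau> + u * M - 2 * \<tau> * u" by (simp add: algebra_simps)
    ultimately have "M + \<tau> \<le> (1 + u) * (M - 2 * \<tau>)" using tau by linarith
    also have "\<dots> \<le> (1 + u)\<^sup>2 * (M - 2 * \<tau>)" using u M by (intro mult_right_mono) (auto simp: power2_eq_square)
    finally have "r2\<^sup>2 \<le> ((1 + u) * r1)\<^sup>2" by (simp add: r power_mult_distrib)
    then have "r2 \<le> (1 + u) * r1" using r u by (auto intro: power2_le_imp_le[of r2 "(1 + u) * r1"])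
    then show ?thesis using r by (simp add: l_def u_def divide_le_eq)
  qed
  show ?thesis unfolding bm_within_def
  proof (intro conjI exI[of _ "\<lambda>y. c0 + r2 *\<^sub>R E y"] exI[of _ "(1 - (1 + 5 * \<tau> / q z)) *\<^sub>R c0"] bml bmu[OF le])
    show "0 < 1 + 5 * \<tau> / q z" using le l0 by linarith
    show "affine_map_between (Rn n) (Rn n) (\<lambda>y. c0 + r2 *\<^sub>R E y)"
      using E c0 by (intro affine_map_linear_plus subspace_Rn) auto
    show "(1 - (1 + 5 * \<tau> / q z)) *\<^sub>R c0 \<in> Rn n" by (rule subspace_scale[OF subspace_Rn c0])
  qed
qed

lemma quadratic_polynomial_shift:
  assumes "quadratic_polynomial q"
  shows "quadratic_polynomial (\<lambda>x. q (x - z))"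
proof -
  obtain c L B where L: "linear L" and B: "bilinear B" and q: "q = (\<lambda>x. c + L x + B x x)"
    using assms unfolding quadratic_polynomial_def by blast
  define L' where "L' = (\<lambda>x. L x - B x z - B z x)"
  have "linear L'" unfolding L'_def
    by (intro linearI) (simp_all add: linear_add[OF L] linear_scale[OF L] bilinear_ladd[OF B] bilinear_radd[OF B]
      bilinear_lmul[OF B] bilinear_rmul[OF B] algebra_simps)
  moreover have "q (x - z) = (c - L z + B z z) + L' x + B x x" for x
    unfolding q L'_def by (simp add: linear_diff[OF L] bilinear_lsub[OF B] bilinear_rsub[OF B])
  ultimately show ?thesis using B unfolding quadratic_polynomial_def by blast
qed

text \<open>The point \<open>x0\<close> of \<open>K\<close> nearest to \<open>p\<close> in the
  Euclidean form \<open>I\<close> has the variational property that \<open>I v (x - x0)\<close> is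
  nonnegative on \<open>K\<close> for \<open>v = x0 - p\<close>, so \<open>I v\<close>
  separates.\<close>

lemma separating_functional:
  assumes K: "K \<subseteq> Rn n" "compact K" "convex K" "K \<noteq> {}" and p: "p \<in> Rn n" "p \<notin> K"
  shows "\<exists>\<phi> :: _ \<Rightarrow> real. linear \<phi> \<and> (\<forall>x\<in>K. \<phi> x > \<phi> p)"
proof -
  let ?l = Poly_Mapping.lookup
  define I where "I = (\<lambda>x y. \<Sum>i<n. ?l x i * ?l y i :: real)"
  have Iadd: "I (x + y) w = I x w + I y w" "I w (x + y) = I w x + I w y" for x y w
    by (simp_all add: I_def lookup_add algebra_simps sum.distrib)
  have Isc: "I (c *\<^sub>R x) w = c * I x w" "I w (c *\<^sub>R x) = c * I w x" for c x w
    by (simp_all add: I_def lookup_scaleR_pm algebra_simps sum_distrib_left)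
  have Isub: "I (x - y) w = I x w - I y w" "I w (x - y) = I w x - I w y" for x y w
    by (simp_all add: I_def lookup_minus algebra_simps sum_subtractf)
  have Isym: "I x y = I y x" for x y by (simp add: I_def mult.commute)
  have "continuous_on K (\<lambda>x. I (x - p) (x - p))"
    unfolding I_def lookup_minus by (intro continuous_intros linear_continuous_on bounded_linear_lookup)
  then obtain x0 where x0: "x0 \<in> K" "\<And>x. x \<in> K \<Longrightarrow> I (x0 - p) (x0 - p) \<le> I (x - p) (x - p)"
    using continuous_attains_inf[OF K(2,4)] by blast
  define v where "v = x0 - p"
  have vR: "v \<in> Rn n" "v \<noteq> 0" using x0(1) p K(1) by (auto simp: v_def intro!: subspace_diff subspace_Rn)
  have vpos: "I v v > 0"
  proof -
    obtain i where i: "i < n" "?l v i \<noteq> 0"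
      using vR unfolding Rn_iff by (metis leI poly_mapping_eqI lookup_zero)
    show ?thesis unfolding I_def using i by (intro sum_pos2[of _ i]) (auto simp: zero_less_mult_iff linorder_neq_iff)
  qed
  have "I v (x - x0) \<ge> 0" if x: "x \<in> K" for x
  proof (rule ccontr)
    assume "\<not> ?thesis"
    then have neg: "I v (x - x0) < 0" by simp
    define a where "a = I v (x - x0)"
    define b where "b = I (x - x0) (x - x0)"
    have b: "b \<ge> 0" by (simp add: b_def I_def sum_nonneg)
    \<comment> \<open>So small that \<open>t * b \<le> - a\<close>: the decrease
      \<open>2 * a\<close> of first order then outweighs the second order term.\<close>
    define t where "t = min 1 (- a / (b + 1))"
    have t: "t > 0" "t \<le> 1" using neg b by (auto simp: t_def a_def intro!: divide_neg_pos)
    have "t \<le> - a / (b + 1)" by (simp add: t_def)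
    then have t3: "t * (b + 1) \<le> - a" using b pos_le_divide_eq[of "b + 1" t "- a"] by simp
    have "x0 + t *\<^sub>R (x - x0) = (1 - t) *\<^sub>R x0 + t *\<^sub>R x" by (simp add: algebra_simps)
    then have "x0 + t *\<^sub>R (x - x0) \<in> K" using convexD[OF K(3) x0(1) x, of "1-t" t] t by simp
    from x0(2)[OF this] have "I v v \<le> I (x0 + t *\<^sub>R (x - x0) - p) (x0 + t *\<^sub>R (x - x0) - p)"
      by (simp only: v_def)
    also have "x0 + t *\<^sub>R (x - x0) - p = v + t *\<^sub>R (x - x0)" by (simp add: v_def)
    finally have "I v v \<le> I (v + t *\<^sub>R (x - x0)) (v + t *\<^sub>R (x - x0))" .
    also have "I (v + t *\<^sub>R (x - x0)) (v + t *\<^sub>R (x - x0)) = I v v + t * (2 * a + t * b)"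
      by (simp only: Iadd Isc a_def b_def Isym[of "x - x0" v]) (simp add: algebra_simps)
    finally have "2 * a + t * b \<ge> 0" using t by (simp add: zero_le_mult_iff)
    moreover have "t * b \<le> - a" using t t3 by (simp add: algebra_simps)
    ultimately show False using neg by (simp add: a_def)
  qed
  then have "\<forall>x\<in>K. I v x > I v p" using vpos by (fastforce simp: Isub v_def)
  moreover have "linear (I v)" by (intro linearI) (simp_all add: Iadd Isc)
  ultimately show ?thesis by (intro exI[of _ "I v"] conjI)
qed

section \<open>Bodies with nearly elliptic sections\<close>

text \<open>The map \<open>A\<close> parametrizes a plane through \<open>x\<close>, \<open>y\<close> and \<open>0\<close>, and the ellipse is the image under
  \<open>A\<close> of the unit disc around \<open>- \<zeta>\<close>.\<close>
definition nearly_elliptic_sections :: "nat \<Rightarrow> (nat \<Rightarrow>\<^sub>0 real) set \<Rightarrow> real \<Rightarrow> bool" where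
  "nearly_elliptic_sections n K \<epsilon> \<longleftrightarrow> (\<forall>x\<in>Rn n. \<forall>y\<in>Rn n. \<exists>(A :: complex \<Rightarrow> _) \<zeta>. linear A \<and> inj A \<and> range A \<subseteq> Rn n \<and> x \<in> range A \<and> y \<in> range A \<and>
     (\<forall>w. norm (w + \<zeta>) \<le> 1 \<longrightarrow> A w \<in> K) \<and> (\<forall>w. A w \<in> K \<longrightarrow> norm (w + \<zeta>) \<le> 1 + \<epsilon>))"

text \<open>\<open>1 - (norm (w + \<zeta>))\<^sup>2\<close> is the natural defining function of the
  ellipse in one plane. The factor \<open>T\<close> stays free because these functions must be
  rescaled from plane to plane before they can come from one \<open>F\<close>.\<close>

lemma quadratic_on_segmentsI:
  assumes K: "convex K"
    and ex: "\<And>x y. x \<in> K \<Longrightarrow> y \<in> K \<Longrightarrow> \<exists>(A :: complex \<Rightarrow> _) \<zeta> T. linear A \<and> x \<in> range A \<and> y \<in> range A \<and>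
      (\<forall>w. A w \<in> K \<longrightarrow> \<bar>F (A w) - T * (1 - (norm (w + \<zeta>))\<^sup>2)\<bar> \<le> \<theta>)"
  shows "quadratic_on_segments \<theta> F K"
  unfolding quadratic_on_segments_def
proof (intro ballI)
  fix x y assume xy: "x \<in> K" "y \<in> K"
  then obtain A :: "complex \<Rightarrow> _" and \<zeta> T where A: "linear A" "x \<in> range A" "y \<in> range A"
    and F: "\<And>w. A w \<in> K \<Longrightarrow> \<bar>F (A w) - T * (1 - (norm (w + \<zeta>))\<^sup>2)\<bar> \<le> \<theta>" using ex by blast
  obtain v w where vw: "x = A v" "y = A w" using A by blast
  define p where "p = v + \<zeta>"
  define d where "d = w - v"
  have "\<bar>F (x + t *\<^sub>R (y - x)) - (T * (1 - p \<bullet> p) + (- 2 * T * (p \<bullet> d)) * t + (- T * (d \<bullet> d)) * t\<^sup>2)\<bar> \<le> \<theta>"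
    if t: "t \<in> {0..1}" for t
  proof -
    have 1: "x + t *\<^sub>R (y - x) = A (v + t *\<^sub>R d)"
      by (simp add: vw d_def linear_add[OF A(1)] linear_diff[OF A(1)] linear_scale[OF A(1)])
    have "x + t *\<^sub>R (y - x) = (1 - t) *\<^sub>R x + t *\<^sub>R y" by (simp add: algebra_simps)
    then have "A (v + t *\<^sub>R d) \<in> K" using convexD[OF K xy, of "1-t" t] t 1 by simp
    from F[OF this] have "\<bar>F (x + t *\<^sub>R (y - x)) - T * (1 - (norm (v + t *\<^sub>R d + \<zeta>))\<^sup>2)\<bar> \<le> \<theta>" unfolding 1 .
    moreover have "v + t *\<^sub>R d + \<zeta> = p + t *\<^sub>R d" by (simp add: p_def)
    then have "(norm (v + t *\<^sub>R d + \<zeta>))\<^sup>2 = p \<bullet> p + 2 * t * (p \<bullet> d) + t\<^sup>2 * (d \<bullet> d)"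
      by (simp only:) (unfold power2_norm_eq_inner,
        simp add: inner_add_left inner_add_right inner_commute[of d p] power2_eq_square algebra_simps)
    ultimately show ?thesis by (simp add: algebra_simps)
  qed
  then show "\<exists>a b c. \<forall>t\<in>{0..1}. \<bar>F (x + t *\<^sub>R (y - x)) - (a + b * t + c * t\<^sup>2)\<bar> \<le> \<theta>" by blast
qed

text \<open>If \<open>f\<close> and \<open>- g\<close> were exact roots of
  \<open>\<kappa> * X\<^sup>2 + l * X - Q\<close>, this polynomial would be
  \<open>\<kappa> * ((X - f) * (X + g))\<close>; the claim is its value at X = 1. Multiplying by
  \<open>f + g\<close> turns the two defects into a linear identity with no separate smallness
  condition on the roots.\<close>

lemma two_root_estimate:
  fixes \<kappa> l Q f g :: real
  assumes fg: "f > 0" "g > 0" and e1: "\<bar>\<kappa> * f\<^sup>2 + l * f - Q\<bar> \<le> c * f\<^sup>2" and e2: "\<bar>\<kappa> * g\<^sup>2 - l * g - Q\<bar> \<le> c * g\<^sup>2"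
    and c: "c \<ge> 0"
  shows "\<bar>(\<kappa> + l - Q) - \<kappa> * ((1 - f) * (1 + g))\<bar> \<le> c * (f + g + f * g)"
proof -
  define a where "a = \<kappa> * f\<^sup>2 + l * f - Q"
  define b where "b = \<kappa> * g\<^sup>2 - l * g - Q"
  have 1: "(l - \<kappa> * (g - f)) * (f + g) = a - b" by (simp add: a_def b_def algebra_simps power2_eq_square)
  have 2: "(\<kappa> * f * g - Q) * (f + g) = a * g + b * f" by (simp add: a_def b_def algebra_simps power2_eq_square)
  have "((\<kappa> + l - Q) - \<kappa> * ((1 - f) * (1 + g))) * (f + g) = (l - \<kappa> * (g - f)) * (f + g) + (\<kappa> * f * g - Q) * (f + g)"
    by (simp add: algebra_simps)
  also have "\<dots> = (a - b) + (a * g + b * f)" unfolding 1 2 ..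
  finally have eq: "((\<kappa> + l - Q) - \<kappa> * ((1 - f) * (1 + g))) * (f + g) = (a - b) + (a * g + b * f)" .
  have "\<bar>(\<kappa> + l - Q) - \<kappa> * ((1 - f) * (1 + g))\<bar> * (f + g) = \<bar>((\<kappa> + l - Q) - \<kappa> * ((1 - f) * (1 + g))) * (f + g)\<bar>"
    using fg unfolding abs_mult by simp
  also have "\<dots> = \<bar>(a - b) + (a * g + b * f)\<bar>" unfolding eq ..
  also have "\<dots> \<le> \<bar>a\<bar> + \<bar>b\<bar> + \<bar>a\<bar> * g + \<bar>b\<bar> * f"
    using fg abs_triangle_ineq[of "a - b" "a * g + b * f"] abs_triangle_ineq4[of a b] abs_triangle_ineq[of "a*g" "b*f"]
    by (simp add: abs_mult)
  also have "\<dots> \<le> c * f\<^sup>2 + c * g\<^sup>2 + c * f\<^sup>2 * g + c * g\<^sup>2 * f"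
    using e1 e2 fg by (intro add_mono mult_right_mono) (auto simp: a_def b_def)
  also have "\<dots> \<le> c * (f + g + f * g) * (f + g)"
    using fg c by (simp add: algebra_simps power2_eq_square)
  finally show ?thesis using fg by simp
qed

locale fat_body =
  fixes n :: nat and K :: "(nat \<Rightarrow>\<^sub>0 real) set" and z :: "nat \<Rightarrow>\<^sub>0 real" and R :: real
  assumes n2: "n \<ge> 2" and KR: "K \<subseteq> Rn n" and comp: "compact K" and conv: "convex K"
    and zR: "z \<in> Rn n" and inner_ball: "cball z 2 \<inter> Rn n \<subseteq> K" and outer: "K \<subseteq> cball z R"
    and zero_int: "\<exists>e>0. cball 0 e \<inter> Rn n \<subseteq> K" and R1: "R \<ge> 1"
begin

text \<open>Here \<open>z\<close> is the centre of an inscribed ball, while \<open>0\<close>, through which the sections pass, may be very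
  close to the boundary; the estimates must not depend on how close it is.\<close>
definition rho :: "(nat \<Rightarrow>\<^sub>0 real) \<Rightarrow> real" where "rho u = Sup {s. s *\<^sub>R u \<in> K}"

text \<open>The Minkowski functional of \<open>K\<close>. At 0 the set in \<open>rho\<close> is
  unbounded, hence the separate value.\<close>

definition gauge :: "(nat \<Rightarrow>\<^sub>0 real) \<Rightarrow> real" where "gauge u = (if u = 0 then 0 else 1 / rho u)"

lemma zero_K: "0 \<in> K"
  using zero_int subspace_0[OF subspace_Rn, of n] by fastforce

lemma norm_z: "norm z \<le> R" using zero_K outer by (auto simp: dist_norm)

lemma norm_K: "x \<in> K \<Longrightarrow> norm x \<le> 2 * R"
  using outer norm_z norm_triangle_ineq[of z "x - z"] by (fastforce simp: dist_norm norm_minus_commute)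

lemma rho:
  assumes "u \<in> Rn n" "u \<noteq> 0"
  shows "rho u > 0" "rho u *\<^sub>R u \<in> K" "\<And>s. s *\<^sub>R u \<in> K \<Longrightarrow> s \<le> rho u"
proof -
  let ?S = "{s. s *\<^sub>R u \<in> K}"
  have "closed ?S"
    using continuous_closed_vimage[of K "\<lambda>s. s *\<^sub>R u"] compact_imp_closed[OF comp]
    by (auto simp: vimage_def)
  moreover have bd: "bdd_above ?S"
  proof (rule bdd_aboveI[of _ "2 * R / norm u"])
    fix s assume "s \<in> ?S"
    then have "\<bar>s\<bar> * norm u \<le> 2 * R" using norm_K[of "s *\<^sub>R u"] by simp
    then have "s * norm u \<le> 2 * R" using mult_right_mono[OF abs_ge_self norm_ge_zero, of s u] by linarith
    then show "s \<le> 2 * R / norm u" using assms by (simp add: le_divide_eq)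
  qed
  moreover have ne: "?S \<noteq> {}" using zero_K by (auto intro!: exI[of _ 0])
  ultimately have "rho u \<in> ?S" unfolding rho_def by (intro closed_contains_Sup)
  then show "rho u *\<^sub>R u \<in> K" by simp
  show le: "s \<le> rho u" if "s *\<^sub>R u \<in> K" for s unfolding rho_def using that bd by (intro cSup_upper) auto
  obtain e where e: "e > 0" "cball 0 e \<inter> Rn n \<subseteq> K" using zero_int by blast
  have "(e / norm u) *\<^sub>R u \<in> cball 0 e \<inter> Rn n" using e assms subspace_scale[OF subspace_Rn assms(1)] by simp
  then have "(e / norm u) *\<^sub>R u \<in> K" using e by blast
  then have "e / norm u \<le> rho u" by (rule le)
  then show "rho u > 0" using e assms by (meson divide_pos_pos less_le_trans zero_less_norm_iff)
qed

lemma gauge_nonneg: "u \<in> Rn n \<Longrightarrow> gauge u \<ge> 0"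
  using rho(1) by (auto simp: gauge_def less_imp_le)

lemma gauge_le_1: "u \<in> K \<Longrightarrow> gauge u \<le> 1"
  using rho(3)[of u 1] KR by (auto simp: gauge_def divide_le_eq_1)

text \<open>Measures how far 0 is from the boundary. The same number normalizes
  \<open>(1 - gauge u) * (1 + gauge (- u))\<close> so that its value at \<open>z\<close> becomes
  \<open>1 - gauge z\<close>, whatever the position of 0.\<close>

definition depth :: real where "depth = 1 / (1 + gauge (- z))"

lemma depth: "0 < depth" "depth \<le> 1"
  using gauge_nonneg[of "- z"] zR subspace_neg[OF subspace_Rn] by (auto simp: depth_def)

text \<open>The origin lies between \<open>- rho (- z) z\<close> and \<open>z\<close>, and the homothety centred at the former
  carries the unit ball around \<open>z\<close> to one of radius \<open>depth\<close> around the origin.\<close>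
lemma depth_ball: "b \<in> Rn n \<Longrightarrow> norm b \<le> 1 \<Longrightarrow> depth *\<^sub>R b \<in> K"
proof (cases "z = 0")
  case True
  assume "b \<in> Rn n" "norm b \<le> 1"
  then have "b \<in> K" using inner_ball True by auto
  moreover have "depth = 1" unfolding depth_def gauge_def by (simp add: True)
  ultimately show ?thesis by simp
next
  case False
  assume b: "b \<in> Rn n" "norm b \<le> 1"
  have mz: "- z \<in> Rn n" "- z \<noteq> 0" using False zR subspace_neg[OF subspace_Rn] by auto
  let ?r = "rho (- z)"
  have r: "?r > 0" "?r *\<^sub>R (- z) \<in> K" using rho[OF mz] by auto
  have s: "depth = ?r / (1 + ?r)" using False r by (simp add: depth_def gauge_def field_simps)
  have "z + b \<in> cball z 2 \<inter> Rn n" using b subspace_add[OF subspace_Rn zR b(1)] by (simp add: dist_norm)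
  then have "z + b \<in> K" using inner_ball by blast
  then have "(1 - depth) *\<^sub>R (?r *\<^sub>R (- z)) + depth *\<^sub>R (z + b) \<in> K"
    using depth r by (intro convexD[OF conv]) auto
  also have "(1 - depth) *\<^sub>R (?r *\<^sub>R (- z)) + depth *\<^sub>R (z + b) = depth *\<^sub>R b + (depth - (1 - depth) * ?r) *\<^sub>R z"
    by (simp add: algebra_simps)
  also have "depth - (1 - depth) * ?r = 0" unfolding s using r by (simp add: field_simps)
  finally show ?thesis by simp
qed

lemma opposite_point: "u \<in> K \<Longrightarrow> (depth / (2 * R)) *\<^sub>R (- u) \<in> K"
proof -
  assume u: "u \<in> K"
  have "(1 / (2 * R)) *\<^sub>R (- u) \<in> Rn n" using u KR by (intro subspace_scale subspace_neg subspace_Rn) auto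
  moreover have "norm ((1 / (2 * R)) *\<^sub>R (- u)) \<le> 1" using norm_K[OF u] R1 by simp
  ultimately show ?thesis using depth_ball by fastforce
qed

lemma gauge_opposite: "u \<in> K \<Longrightarrow> gauge (- u) \<le> 2 * R / depth"
proof (cases "u = 0")
  case True then show ?thesis using R1 depth by (simp add: gauge_def)
next
  case False
  assume u: "u \<in> K"
  have mu: "- u \<in> Rn n" "- u \<noteq> 0" using False u KR subspace_neg[OF subspace_Rn] by auto
  have "depth / (2 * R) \<le> rho (- u)" by (rule rho(3)[OF mu opposite_point[OF u]])
  then have "1 / rho (- u) \<le> 1 / (depth / (2 * R))" using depth R1 by (intro divide_left_mono mult_pos_pos rho(1) mu) auto
  then show ?thesis using False by (simp add: gauge_def)
qed

text \<open>The ball of radius 2 about \<open>z\<close> contains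
  \<open>(1 + 2/R) *\<^sub>R z\<close>. This bounds the defining function at \<open>z\<close> from
  below independently of the position of 0.\<close>

lemma gauge_z: "1 - gauge z \<ge> 1 / (2 * R)"
proof (cases "z = 0")
  case True then show ?thesis using R1 by (simp add: gauge_def field_simps)
next
  case False
  have "norm ((2/R) *\<^sub>R z) \<le> 2" using norm_z R1 by (simp add: field_simps)
  then have "z + (2/R) *\<^sub>R z \<in> K"
    using zR by (intro subsetD[OF inner_ball]) (auto simp: dist_norm intro!: subspace_add subspace_scale subspace_Rn)
  then have "(1 + 2/R) *\<^sub>R z \<in> K" by (simp add: algebra_simps)
  then have "1 + 2/R \<le> rho z" by (rule rho(3)[OF zR False])
  then have "1 / rho z \<le> 1 / (1 + 2/R)" using R1 by (intro divide_left_mono mult_pos_pos rho(1)[OF zR False]) (auto intro: add_pos_pos)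
  also have "\<dots> \<le> 1 - 1 / (2 * R)" using R1 by (simp add: field_simps)
  finally show ?thesis using False by (simp add: gauge_def)
qed

text \<open>Take the last point of the segment in \<open>K\<close>. Were its gauge
  \<open>g < 1\<close>, it would be \<open>g\<close> times a point of \<open>K\<close>, and the ball
  around 0, shrunk by \<open>1 - g\<close>, would leave room to go further.\<close>

lemma exit_point:
  assumes x: "x \<in> Rn n" "x \<notin> K"
  shows "\<exists>t\<in>{0..1}. z + t *\<^sub>R (x - z) \<in> K \<and> gauge (z + t *\<^sub>R (x - z)) = 1"
proof -
  let ?y = "\<lambda>t. z + t *\<^sub>R (x - z)"
  have yR: "?y t \<in> Rn n" for t using x zR by (intro subspace_add subspace_scale subspace_diff subspace_Rn)
  let ?S = "{0..1} \<inter> ?y -` K"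
  have "closed (?y -` K)" using compact_imp_closed[OF comp] by (intro continuous_closed_vimage) auto
  then have S: "compact ?S" by (intro compact_Int_closed) auto
  have "z \<in> K" using inner_ball zR by auto
  then have "0 \<in> ?S" by simp
  then obtain t where t: "t \<in> ?S" "\<And>s. s \<in> ?S \<Longrightarrow> s \<le> t"
    using compact_attains_sup[OF S] by blast
  have t1: "t < 1" using t(1) x by (cases "t = 1") auto
  obtain e where e: "e > 0" "cball 0 e \<inter> Rn n \<subseteq> K" using zero_int by blast
  have "gauge (?y t) = 1"
  proof (rule ccontr)
    assume "gauge (?y t) \<noteq> 1"
    then have g: "gauge (?y t) < 1" using gauge_le_1[of "?y t"] t(1) by auto
    define g where "g = gauge (?y t)"
    have "\<exists>k\<in>K. ?y t = g *\<^sub>R k"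
    proof (cases "?y t = 0")
      case True then show ?thesis using zero_K by (auto simp: g_def gauge_def)
    next
      case False
      then show ?thesis using rho[OF yR False] by (intro bexI[of _ "rho (?y t) *\<^sub>R ?y t"]) (auto simp: g_def gauge_def)
    qed
    then obtain k where k: "k \<in> K" "?y t = g *\<^sub>R k" by blast
    have g01: "g \<ge> 0" "g < 1" using g gauge_nonneg[OF yR] by (auto simp: g_def)
    define s where "s = min (1 - t) ((1 - g) * e / (norm (x - z) + 1))"
    have s0: "s > 0" using t1 g01 e by (auto simp: s_def intro!: divide_pos_pos mult_pos_pos add_nonneg_pos)
    define b where "b = (s / (1 - g)) *\<^sub>R (x - z)"
    have "norm b \<le> e"
    proof -
      have "s * (norm (x - z) + 1) \<le> (1 - g) * e"
      proof -
      have "s \<le> (1 - g) * e / (norm (x - z) + 1)" by (simp add: s_def)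
      moreover have "norm (x - z) + 1 > 0" by (simp add: add_nonneg_pos)
      ultimately show ?thesis by (simp add: le_divide_eq)
    qed
      then have "s * norm (x - z) \<le> (1 - g) * e" using s0 by (simp add: algebra_simps)
      moreover have "norm b = s * norm (x - z) / (1 - g)" unfolding b_def using g01 s0 by simp
      ultimately show ?thesis using g01 by (simp add: pos_divide_le_eq mult.commute)
    qed
    moreover have "b \<in> Rn n" unfolding b_def using x zR by (intro subspace_scale subspace_diff subspace_Rn)
    ultimately have "b \<in> K" using e(2) by auto
    then have "g *\<^sub>R k + (1 - g) *\<^sub>R b \<in> K" using g01 k by (intro convexD[OF conv]) auto
    also have "g *\<^sub>R k + (1 - g) *\<^sub>R b = ?y (t + s)"
      using g01 k(2) by (simp add: b_def) (simp add: algebra_simps flip: k(2))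
    finally have "t + s \<in> ?S" using t(1) s0 by (auto simp: s_def min_def)
    then show False using t(2) s0 by fastforce
  qed
  then show ?thesis using t(1) by auto
qed

text \<open>The farthest point of \<open>K\<close> on the ray lies outside the open inner disc,
  since otherwise the ray could be prolonged within it, and inside the disc of radius
  \<open>1 + \<epsilon>\<close>. The constant is
  \<open>(1 + \<epsilon>)\<^sup>2 \<le> 1 + 3 * \<epsilon>\<close>.\<close>

lemma boundary_value:
  fixes A :: "complex \<Rightarrow> nat \<Rightarrow>\<^sub>0 real"
  assumes A: "linear A" and in1: "\<And>w. norm (w + \<zeta>) \<le> 1 \<Longrightarrow> A w \<in> K" and in2: "\<And>w. A w \<in> K \<Longrightarrow> norm (w + \<zeta>) \<le> 1 + \<epsilon>"
    and eps: "\<epsilon> \<ge> 0" "\<epsilon> \<le> 1" and u: "A w \<noteq> 0" "A w \<in> Rn n"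
  shows "\<bar>1 - (norm (rho (A w) *\<^sub>R w + \<zeta>))\<^sup>2\<bar> \<le> 3 * \<epsilon>"
proof -
  let ?r = "rho (A w)"
  let ?N = "norm (?r *\<^sub>R w + \<zeta>)"
  have "A (?r *\<^sub>R w) \<in> K" using rho(2)[OF u(2,1)] by (simp add: linear_scale[OF A])
  then have N: "?N \<le> 1 + \<epsilon>" by (rule in2)
  have "?N\<^sup>2 \<le> (1 + \<epsilon>)\<^sup>2" using N by (intro power_mono) auto
  also have "\<dots> \<le> 1 + 3 * \<epsilon>" using eps mult_left_mono[of \<epsilon> 1 \<epsilon>] by (simp add: power2_eq_square algebra_simps)
  finally have 1: "?N\<^sup>2 \<le> 1 + 3 * \<epsilon>" .
  have "?N \<ge> 1"
  proof (rule ccontr)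
    assume lt: "\<not> ?N \<ge> 1"
    have w: "w \<noteq> 0" using u linear_0[OF A] by auto
    define s where "s = (1 - ?N) / norm w"
    have s: "s > 0" "s * norm w = 1 - ?N" using lt w by (auto simp: s_def)
    have "norm ((?r + s) *\<^sub>R w + \<zeta>) \<le> ?N + norm (s *\<^sub>R w)"
      using norm_triangle_ineq[of "?r *\<^sub>R w + \<zeta>" "s *\<^sub>R w"] by (simp add: algebra_simps)
    also have "\<dots> = 1" using s by simp
    finally have "A ((?r + s) *\<^sub>R w) \<in> K" by (rule in1)
    then have "(?r + s) *\<^sub>R A w \<in> K" by (simp only: linear_scale[OF A])
    from rho(3)[OF u(2,1) this] have "?r + s \<le> ?r" .
    then show False using s by simp
  qed
  then have "?N\<^sup>2 \<ge> 1" by simp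
  then show ?thesis using 1 by (simp add: abs_le_iff)
qed

text \<open>For an exact ellipse, \<open>gauge u\<close> and \<open>- gauge (- u)\<close> are the
  two roots of \<open>\<kappa> * X\<^sup>2 + l * X - Q\<close>, so
  \<open>(1 - gauge u) * (1 + gauge (- u))\<close> is the defining function of the ellipse divided
  by its value \<open>\<kappa>\<close> at 0. It equals 1 at 0 in every plane, which makes the planes
  agree; the price is the division by \<open>\<kappa>\<close>, which can be as small as the
  depth.\<close>

lemma deep_case:
  assumes H: "nearly_elliptic_sections n K \<epsilon>" and eps: "\<epsilon> > 0" "\<epsilon> \<le> 1" "4 * R * \<epsilon> \<le> depth"
  shows "quadratic_on_segments (120 * R\<^sup>2 * \<epsilon> / depth) (\<lambda>u. depth * ((1 - gauge u) * (1 + gauge (- u)))) K"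
proof (rule quadratic_on_segmentsI[OF conv])
  fix x y assume xy: "x \<in> K" "y \<in> K"
  then obtain A :: "complex \<Rightarrow> _" and \<zeta> where A: "linear A" "inj A" "x \<in> range A" "y \<in> range A"
    and in1: "\<And>w. norm (w + \<zeta>) \<le> 1 \<Longrightarrow> A w \<in> K" and in2: "\<And>w. A w \<in> K \<Longrightarrow> norm (w + \<zeta>) \<le> 1 + \<epsilon>"
    using H KR unfolding nearly_elliptic_sections_def by (elim ballE[of _ _ x] ballE[of _ _ y] exE conjE) auto
  define s where "s = depth"
  have s: "s > 0" "s \<le> 1" using depth by (auto simp: s_def)
  define \<kappa> where "\<kappa> = 1 - (norm \<zeta>)\<^sup>2"
  \<comment> \<open>The centre \<open>- \<zeta>\<close> of the ellipse lies in \<open>K\<close>,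
    hence so does a multiple \<open>r\<close> of its opposite; the outer disc then forces
    \<open>(1 + r) * norm \<zeta> \<le> 1 + \<epsilon>\<close>. For this to give
    \<open>norm \<zeta> < 1\<close>, \<open>\<epsilon>\<close> must be small against the
    depth.\<close>
  have kappa: "\<kappa> \<ge> s / (8 * R)"
  proof -
    define r where "r = s / (2 * R)"
    have r: "0 < r" "r \<le> 1" "2 * \<epsilon> \<le> r" using s R1 eps by (auto simp: r_def s_def field_simps)
    have "A (- \<zeta>) \<in> K" by (rule in1) simp
    from opposite_point[OF this] have "A (r *\<^sub>R \<zeta>) \<in> K"
      by (simp add: r_def s_def linear_scale[OF A(1)] linear_neg[OF A(1)])
    then have "norm (r *\<^sub>R \<zeta> + \<zeta>) \<le> 1 + \<epsilon>" by (rule in2)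
    also have "r *\<^sub>R \<zeta> + \<zeta> = (1 + r) *\<^sub>R \<zeta>" by (simp add: algebra_simps)
    finally have *: "(1 + r) * norm \<zeta> \<le> 1 + \<epsilon>" using r by simp
    have "(1 + r) * (1 - norm \<zeta>) \<ge> r / 2" using * r by (simp add: algebra_simps)
    also have "r / 2 \<ge> (1 + r) * (r / 4)" using r by (simp add: field_simps)
    finally have 1: "1 - norm \<zeta> \<ge> r / 4" using r by simp
    have "(norm \<zeta>)\<^sup>2 \<le> norm \<zeta>" using 1 r mult_left_mono[of "norm \<zeta>" 1 "norm \<zeta>"] by (simp add: power2_eq_square)
    then show ?thesis using 1 by (simp add: \<kappa>_def r_def)
  qed
  have k0: "\<kappa> > 0" using kappa s R1 by (meson divide_pos_pos less_le_trans mult_pos_pos zero_less_numeral zero_less_one)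
  have "\<bar>s * ((1 - gauge (A w)) * (1 + gauge (- A w))) - s / \<kappa> * (1 - (norm (w + \<zeta>))\<^sup>2)\<bar> \<le> 120 * R\<^sup>2 * \<epsilon> / s"
    if w: "A w \<in> K" for w
  proof (cases "A w = 0")
    case True
    then have "w = 0" using A(1,2) linear_injective_0[OF A(1)] by auto
    then show ?thesis using True k0 eps s by (simp add: gauge_def \<kappa>_def[symmetric])
  next
    case False
    let ?u = "A w"
    have u: "?u \<in> Rn n" "- ?u \<in> Rn n" "- ?u \<noteq> 0" using w KR subspace_neg[OF subspace_Rn] False by auto
    define f where "f = gauge ?u"
    define g where "g = gauge (- ?u)"
    have f: "f > 0" "f * rho ?u = 1" using rho(1)[OF u(1) False] False by (auto simp: f_def gauge_def)
    have g: "g > 0" "g * rho (- ?u) = 1" using rho(1)[OF u(2,3)] False by (auto simp: g_def gauge_def)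
    have f1: "f \<le> 1" using gauge_le_1[OF w] by (simp add: f_def)
    have g1: "g \<le> 2 * R / s" using gauge_opposite[OF w] by (simp add: g_def s_def)
    define l where "l = - 2 * (\<zeta> \<bullet> w)"
    define Q where "Q = w \<bullet> w"
    have qt: "1 - (norm (t *\<^sub>R w + \<zeta>))\<^sup>2 = \<kappa> + l * t - Q * t\<^sup>2" for t
      unfolding \<kappa>_def l_def Q_def power2_norm_eq_inner
      by (simp add: inner_add_left inner_add_right inner_commute[of w \<zeta>] power2_eq_square algebra_simps)
    have e1: "\<bar>\<kappa> + l * rho ?u - Q * (rho ?u)\<^sup>2\<bar> \<le> 3 * \<epsilon>"
      using boundary_value[OF A(1) in1 in2 _ _ False u(1)] eps by (simp flip: qt)
    have "\<bar>1 - (norm (rho (A (- w)) *\<^sub>R (- w) + \<zeta>))\<^sup>2\<bar> \<le> 3 * \<epsilon>"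
      using boundary_value[OF A(1) in1 in2, of "- w"] eps u by (simp add: linear_neg[OF A(1)])
    then have e2: "\<bar>\<kappa> - l * rho (- ?u) - Q * (rho (- ?u))\<^sup>2\<bar> \<le> 3 * \<epsilon>"
      using qt[of "- rho (- ?u)"] by (simp add: linear_neg[OF A(1)])
    \<comment> \<open>Passing from the boundary parameter \<open>rho ?u\<close> to its inverse
      \<open>f\<close> reverses the polynomial and multiplies the defect by
      \<open>f\<^sup>2\<close>, the relative error that \<open>two_root_estimate\<close>
      expects.\<close>
    have fe: "\<kappa> * f\<^sup>2 + l * f - Q = (\<kappa> + l * rho ?u - Q * (rho ?u)\<^sup>2) * f\<^sup>2"
    proof -
      have "(\<kappa> + l * rho ?u - Q * (rho ?u)\<^sup>2) * f\<^sup>2 = \<kappa> * f\<^sup>2 + l * f * (f * rho ?u) - Q * (f * rho ?u)\<^sup>2"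
        by (simp add: algebra_simps power2_eq_square)
      then show ?thesis by (simp add: f)
    qed
    have ge: "\<kappa> * g\<^sup>2 - l * g - Q = (\<kappa> - l * rho (- ?u) - Q * (rho (- ?u))\<^sup>2) * g\<^sup>2"
    proof -
      have "(\<kappa> - l * rho (- ?u) - Q * (rho (- ?u))\<^sup>2) * g\<^sup>2 = \<kappa> * g\<^sup>2 - l * g * (g * rho (- ?u)) - Q * (g * rho (- ?u))\<^sup>2"
        by (simp add: algebra_simps power2_eq_square)
      then show ?thesis by (simp add: g)
    qed
    have "\<bar>(\<kappa> + l - Q) - \<kappa> * ((1 - f) * (1 + g))\<bar> \<le> 3 * \<epsilon> * (f + g + f * g)"
    proof (rule two_root_estimate[OF f(1) g(1)])
      show "\<bar>\<kappa> * f\<^sup>2 + l * f - Q\<bar> \<le> 3 * \<epsilon> * f\<^sup>2" unfolding fe abs_mult using e1 by (simp add: mult_right_mono)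
      show "\<bar>\<kappa> * g\<^sup>2 - l * g - Q\<bar> \<le> 3 * \<epsilon> * g\<^sup>2" unfolding ge abs_mult using e2 by (simp add: mult_right_mono)
    qed (use eps in auto)
    also have "\<dots> \<le> 3 * \<epsilon> * (1 + 2 * R / s + 1 * (2 * R / s))"
      using f1 g1 f g eps by (intro mult_left_mono add_mono mult_mono) auto
    also have "\<dots> \<le> 3 * \<epsilon> * (5 * R / s)"
      using s R1 eps by (intro mult_left_mono) (auto simp: field_simps)
    finally have main: "\<bar>(\<kappa> + l - Q) - \<kappa> * ((1 - f) * (1 + g))\<bar> \<le> 15 * \<epsilon> * R / s" by simp
    have wq: "1 - (norm (w + \<zeta>))\<^sup>2 = \<kappa> + l - Q" using qt[of 1] by simp
    have "s * ((1 - f) * (1 + g)) - s / \<kappa> * (1 - (norm (w + \<zeta>))\<^sup>2) = (s / \<kappa>) * (\<kappa> * ((1 - f) * (1 + g)) - (\<kappa> + l - Q))"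
      unfolding wq using k0 by (simp add: field_simps)
    then have "\<bar>s * ((1 - f) * (1 + g)) - s / \<kappa> * (1 - (norm (w + \<zeta>))\<^sup>2)\<bar> = (s / \<kappa>) * \<bar>(\<kappa> + l - Q) - \<kappa> * ((1 - f) * (1 + g))\<bar>"
      using k0 s by (simp add: abs_mult abs_minus_commute)
    also have "\<dots> \<le> (8 * R) * (15 * \<epsilon> * R / s)"
    proof (rule mult_mono[OF _ main])
      show "s / \<kappa> \<le> 8 * R" using kappa k0 R1 by (simp add: field_simps)
    qed (use R1 in auto)
    finally show ?thesis by (simp add: f_def g_def power2_eq_square mult_ac)
  qed
  then show "\<exists>(A :: complex \<Rightarrow> _) \<zeta> T. linear A \<and> x \<in> range A \<and> y \<in> range A \<and> (\<forall>w. A w \<in> K \<longrightarrow>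
     \<bar>depth * ((1 - gauge (A w)) * (1 + gauge (- A w))) - T * (1 - (norm (w + \<zeta>))\<^sup>2)\<bar> \<le> 120 * R\<^sup>2 * \<epsilon> / depth)"
    using A unfolding s_def by blast
qed

text \<open>\<open>\<phi>\<close> almost supports \<open>K\<close> at 0, so in each plane the
  ellipse almost passes through 0 with normal direction given by \<open>\<phi>\<close>. With
  \<open>\<beta>\<close> representing \<open>\<phi>\<close>, its defining function, scaled by half
  the length of \<open>\<beta>\<close>, is nearly
  \<open>\<beta> \<bullet> w - t * (w \<bullet> w)\<close>. On the boundary the two terms nearly
  cancel, so \<open>t * (w \<bullet> w)\<close> is nearly \<open>\<phi> u * gauge u\<close>. Here
  the linear part \<open>\<phi>\<close>, not the value at 0, is common to all planes.\<close>

lemma shallow_case: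
  assumes H: "nearly_elliptic_sections n K \<epsilon>" and eps: "\<epsilon> > 0" "\<epsilon> \<le> 1"
    and \<phi>: "linear \<phi>" "\<phi> z = 1" "\<And>x. x \<in> K \<Longrightarrow> \<phi> x \<ge> - \<nu>" and nu: "0 \<le> \<nu>" "\<nu> \<le> 1"
  shows "quadratic_on_segments (2 * \<nu> + 9 * R * \<epsilon> + 8 * sqrt (12 * R\<^sup>2 * \<epsilon> + 4 * R * \<nu>)) (\<lambda>u. \<phi> u * (1 - gauge u)) K"
proof (rule quadratic_on_segmentsI[OF conv])
  fix x y assume xy: "x \<in> K" "y \<in> K"
  then obtain A :: "complex \<Rightarrow> _" and \<zeta> where A: "linear A" "inj A" "x \<in> range A" "y \<in> range A"
    and in1: "\<And>w. norm (w + \<zeta>) \<le> 1 \<Longrightarrow> A w \<in> K" and in2: "\<And>w. A w \<in> K \<Longrightarrow> norm (w + \<zeta>) \<le> 1 + \<epsilon>"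
    using H KR unfolding nearly_elliptic_sections_def by (elim ballE[of _ _ x] ballE[of _ _ y] exE conjE) auto
  define \<mu> where "\<mu> = sqrt (12 * R\<^sup>2 * \<epsilon> + 4 * R * \<nu>)"
  define \<beta> where "\<beta> = Complex (\<phi> (A 1)) (\<phi> (A \<i>))"
  have \<phi>A: "\<phi> (A w) = \<beta> \<bullet> w" for w
  proof -
    have "w = Re w *\<^sub>R 1 + Im w *\<^sub>R \<i>" by (simp add: complex_eq_iff)
    then have "\<phi> (A w) = \<phi> (A (Re w *\<^sub>R 1 + Im w *\<^sub>R \<i>))" by metis
    also have "\<dots> = Re w * \<phi> (A 1) + Im w * \<phi> (A \<i>)"
      by (simp only: linear_add[OF A(1)] linear_scale[OF A(1)] linear_add[OF \<phi>(1)] linear_scale[OF \<phi>(1)] real_scaleR_def)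
    finally show ?thesis by (simp add: \<beta>_def inner_complex_def)
  qed
  define b where "b = norm \<beta>"
  have b0: "b \<ge> 0" by (simp add: b_def)
  have z1: "norm \<zeta> \<le> 1 + \<epsilon>" using in2[of 0] zero_K linear_0[OF A(1)] by simp
  \<comment> \<open>\<open>\<phi>\<close> is evaluated at the two points of the inner ellipse where
    it is extremal: the smaller value is at least \<open>- \<nu>\<close>, the larger at most
    \<open>2 * R\<close>.\<close>
  have lower: "b - \<nu> \<le> - (\<beta> \<bullet> \<zeta>)" and upper: "2 * b - \<nu> \<le> 2 * R"
  proof -
    define e where "e = (if \<beta> = 0 then 1 else sgn \<beta>)"
    have e: "norm e = 1" "\<beta> \<bullet> e = b"
      by (auto simp: e_def b_def norm_sgn sgn_div_norm dot_square_norm power2_eq_square)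
    have "A (- \<zeta> - e) \<in> K" by (rule in1) (simp add: e)
    from \<phi>(3)[OF this] show 1: "b - \<nu> \<le> - (\<beta> \<bullet> \<zeta>)" by (simp add: \<phi>A inner_diff_right e)
    have "A (- \<zeta> + e) \<in> K" by (rule in1) (simp add: e)
    then have n2: "norm (A (- \<zeta> + e)) \<le> 2 * R" "A (- \<zeta> + e) \<in> Rn n" using norm_K KR by auto
    \<comment> \<open>Here the radius 2 matters: \<open>z - (2 / norm v) *\<^sub>R v\<close> lies in
      \<open>K\<close>, where \<open>\<phi>\<close> is at least -1, while
      \<open>\<phi> z = 1\<close>.\<close>
    have \<phi>n: "\<phi> v \<le> norm v" if v: "v \<in> Rn n" for v
    proof (cases "v = 0")
      case False
      have "z - (2 / norm v) *\<^sub>R v \<in> K" using False v zR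
        by (intro subsetD[OF inner_ball]) (auto simp: dist_norm intro!: subspace_diff subspace_scale subspace_Rn)
      from \<phi>(3)[OF this] have "2 / norm v * \<phi> v \<le> 2"
        using nu by (simp add: linear_diff[OF \<phi>(1)] linear_scale[OF \<phi>(1)] \<phi>(2))
      then show ?thesis using False by (simp add: field_simps)
    qed (simp add: linear_0[OF \<phi>(1)])
    have "\<phi> (A (- \<zeta> + e)) \<le> 2 * R" using \<phi>n[OF n2(2)] n2(1) by linarith
    then show "2 * b - \<nu> \<le> 2 * R" using 1 by (simp add: \<phi>A inner_add_right inner_diff_right e)
  qed
  have b2: "b \<le> 2 * R" using upper nu R1 by linarith
  have sq_eps: "(1 + \<epsilon>)\<^sup>2 \<le> 1 + 3 * \<epsilon>" using eps mult_left_mono[of \<epsilon> 1 \<epsilon>] by (simp add: power2_eq_square algebra_simps)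
  have z2: "(norm \<zeta>)\<^sup>2 \<le> 1 + 3 * \<epsilon>" using power_mono[OF z1, of 2] sq_eps by simp
  \<comment> \<open>Quantifies that \<open>\<beta>\<close> points opposite to \<open>\<zeta>\<close>
    and that \<open>norm \<zeta>\<close> is nearly 1. In the expanded square the terms
    \<open>b\<^sup>2\<close> cancel; taking the root of the rest is where the square root loss
    arises.\<close>
  have mu: "norm (\<beta> + b *\<^sub>R \<zeta>) \<le> \<mu>"
  proof -
    have bb: "\<beta> \<bullet> \<beta> = b * b" by (simp add: b_def dot_square_norm power2_eq_square)
    have "(norm (\<beta> + b *\<^sub>R \<zeta>))\<^sup>2 = b\<^sup>2 + 2 * b * (\<beta> \<bullet> \<zeta>) + b\<^sup>2 * (norm \<zeta>)\<^sup>2"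
      using bb unfolding power2_norm_eq_inner
      by (simp add: inner_add_left inner_add_right inner_commute[of \<zeta> \<beta>] algebra_simps power2_eq_square)
    also have "\<dots> \<le> b\<^sup>2 + 2 * b * (\<nu> - b) + b\<^sup>2 * (1 + 3 * \<epsilon>)"
      using lower z2 b0 by (intro add_mono mult_left_mono) auto
    also have "\<dots> = 3 * \<epsilon> * b\<^sup>2 + 2 * \<nu> * b" by (simp add: algebra_simps power2_eq_square)
    also have "\<dots> \<le> 3 * \<epsilon> * (2 * R)\<^sup>2 + 2 * \<nu> * (2 * R)"
      using b0 b2 eps nu by (intro add_mono mult_left_mono power_mono) auto
    also have "\<dots> = 12 * R\<^sup>2 * \<epsilon> + 4 * R * \<nu>" by (simp add: power2_eq_square)
    finally show ?thesis unfolding \<mu>_def by (rule real_le_rsqrt)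
  qed
  have mu0: "\<mu> \<ge> 0" using mu norm_ge_zero order_trans by blast
  define t where "t = b / 2"
  have t: "0 \<le> t" "t \<le> R" using b0 b2 by (auto simp: t_def)
  define \<kappa> where "\<kappa> = t * (1 - (norm \<zeta>)\<^sup>2)"
  have kappa: "\<bar>\<kappa>\<bar> \<le> \<nu> + 3 * R * \<epsilon>"
  proof -
    have "b - \<nu> \<le> b * norm \<zeta>" using lower norm_cauchy_schwarz[of \<beta> "- \<zeta>"] by (simp add: b_def)
    then have bz: "b * (1 - norm \<zeta>) \<le> \<nu>" by (simp add: algebra_simps)
    have up: "\<kappa> \<le> \<nu>"
    proof (cases "norm \<zeta> \<le> 1")
      case True
      have "\<kappa> = (t * (1 - norm \<zeta>)) * (1 + norm \<zeta>)" by (simp add: \<kappa>_def power2_eq_square algebra_simps)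
      also have "\<dots> \<le> (t * (1 - norm \<zeta>)) * 2" using True t by (intro mult_left_mono) auto
      also have "\<dots> = b * (1 - norm \<zeta>)" by (simp add: t_def)
      finally show ?thesis using bz by simp
    next
      case False
      then have "1 - (norm \<zeta>)\<^sup>2 \<le> 0" by simp
      then have "\<kappa> \<le> 0" unfolding \<kappa>_def using t by (simp add: mult_nonneg_nonpos)
      then show ?thesis using nu by simp
    qed
    have "- \<kappa> = t * ((norm \<zeta>)\<^sup>2 - 1)" by (simp add: \<kappa>_def algebra_simps)
    also have "\<dots> \<le> t * (3 * \<epsilon>)" using t z2 by (intro mult_left_mono) auto
    also have "\<dots> \<le> R * (3 * \<epsilon>)" using t eps by (intro mult_right_mono) auto
    finally have "- \<kappa> \<le> 3 * R * \<epsilon>" by simp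
    moreover have "3 * R * \<epsilon> \<ge> 0" using R1 eps by simp
    ultimately show ?thesis using up nu by (simp add: abs_le_iff)
  qed
  define X where "X = (\<lambda>w. t * (1 - (norm (w + \<zeta>))\<^sup>2))"
  \<comment> \<open>The difference is exactly
    \<open>\<kappa> - (\<beta> + b *\<^sub>R \<zeta>) \<bullet> w\<close>, and both parts are
    small.\<close>
  have X: "\<bar>X w - (\<beta> \<bullet> w - t * (w \<bullet> w))\<bar> \<le> \<nu> + 3 * R * \<epsilon> + 4 * \<mu>" if w: "A w \<in> K" for w
  proof -
    have "X w - (\<beta> \<bullet> w - t * (w \<bullet> w)) = \<kappa> - (\<beta> + b *\<^sub>R \<zeta>) \<bullet> w"
      unfolding X_def \<kappa>_def t_def power2_norm_eq_inner
      by (simp add: inner_add_left inner_add_right inner_commute[of w \<zeta>] algebra_simps)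
    moreover have "\<bar>(\<beta> + b *\<^sub>R \<zeta>) \<bullet> w\<bar> \<le> \<mu> * 4"
    proof -
      have "norm w \<le> norm (w + \<zeta>) + norm \<zeta>" using norm_triangle_ineq4[of "w + \<zeta>" \<zeta>] by simp
      also have "\<dots> \<le> 4" using in2[OF w] z1 eps by linarith
      finally have "norm (\<beta> + b *\<^sub>R \<zeta>) * norm w \<le> \<mu> * 4" using mu mu0 by (intro mult_mono) auto
      then show ?thesis using Cauchy_Schwarz_ineq2[of "\<beta> + b *\<^sub>R \<zeta>" w] by linarith
    qed
    ultimately show ?thesis using kappa by linarith
  qed
  have "\<bar>\<phi> (A w) * (1 - gauge (A w)) - t * (1 - (norm (w + \<zeta>))\<^sup>2)\<bar> \<le> 2 * \<nu> + 9 * R * \<epsilon> + 8 * \<mu>" if w: "A w \<in> K" for w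
  proof (cases "A w = 0")
    case True
    then have "w = 0" using A(1,2) linear_injective_0[OF A(1)] by auto
    then have "\<bar>\<phi> (A w) * (1 - gauge (A w)) - t * (1 - (norm (w + \<zeta>))\<^sup>2)\<bar> = \<bar>\<kappa>\<bar>"
      using True by (simp add: linear_0[OF \<phi>(1)] \<kappa>_def)
    also have "\<dots> \<le> \<nu> + 3 * R * \<epsilon>" by (rule kappa)
    also have "\<dots> \<le> 2 * \<nu> + 9 * R * \<epsilon> + 8 * \<mu>" using nu mu0 R1 eps by (intro add_increasing2 add_mono mult_right_mono) auto
    finally show ?thesis .
  next
    case False
    let ?u = "A w"
    let ?r = "rho ?u"
    have u: "?u \<in> Rn n" using w KR by auto
    define f where "f = gauge ?u"
    have f: "0 \<le> f" "f \<le> 1" "f * ?r = 1" using rho(1)[OF u False] False gauge_le_1[OF w]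
      by (auto simp: f_def gauge_def)
    have rK: "A (?r *\<^sub>R w) \<in> K" using rho(2)[OF u False] by (simp add: linear_scale[OF A(1)])
    have "\<bar>X (?r *\<^sub>R w)\<bar> \<le> R * (3 * \<epsilon>)"
      unfolding X_def abs_mult using boundary_value[OF A(1) in1 in2 _ _ False u] eps t by (intro mult_mono) auto
    then have "\<bar>\<beta> \<bullet> (?r *\<^sub>R w) - t * ((?r *\<^sub>R w) \<bullet> (?r *\<^sub>R w))\<bar> \<le> \<nu> + 6 * R * \<epsilon> + 4 * \<mu>"
      using X[OF rK] by linarith
    \<comment> \<open>Since \<open>f * ?r = 1\<close>, multiplication by \<open>f\<^sup>2\<close>
      turns the boundary relation into one between \<open>f * (\<beta> \<bullet> w)\<close> and
      \<open>t * (w \<bullet> w)\<close> at \<open>w\<close> itself.\<close>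
    then have "f\<^sup>2 * \<bar>\<beta> \<bullet> (?r *\<^sub>R w) - t * ((?r *\<^sub>R w) \<bullet> (?r *\<^sub>R w))\<bar> \<le> 1 * (\<nu> + 6 * R * \<epsilon> + 4 * \<mu>)"
      using f by (intro mult_mono) (auto simp: power_le_one)
    also have "f\<^sup>2 * \<bar>\<beta> \<bullet> (?r *\<^sub>R w) - t * ((?r *\<^sub>R w) \<bullet> (?r *\<^sub>R w))\<bar> = \<bar>f\<^sup>2 * (\<beta> \<bullet> (?r *\<^sub>R w) - t * ((?r *\<^sub>R w) \<bullet> (?r *\<^sub>R w)))\<bar>"
      by (simp add: abs_mult)
    also have "f\<^sup>2 * (\<beta> \<bullet> (?r *\<^sub>R w) - t * ((?r *\<^sub>R w) \<bullet> (?r *\<^sub>R w))) = f * (f * ?r) * (\<beta> \<bullet> w) - (f * ?r)\<^sup>2 * t * (w \<bullet> w)"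
      by (simp add: power2_eq_square algebra_simps)
    finally have "\<bar>f * (\<beta> \<bullet> w) - t * (w \<bullet> w)\<bar> \<le> \<nu> + 6 * R * \<epsilon> + 4 * \<mu>" by (simp add: f(3))
    then have "\<bar>X w - (\<beta> \<bullet> w - f * (\<beta> \<bullet> w))\<bar> \<le> 2 * \<nu> + 9 * R * \<epsilon> + 8 * \<mu>" using X[OF w] by linarith
    then show ?thesis by (simp add: X_def \<phi>A f_def algebra_simps abs_minus_commute)
  qed
  then show "\<exists>(A :: complex \<Rightarrow> _) \<zeta> T. linear A \<and> x \<in> range A \<and> y \<in> range A \<and> (\<forall>w. A w \<in> K \<longrightarrow>
     \<bar>\<phi> (A w) * (1 - gauge (A w)) - T * (1 - (norm (w + \<zeta>))\<^sup>2)\<bar>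
       \<le> 2 * \<nu> + 9 * R * \<epsilon> + 8 * sqrt (12 * R\<^sup>2 * \<epsilon> + 4 * R * \<nu>))"
    using A unfolding \<mu>_def by blast
qed

text \<open>The threshold \<open>e ^ 2\<close> for the depth balances the two cases: the deep one
  has an error of order \<open>e ^ 3 / depth\<close>, the shallow one has
  \<open>\<nu> = 3 * e ^ 2\<close> under a square root. Both are of order \<open>e\<close>.\<close>

lemma near_quadratic_defining_function:
  assumes H: "nearly_elliptic_sections n K (e ^ 3)" and e: "0 < e" "4 * R * e \<le> 1"
  shows "\<exists>F. quadratic_on_segments (120 * R\<^sup>2 * e) F K \<and> F z \<ge> 1 / (2 * R) \<and>
     (\<forall>x\<in>K. F x \<ge> - (120 * R\<^sup>2 * e)) \<and> (\<forall>x. gauge x = 1 \<longrightarrow> F x = 0)"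
proof -
  have "1 * (4 * e) \<le> R * (4 * e)" using R1 e by (intro mult_right_mono) auto
  then have e1: "e \<le> 1/4" using e by linarith
  have e2: "e^2 \<le> 1/16" using power_mono[OF e1, of 2] e by (simp add: power2_eq_square)
  have e3: "e^3 \<le> 1" using e e1 by (simp add: power_le_one)
  have e32: "e^3 \<le> e" using e e1 mult_left_mono[of "e^2" 1 e] e2 by (simp add: power3_eq_cube power2_eq_square)
  have mK: "z \<in> K" using inner_ball zR by auto
  show ?thesis
  proof (cases "depth \<ge> e^2")
    case True
    have "4 * R * e^3 = (4 * R * e) * e^2" by (simp add: power2_eq_square power3_eq_cube)
    also have "\<dots> \<le> 1 * e^2" using e by (intro mult_right_mono) auto
    finally have d: "4 * R * e^3 \<le> depth" using True by simp
    have Q: "quadratic_on_segments (120 * R\<^sup>2 * e^3 / depth) (\<lambda>u. depth * ((1 - gauge u) * (1 + gauge (- u)))) K"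
      by (rule deep_case[OF H _ e3 d]) (use e in simp)
    have le: "120 * R\<^sup>2 * e^3 / depth \<le> 120 * R\<^sup>2 * e"
    proof -
      have "120 * R\<^sup>2 * e^3 = 120 * R\<^sup>2 * e * e^2" by (simp add: power2_eq_square power3_eq_cube)
      also have "\<dots> \<le> 120 * R\<^sup>2 * e * depth" using True e by (intro mult_left_mono) auto
      finally show ?thesis using depth by (simp add: divide_le_eq)
    qed
    show ?thesis
    proof (intro exI[of _ "\<lambda>u. depth * ((1 - gauge u) * (1 + gauge (- u)))"] conjI ballI allI impI)
      show "quadratic_on_segments (120 * R\<^sup>2 * e) (\<lambda>u. depth * ((1 - gauge u) * (1 + gauge (- u)))) K"
        using Q le unfolding quadratic_on_segments_def by (meson order_trans)
      have "depth * (1 + gauge (- z)) = 1" using gauge_nonneg[of "- z"] zR subspace_neg[OF subspace_Rn] by (simp add: depth_def)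
      then have eq: "depth * ((1 - gauge z) * (1 + gauge (- z))) = 1 - gauge z"
        by (metis mult.left_commute mult.right_neutral)
      show "1 / (2 * R) \<le> depth * ((1 - gauge z) * (1 + gauge (- z)))" unfolding eq by (rule gauge_z)
      fix x assume x: "x \<in> K"
      have "gauge (- x) \<ge> 0" using gauge_nonneg x KR subspace_neg[OF subspace_Rn] by blast
      then have "depth * ((1 - gauge x) * (1 + gauge (- x))) \<ge> 0" using depth gauge_le_1[OF x] by simp
      moreover have "120 * R\<^sup>2 * e \<ge> 0" using e by simp
      ultimately show "- (120 * R\<^sup>2 * e) \<le> depth * ((1 - gauge x) * (1 + gauge (- x)))" by linarith
    qed simp
  next
    case False
    then have z0: "z \<noteq> 0" using e2 by (auto simp: depth_def gauge_def)
    then have mz: "- z \<in> Rn n" "- z \<noteq> 0" using zR subspace_neg[OF subspace_Rn] by auto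
    define r where "r = rho (- z)"
    have r: "r > 0" using rho(1)[OF mz] by (simp add: r_def)
    have "depth = r / (1 + r)" using z0 r by (simp add: depth_def gauge_def r_def field_simps)
    then have "r < e^2 * (1 + r)" using False r pos_divide_less_eq[of "1 + r" r "e^2"] by simp
    then have "r * (1 - e^2) < e^2" by (simp add: algebra_simps)
    moreover have "r * (1/2) \<le> r * (1 - e^2)" using r e2 by (intro mult_left_mono) auto
    ultimately have r2: "r < 3 * e^2" using zero_less_power[OF e(1), of 2] by linarith
    \<comment> \<open>Small depth means \<open>rho (- z) < 3 * e ^ 2\<close>, so \<open>p\<close> is
      just outside \<open>K\<close>; the functional separating it, scaled to 1 at \<open>z\<close>,
      is at least \<open>- (3 * e ^ 2)\<close> on \<open>K\<close>.\<close>
    define p where "p = (3 * e^2) *\<^sub>R (- z)"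
    have "p \<notin> K" using rho(3)[OF mz, of "3 * e^2"] r2 by (auto simp: p_def r_def)
    moreover have "p \<in> Rn n" unfolding p_def by (rule subspace_scale[OF subspace_Rn mz(1)])
    ultimately obtain \<psi> :: "_ \<Rightarrow> real" where \<psi>: "linear \<psi>" "\<And>x. x \<in> K \<Longrightarrow> \<psi> x > \<psi> p"
      using separating_functional[OF KR comp conv, of p] zero_K by blast
    have "\<psi> p = - (3 * e^2 * \<psi> z)" by (simp only: p_def linear_scale[OF \<psi>(1)] linear_neg[OF \<psi>(1)] real_scaleR_def mult_minus_right)
    then have \<psi>p: "\<psi> x > - (3 * e^2 * \<psi> z)" if "x \<in> K" for x using \<psi>(2)[OF that] by simp
    have "3 * e^2 * \<psi> z > 0" using \<psi>p[OF zero_K] linear_0[OF \<psi>(1)] by simp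
    then have \<psi>z: "\<psi> z > 0" using e by (simp add: zero_less_mult_iff)
    define \<phi> where "\<phi> = (\<lambda>x. \<psi> x / \<psi> z)"
    have \<phi>: "linear \<phi>" "\<phi> z = 1" "\<And>x. x \<in> K \<Longrightarrow> \<phi> x \<ge> - (3 * e^2)"
    proof -
      show "linear \<phi>" unfolding \<phi>_def
        by (intro linearI) (simp_all add: linear_add[OF \<psi>(1)] linear_scale[OF \<psi>(1)] add_divide_distrib)
      show "\<phi> z = 1" using \<psi>z by (simp add: \<phi>_def)
      show "\<phi> x \<ge> - (3 * e^2)" if "x \<in> K" for x using \<psi>p[OF that] \<psi>z by (simp add: \<phi>_def le_divide_eq)
    qed
    define \<theta> where "\<theta> = 2 * (3 * e^2) + 9 * R * e^3 + 8 * sqrt (12 * R\<^sup>2 * e^3 + 4 * R * (3 * e^2))"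
    have Q: "quadratic_on_segments \<theta> (\<lambda>u. \<phi> u * (1 - gauge u)) K"
      unfolding \<theta>_def by (rule shallow_case[OF H _ e3 \<phi>]) (use e e2 in auto)
    have e2e: "e^2 \<le> e" using e e1 mult_left_mono[of e 1 e] by (simp add: power2_eq_square)
    have RR: "R \<le> R\<^sup>2" using R1 by (simp add: power2_eq_square)
    have eR: "e \<le> R\<^sup>2 * e" "R * e \<le> R\<^sup>2 * e" using R1 RR e mult_right_mono[of 1 "R\<^sup>2" e] by (auto intro: mult_right_mono)
    have le: "\<theta> \<le> 120 * R\<^sup>2 * e"
    proof -
      have "12 * R\<^sup>2 * e^3 + 4 * R * (3 * e^2) \<le> 12 * R\<^sup>2 * e^2 + 12 * R\<^sup>2 * e^2"
      proof (rule add_mono)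
        have "e^3 \<le> e^2" using e e1 mult_right_mono[of e 1 "e^2"] by (simp add: power2_eq_square power3_eq_cube)
        then show "12 * R\<^sup>2 * e^3 \<le> 12 * R\<^sup>2 * e^2" by (intro mult_left_mono) auto
        show "4 * R * (3 * e^2) \<le> 12 * R\<^sup>2 * e^2" using RR mult_right_mono[of R "R\<^sup>2" "12 * e^2"] by simp
      qed
      also have "\<dots> \<le> (5 * R * e)\<^sup>2" by (simp add: power_mult_distrib)
      finally have "sqrt (12 * R\<^sup>2 * e^3 + 4 * R * (3 * e^2)) \<le> 5 * R * e" using R1 e by (intro real_le_lsqrt) auto
      moreover have "R * e^3 \<le> R * e" using e32 R1 by (intro mult_left_mono) auto
      moreover have "0 \<le> R\<^sup>2 * e" using e by simp
      ultimately show ?thesis unfolding \<theta>_def using eR e2e by linarith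
    qed
    show ?thesis
    proof (intro exI[of _ "\<lambda>u. \<phi> u * (1 - gauge u)"] conjI ballI allI impI)
      show "quadratic_on_segments (120 * R\<^sup>2 * e) (\<lambda>u. \<phi> u * (1 - gauge u)) K"
        using Q le unfolding quadratic_on_segments_def by (meson order_trans)
      show "1 / (2 * R) \<le> \<phi> z * (1 - gauge z)" using gauge_z \<phi>(2) by simp
      fix x assume x: "x \<in> K"
      have g: "0 \<le> 1 - gauge x" "1 - gauge x \<le> 1" using gauge_le_1[OF x] gauge_nonneg[of x] x KR by auto
      have "- (3 * e^2) \<le> - (3 * e^2) * (1 - gauge x)" using g e mult_left_mono[of "1 - gauge x" 1 "3 * e^2"] by simp
      also have "\<dots> \<le> \<phi> x * (1 - gauge x)" using \<phi>(3)[OF x] g by (intro mult_right_mono) auto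
      finally show "- (120 * R\<^sup>2 * e) \<le> \<phi> x * (1 - gauge x)" using e2e eR e by linarith
    qed simp
  qed
qed

text \<open>The defining function is at least \<open>1 / (2 * R)\<close> at \<open>z\<close>, so its
  polynomial approximation determines \<open>K\<close> as soon as the error \<open>\<tau>\<close> is
  well below that.\<close>

theorem bm_within_of_nearly_elliptic_sections:
  assumes e: "0 < e" and H: "nearly_elliptic_sections n K (e ^ 3)"
  shows "\<exists>l. bm_within n K l \<and> l \<le> 1 + 10^9 * R^6 * real n * 18 ^ n * e"
proof -
  have crude: "bm_within n K (R * real n)"
  proof (rule bm_within_crude[OF _ zR])
    show "cball z 1 \<inter> Rn n \<subseteq> K" using inner_ball by auto
  qed (use n2 R1 KR outer in auto)
  define \<tau> where "\<tau> = 100000 * R\<^sup>2 * 18 ^ n * (120 * R\<^sup>2 * e)"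
  have tau0: "\<tau> > 0" using R1 e by (simp add: \<tau>_def)
  have final: "72 * R\<^sup>2 * real n * \<tau> \<le> 10^9 * R^6 * real n * 18 ^ n * e"
  proof -
    have "72 * R\<^sup>2 * real n * \<tau> = 864000000 * (R^6 * real n * 18 ^ n * e)"
      by (simp add: \<tau>_def power2_eq_square eval_nat_numeral)
    also have "\<dots> \<le> 10^9 * (R^6 * real n * 18 ^ n * e)" using R1 e by (intro mult_right_mono) auto
    finally show ?thesis by simp
  qed
  show ?thesis
  proof (cases "\<tau> \<le> 1 / (32 * R)")
    \<comment> \<open>The asserted bound is then so weak that the crude comparison with a ball
      already satisfies it.\<close>
    case False
    then have "1 < 32 * R * \<tau>" using R1 by (simp add: field_simps)
    then have "R * real n * 1 \<le> R * real n * (32 * R * \<tau>)" using R1 by (intro mult_left_mono) auto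
    also have "\<dots> = 32 * R\<^sup>2 * real n * \<tau>" by (simp add: power2_eq_square)
    also have "\<dots> \<le> 72 * R\<^sup>2 * real n * \<tau>" using tau0 by (intro mult_right_mono) auto
    finally show ?thesis using crude final by (intro exI[of _ "R * real n"] conjI) (assumption, linarith)
  next
    case True
    have te: "R * e \<le> \<tau>"
    proof -
      have "1 \<le> R\<^sup>2 * (18::real) ^ n" using R1 mult_mono[of 1 "R\<^sup>2" 1 "(18::real)^n"] by (simp add: one_le_power)
      then have "1 \<le> (R\<^sup>2 * (18::real) ^ n) * R" using R1 mult_mono[of 1 "R\<^sup>2 * (18::real) ^ n" 1 R] by simp
      then have "1 \<le> 100000 * R\<^sup>2 * 18 ^ n * (120::real) * R" by simp
      then have "1 * (R * e) \<le> (100000 * R\<^sup>2 * 18 ^ n * 120 * R) * (R * e)" using R1 e by (intro mult_right_mono) auto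
      then show ?thesis by (simp add: \<tau>_def power2_eq_square algebra_simps)
    qed
    have t32: "32 * R * \<tau> \<le> 1" using True R1 by (simp add: field_simps)
    have "\<tau> \<le> R * \<tau>" using R1 tau0 by simp
    then have "4 * R * e \<le> 1" using te t32 by linarith
    then obtain F where F: "quadratic_on_segments (120 * R\<^sup>2 * e) F K" "F z \<ge> 1 / (2 * R)"
      "\<And>x. x \<in> K \<Longrightarrow> F x \<ge> - (120 * R\<^sup>2 * e)" "\<And>x. gauge x = 1 \<Longrightarrow> F x = 0"
      using near_quadratic_defining_function[OF H e] by blast
    define K' where "K' = (\<lambda>x. x - z) ` K"
    have zx: "z + x \<in> K \<longleftrightarrow> x \<in> K'" for x unfolding K'_def by force
    have "\<exists>q. quadratic_polynomial q \<and> (\<forall>x\<in>K'. \<bar>F (z + x) - q x\<bar> \<le> 100000 * R\<^sup>2 * 18 ^ n * (120 * R\<^sup>2 * e))"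
    proof (rule near_quadratic_polynomial[OF n2])
      show "quadratic_on_segments (120 * R\<^sup>2 * e) (\<lambda>x. F (z + x)) K'"
        unfolding quadratic_on_segments_def
      proof (intro ballI)
        fix x y assume "x \<in> K'" "y \<in> K'"
        then have xy: "z + x \<in> K" "z + y \<in> K" by (auto simp: zx)
        obtain a b c where "\<forall>t\<in>{0..1}. \<bar>F (z + x + t *\<^sub>R (z + y - (z + x))) - (a + b * t + c * t\<^sup>2)\<bar> \<le> 120 * R\<^sup>2 * e"
          using F(1) xy unfolding quadratic_on_segments_def by blast
        then show "\<exists>a b c. \<forall>t\<in>{0..1}. \<bar>F (z + (x + t *\<^sub>R (y - x))) - (a + b * t + c * t\<^sup>2)\<bar> \<le> 120 * R\<^sup>2 * e"
          by (intro exI[of _ a] exI[of _ b] exI[of _ c]) (simp add: add.assoc)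
      qed
      show "cball 0 2 \<inter> Rn n \<subseteq> K'"
      proof
        fix x assume "x \<in> cball 0 2 \<inter> Rn n"
        then have "z + x \<in> cball z 2 \<inter> Rn n" using zR subspace_add[OF subspace_Rn] by (auto simp: dist_norm)
        then show "x \<in> K'" using inner_ball zx by blast
      qed
      show "K' \<subseteq> cball 0 R \<inter> Rn n" using outer KR zR subspace_diff[OF subspace_Rn]
        by (auto simp: K'_def dist_norm norm_minus_commute)
    qed (use R1 e in auto)
    then obtain q where q: "quadratic_polynomial q" "\<And>x. x \<in> K' \<Longrightarrow> \<bar>F (z + x) - q x\<bar> \<le> \<tau>"
      unfolding \<tau>_def by blast
    define q' where "q' = (\<lambda>x. q (x - z))"
    have q'F: "\<bar>F x - q' x\<bar> \<le> \<tau>" if "x \<in> K" for x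
      using q(2)[of "x - z"] that by (simp add: q'_def zx[symmetric])
    have zK: "z \<in> K" using inner_ball zR by auto
    have th: "120 * R\<^sup>2 * e \<le> \<tau>"
    proof -
      have "1 \<le> R\<^sup>2 * (18::real) ^ n" using R1 mult_mono[of 1 "R\<^sup>2" 1 "(18::real)^n"] by (simp add: one_le_power)
      then have "1 * (120 * R\<^sup>2 * e) \<le> 100000 * (R\<^sup>2 * 18 ^ n) * (120 * R\<^sup>2 * e)" using e by (intro mult_right_mono) auto
      then show ?thesis by (simp add: \<tau>_def)
    qed
    have "1 / (2 * R) \<ge> 16 * \<tau>" using t32 R1 by (simp add: field_simps)
    then have qz: "q' z \<ge> 12 * \<tau>" "q' z \<ge> 1 / (4 * R)" using q'F[OF zK] F(2) tau0 by (auto simp: abs_le_iff)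
    \<comment> \<open>The level is \<open>2 * \<tau>\<close>: one \<open>\<tau>\<close> because
      \<open>F\<close> may be slightly negative on \<open>K\<close>, one for replacing
      \<open>F\<close> by the polynomial.\<close>
    have "bm_within n K (1 + 5 * (2 * \<tau>) / q' z)"
    proof (rule bm_within_of_quadratic[OF KR _ zK])
      show "bounded K" by (rule compact_imp_bounded[OF comp])
      show "quadratic_polynomial q'" unfolding q'_def by (rule quadratic_polynomial_shift[OF q(1)])
      show "- (2 * \<tau>) \<le> q' x" if "x \<in> K" for x using q'F[OF that] F(3)[OF that] th by (simp add: abs_le_iff)
      show "\<exists>t\<in>{0..1}. q' (z + t *\<^sub>R (x - z)) \<le> 2 * \<tau>" if x: "x \<in> Rn n" "x \<notin> K" for x
      proof -
        obtain t where t: "t \<in> {0..1}" "z + t *\<^sub>R (x - z) \<in> K" "gauge (z + t *\<^sub>R (x - z)) = 1"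
          using exit_point[OF x] by blast
        then have "q' (z + t *\<^sub>R (x - z)) \<le> 2 * \<tau>" using q'F[OF t(2)] F(4)[OF t(3)] tau0 by (simp add: abs_le_iff)
        then show ?thesis using t(1) by blast
      qed
    qed (use tau0 qz in auto)
    moreover have "1 + 5 * (2 * \<tau>) / q' z \<le> 1 + 10^9 * R^6 * real n * 18 ^ n * e"
    proof -
      have "10 * \<tau> / q' z \<le> 10 * \<tau> / (1 / (4 * R))" using qz R1 tau0 by (intro divide_left_mono mult_pos_pos) auto
      also have "\<dots> = 40 * R * 1 * \<tau>" by simp
      also have "\<dots> \<le> 72 * R\<^sup>2 * real n * \<tau>"
        using R1 n2 tau0 by (intro mult_right_mono mult_mono) (auto simp: power2_eq_square intro: mult_mono)
      also note final
      finally show ?thesis by simp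
    qed
    ultimately show ?thesis by blast
  qed
qed

end

section \<open>Linear normalization of the body\<close>

lemma zero_interior_ball:
  assumes "0 \<in> interior_in (Rn n) K"
  shows "\<exists>e>0. cball 0 e \<inter> Rn n \<subseteq> K"
proof -
  obtain U where U: "openin (top_of_set (Rn n)) U" "0 \<in> U" "U \<subseteq> K"
    using assms by (auto simp: interior_of_def)
  then obtain e where "e > 0" "ball 0 e \<inter> Rn n \<subseteq> U"
    by (metis openin_contains_ball)
  then show ?thesis using U(3) by (intro exI[of _ "e/2"]) (auto simp: subset_iff)
qed

text \<open>Each basis vector \<open>d i\<close> found in the difference body is a chord
  \<open>a i - b i\<close> of \<open>K\<close>. Averages of points of the \<open>n\<close> chords
  fill a parallelepiped around the average \<open>z0\<close> of their midpoints; the scale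
  \<open>N = 4 * real n\<close> makes it contain the ball of radius 2. The coefficient bound
  \<open>2 ^ n\<close>, summed over \<open>n\<close> coordinates, gives the outer radius. The map is
  linear, so 0 stays where the sections pass.\<close>

lemma body_normalization:
  assumes n: "n \<ge> 2" and K: "K \<subseteq> Rn n" "compact K" "convex K" and int0: "\<exists>e>0. cball 0 e \<inter> Rn n \<subseteq> K"
  shows "\<exists>S T z. linear S \<and> linear T \<and> (\<forall>x\<in>Rn n. S x \<in> Rn n \<and> T x \<in> Rn n \<and> T (S x) = x \<and> S (T x) = x) \<and>
    fat_body n (S ` K) z (4 * (real n)\<^sup>2 * 2 ^ n)"
proof -
  obtain e where e: "e > 0" "cball 0 e \<inter> Rn n \<subseteq> K" using int0 by blast
  have zK: "0 \<in> K" using e subspace_0[OF subspace_Rn] by auto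
  define D where "D = {x - y |x y. x \<in> K \<and> y \<in> K}"
  have DI: "x - y \<in> D" if "x \<in> K" "y \<in> K" for x y using that by (auto simp: D_def)
  have "\<exists>d c. (\<forall>i<n. d i \<in> D \<and> linear (c i)) \<and> (\<forall>i<n. \<forall>j<n. c i (d j) = (if i = j then 1 else 0 :: real)) \<and>
     (\<forall>x\<in>Rn n. (\<Sum>i<n. c i x *\<^sub>R d i) = x) \<and> (\<forall>x\<in>D. \<forall>i<n. \<bar>c i x\<bar> \<le> 2 ^ n)"
  proof (rule symmetric_body_basis)
    show "D \<subseteq> Rn n" using K(1) subspace_diff[OF subspace_Rn] unfolding D_def by blast
    show "compact D" unfolding D_def by (rule compact_differences[OF K(2,2)])
    have Deq: "D = (\<Union>x\<in>K. \<Union>y\<in>K. {x - y})" by (auto simp: D_def)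
    show "convex D" unfolding Deq by (rule convex_differences[OF K(3,3)])
    show "- x \<in> D" if x: "x \<in> D" for x
    proof -
      obtain u v where "u \<in> K" "v \<in> K" "x = u - v" using x unfolding D_def by blast
      then show ?thesis using DI[of v u] by simp
    qed
    show "\<exists>t>0. t *\<^sub>R unit_pm i \<in> D" if "i < n" for i
    proof (intro exI[of _ e] conjI e)
      have "norm (e *\<^sub>R unit_pm i) \<le> e" using norm_unit_comb_le[of e i 0 0] e by simp
      then have "e *\<^sub>R unit_pm i \<in> K" using that e(2) subspace_scale[OF subspace_Rn unit_pm_Rn[OF that]] by auto
      then show "e *\<^sub>R unit_pm i \<in> D" using DI[OF _ zK] by simp
    qed
  qed
  then obtain d c where dc: "\<forall>i<n. d i \<in> D \<and> linear (c i)"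
    and cd: "\<forall>i<n. \<forall>j<n. c i (d j) = (if i = j then 1 else 0 :: real)"
    and ex: "\<forall>x\<in>Rn n. (\<Sum>i<n. c i x *\<^sub>R d i) = x" and bd: "\<forall>x\<in>D. \<forall>i<n. \<bar>c i x\<bar> \<le> 2 ^ n"
    by (elim exE conjE) (rule that)
  have "\<exists>p. i < n \<longrightarrow> fst p \<in> K \<and> snd p \<in> K \<and> d i = fst p - snd p" for i
  proof (cases "i < n")
    case True
    then have "d i \<in> D" using dc by blast
    then obtain x y where "x \<in> K" "y \<in> K" "d i = x - y" unfolding D_def by blast
    then show ?thesis by (intro exI[of _ "(x, y)"]) simp
  qed simp
  then obtain p where p: "\<And>i. i < n \<Longrightarrow> fst (p i) \<in> K \<and> snd (p i) \<in> K \<and> d i = fst (p i) - snd (p i)" by metis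
  define a where "a = (\<lambda>i. fst (p i))"
  define b where "b = (\<lambda>i. snd (p i))"
  have ab: "\<And>i. i < n \<Longrightarrow> a i \<in> K" "\<And>i. i < n \<Longrightarrow> b i \<in> K" "\<And>i. i < n \<Longrightarrow> d i = a i - b i"
    using p by (simp_all add: a_def b_def)
  have dR: "d i \<in> Rn n" if "i < n" for i unfolding ab(3)[OF that] using ab(1,2)[OF that] K(1) by (intro subspace_diff subspace_Rn) auto
  have cl: "linear (c i)" if "i < n" for i using dc that by blast
  define N where "N = 4 * real n"
  have N: "N > 0" using n by (simp add: N_def)
  define T where "T = (\<lambda>y. \<Sum>i<n. (Poly_Mapping.lookup y i / N) *\<^sub>R d i)"
  define S where "S = (\<lambda>x. \<Sum>i<n. (N * c i x) *\<^sub>R unit_pm i)"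
  have T: "linear T" unfolding T_def
    by (intro linearI) (simp_all add: lookup_add lookup_scaleR_pm add_divide_distrib scaleR_left_distrib sum.distrib scaleR_sum_right)
  have S: "linear S" unfolding S_def
    by (intro linearI) (simp_all add: linear_add[OF cl] linear_scale[OF cl] algebra_simps sum.distrib scaleR_sum_right)
  have TR: "T y \<in> Rn n" for y unfolding T_def using dR by (intro subspace_sum subspace_scale subspace_Rn) auto
  have SR: "S x \<in> Rn n" for x unfolding S_def by (rule sum_unit_Rn)
  have TS: "T (S x) = x" if "x \<in> Rn n" for x
  proof -
    have "T (S x) = (\<Sum>i<n. c i x *\<^sub>R d i)"
      unfolding T_def by (rule sum.cong) (use N in \<open>auto simp: S_def lookup_sum_unit\<close>)
    then show ?thesis using ex that by simp
  qed
  have ST: "S (T y) = y" if "y \<in> Rn n" for y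
  proof -
    have "c i (T y) = Poly_Mapping.lookup y i / N" if i: "i < n" for i
    proof -
      have "c i (T y) = (\<Sum>j<n. Poly_Mapping.lookup y j / N * c i (d j))"
        unfolding T_def by (simp add: linear_sum[OF cl[OF i]] linear_scale[OF cl[OF i]])
      also have "\<dots> = (\<Sum>j<n. if j = i then Poly_Mapping.lookup y i / N else 0)"
        using cd i by (intro sum.cong) auto
      finally show ?thesis using i by simp
    qed
    then have "S (T y) = (\<Sum>i<n. Poly_Mapping.lookup y i *\<^sub>R unit_pm i)"
      unfolding S_def using N by (intro sum.cong) auto
    then show ?thesis using Rn_expand[OF that] by simp
  qed
  define z0 where "z0 = (\<Sum>i<n. (1 / real n) *\<^sub>R ((1/2) *\<^sub>R a i + (1/2) *\<^sub>R b i))"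
  have avg: "(\<Sum>i<n. (1 / real n) *\<^sub>R v i) \<in> K" if "\<And>i. i < n \<Longrightarrow> v i \<in> K" for v
    using that n by (intro convex_sum K(3)) auto
  have z0: "z0 \<in> K" unfolding z0_def
    using ab by (intro avg convexD[OF K(3)]) auto
  define z where "z = S z0"
  have zR: "z \<in> Rn n" by (simp add: z_def SR)
  have Tz: "T z = z0" unfolding z_def using TS z0 K(1) by blast
  have fat: "fat_body n (S ` K) z (4 * (real n)\<^sup>2 * 2 ^ n)"
  proof
    show "S ` K \<subseteq> Rn n" using SR by auto
    have "continuous_on K (\<lambda>x. \<Sum>j<n. Poly_Mapping.lookup x j *\<^sub>R S (unit_pm j))"
      by (intro continuous_intros linear_continuous_on bounded_linear_lookup)
    moreover have "(\<Sum>j<n. Poly_Mapping.lookup x j *\<^sub>R S (unit_pm j)) = S x" if "x \<in> K" for x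
    proof -
      have "S x = S (\<Sum>j<n. Poly_Mapping.lookup x j *\<^sub>R unit_pm j)" using Rn_expand that K(1) by (metis subsetD)
      then show ?thesis by (simp add: linear_sum[OF S] linear_scale[OF S])
    qed
    ultimately have "continuous_on K S" by (simp cong: continuous_on_cong)
    then show "compact (S ` K)" using K(2) by (rule compact_continuous_image)
    show "convex (S ` K)" by (rule convex_linear_image[OF S K(3)])
    show "cball z 2 \<inter> Rn n \<subseteq> S ` K"
    proof
      fix y assume y: "y \<in> cball z 2 \<inter> Rn n"
      define w where "w = y - z"
      have w: "\<bar>Poly_Mapping.lookup w i\<bar> \<le> 2" for i
        using abs_lookup_le_norm[of w i] y by (simp add: w_def dist_norm norm_minus_commute)
      have "T y = z0 + T w" by (simp add: w_def linear_diff[OF T] Tz)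
      also have "\<dots> = (\<Sum>i<n. (1 / real n) *\<^sub>R ((1/2 + Poly_Mapping.lookup w i / 4) *\<^sub>R a i + (1/2 - Poly_Mapping.lookup w i / 4) *\<^sub>R b i))"
        unfolding z0_def T_def sum.distrib[symmetric] using n
        by (intro sum.cong) (auto simp: ab(3) N_def algebra_simps)
      also have "\<dots> \<in> K"
      proof (intro avg convexD[OF K(3)] ab)
        show "0 \<le> 1/2 + Poly_Mapping.lookup w i / 4" "0 \<le> 1/2 - Poly_Mapping.lookup w i / 4" for i
          using w[of i] by (auto simp: abs_le_iff)
      qed auto
      finally have "T y \<in> K" .
      then show "y \<in> S ` K" using ST[of y] y by (metis IntD2 imageI)
    qed
    show "S ` K \<subseteq> cball z (4 * (real n)\<^sup>2 * 2 ^ n)"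
    proof
      fix y assume "y \<in> S ` K"
      then obtain x where x: "x \<in> K" "y = S x" by blast
      have "norm (S (x - z0)) = (\<Sum>i<n. \<bar>N * c i (x - z0)\<bar>)"
        unfolding norm_Rn[OF SR] by (rule sum.cong) (auto simp: S_def lookup_sum_unit)
      also have "\<dots> \<le> (\<Sum>i<n. N * 2 ^ n)"
        using bd DI[OF x(1) z0] N by (intro sum_mono) (auto simp: abs_mult)
      also have "\<dots> = 4 * (real n)\<^sup>2 * 2 ^ n" by (simp add: N_def power2_eq_square)
      finally show "y \<in> cball z (4 * (real n)\<^sup>2 * 2 ^ n)"
        by (simp add: x(2) z_def dist_norm linear_diff[OF S] norm_minus_commute)
    qed
    show "\<exists>e>0. cball 0 e \<inter> Rn n \<subseteq> S ` K"
    proof -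
      define B where "B = (\<Sum>i<n. norm (d i) / N) + 1"
      have B: "B > 0" unfolding B_def using N by (intro add_nonneg_pos sum_nonneg) auto
      have TB: "norm (T y) \<le> B * norm y" for y
      proof -
        have "norm (T y) \<le> (\<Sum>i<n. \<bar>Poly_Mapping.lookup y i\<bar> * (norm (d i) / N))"
          unfolding T_def using N by (intro order_trans[OF norm_sum] sum_mono) auto
        also have "\<dots> \<le> (\<Sum>i<n. norm y * (norm (d i) / N))"
          using N by (intro sum_mono mult_right_mono abs_lookup_le_norm) auto
        also have "\<dots> = norm y * (B - 1)" by (simp add: B_def sum_distrib_left)
        finally show ?thesis by (simp add: algebra_simps) (use norm_ge_zero[of y] in linarith)
      qed
      show ?thesis
      proof (intro exI[of _ "e / B"] conjI subsetI)
        show "e / B > 0" using e B by simp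
        fix y assume y: "y \<in> cball 0 (e / B) \<inter> Rn n"
        have "B * norm y \<le> e" using y B by (simp add: field_simps)
        then have "T y \<in> K" using TB[of y] TR[of y] e(2) by auto
        then show "y \<in> S ` K" using ST[of y] y by (metis IntD2 imageI)
      qed
    qed
    have "1 * 1 \<le> (real n)\<^sup>2 * 2 ^ n" using n by (intro mult_mono) (auto simp: one_le_power)
    then show "1 \<le> 4 * (real n)\<^sup>2 * 2 ^ n" by simp
  qed (use n zR in auto)
  show ?thesis
    by (intro exI[of _ S] exI[of _ T] exI[of _ z] conjI ballI S T SR TR TS ST fat)
qed

lemma nearly_elliptic_sections_linear_image:
  assumes S: "linear S" and T: "linear T" and R: "\<And>x. x \<in> Rn n \<Longrightarrow> S x \<in> Rn n \<and> T x \<in> Rn n \<and> T (S x) = x \<and> S (T x) = x"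
    and K: "K \<subseteq> Rn n" and H: "nearly_elliptic_sections n K \<epsilon>"
  shows "nearly_elliptic_sections n (S ` K) \<epsilon>"
  unfolding nearly_elliptic_sections_def
proof (intro ballI)
  fix x y assume xy: "x \<in> Rn n" "y \<in> Rn n"
  then have "T x \<in> Rn n" "T y \<in> Rn n" using R by auto
  then obtain A :: "complex \<Rightarrow> _" and \<zeta> where A: "linear A" "inj A" "range A \<subseteq> Rn n" "T x \<in> range A" "T y \<in> range A"
    and in1: "\<And>w. norm (w + \<zeta>) \<le> 1 \<Longrightarrow> A w \<in> K" and in2: "\<And>w. A w \<in> K \<Longrightarrow> norm (w + \<zeta>) \<le> 1 + \<epsilon>"
    using H unfolding nearly_elliptic_sections_def by (elim ballE[of _ _ "T x"] ballE[of _ _ "T y"] exE conjE) auto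
  have inv: "T (S (A w)) = A w" for w using R A(3) by blast
  show "\<exists>(A :: complex \<Rightarrow> _) \<zeta>. linear A \<and> inj A \<and> range A \<subseteq> Rn n \<and> x \<in> range A \<and> y \<in> range A \<and>
     (\<forall>w. norm (w + \<zeta>) \<le> 1 \<longrightarrow> A w \<in> S ` K) \<and> (\<forall>w. A w \<in> S ` K \<longrightarrow> norm (w + \<zeta>) \<le> 1 + \<epsilon>)"
  proof (intro exI[of _ "S \<circ> A"] exI[of _ \<zeta>] conjI allI impI)
    show "linear (S \<circ> A)" by (rule linear_compose[OF A(1) S])
    show "inj (S \<circ> A)" using A(2) inv unfolding inj_def comp_def by metis
    show "range (S \<circ> A) \<subseteq> Rn n" using A(3) R by auto
    show "x \<in> range (S \<circ> A)" using A(4) R[OF xy(1)] by (metis comp_apply rangeE rangeI)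
    show "y \<in> range (S \<circ> A)" using A(5) R[OF xy(2)] by (metis comp_apply rangeE rangeI)
    show "(S \<circ> A) w \<in> S ` K" if "norm (w + \<zeta>) \<le> 1" for w using in1[OF that] by simp
    show "norm (w + \<zeta>) \<le> 1 + \<epsilon>" if wK: "(S \<circ> A) w \<in> S ` K" for w
    proof -
      obtain k where k: "k \<in> K" "S (A w) = S k" using wK by auto
      then have "A w = k" using inv[of w] R K by (metis subsetD)
      then show ?thesis using in2 k by blast
    qed
  qed
qed

lemma banach_mazur_dist_of_nearly_elliptic_sections:
  assumes n: "n \<ge> 2" and K: "K \<subseteq> Rn n" "compact K" "convex K" and int0: "\<exists>e>0. cball 0 e \<inter> Rn n \<subseteq> K"
    and e: "e > 0" and H: "nearly_elliptic_sections n K (e ^ 3)"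
  shows "banach_mazur_dist (Rn n) K (Rn n) (euclidean_unit_ball n)
    \<le> 1 + 10^9 * (4 * (real n)\<^sup>2 * 2 ^ n)^6 * real n * 18 ^ n * e"
proof -
  obtain S T z where ST: "linear S" "linear T" "\<forall>x\<in>Rn n. S x \<in> Rn n \<and> T x \<in> Rn n \<and> T (S x) = x \<and> S (T x) = x"
    and fat: "fat_body n (S ` K) z (4 * (real n)\<^sup>2 * 2 ^ n)"
    using body_normalization[OF n K int0] by blast
  interpret fat_body n "S ` K" z "4 * (real n)\<^sup>2 * 2 ^ n" by (rule fat)
  obtain l where l: "bm_within n (S ` K) l" "l \<le> 1 + 10^9 * (4 * (real n)\<^sup>2 * 2 ^ n)^6 * real n * 18 ^ n * e"
    using bm_within_of_nearly_elliptic_sections[OF e nearly_elliptic_sections_linear_image[OF ST(1,2) _ K(1) H]] ST(3) by blast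
  have "bm_within n K l"
    by (rule bm_within_linear_image[OF ST(1) _ ST(2) _ _ K(1) l(1)]) (use ST(3) in auto)
  then show ?thesis using banach_mazur_dist_le l(2) by fastforce
qed

section \<open>Integrals over planar bodies\<close>

definition complex_of_vec :: "real^2 \<Rightarrow> complex" where "complex_of_vec v = Complex (v$1) (v$2)"
definition vec_of_complex :: "complex \<Rightarrow> real^2" where "vec_of_complex z = vector [Re z, Im z]"

lemma vec_of_complex_inverse [simp]: "complex_of_vec (vec_of_complex z) = z"
  by (simp add: complex_of_vec_def vec_of_complex_def)

lemma complex_of_vec_inverse [simp]: "vec_of_complex (complex_of_vec v) = v"
  by (simp add: complex_of_vec_def vec_of_complex_def vec_eq_iff forall_2)

lemma linear_complex_of_vec: "linear complex_of_vec"
  by (intro linearI) (simp_all add: complex_of_vec_def complex_eq_iff)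

lemma linear_vec_of_complex: "linear vec_of_complex"
  by (intro linearI) (simp_all add: vec_of_complex_def vec_eq_iff forall_2)

lemma continuous_complex_of_vec: "continuous_on S complex_of_vec"
  using linear_complex_of_vec linear_continuous_on linear_linear by blast

lemma continuous_vec_of_complex: "continuous_on S vec_of_complex"
  using linear_vec_of_complex linear_continuous_on linear_linear by blast

lemma vimage_complex_of_vec: "complex_of_vec -` M = vec_of_complex ` M"
  by (auto simp: image_iff) (metis complex_of_vec_inverse)

lemma compact_vimage_complex_of_vec: "compact M \<Longrightarrow> compact (complex_of_vec -` M)"
  unfolding vimage_complex_of_vec by (intro compact_continuous_image continuous_vec_of_complex)

text \<open>The integral is taken over \<open>real^2\<close>, where linear maps have matrices and
  the determinant enters the change of variables.\<close>

definition planar_integral :: "complex set \<Rightarrow> (complex \<Rightarrow> 'b::euclidean_space) \<Rightarrow> 'b" where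
  "planar_integral M \<phi> = integral (complex_of_vec -` M) (\<lambda>v. \<phi> (complex_of_vec v))"

lemma absolutely_integrable_on_compact:
  fixes f :: "'a::euclidean_space \<Rightarrow> 'b::euclidean_space"
  assumes "compact S" "continuous_on S f"
  shows "f absolutely_integrable_on S"
  unfolding set_integrable_def
  using borel_integrable_compact[OF assms] integrable_completion by (metis borel_measurable_integrable measurable_lborel2)

lemma planar_integrable:
  fixes \<phi> :: "complex \<Rightarrow> 'b::euclidean_space"
  assumes "compact M" "continuous_on UNIV \<phi>"
  shows "(\<lambda>v. \<phi> (complex_of_vec v)) absolutely_integrable_on (complex_of_vec -` M)"
  by (intro absolutely_integrable_on_compact compact_vimage_complex_of_vec assms(1)
      continuous_on_compose2[OF assms(2)] continuous_complex_of_vec) auto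

lemma planar_integrable':
  fixes \<phi> :: "complex \<Rightarrow> 'b::euclidean_space"
  assumes "compact M" "continuous_on UNIV \<phi>"
  shows "(\<lambda>v. \<phi> (complex_of_vec v)) integrable_on (complex_of_vec -` M)"
  using planar_integrable[OF assms] set_lebesgue_integral_eq_integral(1) by blast

lemma planar_integral_add:
  fixes \<phi> \<psi> :: "complex \<Rightarrow> 'b::euclidean_space"
  assumes "compact M" "continuous_on UNIV \<phi>" "continuous_on UNIV \<psi>"
  shows "planar_integral M (\<lambda>z. \<phi> z + \<psi> z) = planar_integral M \<phi> + planar_integral M \<psi>"
  unfolding planar_integral_def by (intro integral_add planar_integrable' assms)

lemma planar_integral_bounded_linear:
  fixes \<phi> :: "complex \<Rightarrow> 'b::euclidean_space"
  assumes "compact M" "continuous_on UNIV \<phi>" "bounded_linear h"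
  shows "planar_integral M (\<lambda>z. h (\<phi> z)) = h (planar_integral M \<phi>)"
  unfolding planar_integral_def using integral_linear[OF planar_integrable'[OF assms(1,2)] assms(3)] by (simp add: o_def)

lemma planar_integral_mono:
  fixes \<phi> :: "complex \<Rightarrow> real"
  assumes "compact M" "continuous_on UNIV \<phi>" "compact N" "continuous_on UNIV \<psi>" "M \<subseteq> N"
    "\<And>z. z \<in> M \<Longrightarrow> \<phi> z \<le> \<psi> z" "\<And>z. z \<in> N \<Longrightarrow> 0 \<le> \<psi> z"
  shows "planar_integral M \<phi> \<le> planar_integral N \<psi>"
proof -
  have "planar_integral M \<phi> \<le> planar_integral M \<psi>"
    unfolding planar_integral_def using assms by (intro integral_le planar_integrable') auto
  also have "\<dots> \<le> planar_integral N \<psi>"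
    unfolding planar_integral_def using assms by (intro integral_subset_le planar_integrable') auto
  finally show ?thesis .
qed

text \<open>Change of variables for one component \<open>b\<close> of the integrand at a time,
  regarded as a function into \<open>real^1\<close>.\<close>

lemma planar_integral_affine:
  fixes \<phi> :: "complex \<Rightarrow> 'b::euclidean_space"
  assumes L: "linear L" "inj L" and M: "compact M" and \<phi>: "continuous_on UNIV \<phi>"
  shows "planar_integral ((\<lambda>z. L z + d) ` M) \<phi> =
    \<bar>det (matrix (vec_of_complex \<circ> L \<circ> complex_of_vec))\<bar> *\<^sub>R planar_integral M (\<lambda>z. \<phi> (L z + d))"
proof (rule euclidean_eqI)
  fix b :: 'b assume "b \<in> Basis"
  let ?T = "\<lambda>z. L z + d"
  let ?g' = "vec_of_complex \<circ> L \<circ> complex_of_vec"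
  let ?g = "\<lambda>v. ?g' v + vec_of_complex d"
  let ?S = "complex_of_vec -` M"
  let ?J = "\<bar>det (matrix ?g')\<bar>"
  have cL: "continuous_on X L" for X using L(1) linear_continuous_on linear_linear by blast
  have cT: "continuous_on X (\<lambda>z. \<phi> (?T z))" for X
    by (intro continuous_on_compose2[OF \<phi>] continuous_intros cL) auto
  have lin: "linear ?g'" by (intro linear_compose linear_complex_of_vec linear_vec_of_complex L)
  have S: "compact ?S" by (rule compact_vimage_complex_of_vec[OF M])
  have gg: "complex_of_vec (?g v) = ?T (complex_of_vec v)" for v
    by (simp add: linear_add[OF linear_complex_of_vec])
  have gS: "?g ` ?S = complex_of_vec -` (?T ` M)"
    unfolding vimage_complex_of_vec by (auto simp: image_iff linear_add[OF linear_vec_of_complex])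
  define f :: "real^2 \<Rightarrow> real^1" where "f = (\<lambda>v. vec (\<phi> (complex_of_vec v) \<bullet> b))"
  have "linear (\<lambda>x::real. vec x :: real^1)" by (intro linearI) (auto simp: vec_eq_iff)
  then have blv: "bounded_linear (\<lambda>x::real. vec x :: real^1)" by (simp add: linear_linear)
  have fc: "f absolutely_integrable_on ?S \<and> (\<lambda>v. ?J *\<^sub>R f (?g v)) absolutely_integrable_on ?S"
  proof
    have "continuous_on UNIV f" unfolding f_def
      by (intro bounded_linear.continuous_on[OF blv] continuous_intros continuous_on_compose2[OF \<phi>] continuous_complex_of_vec) auto
    then have c: "continuous_on X f" for X using continuous_on_subset by blast
    show "f absolutely_integrable_on ?S" by (intro absolutely_integrable_on_compact S c)
    have "bounded_linear ?g'" using lin linear_conv_bounded_linear by blast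
    then have cg: "continuous_on ?S ?g"
      by (intro continuous_on_add continuous_on_const linear_continuous_on)
    then show "(\<lambda>v. ?J *\<^sub>R f (?g v)) absolutely_integrable_on ?S"
      by (intro absolutely_integrable_on_compact S continuous_on_scaleR continuous_on_const continuous_on_compose2[OF c cg]) auto
  qed
  have "integral (?g ` ?S) f = integral ?S (\<lambda>v. ?J *\<^sub>R f (?g v))"
  proof (rule integral_change_of_variables)
    show "?S \<in> sets lebesgue" using lmeasurable_compact[OF S] by blast
    show "(?g has_derivative ?g') (at v within ?S)" for v
      by (intro has_derivative_add_const linear_imp_has_derivative lin)
    show "inj_on ?g ?S"
    proof (rule inj_onI)
      fix v w assume "?g v = ?g w"
      then have "complex_of_vec (?g v) = complex_of_vec (?g w)" by simp
      then have "L (complex_of_vec v) = L (complex_of_vec w)" unfolding gg by simp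
      then have "complex_of_vec v = complex_of_vec w" using L(2) by (simp add: inj_eq)
      then show "v = w" by (metis complex_of_vec_inverse)
    qed
  qed (use fc in auto)
  then have e1: "integral (complex_of_vec -` (?T ` M)) f $ 1 = integral ?S (\<lambda>v. ?J *\<^sub>R f (?g v)) $ 1" unfolding gS by simp
  have e2: "integral (complex_of_vec -` (?T ` M)) f = vec (integral (complex_of_vec -` (?T ` M)) (\<lambda>v. \<phi> (complex_of_vec v) \<bullet> b))"
    unfolding f_def
  proof -
    have "compact (?T ` M)" by (intro compact_continuous_image M continuous_intros cL)
    then show "integral (complex_of_vec -` (?T ` M)) (\<lambda>v. vec (\<phi> (complex_of_vec v) \<bullet> b) :: real^1) = vec (integral (complex_of_vec -` (?T ` M)) (\<lambda>v. \<phi> (complex_of_vec v) \<bullet> b))"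
      using integral_linear[OF planar_integrable'[of _ "\<lambda>z. \<phi> z \<bullet> b"] blv] \<phi> by (simp add: o_def continuous_on_inner continuous_on_const)
  qed
  have e3: "integral ?S (\<lambda>v. ?J *\<^sub>R f (?g v)) = ?J *\<^sub>R vec (integral ?S (\<lambda>v. \<phi> (?T (complex_of_vec v)) \<bullet> b))"
    unfolding f_def gg integral_cmul
    using integral_linear[OF planar_integrable'[of _ "\<lambda>z. \<phi> (?T z) \<bullet> b"] blv] M cT by (simp add: o_def continuous_on_inner continuous_on_const)
  have eq: "integral (complex_of_vec -` (?T ` M)) (\<lambda>v. \<phi> (complex_of_vec v) \<bullet> b)
     = ?J * integral ?S (\<lambda>v. \<phi> (?T (complex_of_vec v)) \<bullet> b)" using e1 unfolding e2 e3 by simp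
  have TM: "compact (?T ` M)" by (intro compact_continuous_image M continuous_intros cL)
  show "planar_integral (?T ` M) \<phi> \<bullet> b = (?J *\<^sub>R planar_integral M (\<lambda>z. \<phi> (?T z))) \<bullet> b"
    unfolding planar_integral_def inner_scaleR_left
      integral_component_eq[OF planar_integrable'[OF TM \<phi>], symmetric]
      integral_component_eq[OF planar_integrable'[OF M cT], symmetric] by (rule eq)
qed

lemma planar_jacobian_pos:
  assumes "linear L" "inj L"
  shows "\<bar>det (matrix (vec_of_complex \<circ> L \<circ> complex_of_vec))\<bar> > 0"
proof -
  have "inj (vec_of_complex \<circ> L \<circ> complex_of_vec)"
    using assms(2) unfolding inj_def comp_def by (metis complex_of_vec_inverse vec_of_complex_inverse)
  then show ?thesis
    using det_nz_iff_inj[OF linear_compose[OF linear_compose[OF linear_complex_of_vec assms(1)] linear_vec_of_complex]]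
    by (simp add: o_assoc)
qed

lemma planar_jacobian_scale:
  "\<bar>det (matrix (vec_of_complex \<circ> (\<lambda>z. r *\<^sub>R z) \<circ> complex_of_vec))\<bar> = r\<^sup>2"
proof -
  have "matrix (vec_of_complex \<circ> (\<lambda>z. r *\<^sub>R z) \<circ> complex_of_vec) = (mat r :: real^2^2)"
    unfolding matrix_def by (simp add: vec_eq_iff forall_2 vec_of_complex_def complex_of_vec_def mat_def axis_def)
  then show ?thesis by (simp add: det_2 mat_def power2_eq_square)
qed

section \<open>Area of planar sets\<close>

definition area :: "complex set \<Rightarrow> real" where "area M = planar_integral M (\<lambda>_. 1)"

lemma area_mono: "compact M \<Longrightarrow> compact N \<Longrightarrow> M \<subseteq> N \<Longrightarrow> area M \<le> area N"
  unfolding area_def by (rule planar_integral_mono) auto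

lemma area_scale: "compact M \<Longrightarrow> r \<noteq> 0 \<Longrightarrow> area ((\<lambda>z. r *\<^sub>R z + d) ` M) = r\<^sup>2 * area M"
  unfolding area_def using planar_integral_affine[of "\<lambda>z. r *\<^sub>R z" M "\<lambda>_. 1::real" d] planar_jacobian_scale[of r]
  by (simp add: inj_def linear_scaleR)

lemma area_cball_pos: "r > 0 \<Longrightarrow> area (cball w r) > 0"
proof -
  assume r: "r > 0"
  let ?S = "complex_of_vec -` cball w r"
  have S: "compact ?S" by (rule compact_vimage_complex_of_vec) simp
  have "area (cball w r) = measure lebesgue ?S"
    unfolding area_def planar_integral_def using lmeasure_integral[OF lmeasurable_compact[OF S]] by simp
  moreover have "open (complex_of_vec -` ball w r)"
    using continuous_complex_of_vec[of UNIV] by (intro open_vimage) auto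
  moreover have "vec_of_complex w \<in> complex_of_vec -` ball w r" using r by simp
  ultimately show ?thesis
    using S lmeasurable_compact[OF S] open_not_negligible[of "complex_of_vec -` ball w r"] negligible_subset[of ?S]
    by (metis ball_subset_cball empty_iff negligible_iff_measure vimage_mono zero_less_measure_iff)
qed

lemma area_pos: "compact M \<Longrightarrow> interior M \<noteq> {} \<Longrightarrow> area M > 0"
proof -
  assume M: "compact M" "interior M \<noteq> {}"
  then obtain w r where "r > 0" "cball w r \<subseteq> M" by (meson ex_in_conv mem_interior_cball)
  then show ?thesis using area_mono[of "cball w r" M] area_cball_pos[of r w] M(1) by (meson compact_cball less_le_trans)
qed

lemma integral_Diff_absolutely_integrable:
  fixes f :: "'a::euclidean_space \<Rightarrow> 'b::euclidean_space"
  assumes "f absolutely_integrable_on T" "f absolutely_integrable_on S" "S \<subseteq> T"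
  shows "integral (T - S) f = integral T f - integral S f"
  using assms set_lebesgue_integral_eq_integral(1) by (intro integral_setdiff) (auto simp: Diff_eq_empty_iff[THEN iffD2])

lemma planar_integral_diff_bound:
  fixes \<phi> :: "complex \<Rightarrow> 'b::euclidean_space"
  assumes M: "compact M" "compact N" "M \<subseteq> N" and \<phi>: "continuous_on UNIV \<phi>" and B: "\<And>z. z \<in> N \<Longrightarrow> norm (\<phi> z) \<le> B"
  shows "norm (planar_integral N \<phi> - planar_integral M \<phi>) \<le> B * (area N - area M)"
proof -
  let ?S = "complex_of_vec -` M" and ?T = "complex_of_vec -` N"
  have ST: "?S \<subseteq> ?T" using M(3) by auto
  have meas: "?T - ?S \<in> lmeasurable"
    using compact_vimage_complex_of_vec[OF M(1)] compact_vimage_complex_of_vec[OF M(2)] lmeasurable_compact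
    by (intro fmeasurable.Diff) auto
  have i1: "(\<lambda>v. \<phi> (complex_of_vec v)) absolutely_integrable_on (?T - ?S)"
    by (rule set_integrable_subset[OF planar_integrable[OF M(2) \<phi>]]) (use meas in auto)
  have i2: "(\<lambda>v. 1 :: real) absolutely_integrable_on (?T - ?S)"
    by (rule set_integrable_subset[OF planar_integrable[OF M(2), of "\<lambda>_. 1::real"]]) (use meas in auto)
  have "norm (planar_integral N \<phi> - planar_integral M \<phi>) = norm (integral (?T - ?S) (\<lambda>v. \<phi> (complex_of_vec v)))"
    unfolding planar_integral_def
    by (simp add: integral_Diff_absolutely_integrable[OF planar_integrable[OF M(2) \<phi>] planar_integrable[OF M(1) \<phi>] ST])
  also have "\<dots> \<le> integral (?T - ?S) (\<lambda>v. B * 1)"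
    using i1 B integrable_on_const[OF meas, of B] by (intro integral_norm_bound_integral)
      (auto intro: set_lebesgue_integral_eq_integral(1))
  also have "\<dots> = B * integral (?T - ?S) (\<lambda>v. 1)" by (simp only: integral_mult_right)
  also have "integral (?T - ?S) (\<lambda>v. 1 :: real) = area N - area M"
    unfolding area_def planar_integral_def
    using planar_integrable[OF M(2), of "\<lambda>_. 1::real"] planar_integrable[OF M(1), of "\<lambda>_. 1::real"] ST
    by (intro integral_Diff_absolutely_integrable) auto
  finally show ?thesis .
qed

section \<open>Planar bodies and means over them\<close>

definition planar_body :: "complex set \<Rightarrow> bool" where
  "planar_body M \<longleftrightarrow> compact M \<and> convex M \<and> interior M \<noteq> {}"

definition mean :: "complex set \<Rightarrow> (complex \<Rightarrow> 'b::euclidean_space) \<Rightarrow> 'b" where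
  "mean M \<phi> = planar_integral M \<phi> /\<^sub>R area M"

lemma planar_body_area: "planar_body M \<Longrightarrow> area M > 0"
  using area_pos by (simp add: planar_body_def)

lemma mean_add:
  fixes \<phi> \<psi> :: "complex \<Rightarrow> 'b::euclidean_space"
  assumes "planar_body M" "continuous_on UNIV \<phi>" "continuous_on UNIV \<psi>"
  shows "mean M (\<lambda>z. \<phi> z + \<psi> z) = mean M \<phi> + mean M \<psi>"
  using assms unfolding mean_def planar_body_def by (simp add: planar_integral_add scaleR_right_distrib)

lemma mean_bounded_linear:
  fixes \<phi> :: "complex \<Rightarrow> 'b::euclidean_space"
  assumes "planar_body M" "continuous_on UNIV \<phi>" "bounded_linear h"
  shows "mean M (\<lambda>z. h (\<phi> z)) = h (mean M \<phi>)"
  using assms unfolding mean_def planar_body_def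
  by (simp add: planar_integral_bounded_linear linear_scale[OF bounded_linear.linear])

lemma mean_const: "planar_body M \<Longrightarrow> mean M (\<lambda>_. c) = c"
proof -
  assume M: "planar_body M"
  have "mean M (\<lambda>_. 1 :: real) = 1" using planar_body_area[OF M] by (simp add: mean_def area_def)
  then show ?thesis
    using mean_bounded_linear[OF M, of "\<lambda>_. 1" "\<lambda>r. r *\<^sub>R c"] by (simp add: bounded_linear_scaleR_left)
qed

lemma mean_mult: "planar_body M \<Longrightarrow> continuous_on UNIV \<phi> \<Longrightarrow> mean M (\<lambda>z. c * \<phi> z) = c * mean M \<phi>" for c :: complex
  by (rule mean_bounded_linear[OF _ _ bounded_linear_mult_right])

lemma mean_mult_real: "planar_body M \<Longrightarrow> continuous_on UNIV \<phi> \<Longrightarrow> mean M (\<lambda>z. c * \<phi> z) = c * mean M \<phi>" for c :: real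
  by (rule mean_bounded_linear[OF _ _ bounded_linear_mult_right])

lemma mean_cnj: "planar_body M \<Longrightarrow> continuous_on UNIV \<phi> \<Longrightarrow> mean M (\<lambda>z. cnj (\<phi> z)) = cnj (mean M \<phi>)"
  by (rule mean_bounded_linear[OF _ _ bounded_linear_cnj])

lemma mean_Re: "planar_body M \<Longrightarrow> continuous_on UNIV \<phi> \<Longrightarrow> mean M (\<lambda>z. Re (\<phi> z)) = Re (mean M \<phi>)"
  by (rule mean_bounded_linear[OF _ _ bounded_linear_Re])

lemma mean_of_real: "planar_body M \<Longrightarrow> continuous_on UNIV \<phi> \<Longrightarrow> mean M (\<lambda>z. complex_of_real (\<phi> z)) = of_real (mean M \<phi>)"
  by (rule mean_bounded_linear[OF _ _ bounded_linear_of_real])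

lemma planar_body_affine:
  assumes L: "linear L" "inj L" and M: "planar_body M"
  shows "planar_body ((\<lambda>z. L z + d) ` M)"
proof -
  have "compact ((\<lambda>z. L z + d) ` M)"
    using M L(1) unfolding planar_body_def
    by (intro compact_continuous_image continuous_intros linear_continuous_on) (auto simp: linear_linear)
  moreover have im: "(\<lambda>z. L z + d) ` M = (+) d ` (L ` M)" by (simp add: image_image add.commute)
  moreover have "convex ((+) d ` (L ` M))"
    using M L(1) by (intro convex_translation convex_linear_image) (auto simp: planar_body_def)
  moreover have "interior ((+) d ` (L ` M)) = (+) d ` (L ` interior M)"
    by (simp add: interior_translation interior_injective_linear_image L)
  ultimately show ?thesis using M unfolding planar_body_def by simp
qed

text \<open>The Jacobian cancels between integral and area. For this reason moments are defined by
  means.\<close>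

lemma mean_affine:
  fixes \<phi> :: "complex \<Rightarrow> 'b::euclidean_space"
  assumes L: "linear L" "inj L" and M: "planar_body M" and \<phi>: "continuous_on UNIV \<phi>"
  shows "mean ((\<lambda>z. L z + d) ` M) \<phi> = mean M (\<lambda>z. \<phi> (L z + d))"
proof -
  have c: "compact M" using M by (simp add: planar_body_def)
  show ?thesis
    unfolding mean_def area_def planar_integral_affine[OF L c \<phi>] planar_integral_affine[OF L c continuous_on_const]
    using planar_jacobian_pos[OF L] by simp
qed

section \<open>Normal form of a planar body\<close>

definition centroid :: "complex set \<Rightarrow> complex" where "centroid M = mean M (\<lambda>z. z)"
definition variance :: "complex set \<Rightarrow> real" where "variance M = mean M (\<lambda>z. (cmod (z - centroid M))\<^sup>2)"
definition pseudovariance :: "complex set \<Rightarrow> complex" where "pseudovariance M = mean M (\<lambda>z. (z - centroid M)\<^sup>2)"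
text \<open>The root \<open>b\<close> of modulus less than 1 of \<open>\<tau> - 2 b \<sigma> + b\<^sup>2 cnj \<tau> = 0\<close>, with \<open>\<sigma>\<close> the variance and \<open>\<tau>\<close> the
  pseudovariance; the left side is the pseudovariance of the image under \<open>z \<mapsto> z - b cnj z\<close>.\<close>
definition shear :: "complex set \<Rightarrow> complex" where
  "shear M = pseudovariance M / of_real (variance M + sqrt ((variance M)\<^sup>2 - (cmod (pseudovariance M))\<^sup>2))"
definition normalize_pt :: "complex set \<Rightarrow> complex \<Rightarrow> complex" where
  "normalize_pt M z = (z - centroid M) - shear M * cnj (z - centroid M)"
definition normal_form :: "complex set \<Rightarrow> complex set" where "normal_form M = normalize_pt M ` M"

text \<open>By \<open>linear_form_exists\<close> every real-linear map of the plane has the form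
  \<open>p * w + q * cnj w\<close>; in this form its effect on the second moments is polynomial in
  \<open>p\<close> and \<open>q\<close>.\<close>

lemma mean_form_square:
  assumes M: "planar_body M"
  shows "mean M (\<lambda>z. p * (z - centroid M) + q * cnj (z - centroid M)) = 0" (is ?A)
    and "mean M (\<lambda>z. (p * (z - centroid M) + q * cnj (z - centroid M))\<^sup>2)
      = p\<^sup>2 * pseudovariance M + 2 * p * q * of_real (variance M) + q\<^sup>2 * cnj (pseudovariance M)" (is ?B)
proof -
  let ?g = "centroid M"
  have 1: "mean M (\<lambda>z. z - ?g) = 0"
    using mean_add[OF M, of "\<lambda>z. z" "\<lambda>_. - ?g"] by (simp add: mean_const[OF M] centroid_def continuous_on_id)
  have 2: "mean M (\<lambda>z. cnj (z - ?g)) = 0"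
    using mean_cnj[OF M, of "\<lambda>z. z - ?g"] 1 by (simp add: continuous_intros)
  have "mean M (\<lambda>z. p * (z - ?g) + q * cnj (z - ?g)) = mean M (\<lambda>z. p * (z - ?g)) + mean M (\<lambda>z. q * cnj (z - ?g))"
    by (intro mean_add M continuous_intros)
  also have "\<dots> = p * mean M (\<lambda>z. z - ?g) + q * mean M (\<lambda>z. cnj (z - ?g))"
    by (intro arg_cong2[where f = "(+)"] mean_mult M continuous_intros)
  finally show ?A unfolding 1 2 by simp
  have "(p * (z - ?g) + q * cnj (z - ?g))\<^sup>2 = p\<^sup>2 * (z - ?g)\<^sup>2 + (2 * p * q * of_real ((cmod (z - ?g))\<^sup>2) + q\<^sup>2 * cnj ((z - ?g)\<^sup>2))" for z
    unfolding complex_norm_square by (simp add: power2_eq_square algebra_simps)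
  then have "mean M (\<lambda>z. (p * (z - ?g) + q * cnj (z - ?g))\<^sup>2) =
    mean M (\<lambda>z. p\<^sup>2 * (z - ?g)\<^sup>2 + (2 * p * q * of_real ((cmod (z - ?g))\<^sup>2) + q\<^sup>2 * cnj ((z - ?g)\<^sup>2)))" by presburger
  also have "\<dots> = mean M (\<lambda>z. p\<^sup>2 * (z - ?g)\<^sup>2) + (mean M (\<lambda>z. 2 * p * q * of_real ((cmod (z - ?g))\<^sup>2)) + mean M (\<lambda>z. q\<^sup>2 * cnj ((z - ?g)\<^sup>2)))"
    by (subst mean_add[OF M], (intro continuous_intros)+, subst mean_add[OF M], (intro continuous_intros)+) (rule refl)
  also have "mean M (\<lambda>z. p\<^sup>2 * (z - ?g)\<^sup>2) = p\<^sup>2 * pseudovariance M"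
    unfolding pseudovariance_def by (intro mean_mult M continuous_intros)
  also have "mean M (\<lambda>z. q\<^sup>2 * cnj ((z - ?g)\<^sup>2)) = q\<^sup>2 * mean M (\<lambda>z. cnj ((z - ?g)\<^sup>2))"
    by (intro mean_mult M continuous_intros)
  also have "mean M (\<lambda>z. cnj ((z - ?g)\<^sup>2)) = cnj (pseudovariance M)"
    unfolding pseudovariance_def by (intro mean_cnj M continuous_intros)
  also have "mean M (\<lambda>z. 2 * p * q * of_real ((cmod (z - ?g))\<^sup>2)) = 2 * p * q * mean M (\<lambda>z. complex_of_real ((cmod (z - ?g))\<^sup>2))"
    by (intro mean_mult M continuous_intros)
  also have "mean M (\<lambda>z. complex_of_real ((cmod (z - ?g))\<^sup>2)) = of_real (variance M)"
    unfolding variance_def by (intro mean_of_real M continuous_intros)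
  finally show ?B by simp
qed

lemma moments_affine:
  fixes d :: complex
  assumes L: "linear L" "inj L" "\<And>w. L w = p * w + q * cnj w" and M: "planar_body M"
  defines "N \<equiv> (\<lambda>z. L z + d) ` M"
  shows "centroid N = L (centroid M) + d"
    and "pseudovariance N = p\<^sup>2 * pseudovariance M + 2 * p * q * of_real (variance M) + q\<^sup>2 * cnj (pseudovariance M)"
    and "variance N = mean M (\<lambda>z. (cmod (L (z - centroid M)))\<^sup>2)"
proof -
  let ?g = "centroid M"
  have cL: "continuous_on X L" for X unfolding L(3) by (intro continuous_intros)
  have "centroid N = mean M (\<lambda>z. L z + d)"
    unfolding centroid_def N_def by (intro mean_affine L M continuous_intros)
  also have "\<dots> = mean M (\<lambda>z. (p * (z - ?g) + q * cnj (z - ?g)) + (L ?g + d))"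
    unfolding L(3) by (simp add: algebra_simps)
  also have "\<dots> = L ?g + d"
    using mean_form_square(1)[OF M, of p q] by (subst mean_add[OF M]) (auto intro!: continuous_intros simp: mean_const[OF M])
  finally show g: "centroid N = L (centroid M) + d" .
  have d: "L z + d - centroid N = L (z - ?g)" for z unfolding g by (simp add: linear_diff[OF L(1)])
  have "pseudovariance N = mean M (\<lambda>z. (L z + d - centroid N)\<^sup>2)"
    unfolding pseudovariance_def by (subst (1) N_def) (intro mean_affine L M continuous_intros)
  then show "pseudovariance N = p\<^sup>2 * pseudovariance M + 2 * p * q * of_real (variance M) + q\<^sup>2 * cnj (pseudovariance M)"
    unfolding d unfolding L(3) mean_form_square(2)[OF M] .
  have "variance N = mean M (\<lambda>z. (cmod (L z + d - centroid N))\<^sup>2)"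
    unfolding variance_def by (subst (1) N_def) (intro mean_affine L M continuous_intros)
  then show "variance N = mean M (\<lambda>z. (cmod (L (z - centroid M)))\<^sup>2)" unfolding d .
qed

text \<open>Bounds the eccentricity of the inertia ellipse: \<open>variance M - cmod (pseudovariance M)\<close> is twice
  its smaller eigenvalue.\<close>
lemma variance_gap:
  assumes M: "planar_body M" and r: "r > 0" "cball w r \<subseteq> M" and R: "M \<subseteq> cball 0 R"
  shows "variance M - cmod (pseudovariance M) \<ge> r^4 / (128 * R\<^sup>2)"
proof -
  let ?g = "centroid M"
  have Mc: "compact M" using M by (simp add: planar_body_def)
  \<comment> \<open>A rotation by \<open>v\<close> makes the pseudovariance real and nonnegative.
    The gap is then the mean of \<open>\<psi>\<close>, twice the squared distance to a line through
    the centroid.\<close>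
  obtain v where v: "cmod v = 1" "v\<^sup>2 * pseudovariance M = of_real (cmod (pseudovariance M))"
  proof (cases "pseudovariance M = 0")
    case True then show ?thesis by (intro that[of 1]) auto
  next
    case False
    define v where "v = csqrt (cnj (sgn (pseudovariance M)))"
    have v2: "v\<^sup>2 = cnj (sgn (pseudovariance M))" by (simp add: v_def)
    have "cmod v ^ 2 = 1" using False by (simp flip: norm_power add: v2 norm_sgn)
    then have "cmod v = 1" using norm_ge_zero[of v] by (simp add: power2_eq_1_iff)
    moreover have "v\<^sup>2 * pseudovariance M = of_real (cmod (pseudovariance M))"
      unfolding v2 sgn_eq using False complex_norm_square[of "pseudovariance M"]
      by (simp add: field_simps power2_eq_square)
    ultimately show ?thesis by (rule that)
  qed
  define \<psi> where "\<psi> = (\<lambda>z. 2 * (Im (v * (z - ?g)))\<^sup>2)"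
  have c\<psi>: "continuous_on X \<psi>" for X unfolding \<psi>_def by (intro continuous_intros)
  have "mean M (\<lambda>z. (cmod (z - ?g))\<^sup>2) = mean M (\<lambda>z. \<psi> z + Re (v\<^sup>2 * (z - ?g)\<^sup>2))"
  proof -
    have "(cmod (z - ?g))\<^sup>2 = \<psi> z + Re (v\<^sup>2 * (z - ?g)\<^sup>2)" for z
    proof -
      have "(cmod (z - ?g))\<^sup>2 = (cmod (v * (z - ?g)))\<^sup>2" using v(1) by (simp add: norm_mult)
      also have "\<dots> = \<psi> z + Re ((v * (z - ?g))\<^sup>2)" unfolding cmod_power2 \<psi>_def by (simp add: power2_eq_square)
      finally show ?thesis by (simp add: power_mult_distrib)
    qed
    then show ?thesis by presburger
  qed
  also have "\<dots> = mean M \<psi> + mean M (\<lambda>z. Re (v\<^sup>2 * (z - ?g)\<^sup>2))"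
    by (intro mean_add M c\<psi> continuous_intros)
  also have "mean M (\<lambda>z. Re (v\<^sup>2 * (z - ?g)\<^sup>2)) = Re (mean M (\<lambda>z. v\<^sup>2 * (z - ?g)\<^sup>2))"
    by (intro mean_Re M continuous_intros)
  also have "mean M (\<lambda>z. v\<^sup>2 * (z - ?g)\<^sup>2) = v\<^sup>2 * pseudovariance M"
    unfolding pseudovariance_def by (intro mean_mult M continuous_intros)
  finally have gap: "variance M - cmod (pseudovariance M) = mean M \<psi>" using v(2) by (simp add: variance_def)
  define t where "t = Im (v * (w - ?g))"
  define s where "s = (if t \<ge> 0 then 1 else -1 :: real)"
  \<comment> \<open>The centre of the ball is moved by \<open>r / 2\<close> away from that line, so
    that a disc of radius \<open>r/4\<close> around \<open>p\<close> is still in \<open>M\<close>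
    and stays at distance \<open>r/4\<close> from the line.\<close>
  define p where "p = w + of_real (s * r / 2) * (\<i> * cnj v)"
  have vv: "v * cnj v = 1" using v(1) complex_norm_square[of v] by simp
  have "v * (p - ?g) = v * (w - ?g) + of_real (s * r / 2) * \<i> * (v * cnj v)" by (simp add: p_def algebra_simps)
  then have "Im (v * (p - ?g)) = t + s * r / 2" by (simp add: vv t_def)
  then have imp: "\<bar>Im (v * (p - ?g))\<bar> \<ge> r / 2" using r by (auto simp: s_def)
  have dp: "dist w p \<le> r / 2" using r v(1) by (simp add: p_def dist_norm norm_mult s_def)
  have sub: "cball p (r/4) \<subseteq> M"
  proof
    fix z assume "z \<in> cball p (r/4)"
    then have "dist w z \<le> r" using dist_triangle[of w z p] dp r by simp
    then show "z \<in> M" using r(2) by auto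
  qed
  have low: "\<psi> z \<ge> r\<^sup>2 / 8" if "z \<in> cball p (r/4)" for z
  proof -
    have "\<bar>Im (v * (z - p))\<bar> \<le> r/4" using abs_Im_le_cmod[of "v * (z - p)"] that v(1)
      by (simp add: norm_mult dist_norm norm_minus_commute)
    moreover have "Im (v * (z - ?g)) = Im (v * (p - ?g)) + Im (v * (z - p))" by (simp add: algebra_simps)
    ultimately have "\<bar>Im (v * (z - ?g))\<bar> \<ge> r/4" using imp by linarith
    then have "(r/4)\<^sup>2 \<le> \<bar>Im (v * (z - ?g))\<bar>\<^sup>2" using r by (intro power_mono) auto
    then show ?thesis by (simp add: \<psi>_def power2_eq_square)
  qed
  have "r\<^sup>2 / 8 * area (cball p (r/4)) = planar_integral (cball p (r/4)) (\<lambda>z. r\<^sup>2 / 8)"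
    unfolding area_def using planar_integral_bounded_linear[OF _ _ bounded_linear_mult_right, of "cball p (r/4)" "\<lambda>_. 1::real" "r\<^sup>2 / 8"]
    by simp
  also have "\<dots> \<le> planar_integral M \<psi>"
    using low by (intro planar_integral_mono Mc c\<psi> sub) (auto simp: \<psi>_def)
  finally have 1: "r\<^sup>2 / 8 * area (cball p (r/4)) \<le> planar_integral M \<psi>" .
  have "w \<in> M" using r by auto
  have R0: "R > 0"
  proof -
    have "w + of_real r \<in> M" "w - of_real r \<in> M" using r by (auto intro!: subsetD[OF r(2)] simp: dist_norm)
    then have "cmod (w + of_real r) \<le> R" "cmod (w - of_real r) \<le> R" using R unfolding subset_iff mem_cball_0 by blast+
    moreover have "2 * r \<le> cmod (w + of_real r) + cmod (w - of_real r)"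
      using norm_triangle_ineq4[of "w + of_real r" "w - of_real r"] r by simp
    ultimately show ?thesis using r by linarith
  qed
  \<comment> \<open>The small disc occupies at least a fraction \<open>(r / (4*R))\<^sup>2\<close>
    of \<open>M\<close>, and \<open>\<psi> \<ge> r\<^sup>2 / 8\<close> on it; the product is the
    asserted bound.\<close>
  have "cball (0::complex) R = (\<lambda>z. (4*R/r) *\<^sub>R z + (- (4*R/r) *\<^sub>R p)) ` cball p (r/4)"
  proof -
    have "cball (0::complex) R \<subseteq> (\<lambda>z. (4*R/r) *\<^sub>R z + (- (4*R/r) *\<^sub>R p)) ` cball p (r/4)"
    proof
      fix y :: complex assume y: "y \<in> cball 0 R"
      have "y = (4*R/r) *\<^sub>R (p + (r/(4*R)) *\<^sub>R y) + (- (4*R/r) *\<^sub>R p)" using r R0 by (simp add: scaleR_right_distrib)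
      moreover have "p + (r/(4*R)) *\<^sub>R y \<in> cball p (r/4)" using y r R0 by (simp add: dist_norm field_simps)
      ultimately show "y \<in> (\<lambda>z. (4*R/r) *\<^sub>R z + (- (4*R/r) *\<^sub>R p)) ` cball p (r/4)" by blast
    qed
    moreover have "(4*R/r) *\<^sub>R z + (- (4*R/r) *\<^sub>R p) \<in> cball 0 R" if "z \<in> cball p (r/4)" for z
    proof -
      have "(4*R/r) *\<^sub>R z + (- (4*R/r) *\<^sub>R p) = (4*R/r) *\<^sub>R (z - p)" by (simp add: scaleR_right_diff_distrib)
      then have "norm ((4*R/r) *\<^sub>R z + (- (4*R/r) *\<^sub>R p)) = 4*R/r * norm (z - p)"
        using r R0 by (simp only: norm_scaleR) simp
      also have "\<dots> \<le> 4*R/r * (r/4)"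
        using that r R0 by (intro mult_left_mono) (auto simp: dist_norm norm_minus_commute)
      finally show ?thesis using r R0 by simp
    qed
    ultimately show ?thesis by blast
  qed
  then have "area (cball 0 R) = (4*R/r)\<^sup>2 * area (cball p (r/4))"
    using area_scale[of "cball p (r/4)" "4*R/r" "- (4*R/r) *\<^sub>R p"] r R0 by simp
  moreover have "area M \<le> area (cball 0 R)" by (intro area_mono Mc R) auto
  ultimately have 2: "area M \<le> (4*R/r)\<^sup>2 * area (cball p (r/4))" by simp
  have "r^4 / (128 * R\<^sup>2) * area M \<le> r^4 / (128 * R\<^sup>2) * ((4*R/r)\<^sup>2 * area (cball p (r/4)))"
    using 2 by (intro mult_left_mono) auto
  also have "\<dots> = r\<^sup>2 / 8 * area (cball p (r/4))" using r R0 by (simp add: power_divide power2_eq_square eval_nat_numeral)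
  also note 1
  finally have "r^4 / (128 * R\<^sup>2) \<le> planar_integral M \<psi> / area M"
    using planar_body_area[OF M] by (simp add: pos_le_divide_eq)
  then show ?thesis unfolding gap mean_def by (simp add: field_simps)
qed

lemma planar_body_balls:
  assumes "planar_body M"
  obtains w r R where "r > 0" "cball w r \<subseteq> M" "M \<subseteq> cball 0 R"
proof -
  obtain w where "w \<in> interior M" using assms by (auto simp: planar_body_def)
  then have "\<exists>e>0. cball w e \<subseteq> M" by (simp only: mem_interior_cball)
  then obtain r where "r > 0" "cball w r \<subseteq> M" by blast
  moreover have "bounded M" using assms by (simp add: planar_body_def compact_imp_bounded)
  then obtain R where "\<forall>x\<in>M. norm x \<le> R" by (auto simp: bounded_iff)
  then have "M \<subseteq> cball 0 R" by auto
  ultimately show ?thesis by (rule that)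
qed

lemma pseudovariance_less_variance:
  assumes "planar_body M"
  shows "cmod (pseudovariance M) < variance M"
proof -
  obtain w r R where b: "r > 0" "cball w r \<subseteq> M" "M \<subseteq> cball 0 R" using planar_body_balls[OF assms] .
  have "R \<noteq> 0"
  proof
    assume "R = 0"
    moreover have "w + of_real r \<in> M" "w \<in> M" using b(1) by (auto intro!: subsetD[OF b(2)] simp: dist_norm)
    ultimately have "w + of_real r = 0" "w = 0" using b(3) by auto
    then show False using b by simp
  qed
  then have "r^4 / (128 * R\<^sup>2) > 0" using b by simp
  then show ?thesis using variance_gap[OF assms b] by linarith
qed

lemma shear_less_1:
  assumes "planar_body M" shows "cmod (shear M) < 1"
proof -
  note 1 = pseudovariance_less_variance[OF assms]
  then have "variance M > 0" using norm_ge_zero order_le_less_trans by blast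
  moreover have "sqrt ((variance M)\<^sup>2 - (cmod (pseudovariance M))\<^sup>2) \<ge> 0"
    using 1 by (simp add: power_mono)
  ultimately have "cmod (pseudovariance M) < variance M + sqrt ((variance M)\<^sup>2 - (cmod (pseudovariance M))\<^sup>2)"
    "variance M + sqrt ((variance M)\<^sup>2 - (cmod (pseudovariance M))\<^sup>2) > 0" using 1 by linarith+
  then show ?thesis unfolding shear_def norm_divide norm_of_real by (simp add: divide_less_eq)
qed

lemma linear_form: "linear (\<lambda>w. p * w + q * cnj w)"
  by (intro linearI) (simp_all add: algebra_simps scaleR_conv_of_real)

lemma linear_form_exists:
  assumes "linear L" shows "\<exists>p q. \<forall>w. L w = p * w + q * cnj w"
proof (intro exI allI)
  fix w
  have "w = Re w *\<^sub>R 1 + Im w *\<^sub>R \<i>" by (simp add: complex_eq_iff)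
  then have "L w = L (Re w *\<^sub>R 1 + Im w *\<^sub>R \<i>)" by (rule arg_cong)
  also have "\<dots> = Re w *\<^sub>R L 1 + Im w *\<^sub>R L \<i>" by (simp only: linear_add[OF assms] linear_scale[OF assms])
  finally have "L w = Re w *\<^sub>R L 1 + Im w *\<^sub>R L \<i>" .
  then show "L w = ((L 1 - \<i> * L \<i>) / 2) * w + ((L 1 + \<i> * L \<i>) / 2) * cnj w"
    by (simp add: complex_eq_iff field_simps)
qed

lemma inj_form:
  assumes "cmod q \<noteq> cmod p" shows "inj (\<lambda>w. p * w + q * cnj w)"
proof -
  have "w = 0" if "p * w + q * cnj w = 0" for w
  proof -
    have "p * w = - (q * cnj w)" using that by (simp add: add_eq_0_iff2)
    then have "cmod (p * w) = cmod (q * cnj w)" by simp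
    then show ?thesis using assms by (auto simp: norm_mult)
  qed
  then show ?thesis using linear_injective_0[OF linear_form] by blast
qed

lemma normalize_pt_form:
  "normalize_pt M z = (1 * z + (- shear M) * cnj z) + (- (centroid M) + shear M * cnj (centroid M))"
  by (simp add: normalize_pt_def algebra_simps)

lemma normal_form_props:
  assumes M: "planar_body M"
  shows "planar_body (normal_form M)" "centroid (normal_form M) = 0" "pseudovariance (normal_form M) = 0"
proof -
  let ?L = "\<lambda>w. 1 * w + (- shear M) * cnj w"
  let ?d = "- centroid M + shear M * cnj (centroid M)"
  have L: "linear ?L" "inj ?L" using linear_form[of 1 "- shear M"] inj_form[of "- shear M" 1] shear_less_1[OF M] by auto
  have nf: "normal_form M = (\<lambda>z. ?L z + ?d) ` M" unfolding normal_form_def normalize_pt_form ..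
  show "planar_body (normal_form M)" unfolding nf by (rule planar_body_affine[OF L M])
  show "centroid (normal_form M) = 0" unfolding nf moments_affine(1)[OF L refl M] by simp
  have eq: "pseudovariance (normal_form M) =
    pseudovariance M - 2 * shear M * of_real (variance M) + (shear M)\<^sup>2 * cnj (pseudovariance M)"
    unfolding nf moments_affine(2)[OF L refl M] by simp
  define D where "D = sqrt ((variance M)\<^sup>2 - (cmod (pseudovariance M))\<^sup>2)"
  note gap = pseudovariance_less_variance[OF M]
  have v: "variance M > 0" using gap norm_ge_zero order_le_less_trans by blast
  have D: "D \<ge> 0" "D\<^sup>2 = (variance M)\<^sup>2 - (cmod (pseudovariance M))\<^sup>2"
    using gap power_mono[of "cmod (pseudovariance M)" "variance M" 2] by (auto simp: D_def)
  define E where "E = complex_of_real (variance M + D)"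
  have E0: "E \<noteq> 0" using v D unfolding E_def of_real_eq_0_iff by linarith
  have s: "shear M = pseudovariance M / E" by (simp add: shear_def E_def D_def)
  have tt: "pseudovariance M * cnj (pseudovariance M) = of_real ((variance M)\<^sup>2 - D\<^sup>2)"
    unfolding D(2) using complex_norm_square[of "pseudovariance M"] by simp
  have "pseudovariance (normal_form M) = pseudovariance M / E\<^sup>2 *
    (E\<^sup>2 - 2 * E * of_real (variance M) + pseudovariance M * cnj (pseudovariance M))"
    unfolding eq s using E0 by (simp add: field_simps power2_eq_square)
  \<comment> \<open>With \<open>E\<close> the variance plus \<open>D\<close>, this is the square of
    \<open>E\<close> minus the variance, less \<open>D\<^sup>2\<close>.\<close>
  also have "E\<^sup>2 - 2 * E * of_real (variance M) + pseudovariance M * cnj (pseudovariance M) = 0"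
    unfolding tt E_def by (simp add: power2_eq_square algebra_simps)
  finally show "pseudovariance (normal_form M) = 0" by simp
qed

text \<open>A real-linear map \<open>\<omega> \<mapsto> p \<omega> + q cnj \<omega>\<close> between bodies of vanishing pseudovariance satisfies
  \<open>p q = 0\<close>, that is, it is a similarity.\<close>
lemma normal_form_affine:
  assumes L: "linear L" "inj L" and M: "planar_body M"
  shows "\<exists>a. a \<noteq> 0 \<and> (normal_form ((\<lambda>z. L z + d) ` M) = (\<lambda>z. a * z) ` normal_form M \<or>
     normal_form ((\<lambda>z. L z + d) ` M) = (\<lambda>z. a * cnj z) ` normal_form M)"
proof -
  let ?N = "(\<lambda>z. L z + d) ` M"
  have N: "planar_body ?N" by (rule planar_body_affine[OF L M])
  define b where "b = shear M"
  define c where "c = 1 - (cmod b)\<^sup>2"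
  have b1: "cmod b < 1" using shear_less_1[OF M] by (simp add: b_def)
  then have c: "c > 0" by (simp add: c_def abs_square_less_1)
  \<comment> \<open>\<open>U\<close> inverts the linear part of \<open>normalize_pt M\<close>, so
    \<open>P\<close> is the map that \<open>L\<close> induces between the two normal forms.\<close>
  define U where "U = (\<lambda>w. (1 / of_real c) * w + (b / of_real c) * cnj w)"
  define V where "V = (\<lambda>w. 1 * w + (- shear ?N) * cnj w)"
  define P where "P = V \<circ> L \<circ> U"
  have U: "linear U" unfolding U_def by (rule linear_form)
  have V: "linear V" unfolding V_def by (rule linear_form)
  have P: "linear P" unfolding P_def by (intro linear_compose U V L)
  have Uinv: "U (w - b * cnj w) = w" for w
  proof -
    have "U (w - b * cnj w) = (1 - b * cnj b) / of_real c * w" by (simp add: U_def algebra_simps add_divide_distrib diff_divide_distrib)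
    also have "1 - b * cnj b = of_real c" unfolding c_def using complex_norm_square[of b] by simp
    finally show ?thesis using c by simp
  qed
  obtain p q where pq: "\<And>w. P w = p * w + q * cnj w" using linear_form_exists[OF P] by blast
  obtain p0 q0 where pq0: "\<And>w. L w = p0 * w + q0 * cnj w" using linear_form_exists[OF L(1)] by blast
  have eqpt: "normalize_pt ?N (L z + d) = P (normalize_pt M z)" for z
  proof -
    have "normalize_pt ?N (L z + d) = V (L z + d - centroid ?N)" by (simp add: normalize_pt_def V_def)
    also have "L z + d - centroid ?N = L (z - centroid M)"
      unfolding moments_affine(1)[OF L pq0 M] by (simp add: linear_diff[OF L(1)])
    also have "z - centroid M = U (normalize_pt M z)" unfolding normalize_pt_def b_def[symmetric] Uinv ..
    finally show ?thesis by (simp add: P_def)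
  qed
  have im: "normal_form ?N = P ` normal_form M"
    unfolding normal_form_def image_image eqpt by simp
  have nM: "planar_body (normal_form M)" by (rule normal_form_props[OF M])
  have "inj V" unfolding V_def using inj_form[of "- shear ?N" 1] shear_less_1[OF N] by simp
  moreover have "inj U" unfolding U_def using inj_form[of "b / of_real c" "1 / of_real c"] b1 c by (simp add: norm_divide divide_cancel_right)
  ultimately have injP: "inj P" unfolding P_def using L(2) by (intro inj_compose)
  have im0: "normal_form ?N = (\<lambda>z. P z + 0) ` normal_form M" using im by simp
  have "0 = pseudovariance (normal_form ?N)" using normal_form_props(3)[OF N] by simp
  also have "\<dots> = 2 * p * q * of_real (variance (normal_form M))"
    unfolding im0 moments_affine(2)[OF P injP pq nM] normal_form_props(3)[OF M] by simp
  finally have "p = 0 \<or> q = 0"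
    using pseudovariance_less_variance[OF nM] normal_form_props(3)[OF M] by auto
  moreover have "P 1 \<noteq> 0" using injP linear_injective_0[OF P] by auto
  ultimately show ?thesis
  proof (elim disjE)
    assume "p = 0"
    then show ?thesis using im pq \<open>P 1 \<noteq> 0\<close> by (intro exI[of _ q]) auto
  next
    assume "q = 0"
    then show ?thesis using im pq \<open>P 1 \<noteq> 0\<close> by (intro exI[of _ p]) auto
  qed
qed

text \<open>\<open>shear\<close> acquires the factor \<open>a\<^sup>2 / (cmod a)\<^sup>2\<close>,
  which commutes with the conjugation in \<open>normalize_pt\<close>. In contrast to
  \<open>normal_form_affine\<close>, the multiplier is known exactly; the winding argument needs its
  phase.\<close>

lemma normal_form_mult:
  assumes M: "planar_body M" and a: "a \<noteq> 0"
  shows "normal_form ((\<lambda>z. a * z) ` M) = (\<lambda>z. a * z) ` normal_form M"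
proof -
  let ?N = "(\<lambda>z. a * z) ` M"
  let ?L = "\<lambda>w. a * w + 0 * cnj w"
  have L: "linear ?L" "inj ?L" using linear_form[of a 0] inj_form[of 0 a] a by auto
  have N: "?N = (\<lambda>z. ?L z + 0) ` M" by simp
  have g: "centroid ?N = a * centroid M" unfolding N moments_affine(1)[OF L refl M] by simp
  have t: "pseudovariance ?N = a\<^sup>2 * pseudovariance M" unfolding N moments_affine(2)[OF L refl M] by simp
  have "variance ?N = mean M (\<lambda>z. (cmod a)\<^sup>2 * (cmod (z - centroid M))\<^sup>2)"
    unfolding N moments_affine(3)[OF L refl M] by (simp add: norm_mult power_mult_distrib flip: right_diff_distrib)
  also have "\<dots> = (cmod a)\<^sup>2 * variance M" unfolding variance_def by (intro mean_mult_real M continuous_intros)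
  finally have v: "variance ?N = (cmod a)\<^sup>2 * variance M" .
  have "sqrt ((variance ?N)\<^sup>2 - (cmod (pseudovariance ?N))\<^sup>2)
    = sqrt (((cmod a)\<^sup>2)\<^sup>2 * ((variance M)\<^sup>2 - (cmod (pseudovariance M))\<^sup>2))"
    unfolding v t by (simp add: norm_mult norm_power power_mult_distrib algebra_simps)
  also have "\<dots> = (cmod a)\<^sup>2 * sqrt ((variance M)\<^sup>2 - (cmod (pseudovariance M))\<^sup>2)"
    unfolding real_sqrt_mult by (subst real_sqrt_abs) simp
  finally have "shear ?N = a\<^sup>2 * pseudovariance M / of_real ((cmod a)\<^sup>2 * (variance M + sqrt ((variance M)\<^sup>2 - (cmod (pseudovariance M))\<^sup>2)))"
    unfolding shear_def t v by (simp add: algebra_simps)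
  also have "\<dots> = a\<^sup>2 / of_real ((cmod a)\<^sup>2) * shear M" by (simp add: shear_def)
  also have "of_real ((cmod a)\<^sup>2) = a * cnj a" by (rule complex_norm_square)
  finally have s: "shear ?N * cnj a = a * shear M" using a by (simp add: power2_eq_square)
  have "normalize_pt ?N (a * z) = a * normalize_pt M z" for z
  proof -
    have "normalize_pt ?N (a * z) = a * (z - centroid M) - (shear ?N * cnj a) * cnj (z - centroid M)"
      unfolding normalize_pt_def g by (simp add: algebra_simps)
    then show ?thesis unfolding s normalize_pt_def by (simp add: algebra_simps)
  qed
  then show ?thesis unfolding normal_form_def image_image by simp
qed

text \<open>Between 1 and 2, \<open>l\<^sup>2 \<le> 3 * l - 2\<close>, so the area grows by at most
  the fraction \<open>3 * (l - 1)\<close>. This enters twice, through the integral and through the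
  division by the area, whence 6.\<close>

lemma mean_diff_bound:
  fixes \<phi> :: "complex \<Rightarrow> 'b::euclidean_space"
  assumes M: "planar_body M" and N: "planar_body N" and sub: "M \<subseteq> N" "N \<subseteq> (\<lambda>x. l *\<^sub>R x + z) ` M" and l: "1 \<le> l" "l \<le> 2"
    and \<phi>: "continuous_on UNIV \<phi>" and B: "\<And>z. z \<in> N \<Longrightarrow> norm (\<phi> z) \<le> B"
  shows "norm (mean N \<phi> - mean M \<phi>) \<le> 6 * B * (l - 1)"
proof -
  have Mc: "compact M" and Nc: "compact N" using M N by (auto simp: planar_body_def)
  define A1 where "A1 = area M"
  define A2 where "A2 = area N"
  have A: "A1 > 0" "A2 > 0" using planar_body_area M N by (auto simp: A1_def A2_def)
  have A12: "A1 \<le> A2" unfolding A1_def A2_def by (rule area_mono[OF Mc Nc sub(1)])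
  have cim: "compact ((\<lambda>x. l *\<^sub>R x + z) ` M)" by (intro compact_continuous_image Mc continuous_intros)
  have "A2 \<le> l\<^sup>2 * A1" unfolding A1_def A2_def using area_mono[OF Nc cim sub(2)] area_scale[OF Mc, of l z] l by simp
  moreover have "l * l \<le> 2 * l" using l by simp
  then have "l\<^sup>2 \<le> 3 * l - 2" using mult_nonneg_nonneg[of "l - 1" "2 - l"] l by (simp add: algebra_simps power2_eq_square)
  then have "l\<^sup>2 * A1 \<le> (3 * l - 2) * A1" using A by (intro mult_right_mono) auto
  ultimately have d: "A2 - A1 \<le> 3 * (l - 1) * A1" by (simp add: algebra_simps)
  have "M \<noteq> {}" using M by (auto simp: planar_body_def)
  then obtain x where "x \<in> M" by blast
  then have B0: "B \<ge> 0" using sub(1) B[of x] norm_ge_zero[of "\<phi> x"] by (meson order_trans subsetD)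
  define I1 where "I1 = planar_integral M \<phi>"
  define I2 where "I2 = planar_integral N \<phi>"
  have 1: "norm (I2 - I1) \<le> B * (A2 - A1)"
    unfolding I1_def I2_def A1_def A2_def by (rule planar_integral_diff_bound[OF Mc Nc sub(1) \<phi> B])
  have 2: "norm I1 \<le> B * A1"
  proof -
    have e: "compact ({}::complex set)" by simp
    have "norm (planar_integral M \<phi> - planar_integral {} \<phi>) \<le> B * (area M - area {})"
      by (rule planar_integral_diff_bound[OF e Mc _ \<phi>]) (use B sub in auto)
    then show ?thesis by (simp add: I1_def A1_def area_def planar_integral_def)
  qed
  have A12': "(A2 - A1) / (A1 * A2) = 1 / A1 - 1 / A2" using A by (simp add: field_simps)
  have "mean N \<phi> - mean M \<phi> = (1/A2) *\<^sub>R (I2 - I1) - ((A2 - A1) / (A1 * A2)) *\<^sub>R I1"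
    unfolding mean_def A1_def[symmetric] A2_def[symmetric] I1_def[symmetric] I2_def[symmetric] using A
    by (simp add: A12' scaleR_right_diff_distrib scaleR_left_diff_distrib inverse_eq_divide)
  then have "norm (mean N \<phi> - mean M \<phi>) \<le> (1/A2) * norm (I2 - I1) + ((A2 - A1) / (A1 * A2)) * norm I1"
    using norm_triangle_ineq4[of "(1/A2) *\<^sub>R (I2 - I1)" "((A2 - A1) / (A1 * A2)) *\<^sub>R I1"] A A12 by simp
  also have "\<dots> \<le> (1/A2) * (B * (A2 - A1)) + ((A2 - A1) / (A1 * A2)) * (B * A1)"
    using 1 2 A A12 by (intro add_mono mult_left_mono) auto
  also have "\<dots> = 2 * B * ((A2 - A1) / A2)" using A by (simp add: field_simps)
  also have "\<dots> \<le> 2 * B * (3 * (l - 1))"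
  proof (intro mult_left_mono)
    have "3 * (l - 1) * A1 \<le> 3 * (l - 1) * A2" using A12 l by (intro mult_left_mono) auto
    then show "(A2 - A1) / A2 \<le> 3 * (l - 1)" using A d by (simp add: pos_divide_le_eq)
  qed (use B0 in auto)
  finally show ?thesis by (simp add: algebra_simps)
qed

section \<open>Support functions and their Fourier coefficients\<close>

definition support_fun :: "complex set \<Rightarrow> real \<Rightarrow> real" where
  "support_fun M \<theta> = (SUP z\<in>M. cis \<theta> \<bullet> z)"

lemma norm_cis_diff: "cmod (cis a - cis b) = 2 * \<bar>sin ((a - b) / 2)\<bar>"
proof -
  have "(cmod (cis a - cis b))\<^sup>2 = (cos a - cos b)\<^sup>2 + (sin a - sin b)\<^sup>2" by (simp add: cmod_power2)
  also have "\<dots> = ((cos a)\<^sup>2 + (sin a)\<^sup>2) + ((cos b)\<^sup>2 + (sin b)\<^sup>2) - 2 * (cos a * cos b + sin a * sin b)"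
    by (simp add: power2_eq_square algebra_simps)
  also have "\<dots> = 2 - 2 * cos (a - b)" by (simp add: cos_diff)
  also have "cos (a - b) = 1 - 2 * (sin ((a - b) / 2))\<^sup>2"
  proof -
    have "2 * ((a - b) / 2) = a - b" by simp
    then show ?thesis using cos_double_sin[of "(a - b) / 2"] by (simp only:)
  qed
  finally have "(cmod (cis a - cis b))\<^sup>2 = (2 * \<bar>sin ((a - b) / 2)\<bar>)\<^sup>2" by (simp add: power_mult_distrib)
  then show ?thesis by (rule power2_eq_imp_eq) auto
qed

context
  fixes M :: "complex set" assumes M: "compact M" "M \<noteq> {}"
begin

lemma support_fun_attained: "\<exists>z\<in>M. support_fun M \<theta> = cis \<theta> \<bullet> z \<and> (\<forall>y\<in>M. cis \<theta> \<bullet> y \<le> cis \<theta> \<bullet> z)"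
proof -
  have "continuous_on M (\<lambda>z. cis \<theta> \<bullet> z)" by (intro continuous_intros)
  then obtain z where z: "z \<in> M" "\<forall>y\<in>M. cis \<theta> \<bullet> y \<le> cis \<theta> \<bullet> z" using continuous_attains_sup[OF M] by blast
  then have "support_fun M \<theta> = cis \<theta> \<bullet> z" unfolding support_fun_def by (intro cSup_eq_maximum) auto
  then show ?thesis using z by blast
qed

lemma support_fun_ge: "z \<in> M \<Longrightarrow> cis \<theta> \<bullet> z \<le> support_fun M \<theta>"
  using support_fun_attained[of \<theta>] by auto

lemma support_fun_le: "(\<And>z. z \<in> M \<Longrightarrow> cis \<theta> \<bullet> z \<le> c) \<Longrightarrow> support_fun M \<theta> \<le> c"
  using support_fun_attained[of \<theta>] by auto

text \<open>The chord length of the circle is kept as a sine: it is periodic, and against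
  \<open>cos_kernel\<close> it has an explicit integral.\<close>

lemma support_fun_lipschitz:
  assumes "M \<subseteq> cball 0 R"
  shows "\<bar>support_fun M a - support_fun M b\<bar> \<le> 2 * R * \<bar>sin ((a - b) / 2)\<bar>"
proof -
  have *: "support_fun M a \<le> support_fun M b + 2 * R * \<bar>sin ((a - b) / 2)\<bar>" for a b
  proof (rule support_fun_le)
    fix z assume z: "z \<in> M"
    have "cis a \<bullet> z = cis b \<bullet> z + (cis a - cis b) \<bullet> z" by (simp add: inner_diff_left)
    also have "\<dots> \<le> support_fun M b + cmod (cis a - cis b) * cmod z"
      by (intro add_mono support_fun_ge z norm_cauchy_schwarz)
    also have "cmod (cis a - cis b) * cmod z \<le> 2 * \<bar>sin ((a - b) / 2)\<bar> * R"
      unfolding norm_cis_diff using assms z by (intro mult_left_mono) auto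
    finally show "cis a \<bullet> z \<le> support_fun M b + 2 * R * \<bar>sin ((a - b) / 2)\<bar>" by (simp add: mult_ac)
  qed
  have "\<bar>sin ((b - a) / 2)\<bar> = \<bar>sin ((a - b) / 2)\<bar>"
    using sin_minus[of "(a - b)/2"] by (metis abs_minus_cancel minus_diff_eq minus_divide_left)
  then show ?thesis using *[of a b] *[of b a] by (simp add: abs_le_iff)
qed

lemma continuous_support_fun: "continuous_on X (support_fun M)"
proof -
  obtain R where "\<forall>z\<in>M. norm z \<le> R" using compact_imp_bounded[OF M(1)] by (auto simp: bounded_iff)
  then have R: "M \<subseteq> cball 0 R" by auto
  obtain x where "x \<in> M" using M(2) by blast
  then have "norm x \<le> R" using R by auto
  then have R0: "R \<ge> 0" using norm_ge_zero[of x] by linarith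
  have "dist (support_fun M a) (support_fun M b) \<le> R * dist a b" for a b
  proof -
    have "2 * R * \<bar>sin ((a - b) / 2)\<bar> \<le> 2 * R * \<bar>(a - b) / 2\<bar>"
      using R0 by (intro mult_left_mono abs_sin_x_le_abs_x) auto
    then show ?thesis using support_fun_lipschitz[OF R, of a b] by (simp add: dist_real_def)
  qed
  then have "R-lipschitz_on X (support_fun M)" using R0 by (intro lipschitz_onI)
  then show ?thesis by (rule lipschitz_on_continuous_on)
qed

end

lemma support_fun_periodic: "support_fun M (\<theta> + 2 * pi) = support_fun M \<theta>"
  by (simp add: support_fun_def cis_mult[symmetric])

lemma support_fun_mult: "support_fun ((\<lambda>z. p * z) ` M) \<theta> = cmod p * support_fun M (\<theta> - Arg p)"
  if MM: "compact M" "M \<noteq> {}"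
proof -
  have im: "compact ((\<lambda>z. p * z) ` M)" "(\<lambda>z. p * z) ` M \<noteq> {}"
    using that by (auto intro!: compact_continuous_image continuous_intros)
  have eq: "cis \<theta> \<bullet> (p * z) = cmod p * (cis (\<theta> - Arg p) \<bullet> z)" for z
  proof -
    have "Re p = cmod p * cos (Arg p)" "Im p = cmod p * sin (Arg p)"
      using rcis_cmod_Arg[of p] by (metis Re_rcis, metis Im_rcis)
    then show ?thesis by (simp add: inner_complex_def cos_diff sin_diff algebra_simps)
  qed
  obtain z where z: "z \<in> M" "support_fun M (\<theta> - Arg p) = cis (\<theta> - Arg p) \<bullet> z"
    using support_fun_attained[OF MM] by blast
  show ?thesis
  proof (rule antisym)
    show "support_fun ((\<lambda>z. p * z) ` M) \<theta> \<le> cmod p * support_fun M (\<theta> - Arg p)"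
      by (rule support_fun_le[OF im]) (auto simp: eq intro!: mult_left_mono support_fun_ge[OF MM])
    show "cmod p * support_fun M (\<theta> - Arg p) \<le> support_fun ((\<lambda>z. p * z) ` M) \<theta>"
      using support_fun_ge[OF im imageI[OF z(1)], of \<theta>] z(2) by (simp add: eq)
  qed
qed

lemma support_fun_cnj: "support_fun (cnj ` M) \<theta> = support_fun M (- \<theta>)"
proof -
  have "cis \<theta> \<bullet> cnj z = cis (- \<theta>) \<bullet> z" for z by (simp add: inner_complex_def)
  then show ?thesis unfolding support_fun_def image_image by simp
qed

lemma support_fun_hausdorff:
  assumes M: "compact M" "M \<noteq> {}" and N: "compact N" "N \<noteq> {}"
    and 1: "\<And>x. x \<in> M \<Longrightarrow> \<exists>y\<in>N. cmod (x - y) \<le> e" and 2: "\<And>x. x \<in> N \<Longrightarrow> \<exists>y\<in>M. cmod (x - y) \<le> e"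
  shows "\<bar>support_fun M \<theta> - support_fun N \<theta>\<bar> \<le> e"
proof -
  have *: "support_fun A \<theta> \<le> support_fun B \<theta> + e"
    if A: "compact A" "A \<noteq> {}" and B: "compact B" "B \<noteq> {}" and near: "\<And>x. x \<in> A \<Longrightarrow> \<exists>y\<in>B. cmod (x - y) \<le> e" for A B
  proof (rule support_fun_le[OF A])
    fix x assume "x \<in> A"
    then obtain y where y: "y \<in> B" "cmod (x - y) \<le> e" using near by blast
    have "cis \<theta> \<bullet> x = cis \<theta> \<bullet> y + cis \<theta> \<bullet> (x - y)" by (simp add: inner_diff_right)
    also have "\<dots> \<le> support_fun B \<theta> + cmod (cis \<theta>) * cmod (x - y)"
      by (intro add_mono support_fun_ge B y norm_cauchy_schwarz)
    finally show "cis \<theta> \<bullet> x \<le> support_fun B \<theta> + e" using y by simp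
  qed
  show ?thesis using *[OF M N 1] *[OF N M 2] by (simp add: abs_le_iff)
qed

section \<open>Fourier coefficients of periodic functions\<close>

lemma periodic_integral_shift:
  fixes F :: "real \<Rightarrow> complex"
  assumes cont: "continuous_on UNIV F" and per: "\<And>t. F (t + p) = F t" and p: "p > 0"
  shows "integral {0..p} (\<lambda>t. F (t + c)) = integral {0..p} F"
proof -
  define B where "B = \<bar>c\<bar> + p + 1"
  obtain P where P: "\<And>x. x \<in> {-B..B} \<Longrightarrow> (P has_vector_derivative F x) (at x within {-B..B})"
    using antiderivative_continuous[of "-B" B F] continuous_on_subset[OF cont] by blast
  have Pi: "(P has_vector_derivative F x) (at x)" if "x \<in> {-B<..<B}" for x
    using P[of x] that at_within_Icc_at[of "-B" x B] by auto
  define S where "S = {-\<bar>c\<bar>..\<bar>c\<bar>}"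
  \<comment> \<open>\<open>P (t + p) - P t\<close> is the integral over the period starting at
    \<open>t\<close>, and periodicity of \<open>F\<close> makes its derivative vanish.\<close>
  have D: "((\<lambda>t. P (t + p) - P t) has_vector_derivative 0) (at t within S)" if t: "t \<in> S" for t
  proof -
    have 1: "t \<in> {-B<..<B}" "t + p \<in> {-B<..<B}" using t p by (auto simp: S_def B_def)
    have "((\<lambda>t. t + p) has_vector_derivative 1) (at t)" by (auto intro!: derivative_eq_intros)
    then have 2: "((\<lambda>t. P (t + p)) has_vector_derivative F (t + p)) (at t)"
      using vector_diff_chain_at[of "\<lambda>t. t + p" 1 t P "F (t + p)"] Pi[OF 1(2)]
      by (simp add: o_def)
    show "((\<lambda>t. P (t + p) - P t) has_vector_derivative 0) (at t within S)"
      using has_vector_derivative_diff[OF 2 Pi[OF 1(1)]] per[of t] has_vector_derivative_at_within by force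
  qed
  have "convex S" by (simp add: S_def)
  then obtain k where k: "\<And>t. t \<in> S \<Longrightarrow> P (t + p) - P t = k"
    using has_vector_derivative_zero_constant[of S "\<lambda>t. P (t + p) - P t"] D by blast
  have int: "integral {0..p} (\<lambda>t. F (t + a)) = k" if a: "a \<in> S" for a
  proof -
    have "((\<lambda>t. F (t + a)) has_integral (P (p + a) - P (0 + a))) {0..p}"
    proof (rule fundamental_theorem_of_calculus)
      fix t assume t: "t \<in> {0..p}"
      have 1: "t + a \<in> {-B<..<B}" using t a by (auto simp: S_def B_def)
      have "((\<lambda>t. t + a) has_vector_derivative 1) (at t)" by (auto intro!: derivative_eq_intros)
      then have "((\<lambda>t. P (t + a)) has_vector_derivative F (t + a)) (at t)"
        using vector_diff_chain_at[of "\<lambda>t. t + a" 1 t P "F (t + a)"] Pi[OF 1]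
        by (simp add: o_def)
      then show "((\<lambda>t. P (t + a)) has_vector_derivative F (t + a)) (at t within {0..p})"
        by (rule has_vector_derivative_at_within)
    qed (use p in simp)
    then show ?thesis using k[OF a] by (simp add: integral_unique add.commute)
  qed
  have "c \<in> S" "0 \<in> S" by (auto simp: S_def)
  then show ?thesis using int[of c] int[of 0] by simp
qed

lemma cis_nat_periodic: "cis (- real k * (t + 2 * pi)) = cis (- real k * t)"
proof -
  have "cis (- real k * (t + 2 * pi)) = cis (- real k * t) * cis (2 * pi * (- real k))"
    by (simp add: cis_mult algebra_simps)
  also have "cis (2 * pi * (- real k)) = 1" by (rule cis_multiple_2pi) auto
  finally show ?thesis by simp
qed

definition fourier_coeff :: "nat \<Rightarrow> (real \<Rightarrow> real) \<Rightarrow> complex" where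
  "fourier_coeff k h = integral {0..2*pi} (\<lambda>t. of_real (h t) * cis (- real k * t))"

context
  fixes h :: "real \<Rightarrow> real"
  assumes cont: "continuous_on UNIV h" and per: "\<And>t. h (t + 2 * pi) = h t"
begin

lemma continuous_h: "continuous_on X (\<lambda>t. h (f t))" if "continuous_on X f"
  by (rule continuous_on_compose2[OF cont that]) auto

lemma fourier_coeff_shift: "fourier_coeff k (\<lambda>t. h (t - a)) = cis (- real k * a) * fourier_coeff k h"
proof -
  let ?F = "\<lambda>t. of_real (h (t - a)) * cis (- real k * t)"
  have "integral {0..2*pi} (\<lambda>t. ?F (t + a)) = integral {0..2*pi} ?F"
  proof (rule periodic_integral_shift)
    show "continuous_on UNIV ?F" by (intro continuous_intros continuous_h)
    show "?F (t + 2 * pi) = ?F t" for t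
    proof -
      have "cis (- real k * (t + 2 * pi)) = cis (- real k * t)"
        by (rule cis_nat_periodic)
      then show ?thesis using per[of "t - a"] by (simp add: algebra_simps)
    qed
  qed simp
  moreover have "(\<lambda>t. ?F (t + a)) = (\<lambda>t. cis (- real k * a) * (of_real (h t) * cis (- real k * t)))"
  proof
    fix t
    have "cis (- real k * (t + a)) = cis (- real k * a) * cis (- real k * t)" by (simp add: cis_mult algebra_simps)
    then show "?F (t + a) = cis (- real k * a) * (of_real (h t) * cis (- real k * t))" by simp
  qed
  ultimately show ?thesis unfolding fourier_coeff_def by (simp only: integral_mult_right)
qed

lemma fourier_coeff_reflect: "fourier_coeff k (\<lambda>t. h (- t)) = cnj (fourier_coeff k h)"
proof -
  let ?F = "\<lambda>t. of_real (h t) * cis (- real k * t)"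
  have "fourier_coeff k (\<lambda>t. h (- t)) = integral {0..2*pi} (\<lambda>t. cnj (?F (- t)))"
    unfolding fourier_coeff_def by (simp add: cis_cnj)
  also have "\<dots> = cnj (integral {0..2*pi} (\<lambda>t. ?F (- t)))"
  proof -
    have "(\<lambda>t. ?F (- t)) integrable_on {0..2*pi}"
      by (intro integrable_continuous_interval continuous_intros continuous_h)
    from integral_linear[OF this bounded_linear_cnj] show ?thesis by (simp add: o_def)
  qed
  also have "integral {0..2*pi} (\<lambda>t. ?F (- t)) = integral {-(2*pi)..-0} ?F"
    using Henstock_Kurzweil_Integration.integral_reflect_real[of 0 "-(2*pi)" ?F] by simp
  also have "\<dots> = integral {0..2*pi} (\<lambda>t. ?F (t + - (2*pi)))"
  proof -
    have "((\<lambda>t. ?F t) has_integral integral {-(2*pi)..0} ?F) (cbox (-(2*pi)) 0)"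
      unfolding box_real by (intro integrable_integral integrable_continuous_interval continuous_intros continuous_h)
    from has_integral_affinity[OF this, of 1 "- (2*pi)"]
    have "((\<lambda>t. ?F (t + - (2*pi))) has_integral integral {-(2*pi)..0} ?F) {0..2*pi}"
      by (simp add: image_affinity_cbox)
    then show ?thesis by (simp add: integral_unique)
  qed
  also have "\<dots> = integral {0..2*pi} ?F"
  proof (rule periodic_integral_shift)
    show "continuous_on UNIV ?F" by (intro continuous_intros continuous_h)
    show "?F (t + 2 * pi) = ?F t" for t
    proof -
      have "cis (- real k * (t + 2 * pi)) = cis (- real k * t)"
        by (rule cis_nat_periodic)
      then show ?thesis using per[of t] by simp
    qed
  qed simp
  finally show ?thesis unfolding fourier_coeff_def .
qed

end

text \<open>The recursion \<open>a (m + 1) = a m * (2 * m + 1) / (2 * m + 2)\<close> shows that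
  \<open>(a m)\<^sup>2 * (4 * m)\<close> is nondecreasing, and it is 1 for m = 1.\<close>

lemma central_binomial_ratio:
  assumes "m \<ge> 1"
  shows "real ((2 * m) choose m) / 4 ^ m \<ge> 1 / (2 * sqrt (real m))"
proof -
  define a where "a = (\<lambda>m. real ((2 * m) choose m) / 4 ^ m)"
  have rec: "a (Suc m) * (2 * real m + 2) = a m * (2 * real m + 1)" for m
  proof -
    have 1: "Suc m * ((2 * Suc m) choose Suc m) = (2 * Suc m) * ((2 * m + 1) choose m)"
      using Suc_times_binomial_eq[of "2 * m + 1" m] by simp
    have 2: "Suc m * ((2 * m + 1) choose Suc m) = (2 * m + 1) * ((2 * m) choose m)"
      using Suc_times_binomial_eq[of "2 * m" m] by simp
    have 3: "(2 * m + 1) choose Suc m = (2 * m + 1) choose m"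
      using binomial_symmetric[of m "2 * m + 1"] by simp
    define X where "X = ((2 * Suc m) choose Suc m)"
    define Y where "Y = ((2 * m + 1) choose m)"
    define Z where "Z = ((2 * m) choose m)"
    have "Suc m * X = 2 * (Suc m * Y)" using 1 unfolding X_def Y_def by (simp only: mult.assoc)
    also have "Suc m * Y = (2 * m + 1) * Z" using 2 3 unfolding Y_def Z_def by (simp only:)
    finally have "real (Suc m * X) = real (2 * ((2 * m + 1) * Z))" by (rule arg_cong)
    then have "(1 + real m) * real X = 2 * ((2 * real m + 1) * real Z)" by (simp add: algebra_simps)
    then have "((1 + real m) * real X) / (2 * 4 ^ m) = (2 * ((2 * real m + 1) * real Z)) / (2 * 4 ^ m)" by (simp only:)
    moreover have "real X / (4 * 4 ^ m) * (2 * real m + 2) = ((1 + real m) * real X) / (2 * 4 ^ m)" by (simp add: field_simps)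
    moreover have "(2 * ((2 * real m + 1) * real Z)) / (2 * 4 ^ m) = real Z / 4 ^ m * (2 * real m + 1)" by simp
    ultimately have "real X / (4 * 4 ^ m) * (2 * real m + 2) = real Z / 4 ^ m * (2 * real m + 1)" by (simp only:)
    then show ?thesis unfolding a_def X_def[symmetric] Z_def[symmetric] by simp
  qed
  have pos: "a m > 0" for m by (simp add: a_def)
  have "(a m)\<^sup>2 * (4 * real m) \<ge> 1" using assms
  proof (induction m rule: dec_induct)
    case base show ?case by (simp add: a_def power2_eq_square)
  next
    case (step m)
    have m: "real m \<ge> 1" using step by simp
    have "(a (Suc m))\<^sup>2 * (2 * real m + 2)\<^sup>2 = (a m)\<^sup>2 * (2 * real m + 1)\<^sup>2"
      using rec[of m] by (metis power_mult_distrib)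
    then have "(a (Suc m))\<^sup>2 * (4 * real (Suc m)) * (real m + 1) = (a m)\<^sup>2 * (2 * real m + 1)\<^sup>2"
      by (simp add: power2_eq_square algebra_simps)
    also have "\<dots> \<ge> (a m)\<^sup>2 * (4 * real m * (real m + 1))"
      by (intro mult_left_mono) (auto simp: power2_eq_square algebra_simps)
    also have "(a m)\<^sup>2 * (4 * real m * (real m + 1)) = (a m)\<^sup>2 * (4 * real m) * (real m + 1)" by simp
    also have "\<dots> \<ge> 1 * (real m + 1)" using step m by (intro mult_right_mono) auto
    finally show ?case using m by simp
  qed
  moreover have "(2 * sqrt (real m) * a m)\<^sup>2 = (a m)\<^sup>2 * (4 * real m)" by (simp add: power_mult_distrib)
  ultimately have "1\<^sup>2 \<le> (2 * sqrt (real m) * a m)\<^sup>2" by simp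
  then have "1 \<le> 2 * sqrt (real m) * a m" by (rule power2_le_imp_le) (use pos[of m] in simp)
  then show ?thesis using assms by (simp add: a_def field_simps)
qed

text \<open>The de la Vallee Poussin kernel \<open>((1 + cos t) / 2) ^ m\<close>, scaled to have
  maximum 1 at 0: a nonnegative trigonometric polynomial.\<close>

definition cos_kernel :: "nat \<Rightarrow> real \<Rightarrow> real" where "cos_kernel m t = cos (t / 2) ^ (2 * m)"

lemma cos_kernel_expansion:
  "complex_of_real (cos_kernel m t) = (1 / 4 ^ m) * (\<Sum>j\<le>2*m. of_nat ((2*m) choose j) * cis ((real j - real m) * t))"
proof -
  have "complex_of_real (2 * cos (t / 2)) = cis (t / 2) + cis (- (t / 2))" by (simp add: complex_eq_iff)
  then have "complex_of_real (2 * cos (t / 2)) ^ (2 * m) = (cis (t / 2) + cis (- (t / 2))) ^ (2 * m)" by simp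
  also have "\<dots> = (\<Sum>j\<le>2*m. of_nat ((2*m) choose j) * cis (t / 2) ^ j * cis (- (t / 2)) ^ (2 * m - j))"
    by (rule binomial_ring)
  also have "\<dots> = (\<Sum>j\<le>2*m. of_nat ((2*m) choose j) * cis ((real j - real m) * t))"
  proof (rule sum.cong[OF refl])
    fix j assume "j \<in> {..2*m}"
    then have r: "real (2 * m - j) = 2 * real m - real j" by (simp add: of_nat_diff)
    have "cis (t / 2) ^ j * cis (- (t / 2)) ^ (2 * m - j) = cis (real j * (t / 2)) * cis (real (2 * m - j) * - (t / 2))"
      unfolding Complex.DeMoivre ..
    also have "\<dots> = cis (real j * (t / 2) + real (2 * m - j) * - (t / 2))" by (rule cis_mult)
    also have "real j * (t / 2) + real (2 * m - j) * - (t / 2) = (real j - real m) * t" unfolding r by (simp add: field_simps)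
    finally have "cis (t / 2) ^ j * cis (- (t / 2)) ^ (2 * m - j) = cis ((real j - real m) * t)" .
    then show "of_nat ((2*m) choose j) * cis (t / 2) ^ j * cis (- (t / 2)) ^ (2 * m - j) = of_nat ((2*m) choose j) * cis ((real j - real m) * t)"
      by (simp add: mult.assoc)
  qed
  finally have "complex_of_real (2 * cos (t / 2)) ^ (2 * m) = (\<Sum>j\<le>2*m. of_nat ((2*m) choose j) * cis ((real j - real m) * t))" .
  moreover have "complex_of_real (2 * cos (t / 2)) ^ (2 * m) = 4 ^ m * complex_of_real (cos_kernel m t)"
    by (simp add: cos_kernel_def power_mult_distrib power_mult)
  ultimately show ?thesis by (simp add: field_simps)
qed

lemma continuous_cos_kernel: "continuous_on X (cos_kernel m)"
  unfolding cos_kernel_def by (intro continuous_intros) auto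

text \<open>In the binomial expansion the index \<open>j = m\<close> is frequency 0 and gives the
  subtracted term. The other weights sum to at most 1, and the negative frequencies of a real
  function are conjugates of positive ones.\<close>

lemma kernel_fourier_bound:
  fixes m :: nat
  assumes cont: "continuous_on UNIV h" and small: "\<And>k. k \<ge> 1 \<Longrightarrow> cmod (fourier_coeff k h) \<le> \<eta>"
  defines "w \<equiv> real ((2*m) choose m) / 4 ^ m"
  shows "\<bar>integral {0..2*pi} (\<lambda>t. h t * cos_kernel m t) - w * integral {0..2*pi} h\<bar> \<le> \<eta>"
proof -
  let ?C = "\<lambda>j. of_nat ((2*m) choose j) :: complex"
  define I where "I = (\<lambda>j. integral {0..2*pi} (\<lambda>t. of_real (h t) * cis ((real j - real m) * t)))"
  have ch: "continuous_on X h" for X using cont continuous_on_subset by blast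
  have Ij: "cmod (I j) \<le> \<eta>" if "j \<noteq> m" for j
  proof (cases "j < m")
    case True
    then have "I j = fourier_coeff (m - j) h" unfolding I_def fourier_coeff_def by (simp add: of_nat_diff)
    then show ?thesis using small[of "m - j"] True by simp
  next
    case False
    then have jm: "j > m" using that by simp
    have "(\<lambda>t. of_real (h t) * cis (- real (j - m) * t)) integrable_on {0..2*pi}"
      by (intro integrable_continuous_interval continuous_intros ch)
    from integral_linear[OF this bounded_linear_cnj]
    have "I j = cnj (fourier_coeff (j - m) h)"
      unfolding I_def fourier_coeff_def using jm by (simp add: o_def cis_cnj of_nat_diff algebra_simps)
    then show ?thesis using small[of "j - m"] jm by simp
  qed
  have eta: "\<eta> \<ge> 0" using small[of 1] norm_ge_zero[of "fourier_coeff 1 h"] by linarith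
  have Im: "I m = of_real (integral {0..2*pi} h)"
    unfolding I_def using integral_linear[OF integrable_continuous_interval[OF ch] bounded_linear_of_real, of 0 "2*pi"] by (simp add: o_def)
  have cI: "(\<lambda>t. h t * cos_kernel m t) integrable_on {0..2*pi}"
    by (intro integrable_continuous_interval continuous_intros ch continuous_cos_kernel)
  have "complex_of_real (integral {0..2*pi} (\<lambda>t. h t * cos_kernel m t)) = integral {0..2*pi} (\<lambda>t. complex_of_real (h t * cos_kernel m t))"
    by (rule integral_linear[OF cI bounded_linear_of_real, unfolded o_def, symmetric])
  also have "\<dots> = integral {0..2*pi} (\<lambda>t. \<Sum>j\<le>2*m. (?C j / 4 ^ m) * (of_real (h t) * cis ((real j - real m) * t)))"
    unfolding of_real_mult cos_kernel_expansion by (simp add: sum_distrib_left algebra_simps)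
  also have "\<dots> = (\<Sum>j\<le>2*m. (?C j / 4 ^ m) * I j)"
    unfolding I_def
    by (subst integral_sum) (auto intro!: integrable_continuous_interval continuous_intros ch simp: integral_mult_right)
  also have "\<dots> = (?C m / 4 ^ m) * I m + (\<Sum>j\<in>{..2*m} - {m}. (?C j / 4 ^ m) * I j)"
    by (rule sum.remove) auto
  finally have e: "complex_of_real (integral {0..2*pi} (\<lambda>t. h t * cos_kernel m t)) = (?C m / 4 ^ m) * I m + (\<Sum>j\<in>{..2*m} - {m}. (?C j / 4 ^ m) * I j)" .
  define S where "S = (\<Sum>j\<in>{..2*m} - {m}. (?C j / 4 ^ m) * I j)"
  have "complex_of_real (integral {0..2*pi} (\<lambda>t. h t * cos_kernel m t) - w * integral {0..2*pi} h) = S"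
    unfolding of_real_diff e S_def[symmetric] Im by (simp add: w_def)
  then have "\<bar>integral {0..2*pi} (\<lambda>t. h t * cos_kernel m t) - w * integral {0..2*pi} h\<bar> = cmod S"
    by (metis norm_of_real)
  also have "cmod S = cmod (\<Sum>j\<in>{..2*m} - {m}. (?C j / 4 ^ m) * I j)" unfolding S_def ..
  also have "\<dots> \<le> (\<Sum>j\<in>{..2*m} - {m}. (real ((2*m) choose j) / 4 ^ m) * \<eta>)"
    by (intro order_trans[OF norm_sum] sum_mono) (auto simp: norm_mult norm_divide norm_power intro!: mult_left_mono divide_right_mono Ij)
  also have "\<dots> \<le> (\<Sum>j\<le>2*m. (real ((2*m) choose j) / 4 ^ m) * \<eta>)"
    using eta by (intro sum_mono2) auto
  also have "\<dots> = (\<Sum>j\<le>2*m. real ((2*m) choose j)) / 4 ^ m * \<eta>"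
    by (simp add: sum_divide_distrib sum_distrib_right)
  also have "(\<Sum>j\<le>2*m. real ((2*m) choose j)) = 4 ^ m"
    using choose_row_sum[of "2*m"] by (simp add: power_mult flip: of_nat_sum)
  finally show ?thesis by simp
qed

text \<open>A translation by half the period of the mode, \<open>pi / k\<close>, fixes a constant
  but changes the sign of the coefficient.\<close>

lemma fourier_coeff_const: "k \<ge> 1 \<Longrightarrow> fourier_coeff k (\<lambda>_. 1) = 0"
proof -
  assume k: "k \<ge> 1"
  have "fourier_coeff k (\<lambda>_. 1) = cis (- real k * (pi / real k)) * fourier_coeff k (\<lambda>_. 1)"
    using fourier_coeff_shift[of "\<lambda>_. 1" k "pi / real k"] by simp
  moreover have "- real k * (pi / real k) = - pi" using k by simp
  ultimately have "fourier_coeff k (\<lambda>_. 1) = cis (- pi) * fourier_coeff k (\<lambda>_. 1)" by (simp only:)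
  then show ?thesis by (simp add: complex_eq_iff)
qed

lemma cos_kernel_integral: "integral {0..2*pi} (cos_kernel m) = 2 * pi * (real ((2*m) choose m) / 4 ^ m)"
  using kernel_fourier_bound[of "\<lambda>_. 1" 0 m] fourier_coeff_const by simp

lemma sin_cos_kernel_integral: "((\<lambda>t. sin (t / 2) * cos_kernel m t) has_integral 4 / (2 * real m + 1)) {0..2*pi}"
proof -
  define n where "n = 2 * m"
  define P where "P = (\<lambda>t. - 2 * cos (t / 2) ^ Suc n / (real n + 1))"
  have "((\<lambda>t. sin (t / 2) * cos (t / 2) ^ n) has_integral (P (2 * pi) - P 0)) {0..2*pi}"
  proof (rule fundamental_theorem_of_calculus)
    fix t
    have "((\<lambda>t. cos (t / 2) ^ Suc n) has_real_derivative (1 + real n) * (cos (t / 2) ^ n * (- sin (t / 2) * (1/2)))) (at t within {0..2*pi})"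
      by (rule DERIV_power_Suc[THEN DERIV_cong]) (auto intro!: derivative_eq_intros)
    from DERIV_cdivide[OF DERIV_cmult[OF this, of "-2"], of "real n + 1"]
    have "(P has_real_derivative (- 2 * ((1 + real n) * (cos (t / 2) ^ n * (- sin (t / 2) * (1/2)))) / (real n + 1))) (at t within {0..2*pi})"
      unfolding P_def .
    moreover have "- 2 * ((1 + real n) * (cos (t / 2) ^ n * (- sin (t / 2) * (1/2)))) / (real n + 1) = sin (t / 2) * cos (t / 2) ^ n"
      by (simp add: field_simps)
    ultimately show "(P has_vector_derivative sin (t / 2) * cos (t / 2) ^ n) (at t within {0..2*pi})"
      by (simp add: has_real_derivative_iff_has_vector_derivative)
  qed simp
  moreover have "P (2 * pi) = 2 / (2 * real m + 1)" "P 0 = - 2 / (2 * real m + 1)" by (simp_all add: P_def n_def)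
  then have "P (2 * pi) - P 0 = 4 / (2 * real m + 1)" by (simp flip: add_divide_distrib)
  ultimately show ?thesis by (simp add: cos_kernel_def n_def)
qed

text \<open>Testing against \<open>cos_kernel m\<close>, which has width of order \<open>1 / sqrt m\<close> and Fourier coefficients of
  total mass \<open>1\<close> after normalization by its maximum.\<close>
lemma near_constant_of_small_fourier_coeffs:
  assumes cont: "continuous_on UNIV h" and per: "\<And>t. h (t + 2 * pi) = h t"
    and lip: "\<And>a b. \<bar>h a - h b\<bar> \<le> 2 * R * \<bar>sin ((a - b) / 2)\<bar>" and R: "R \<ge> 0"
    and small: "\<And>k. k \<ge> 1 \<Longrightarrow> cmod (fourier_coeff k h) \<le> \<eta>" and m: "m \<ge> 1"
  shows "\<bar>h \<theta> - integral {0..2*pi} h / (2 * pi)\<bar> \<le> \<eta> * sqrt (real m) + 4 * R / sqrt (real m)"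
proof -
  \<comment> \<open>Translating \<open>h\<close> centres the kernel at \<open>\<theta>\<close> and
    only changes the phases of the coefficients.\<close>
  define H where "H = (\<lambda>t. h (t - (- \<theta>)))"
  have cH: "continuous_on X H" for X unfolding H_def
    by (intro continuous_on_compose2[OF cont] continuous_intros) auto
  have FH: "fourier_coeff k H = cis (real k * \<theta>) * fourier_coeff k h" for k
    unfolding H_def fourier_coeff_shift[OF cont per] by simp
  have ch: "continuous_on X h" for X using cont continuous_on_subset by blast
  have f0: "fourier_coeff 0 f = of_real (integral {0..2*pi} f)" if "continuous_on {0..2*pi} f" for f
    unfolding fourier_coeff_def using integral_linear[OF integrable_continuous_interval[OF that] bounded_linear_of_real] by (simp add: o_def)
  have IH: "integral {0..2*pi} H = integral {0..2*pi} h"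
    using FH[of 0] f0[OF cH] f0[OF ch] by simp
  define w where "w = real ((2*m) choose m) / 4 ^ m"
  have w: "w \<ge> 1 / (2 * sqrt (real m))" unfolding w_def by (rule central_binomial_ratio[OF m])
  have sm: "sqrt (real m) > 0" using m by simp
  have w0: "w > 0" using w sm by (meson divide_pos_pos less_le_trans mult_pos_pos zero_less_numeral zero_less_one)
  have 1: "\<bar>integral {0..2*pi} (\<lambda>t. H t * cos_kernel m t) - w * integral {0..2*pi} h\<bar> \<le> \<eta>"
    unfolding w_def IH[symmetric] by (rule kernel_fourier_bound[OF cH]) (simp add: FH norm_mult small)
  have 2: "\<bar>integral {0..2*pi} (\<lambda>t. (H t - h \<theta>) * cos_kernel m t)\<bar> \<le> 2 * R * (4 / (2 * real m + 1))"
  proof -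
    have hI: "((\<lambda>t. 2 * R * (sin (t / 2) * cos_kernel m t)) has_integral 2 * R * (4 / (2 * real m + 1))) {0..2*pi}"
      by (intro has_integral_mult_right sin_cos_kernel_integral)
    have "norm ((H t - h \<theta>) * cos_kernel m t) \<le> 2 * R * (sin (t / 2) * cos_kernel m t)" if t: "t \<in> {0..2*pi}" for t
    proof -
      have s: "sin (t / 2) \<ge> 0" using t by (intro sin_ge_zero) auto
      have k: "cos_kernel m t \<ge> 0" by (simp add: cos_kernel_def)
      have "\<bar>H t - h \<theta>\<bar> \<le> 2 * R * sin (t / 2)" using lip[of "t + \<theta>" \<theta>] s by (simp add: H_def)
      then have "\<bar>H t - h \<theta>\<bar> * cos_kernel m t \<le> 2 * R * sin (t / 2) * cos_kernel m t" by (rule mult_right_mono[OF _ k])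
      then show ?thesis using k by (simp add: abs_mult mult.assoc)
    qed
    then have "norm (integral {0..2*pi} (\<lambda>t. (H t - h \<theta>) * cos_kernel m t)) \<le> integral {0..2*pi} (\<lambda>t. 2 * R * (sin (t / 2) * cos_kernel m t))"
      by (intro integral_norm_bound_integral integrable_continuous_interval continuous_intros cH continuous_cos_kernel has_integral_integrable[OF hI])
    then show ?thesis by (simp only: integral_unique[OF hI] real_norm_def)
  qed
  have "integral {0..2*pi} (\<lambda>t. (H t - h \<theta>) * cos_kernel m t)
    = integral {0..2*pi} (\<lambda>t. H t * cos_kernel m t - h \<theta> * cos_kernel m t)" by (simp add: algebra_simps)
  also have "\<dots> = integral {0..2*pi} (\<lambda>t. H t * cos_kernel m t) - integral {0..2*pi} (\<lambda>t. h \<theta> * cos_kernel m t)"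
    by (intro integral_diff integrable_continuous_interval continuous_intros cH continuous_cos_kernel)
  also have "integral {0..2*pi} (\<lambda>t. h \<theta> * cos_kernel m t) = h \<theta> * (2 * pi * w)"
    unfolding integral_mult_right cos_kernel_integral w_def ..
  finally have 3: "\<bar>integral {0..2*pi} (\<lambda>t. H t * cos_kernel m t) - h \<theta> * (2 * pi * w)\<bar> \<le> 8 * R / (2 * real m + 1)"
    using 2 by simp
  have "8 * R / (2 * real m + 1) \<le> 4 * R / real m" using R m by (simp add: field_simps)
  then have "\<bar>h \<theta> * (2 * pi * w) - w * integral {0..2*pi} h\<bar> \<le> \<eta> + 4 * R / real m" using 1 3 by linarith
  also have "h \<theta> * (2 * pi * w) - w * integral {0..2*pi} h = (2 * pi * w) * (h \<theta> - integral {0..2*pi} h / (2 * pi))"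
    by (simp add: field_simps)
  finally have 4: "2 * pi * w * \<bar>h \<theta> - integral {0..2*pi} h / (2 * pi)\<bar> \<le> \<eta> + 4 * R / real m"
    using w0 by (simp add: abs_mult)
  \<comment> \<open>The kernel has mass \<open>2 * pi * w\<close>, at least
    \<open>1 / sqrt m\<close>; dividing by it multiplies both errors by at most
    \<open>sqrt m\<close>.\<close>
  have "1 / sqrt (real m) \<le> 2 * pi * (1 / (2 * sqrt (real m)))" using sm pi_ge_two by (simp add: field_simps)
  also have "\<dots> \<le> 2 * pi * w" using w by (intro mult_left_mono) auto
  finally have "1 / sqrt (real m) * \<bar>h \<theta> - integral {0..2*pi} h / (2 * pi)\<bar> \<le> 2 * pi * w * \<bar>h \<theta> - integral {0..2*pi} h / (2 * pi)\<bar>"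
    by (rule mult_right_mono) simp
  then have "1 / sqrt (real m) * \<bar>h \<theta> - integral {0..2*pi} h / (2 * pi)\<bar> \<le> \<eta> + 4 * R / real m"
    using 4 by (rule order_trans)
  then have "sqrt (real m) * (1 / sqrt (real m) * \<bar>h \<theta> - integral {0..2*pi} h / (2 * pi)\<bar>) \<le> sqrt (real m) * (\<eta> + 4 * R / real m)"
    using sm by (intro mult_left_mono) auto
  then have "\<bar>h \<theta> - integral {0..2*pi} h / (2 * pi)\<bar> \<le> sqrt (real m) * (\<eta> + 4 * R / real m)"
    using sm by simp
  also have "\<dots> = \<eta> * sqrt (real m) + 4 * R / sqrt (real m)"
  proof -
    have s: "sqrt (real m) / real m = 1 / sqrt (real m)" by (subst frac_eq_eq) (use m in auto)
    have "sqrt (real m) * (\<eta> + 4 * R / real m) = \<eta> * sqrt (real m) + 4 * R * (sqrt (real m) / real m)"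
      by (simp add: distrib_left)
    then show ?thesis unfolding s by simp
  qed
  finally show ?thesis .
qed

section \<open>Fourier coefficients of the normal form\<close>

definition Phi :: "nat \<Rightarrow> complex set \<Rightarrow> complex" where
  "Phi k M = fourier_coeff k (support_fun (normal_form M))"

lemma planar_body_compact: "planar_body M \<Longrightarrow> compact M \<and> M \<noteq> {}"
  by (auto simp: planar_body_def)

lemma fourier_coeff_cmult: "fourier_coeff k (\<lambda>t. c * h t) = of_real c * fourier_coeff k h"
  unfolding fourier_coeff_def by (simp add: mult.assoc flip: integral_mult_right)

lemma fourier_coeff_similar:
  assumes M: "compact M" "M \<noteq> {}"
  shows "fourier_coeff k (support_fun ((\<lambda>z. a * z) ` M)) = of_real (cmod a) * cis (- real k * Arg a) * fourier_coeff k (support_fun M)"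
    and "fourier_coeff k (support_fun ((\<lambda>z. a * cnj z) ` M)) = of_real (cmod a) * cis (- real k * Arg a) * cnj (fourier_coeff k (support_fun M))"
proof -
  have main: "fourier_coeff k (support_fun ((\<lambda>z. a * z) ` M)) = of_real (cmod a) * cis (- real k * Arg a) * fourier_coeff k (support_fun M)"
    if M: "compact M" "M \<noteq> {}" for M
  proof -
    have "support_fun ((\<lambda>z. a * z) ` M) = (\<lambda>t. cmod a * support_fun M (t - Arg a))"
      using support_fun_mult[OF M] by auto
    then show ?thesis
      using fourier_coeff_shift[OF continuous_support_fun[OF M] support_fun_periodic, of k "Arg a"]
      by (simp add: fourier_coeff_cmult[of k "cmod a" "\<lambda>t. support_fun M (t - Arg a)"])
  qed
  show "fourier_coeff k (support_fun ((\<lambda>z. a * z) ` M)) = of_real (cmod a) * cis (- real k * Arg a) * fourier_coeff k (support_fun M)"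
    by (rule main[OF M])
  have cM: "compact (cnj ` M)" "cnj ` M \<noteq> {}" using M by (auto intro!: compact_continuous_image continuous_intros)
  have "(\<lambda>z. a * cnj z) ` M = (\<lambda>z. a * z) ` (cnj ` M)" by (simp add: image_image)
  moreover have "support_fun (cnj ` M) = (\<lambda>t. support_fun M (- t))" using support_fun_cnj by auto
  ultimately show "fourier_coeff k (support_fun ((\<lambda>z. a * cnj z) ` M)) = of_real (cmod a) * cis (- real k * Arg a) * cnj (fourier_coeff k (support_fun M))"
    using main[OF cM] fourier_coeff_reflect[OF continuous_support_fun[OF M] support_fun_periodic, of k] by simp
qed

text \<open>The normal forms differ by a similarity, possibly composed with conjugation. Its
  multiplier is not controlled, but the vanishing of a coefficient survives any such map.\<close>

lemma Phi_affine_zero: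
  assumes L: "linear L" "inj L" and M: "planar_body M" and 0: "Phi k M = 0"
  shows "Phi k ((\<lambda>z. L z + d) ` M) = 0"
proof -
  have nf: "compact (normal_form M)" "normal_form M \<noteq> {}"
    using planar_body_compact[OF normal_form_props(1)[OF M]] by auto
  obtain a where "normal_form ((\<lambda>z. L z + d) ` M) = (\<lambda>z. a * z) ` normal_form M \<or>
     normal_form ((\<lambda>z. L z + d) ` M) = (\<lambda>z. a * cnj z) ` normal_form M"
    using normal_form_affine[OF L M] by blast
  then show ?thesis using fourier_coeff_similar[OF nf] 0 unfolding Phi_def by (elim disjE) auto
qed

lemma Phi_mult:
  assumes M: "planar_body M" and a: "a \<noteq> 0"
  shows "Phi k ((\<lambda>z. a * z) ` M) = of_real (cmod a) * cis (- real k * Arg a) * Phi k M"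
  unfolding Phi_def normal_form_mult[OF M a]
  using planar_body_compact[OF normal_form_props(1)[OF M]] by (intro fourier_coeff_similar) auto

lemma fourier_coeff_diff_bound:
  assumes f: "continuous_on UNIV f" and g: "continuous_on UNIV g" and e: "\<And>t. \<bar>f t - g t\<bar> \<le> e"
  shows "cmod (fourier_coeff k f - fourier_coeff k g) \<le> 2 * pi * e"
proof -
  have c: "continuous_on X f" "continuous_on X g" for X using f g continuous_on_subset by blast+
  have "fourier_coeff k f - fourier_coeff k g = integral {0..2*pi} (\<lambda>t. of_real (f t) * cis (- real k * t) - of_real (g t) * cis (- real k * t))"
    unfolding fourier_coeff_def
    by (intro integral_diff[symmetric] integrable_continuous_interval continuous_intros c)
  also have "cmod \<dots> \<le> e * (2 * pi - 0)"
  proof (rule integral_bound)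
    fix t
    have "of_real (f t) * cis (- real k * t) - of_real (g t) * cis (- real k * t) = of_real (f t - g t) * cis (- real k * t)"
      by (simp add: algebra_simps)
    then show "cmod (of_real (f t) * cis (- real k * t) - of_real (g t) * cis (- real k * t)) \<le> e"
      using e[of t] by (simp only: norm_mult norm_of_real norm_cis mult_1_right)
  qed (simp, intro continuous_intros c)
  finally show ?thesis by (simp add: mult_ac)
qed

section \<open>Stability of the normal form\<close>

lemma pseudovariance_eq:
  assumes M: "planar_body M"
  shows "pseudovariance M = mean M (\<lambda>z. z\<^sup>2) - (centroid M)\<^sup>2"
proof -
  let ?g = "centroid M"
  have "(z - ?g)\<^sup>2 = z\<^sup>2 + ((- 2 * ?g) * z + ?g\<^sup>2)" for z by (simp add: power2_eq_square algebra_simps)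
  then have "pseudovariance M = mean M (\<lambda>z. z\<^sup>2 + ((- 2 * ?g) * z + ?g\<^sup>2))" unfolding pseudovariance_def by presburger
  also have "\<dots> = mean M (\<lambda>z. z\<^sup>2) + mean M (\<lambda>z. (- 2 * ?g) * z + ?g\<^sup>2)"
    by (intro mean_add M continuous_intros)
  also have "mean M (\<lambda>z. (- 2 * ?g) * z + ?g\<^sup>2) = mean M (\<lambda>z. (- 2 * ?g) * z) + mean M (\<lambda>z. ?g\<^sup>2)"
    by (intro mean_add M continuous_intros)
  also have "mean M (\<lambda>z. (- 2 * ?g) * z) = (- 2 * ?g) * mean M (\<lambda>z. z)"
    by (intro mean_mult M continuous_intros)
  also have "mean M (\<lambda>z. z) = ?g" by (simp add: centroid_def)
  finally show ?thesis by (simp add: mean_const[OF M] power2_eq_square)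
qed

text \<open>Consider the point of \<open>M\<close> with the smallest inner product with
  \<open>z\<close>. Its preimage has no smaller one, so a large shift along \<open>z\<close> could
  only be compensated by the dilation, which contributes at most
  \<open>(l - 1) * R * cmod z\<close>.\<close>

lemma homothety_shift_bound:
  assumes M: "compact M" "M \<noteq> {}" "M \<subseteq> cball 0 R" and sub: "M \<subseteq> (\<lambda>x. l *\<^sub>R x + z) ` M" and l: "l \<ge> 1"
  shows "cmod z \<le> (l - 1) * R"
proof (cases "z = 0")
  case True
  obtain x where "x \<in> M" using M by blast
  then have "R \<ge> 0" using M(3) norm_ge_zero[of x] by (meson mem_cball_0 order_trans subsetD)
  then show ?thesis using True l by simp
next
  case False
  have "continuous_on M (\<lambda>x. x \<bullet> z)" by (intro continuous_intros)
  then obtain x where x: "x \<in> M" "\<And>y. y \<in> M \<Longrightarrow> x \<bullet> z \<le> y \<bullet> z" using continuous_attains_inf[OF M(1,2)] by blast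
  obtain y where y: "y \<in> M" "x = l *\<^sub>R y + z" using sub x(1) by blast
  have "x \<bullet> z = l * (y \<bullet> z) + z \<bullet> z" by (simp add: y(2) inner_add_left)
  moreover have "l * (x \<bullet> z) \<le> l * (y \<bullet> z)" using x(2)[OF y(1)] l by (intro mult_left_mono) auto
  ultimately have "z \<bullet> z \<le> (l - 1) * (- (x \<bullet> z))" by (simp add: algebra_simps)
  also have "\<dots> \<le> (l - 1) * (R * cmod z)"
  proof (intro mult_left_mono)
    have "- (x \<bullet> z) \<le> cmod x * cmod z" using norm_cauchy_schwarz[of "- x" z] by simp
    also have "\<dots> \<le> R * cmod z" using x(1) M(3) by (intro mult_right_mono) auto
    finally show "- (x \<bullet> z) \<le> R * cmod z" .
  qed (use l in simp)
  finally have "cmod z * cmod z \<le> (l - 1) * R * cmod z" by (simp add: dot_square_norm power2_eq_square mult.assoc)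
  then show ?thesis using False by simp
qed

text \<open>The centroid and pseudovariance of \<open>M\<close> vanish, so those of \<open>N\<close>
  are of order \<open>l - 1\<close>. With the lower bound on the variance, the shear is of that
  order too, and normalization moves points of \<open>N\<close> by as little. Constants:
  \<open>N\<close> lies in the disc of radius \<open>3 * R\<close>, so 128 becomes 1152; 378 is 54
  plus the square of 18; 435456 is 378 times 1152; 21 is 3 plus 18.\<close>

lemma support_fun_normal_form_stable:
  assumes M: "planar_body M" "centroid M = 0" "pseudovariance M = 0" and r: "r > 0" "cball w r \<subseteq> M" and R: "M \<subseteq> cball 0 R" "R > 0"
    and N: "planar_body N" "M \<subseteq> N" "N \<subseteq> (\<lambda>x. l *\<^sub>R x + z) ` M" and l: "1 \<le> l" "l \<le> 2"
  shows "\<bar>support_fun (normal_form N) t - support_fun M t\<bar> \<le> (20 * R + 21 * R * (435456 * R^4 / r^4)) * (l - 1)"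
proof -
  have Mc: "compact M" "M \<noteq> {}" using planar_body_compact M by auto
  have "M \<subseteq> (\<lambda>x. l *\<^sub>R x + z) ` M" using N by blast
  then have zb: "cmod z \<le> (l - 1) * R" by (rule homothety_shift_bound[OF Mc R(1) _ l(1)])
  have lR: "(l - 1) * R \<le> 1 * R" using l R by (intro mult_right_mono) auto
  have near: "\<exists>y\<in>M. cmod (x - y) \<le> 2 * R * (l - 1)" and N3: "cmod x \<le> 3 * R" if x: "x \<in> N" for x
  proof -
    obtain y where y: "y \<in> M" "x = l *\<^sub>R y + z" using x N by blast
    have yR: "cmod y \<le> R" using y R by auto
    have "x - y = (l - 1) *\<^sub>R y + z" by (simp add: y(2) algebra_simps)
    then have "cmod (x - y) \<le> cmod ((l - 1) *\<^sub>R y) + cmod z" by (simp only: norm_triangle_ineq)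
    also have "cmod ((l - 1) *\<^sub>R y) \<le> (l - 1) * R" using l yR by (simp add: mult_left_mono)
    finally show "\<exists>y\<in>M. cmod (x - y) \<le> 2 * R * (l - 1)" using zb y(1) by (intro bexI[of _ y]) (auto simp: algebra_simps)
    have "cmod x \<le> cmod (l *\<^sub>R y) + cmod z" unfolding y(2) by (rule norm_triangle_ineq)
    also have "cmod (l *\<^sub>R y) \<le> 2 * R" unfolding norm_scaleR using l yR by (intro mult_mono) auto
    finally show "cmod x \<le> 3 * R" using zb lR by linarith
  qed
  define g where "g = centroid N"
  have "cmod (mean N (\<lambda>z. z) - mean M (\<lambda>z. z)) \<le> 6 * (3 * R) * (l - 1)"
    by (rule mean_diff_bound[OF M(1) N l]) (auto intro: continuous_intros N3)
  then have g: "cmod g \<le> 18 * R * (l - 1)" using M(2) by (simp add: g_def centroid_def)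
  then have g18: "cmod g \<le> 18 * R" using lR by (simp add: algebra_simps)
  have "cmod (mean N (\<lambda>z. z\<^sup>2) - mean M (\<lambda>z. z\<^sup>2)) \<le> 6 * (9 * R\<^sup>2) * (l - 1)"
  proof (rule mean_diff_bound[OF M(1) N l])
    show "cmod (x\<^sup>2) \<le> 9 * R\<^sup>2" if "x \<in> N" for x
      using power_mono[OF N3[OF that], of 2] by (simp add: norm_power power_mult_distrib)
  qed (intro continuous_intros)
  moreover have "mean M (\<lambda>z. z\<^sup>2) = 0" using pseudovariance_eq[OF M(1)] M by simp
  ultimately have m2: "cmod (mean N (\<lambda>z. z\<^sup>2)) \<le> 54 * R\<^sup>2 * (l - 1)" by simp
  have "cmod (pseudovariance N) \<le> cmod (mean N (\<lambda>z. z\<^sup>2)) + cmod (g\<^sup>2)"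
    unfolding pseudovariance_eq[OF N(1)] g_def by (rule norm_triangle_ineq4)
  also have "cmod (g\<^sup>2) \<le> (18 * R) * (18 * R * (l - 1))"
    unfolding power2_eq_square norm_mult using g g18 R by (intro mult_mono) auto
  finally have pv: "cmod (pseudovariance N) \<le> 378 * R\<^sup>2 * (l - 1)" using m2 by (simp add: power2_eq_square algebra_simps)
  have "N \<subseteq> cball 0 (3 * R)" using N3 by auto
  from variance_gap[OF N(1) r(1) order_trans[OF r(2) N(2)] this]
  have "r^4 / (1152 * R\<^sup>2) \<le> variance N - cmod (pseudovariance N)" by (simp add: power_mult_distrib)
  then have var: "variance N \<ge> r^4 / (1152 * R\<^sup>2)" using norm_ge_zero[of "pseudovariance N"] by linarith
  define b where "b = shear N"
  have b: "cmod b \<le> 435456 * R^4 / r^4 * (l - 1)"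
  proof -
    define s where "s = sqrt ((variance N)\<^sup>2 - (cmod (pseudovariance N))\<^sup>2)"
    have s: "s \<ge> 0" unfolding s_def using pseudovariance_less_variance[OF N(1)] by (simp add: power_mono)
    have v0: "r^4 / (1152 * R\<^sup>2) > 0" using r R by simp
    have "cmod b = cmod (pseudovariance N) / (variance N + s)"
      unfolding b_def shear_def s_def[symmetric] norm_divide norm_of_real using var v0 s by simp
    also have "\<dots> \<le> (378 * R\<^sup>2 * (l - 1)) / (r^4 / (1152 * R\<^sup>2))"
      using pv var v0 s l by (intro frac_le) auto
    also have "\<dots> = 435456 * R^4 / r^4 * (l - 1)" using r R by (simp add: field_simps power2_eq_square eval_nat_numeral)
    finally show ?thesis .
  qed
  define B where "B = 435456 * R^4 / r^4"
  have B0: "B \<ge> 0" using r by (simp add: B_def)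
  have disp: "cmod (normalize_pt N x - x) \<le> (18 * R + 21 * R * B) * (l - 1)" if x: "x \<in> N" for x
  proof -
    have "normalize_pt N x - x = - (g + b * cnj (x - g))" by (simp add: normalize_pt_def g_def b_def)
    then have "cmod (normalize_pt N x - x) = cmod (g + b * cnj (x - g))" by (simp only: norm_minus_cancel)
    also have "\<dots> \<le> cmod g + cmod b * cmod (x - g)"
      using norm_triangle_ineq[of g "b * cnj (x - g)"] by (simp only: norm_mult complex_mod_cnj)
    also have "\<dots> \<le> 18 * R * (l - 1) + (B * (l - 1)) * (21 * R)"
    proof (intro add_mono mult_mono g)
      show "cmod b \<le> B * (l - 1)" using b by (simp add: B_def)
      show "cmod (x - g) \<le> 21 * R" using norm_triangle_ineq4[of x g] N3[OF x] g18 by linarith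
    qed (use B0 l in auto)
    finally show ?thesis by (simp add: algebra_simps)
  qed
  have nf: "compact (normal_form N)" "normal_form N \<noteq> {}"
    using planar_body_compact[OF normal_form_props(1)[OF N(1)]] by auto
  show ?thesis unfolding B_def[symmetric]
  proof (rule support_fun_hausdorff[OF nf Mc])
    fix x assume "x \<in> normal_form N"
    then obtain u where u: "u \<in> N" "x = normalize_pt N u" by (auto simp: normal_form_def)
    obtain y where y: "y \<in> M" "cmod (u - y) \<le> 2 * R * (l - 1)" using near[OF u(1)] by blast
    have "cmod (x - y) \<le> cmod (x - u) + cmod (u - y)" using norm_triangle_ineq[of "x - u" "u - y"] by simp
    also have "\<dots> \<le> (18 * R + 21 * R * B) * (l - 1) + 2 * R * (l - 1)" using disp[OF u(1)] y u by simp
    finally show "\<exists>y\<in>M. cmod (x - y) \<le> (20 * R + 21 * R * B) * (l - 1)" using y by (intro bexI[of _ y]) (auto simp: algebra_simps)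
  next
    fix x assume x: "x \<in> M"
    then have xN: "x \<in> N" using N by blast
    have "cmod (x - normalize_pt N x) \<le> (18 * R + 21 * R * B) * (l - 1)" using disp[OF xN] by (simp add: norm_minus_commute)
    also have "\<dots> \<le> (20 * R + 21 * R * B) * (l - 1)" using R l by (intro mult_right_mono) auto
    finally show "\<exists>y\<in>normal_form N. cmod (x - y) \<le> (20 * R + 21 * R * B) * (l - 1)"
      using xN by (intro bexI[of _ "normalize_pt N x"]) (auto simp: normal_form_def)
  qed
qed

lemma subset_of_support_fun_le:
  assumes M: "compact M" "M \<noteq> {}" and le: "\<And>t. support_fun M t \<le> c"
  shows "M \<subseteq> cball 0 c"
proof
  fix z assume z: "z \<in> M"
  have "cis (Arg z) \<bullet> z = cmod z"
  proof -
    have R: "Re z = cmod z * cos (Arg z)" and I: "Im z = cmod z * sin (Arg z)"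
      using rcis_cmod_Arg[of z] by (metis Re_rcis, metis Im_rcis)
    have "cis (Arg z) \<bullet> z = cos (Arg z) * Re z + sin (Arg z) * Im z" by (simp add: inner_complex_def)
    also have "\<dots> = cmod z * ((cos (Arg z))\<^sup>2 + (sin (Arg z))\<^sup>2)" unfolding R I by algebra
    finally have "cis (Arg z) \<bullet> z = cmod z * ((cos (Arg z))\<^sup>2 + (sin (Arg z))\<^sup>2)" .
    then show ?thesis by simp
  qed
  then show "z \<in> cball 0 c" using support_fun_ge[OF M z, of "Arg z"] le[of "Arg z"] by simp
qed

lemma superset_of_support_fun_ge:
  assumes M: "compact M" "convex M" "M \<noteq> {}" and ge: "\<And>t. support_fun M t \<ge> c"
  shows "cball 0 c \<subseteq> M"
proof (rule ccontr)
  assume "\<not> cball 0 c \<subseteq> M"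
  then obtain z where "z \<in> cball 0 c" and zM: "z \<notin> M" by blast
  then have z: "cmod z \<le> c" "z \<notin> M" by simp_all
  obtain a b where ab: "a \<bullet> z < b" "\<And>x. x \<in> M \<Longrightarrow> b < a \<bullet> x"
    using separating_hyperplane_closed_point[OF M(2) compact_imp_closed[OF M(1)] z(2)] by blast
  have a0: "a \<noteq> 0" using ab M(3) by force
  define t where "t = Arg (- a)"
  have ta: "cmod a *\<^sub>R cis t = - a" using rcis_cmod_Arg[of "- a"] by (simp add: t_def rcis_def scaleR_conv_of_real)
  obtain x where x: "x \<in> M" "support_fun M t = cis t \<bullet> x" using support_fun_attained[OF M(1,3)] by blast
  have "cmod a * (cis t \<bullet> x) = - (a \<bullet> x)" using ta by (metis inner_minus_left inner_scaleR_left)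
  also have "\<dots> < - (a \<bullet> z)" using ab(1) ab(2)[OF x(1)] by linarith
  also have "\<dots> = cmod a * (cis t \<bullet> z)" using ta by (metis inner_minus_left inner_scaleR_left)
  finally have "cis t \<bullet> x < cis t \<bullet> z" using a0 by simp
  also have "\<dots> \<le> cmod z" using norm_cauchy_schwarz[of "cis t" z] by simp
  finally show False using z(1) ge[of t] x(2) by linarith
qed

text \<open>The width of \<open>M\<close> in every direction is at least \<open>2 r\<close>, which bounds the mean support from below.\<close>
lemma nearly_disc_of_nearly_constant_support:
  assumes M: "compact M" "convex M" and r: "r > 0" "cball w r \<subseteq> M"
    and near: "\<And>t. \<bar>support_fun M t - m\<bar> \<le> \<tau>" and tau: "4 * \<tau> \<le> r"
  shows "\<exists>\<rho>>0. cball 0 \<rho> \<subseteq> M \<and> M \<subseteq> cball 0 (\<rho> * (1 + 4 * \<tau> / r))"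
proof -
  have wM: "w \<in> M" using r by auto
  then have ne: "M \<noteq> {}" by blast
  have "w + of_real r \<in> M" "w - of_real r \<in> M" using r by (auto intro!: subsetD[OF r(2)] simp: dist_norm)
  note support_fun_ge[OF M(1) ne this(1), of 0] support_fun_ge[OF M(1) ne this(2), of pi]
  then have "2 * r \<le> support_fun M 0 + support_fun M pi" by (simp add: inner_complex_def)
  then have m: "m \<ge> r - \<tau>" using near[of 0] near[of pi] by linarith
  define \<rho> where "\<rho> = m - \<tau>"
  have rho: "\<rho> \<ge> r / 2" using m tau by (simp add: \<rho>_def)
  have t0: "\<tau> \<ge> 0" using near[of 0] by linarith
  show ?thesis
  proof (intro exI[of _ \<rho>] conjI)
    show "\<rho> > 0" using rho r by linarith
    have "\<rho> \<le> support_fun M t" "support_fun M t \<le> m + \<tau>" for t using near[of t] by (auto simp: \<rho>_def abs_le_iff)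
    then show "cball 0 \<rho> \<subseteq> M" by (intro superset_of_support_fun_ge[OF M ne])
    have "M \<subseteq> cball 0 (m + \<tau>)" by (rule subset_of_support_fun_le[OF M(1) ne]) fact
    moreover have "m + \<tau> \<le> \<rho> * (1 + 4 * \<tau> / r)"
    proof -
      have "r / 2 * (4 * \<tau> / r) \<le> \<rho> * (4 * \<tau> / r)" using rho t0 r by (intro mult_right_mono) auto
      then show ?thesis using r by (simp add: \<rho>_def algebra_simps)
    qed
    ultimately show "M \<subseteq> cball 0 (\<rho> * (1 + 4 * \<tau> / r))" by (meson order_trans subset_cball)
  qed
qed

lemma homothety_ge_1:
  assumes M: "planar_body M" and sub: "M \<subseteq> (\<lambda>x. l *\<^sub>R x + z) ` M" and l: "l > 0"
  shows "l \<ge> 1"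
proof (rule ccontr)
  assume "\<not> l \<ge> 1"
  then have l2: "l\<^sup>2 < 1" using l by (simp add: abs_square_less_1)
  have Mc: "compact M" using M by (simp add: planar_body_def)
  have "area M \<le> area ((\<lambda>x. l *\<^sub>R x + z) ` M)"
    by (intro area_mono Mc sub compact_continuous_image continuous_intros)
  also have "\<dots> = l\<^sup>2 * area M" using l by (intro area_scale Mc) auto
  finally have "area M \<le> l\<^sup>2 * area M" .
  then show False using mult_strict_right_mono[OF l2 planar_body_area[OF M]] by simp
qed

lemma mean_bound:
  fixes \<phi> :: "complex \<Rightarrow> 'b::euclidean_space"
  assumes M: "planar_body M" and \<phi>: "continuous_on UNIV \<phi>" and B: "\<And>z. z \<in> M \<Longrightarrow> norm (\<phi> z) \<le> B"
  shows "norm (mean M \<phi>) \<le> B"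
proof -
  have Mc: "compact M" using M by (simp add: planar_body_def)
  have "norm (planar_integral M \<phi> - planar_integral {} \<phi>) \<le> B * (area M - area {})"
    by (rule planar_integral_diff_bound[OF _ Mc _ \<phi> B]) auto
  then have "norm (planar_integral M \<phi>) \<le> B * area M" by (simp add: area_def planar_integral_def)
  then show ?thesis using planar_body_area[OF M] by (simp add: mean_def field_simps)
qed

text \<open>In this position \<open>variance_gap\<close> gives 2^-25 and the variance is at most
  2^8, so \<open>1 - cmod (shear M)\<close> is at least 2^-33. Undoing the shear expands lengths by
  at most the inverse of that, hence the disc of radius 1/8 leaves one of radius 2^-36. The bounds
  are the same for all bodies.\<close>

lemma normal_form_round:
  assumes M: "planar_body M" and inner: "cball 0 (1/8) \<subseteq> M" and outer: "M \<subseteq> cball 0 8"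
  shows "\<exists>w. cball w (1 / 2^36) \<subseteq> normal_form M" and "normal_form M \<subseteq> cball 0 32"
proof -
  let ?g = "centroid M"
  define b where "b = shear M"
  have z8: "cmod z \<le> 8" if "z \<in> M" for z using that outer by auto
  have g8: "cmod ?g \<le> 8" unfolding centroid_def by (rule mean_bound[OF M]) (auto intro: continuous_intros z8)
  have zg: "cmod (z - ?g) \<le> 16" if "z \<in> M" for z using norm_triangle_ineq4[of z ?g] z8[OF that] g8 by linarith
  have "norm (variance M) \<le> 256" unfolding variance_def
  proof (rule mean_bound[OF M])
    show "norm ((cmod (z - ?g))\<^sup>2) \<le> 256" if "z \<in> M" for z
      using power_mono[OF zg[OF that], of 2] by simp
  qed (intro continuous_intros)
  then have var: "variance M \<le> 256" by simp
  have gap: "variance M - cmod (pseudovariance M) \<ge> 1 / 2^25"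
    using variance_gap[OF M _ inner outer] by (simp add: power_divide)
  have v25: "variance M \<ge> 1 / 2^25" using gap norm_ge_zero[of "pseudovariance M"] by linarith
  have "(0::real) < 1 / 2^25" by simp
  then have v0: "variance M > 0" using v25 by linarith
  have b1: "cmod b \<le> 1 - 1 / 2^33"
  proof -
    define s where "s = sqrt ((variance M)\<^sup>2 - (cmod (pseudovariance M))\<^sup>2)"
    have s: "s \<ge> 0" unfolding s_def using pseudovariance_less_variance[OF M] by (simp add: power_mono)
    have "cmod b = cmod (pseudovariance M) / (variance M + s)"
      unfolding b_def shear_def s_def[symmetric] norm_divide norm_of_real using v0 s by simp
    also have "\<dots> \<le> (variance M - 1 / 2^25) / variance M"
      using gap v0 v25 s by (intro frac_le) auto
    also have "\<dots> = 1 - (1 / 2^25) / variance M" using v0 by (simp add: diff_divide_distrib)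
    finally have "cmod b \<le> 1 - (1 / 2^25) / variance M" .
    moreover have "(1 / 2^25) / variance M \<ge> (1 / 2^25) / 256" using v0 var by (intro divide_left_mono) auto
    ultimately have "cmod b \<le> 1 - (1 / 2^25) / 256" by linarith
    then show ?thesis by simp
  qed
  define \<kappa> where "\<kappa> = 1 - cmod b"
  have kappa: "\<kappa> \<ge> 1 / 2^33" using b1 by (simp add: \<kappa>_def)
  moreover have "(0::real) < 1 / 2^33" by simp
  ultimately have k0: "\<kappa> > 0" by linarith
  define c where "c = 1 - (cmod b)\<^sup>2"
  have c: "c = \<kappa> * (1 + cmod b)" by (simp add: c_def \<kappa>_def power2_eq_square algebra_simps)
  have p: "1 + cmod b \<noteq> 0" using norm_ge_zero[of b] by linarith
  have c0: "c > 0" unfolding c using k0 by (simp add: add_pos_nonneg)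
  show "\<exists>w. cball w (1 / 2^36) \<subseteq> normal_form M"
  proof (intro exI subsetI)
    fix y assume y: "y \<in> cball (normalize_pt M 0) (1 / 2^36)"
    define v where "v = y - normalize_pt M 0"
    have v: "cmod v \<le> 1 / 2^36" using y by (simp add: v_def dist_norm norm_minus_commute)
    define u where "u = (v + b * cnj v) / of_real c"
    have "cmod u \<le> (cmod v + cmod b * cmod v) / c"
      unfolding u_def norm_divide using c0 norm_triangle_ineq[of v "b * cnj v"] by (simp add: norm_mult divide_right_mono)
    also have "\<dots> = ((1 + cmod b) * cmod v) / ((1 + cmod b) * \<kappa>)" unfolding c by (simp add: algebra_simps)
    also have "\<dots> = cmod v / \<kappa>" using p by (rule mult_divide_mult_cancel_left)
    also have "\<dots> \<le> (1 / 2^36) / (1 / 2^33)" using v kappa by (intro frac_le) auto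
    finally have "cmod u \<le> 1/8" by simp
    then have uM: "u \<in> M" using inner by auto
    have "b * cnj b = of_real ((cmod b)\<^sup>2)" by (rule complex_norm_square[symmetric])
    then have "1 - b * cnj b = of_real c" by (simp add: c_def)
    moreover have "u - b * cnj u = (1 - b * cnj b) * v / of_real c"
      by (simp add: u_def algebra_simps add_divide_distrib diff_divide_distrib)
    ultimately have "u - b * cnj u = v" using c0 by simp
    moreover have "normalize_pt M u = normalize_pt M 0 + (u - b * cnj u)" by (simp add: normalize_pt_def b_def algebra_simps)
    ultimately have "y = normalize_pt M u" by (simp add: v_def)
    then show "y \<in> normal_form M" using uM by (simp add: normal_form_def)
  qed
  show "normal_form M \<subseteq> cball 0 32"
  proof
    fix y assume "y \<in> normal_form M"
    then obtain z where z: "z \<in> M" "y = normalize_pt M z" by (auto simp: normal_form_def)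
    have "cmod y \<le> cmod (z - ?g) + cmod b * cmod (z - ?g)"
      unfolding z(2) normalize_pt_def b_def using norm_triangle_ineq4[of "z - ?g" "shear M * cnj (z - ?g)"] by (simp only: norm_mult complex_mod_cnj)
    also have "\<dots> \<le> 16 + 1 * 16" using zg[OF z(1)] k0 by (intro add_mono mult_mono) (auto simp: \<kappa>_def)
    finally show "y \<in> cball 0 32" by simp
  qed
qed

lemma round_position:
  assumes M: "planar_body M"
  shows "\<exists>(L :: complex \<Rightarrow> complex) d. linear L \<and> inj L \<and> cball 0 (1/8) \<subseteq> (\<lambda>z. L z + d) ` M \<and> (\<lambda>z. L z + d) ` M \<subseteq> cball 0 8"
proof -
  have Mc: "compact M" "convex M" using M by (auto simp: planar_body_def)
  define J where "J = (\<lambda>z. Re z *\<^sub>R unit_pm 0 + Im z *\<^sub>R unit_pm 1)"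
  have J: "linear J" unfolding J_def by (intro linearI) (simp_all add: algebra_simps)
  have lkJ: "Poly_Mapping.lookup (J z) 0 = Re z" "Poly_Mapping.lookup (J z) 1 = Im z" for z
    by (simp_all add: J_def lookup_add lookup_scaleR_pm lookup_single lookup_one)
  have Jinj: "z = z'" if "J z = J z'" for z z' using that lkJ[of z] lkJ[of z'] by (simp add: complex_eq_iff)
  have JR: "J z \<in> Rn 2" for z unfolding J_def
    by (intro subspace_add subspace_scale subspace_Rn unit_pm_Rn) auto
  define D where "D = {x - y |x y. x \<in> M \<and> y \<in> M}"
  have DI: "x - y \<in> D" if "x \<in> M" "y \<in> M" for x y using that by (auto simp: D_def)
  have "\<exists>d c. (\<forall>i<2::nat. d i \<in> J ` D \<and> linear (c i)) \<and> (\<forall>i<2::nat. \<forall>j<2::nat. c i (d j) = (if i = j then 1 else 0 :: real)) \<and>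
     (\<forall>x\<in>Rn 2. (\<Sum>i<2. c i x *\<^sub>R d i) = x) \<and> (\<forall>x\<in>J ` D. \<forall>i<2::nat. \<bar>c i x\<bar> \<le> 2 ^ 2)"
  proof (rule symmetric_body_basis)
    show "J ` D \<subseteq> Rn 2" using JR by auto
    have "compact D" unfolding D_def by (rule compact_differences[OF Mc(1,1)])
    then show "compact (J ` D)" using J by (intro compact_continuous_image linear_continuous_on) (simp_all add: linear_linear)
    have Deq: "D = (\<Union>x\<in>M. \<Union>y\<in>M. {x - y})" by (auto simp: D_def)
    have "convex D" unfolding Deq by (rule convex_differences[OF Mc(2,2)])
    then show "convex (J ` D)" by (rule convex_linear_image[OF J])
    show "- x \<in> J ` D" if "x \<in> J ` D" for x
    proof -
      obtain u v where uv: "u \<in> M" "v \<in> M" "x = J (u - v)" using \<open>x \<in> J ` D\<close> by (auto simp: D_def)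
      have "- x = J (v - u)" unfolding uv(3) linear_neg[OF J, symmetric] by simp
      then show ?thesis using DI[OF uv(2,1)] by blast
    qed
    show "\<exists>t>0. t *\<^sub>R unit_pm i \<in> J ` D" if "i < 2" for i
    proof -
      obtain w r R where r: "r > 0" "cball w r \<subseteq> M" "M \<subseteq> cball 0 R" using planar_body_balls[OF M] .
      define e where "e = (if i = 0 then 1 else \<i>)"
      have "w + of_real r * e \<in> M" "w \<in> M" using r by (auto intro!: subsetD[OF r(2)] simp: dist_norm norm_mult e_def)
      then have "of_real r * e \<in> D" using DI[of "w + of_real r * e" w] by simp
      moreover have "J (of_real r * e) = r *\<^sub>R unit_pm i"
        using that by (cases "i = 0") (auto simp: J_def e_def less_2_cases_iff)
      ultimately show ?thesis using r(1) by (metis imageI)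
    qed
  qed
  then obtain dd c where dc: "\<forall>i<2::nat. dd i \<in> J ` D \<and> linear (c i)"
    and cd: "\<forall>i<2::nat. \<forall>j<2::nat. c i (dd j) = (if i = j then 1 else 0 :: real)"
    and ex: "\<forall>x\<in>Rn 2. (\<Sum>i<2. c i x *\<^sub>R dd i) = x" and bd: "\<forall>x\<in>J ` D. \<forall>i<2::nat. \<bar>c i x\<bar> \<le> 2 ^ 2"
    by (elim exE conjE) (rule that)
  have "\<exists>a b. a \<in> M \<and> b \<in> M \<and> dd i = J (a - b)" if i: "i < 2" for i
  proof -
    have "dd i \<in> J ` D" using dc i by blast
    then show ?thesis unfolding D_def by blast
  qed
  from this[of 0] this[of 1] obtain a0 b0 a1 b1 where ab: "a0 \<in> M" "b0 \<in> M" "dd 0 = J (a0 - b0)" "a1 \<in> M" "b1 \<in> M" "dd 1 = J (a1 - b1)"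
    by auto
  have cl: "linear (c 0)" "linear (c 1)" using dc by auto
  define A where "A = (\<lambda>z. Complex (c 0 (J z)) (c 1 (J z)))"
  have A: "linear A"
  proof (rule linearI)
    show "A (x + y) = A x + A y" for x y
      unfolding A_def linear_add[OF J] linear_add[OF cl(1)] linear_add[OF cl(2)] by (simp add: complex_eq_iff)
    show "A (t *\<^sub>R x) = t *\<^sub>R A x" for t x
      unfolding A_def linear_scale[OF J] linear_scale[OF cl(1)] linear_scale[OF cl(2)] by (simp add: complex_eq_iff)
  qed
  have "z = 0" if "A z = 0" for z
  proof -
    have "c 0 (J z) = 0" "c 1 (J z) = 0" using that by (auto simp: A_def complex_eq_iff)
    then have "(\<Sum>i<2. c i (J z) *\<^sub>R dd i) = 0" by (simp add: numeral_2_eq_2)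
    then have "J z = 0" using bspec[OF ex JR[of z]] by (simp only:)
    then show ?thesis using Jinj[of z 0] linear_0[OF J] by simp
  qed
  then have Ainj: "inj A" using linear_injective_0[OF A] by blast
  have A1: "A (a0 - b0) = 1" "A (a1 - b1) = \<i>"
    using cd ab(3,6) by (simp_all add: A_def complex_eq_iff flip: ab(3,6))
  define z0 where "z0 = (1/4) *\<^sub>R (a0 + b0 + a1 + b1)"
  have comb: "s1 *\<^sub>R a0 + s2 *\<^sub>R b0 + s3 *\<^sub>R a1 + s4 *\<^sub>R b1 \<in> M"
    if "s1 \<ge> 0" "s2 \<ge> 0" "s3 \<ge> 0" "s4 \<ge> 0" "s1 + s2 = 1/2" "s3 + s4 = 1/2" for s1 s2 s3 s4
  proof -
    have "(2 * s1) *\<^sub>R a0 + (2 * s2) *\<^sub>R b0 \<in> M" "(2 * s3) *\<^sub>R a1 + (2 * s4) *\<^sub>R b1 \<in> M"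
      using that ab by (auto intro!: convexD[OF Mc(2)])
    from convexD[OF Mc(2) this, of "1/2" "1/2"] show ?thesis by (simp add: scaleR_right_distrib add.assoc)
  qed
  have z0: "z0 \<in> M" using comb[of "1/4" "1/4" "1/4" "1/4"] by (simp add: z0_def scaleR_right_distrib)
  show ?thesis
  proof (intro exI[of _ A] exI[of _ "- A z0"] conjI A Ainj)
    show "cball 0 (1/8) \<subseteq> (\<lambda>z. A z + - A z0) ` M"
    proof
      fix y :: complex assume "y \<in> cball 0 (1/8)"
      then have y: "\<bar>Re y\<bar> \<le> 1/8" "\<bar>Im y\<bar> \<le> 1/8" using abs_Re_le_cmod[of y] abs_Im_le_cmod[of y] by auto
      define x where "x = z0 + (Re y *\<^sub>R (a0 - b0) + Im y *\<^sub>R (a1 - b1))"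
      have "x = (1/4 + Re y) *\<^sub>R a0 + (1/4 - Re y) *\<^sub>R b0 + (1/4 + Im y) *\<^sub>R a1 + (1/4 - Im y) *\<^sub>R b1"
        by (simp add: x_def z0_def algebra_simps)
      also have "\<dots> \<in> M" using y by (intro comb) (auto simp: abs_le_iff)
      finally have "x \<in> M" .
      moreover have "A x + - A z0 = Re y *\<^sub>R 1 + Im y *\<^sub>R \<i>"
        unfolding x_def linear_add[OF A] linear_scale[OF A] A1 by simp
      then have "A x + - A z0 = y" by (simp add: complex_eq_iff)
      ultimately show "y \<in> (\<lambda>z. A z + - A z0) ` M" by (intro image_eqI[of _ _ x]) auto
    qed
    show "(\<lambda>z. A z + - A z0) ` M \<subseteq> cball 0 8"
    proof
      fix y assume "y \<in> (\<lambda>z. A z + - A z0) ` M"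
      then obtain x where x: "x \<in> M" "y = A (x - z0)" by (auto simp: linear_diff[OF A])
      have JD: "J (x - z0) \<in> J ` D" using DI[OF x(1) z0] by blast
      have "\<bar>Re y\<bar> \<le> 4" "\<bar>Im y\<bar> \<le> 4" using bd[rule_format, OF JD, of 0] bd[rule_format, OF JD, of 1] by (auto simp: x(2) A_def)
      then show "y \<in> cball 0 8" using cmod_le[of y] by simp
    qed
  qed
qed

text \<open>The functions \<open>Phi k\<close> are compared with bodies on which they vanish, so all nontrivial Fourier
  coefficients of the support function of the normalized body are of order \<open>\<delta>\<close>.\<close>
theorem nearly_elliptic_of_Phi_zeros:
  "\<exists>C>0. \<forall>M \<delta>. planar_body M \<longrightarrow> \<delta> > 0 \<longrightarrow>
     (\<forall>k\<ge>1. \<exists>N L d l z. planar_body N \<and> Phi k N = 0 \<and> linear L \<and> inj L \<and> 0 < l \<and> l < 1 + \<delta> \<and>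
        M \<subseteq> (\<lambda>x. L x + d) ` N \<and> (\<lambda>x. L x + d) ` N \<subseteq> (\<lambda>x. l *\<^sub>R x + z) ` M) \<longrightarrow>
     (\<exists>(A :: complex \<Rightarrow> complex) \<zeta>. linear A \<and> inj A \<and> (\<forall>w. norm (w + \<zeta>) \<le> 1 \<longrightarrow> A w \<in> M) \<and>
        (\<forall>w. A w \<in> M \<longrightarrow> norm (w + \<zeta>) \<le> 1 + C * sqrt \<delta>))"
proof -
  \<comment> \<open>\<open>r\<close> and \<open>R\<close> are the radii of
    \<open>normal_form_round\<close>. The three summands of \<open>C\<close> serve, in order, the
    main case, the case \<delta> > 1, and the case where \<delta> is at most 1 but
    \<open>C2 * sqrt \<delta>\<close> is too large against \<open>r\<close>.\<close>
  define r :: real where "r = 1 / 2^36"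
  define R :: real where "R = 32"
  define C1 where "C1 = 20 * R + 21 * R * (435456 * R^4 / r^4)"
  define C2 where "C2 = 2 * pi * C1 * sqrt 2 + 4 * R"
  define C where "C = 4 * C2 / r + 2 * R / r + (2 * R / r) * (4 * C2 / r)"
  have rR: "r > 0" "R > 0" by (auto simp: r_def R_def)
  have C1: "C1 > 0" unfolding C1_def using rR by (intro add_pos_nonneg) auto
  have C2: "C2 > 0" unfolding C2_def using rR C1 by (intro add_nonneg_pos) auto
  have C: "C > 0" "4 * C2 / r \<le> C" "2 * R / r \<le> C" "(2 * R / r) * (4 * C2 / r) \<le> C"
    using rR C2 by (auto simp: C_def add_nonneg_nonneg intro!: add_pos_pos)
  show ?thesis
  proof (intro exI[of _ C] conjI allI impI C(1))
    fix M \<delta>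
    assume M: "planar_body M" and \<delta>: "\<delta> > (0::real)"
    assume H: "\<forall>k\<ge>1. \<exists>N L d l z. planar_body N \<and> Phi k N = 0 \<and> linear L \<and> inj L \<and> 0 < l \<and> l < 1 + \<delta> \<and>
        M \<subseteq> (\<lambda>x. L x + d) ` N \<and> (\<lambda>x. L x + d) ` N \<subseteq> (\<lambda>x. l *\<^sub>R x + z) ` M"
    obtain L1 :: "complex \<Rightarrow> complex" and d1 where L1: "linear L1" "inj L1" and in1: "cball 0 (1/8) \<subseteq> (\<lambda>z. L1 z + d1) ` M" "(\<lambda>z. L1 z + d1) ` M \<subseteq> cball 0 8"
      using round_position[OF M] by blast
    \<comment> \<open>First the round position, for uniform radii, then the normal form, for
      vanishing moments; both are affine and are combined into \<open>T\<close>.\<close>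
    let ?M1 = "(\<lambda>z. L1 z + d1) ` M"
    have M1: "planar_body ?M1" by (rule planar_body_affine[OF L1 M])
    define L2 where "L2 = (\<lambda>w. 1 * w + (- shear ?M1) * cnj w)"
    define d2 where "d2 = - centroid ?M1 + shear ?M1 * cnj (centroid ?M1)"
    have L2: "linear L2" "inj L2" unfolding L2_def using linear_form[of 1 "- shear ?M1"] inj_form[of "- shear ?M1" 1] shear_less_1[OF M1] by auto
    define L0 where "L0 = L2 \<circ> L1"
    define d0 where "d0 = L2 d1 + d2"
    have L0: "linear L0" "inj L0" unfolding L0_def by (intro linear_compose L1 L2 inj_compose)+
    define T where "T = (\<lambda>z. L0 z + d0)"
    have nfT: "normal_form ?M1 = T ` M"
      unfolding normal_form_def normalize_pt_form image_image T_def L0_def d0_def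
      by (simp add: linear_add[OF L2(1)] add.assoc flip: L2_def[THEN fun_cong, simplified] d2_def)
         (simp add: L2_def d2_def algebra_simps)
    define M' where "M' = T ` M"
    have M': "planar_body M'" "centroid M' = 0" "pseudovariance M' = 0"
      using normal_form_props[OF M1] unfolding nfT M'_def by auto
    obtain w where w: "cball w r \<subseteq> M'" using normal_form_round(1)[OF M1 in1] unfolding nfT M'_def r_def by blast
    have MR: "M' \<subseteq> cball 0 R" using normal_form_round(2)[OF M1 in1] unfolding nfT M'_def R_def .
    have Mc: "compact M'" "convex M'" "M' \<noteq> {}" using planar_body_compact[OF M'(1)] M'(1) by (simp_all add: planar_body_def)
    have disc: "\<exists>c \<rho>. \<rho> > 0 \<and> cball c \<rho> \<subseteq> M' \<and> M' \<subseteq> cball c (\<rho> * (1 + C * sqrt \<delta>))"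
    proof (cases "\<delta> \<le> 1 \<and> 4 * (C2 * sqrt \<delta>) \<le> r")
      \<comment> \<open>Then \<open>C * sqrt \<delta>\<close> is at least \<open>2 * R / r\<close>,
        and the discs of radius \<open>r\<close> and \<open>2 * R\<close> about \<open>w\<close>
        already suffice.\<close>
      case False
      have sd: "sqrt \<delta> > 0" using \<delta> by simp
      have "2 * R / r \<le> C * sqrt \<delta>"
      proof (cases "\<delta> \<le> 1")
        case True
        then have "1 \<le> 4 * C2 / r * sqrt \<delta>" using False rR by (simp add: field_simps)
        then have "2 * R / r * 1 \<le> 2 * R / r * (4 * C2 / r * sqrt \<delta>)" using rR by (intro mult_left_mono) auto
        also have "\<dots> = (2 * R / r) * (4 * C2 / r) * sqrt \<delta>" by simp
        also have "\<dots> \<le> C * sqrt \<delta>" using C sd by (intro mult_right_mono) auto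
        finally show ?thesis by simp
      next
        case False
        then have "1 \<le> sqrt \<delta>" by simp
        then have "C * 1 \<le> C * sqrt \<delta>" using C by (intro mult_left_mono) auto
        then show ?thesis using C by linarith
      qed
      then have "2 * R \<le> r * (1 + C * sqrt \<delta>)" using rR by (simp add: field_simps)
      moreover have "w \<in> M'" using w rR by auto
      then have wR: "cmod w \<le> R" using MR by auto
      have "x \<in> cball w (2 * R)" if "x \<in> M'" for x
      proof -
        have "cmod x \<le> R" using that MR by auto
        then show ?thesis using wR norm_triangle_ineq4[of w x] by (simp add: dist_norm)
      qed
      then have "M' \<subseteq> cball w (2 * R)" by blast
      ultimately have "M' \<subseteq> cball w (r * (1 + C * sqrt \<delta>))" by (meson order_trans subset_cball)
      then show ?thesis using w rR by blast
    next
      case True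
      \<comment> \<open>With \<open>\<eta>\<close> of order \<delta>, the choice of \<open>m\<close>
        about \<open>1 / \<delta>\<close> balances \<open>\<eta> * sqrt m\<close> against
        \<open>R / sqrt m\<close>; both become of order \<open>sqrt \<delta>\<close>.\<close>
      define m where "m = nat \<lceil>1 / \<delta>\<rceil>"
      have m1: "real m \<ge> 1 / \<delta>" "real m \<le> 1 / \<delta> + 1" using \<delta> by (auto simp: m_def)
      have d1: "1 / \<delta> \<ge> 1" using True \<delta> by simp
      have m: "m \<ge> 1" using m1 d1 by linarith
      define \<eta> where "\<eta> = 2 * pi * (C1 * \<delta>)"
      have small: "cmod (fourier_coeff k (support_fun M')) \<le> \<eta>" if k: "k \<ge> 1" for k
      proof -
        obtain N L d l z where N: "planar_body N" "Phi k N = 0" "linear L" "inj L" "0 < l" "l < 1 + \<delta>"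
          "M \<subseteq> (\<lambda>x. L x + d) ` N" "(\<lambda>x. L x + d) ` N \<subseteq> (\<lambda>x. l *\<^sub>R x + z) ` M" using H k by blast
        \<comment> \<open>The comparison body carried to the coordinates of \<open>M'\<close>. Its
          coefficient still vanishes, and it is still caught between \<open>M'\<close> and a
          homothetic copy, so the coefficient of \<open>M'\<close> is within \<open>\<eta>\<close>
          of 0.\<close>
        define N' where "N' = (\<lambda>x. (L0 \<circ> L) x + (L0 d + d0)) ` N"
        have Ll: "linear (L0 \<circ> L)" "inj (L0 \<circ> L)" by (intro linear_compose N L0 inj_compose)+
        have N'eq: "N' = T ` ((\<lambda>x. L x + d) ` N)" unfolding N'_def T_def image_image by (simp add: linear_add[OF L0(1)] add.assoc)
        have N': "planar_body N'" "Phi k N' = 0" unfolding N'_def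
          by (rule planar_body_affine[OF Ll N(1)], rule Phi_affine_zero[OF Ll N(1,2)])
        have s1: "M' \<subseteq> N'" unfolding N'eq M'_def using N(7) by (rule image_mono)
        have s2: "N' \<subseteq> (\<lambda>x. l *\<^sub>R x + (L0 z + d0 - l *\<^sub>R d0)) ` M'"
        proof -
          have "N' \<subseteq> T ` ((\<lambda>x. l *\<^sub>R x + z) ` M)" unfolding N'eq using N(8) by (rule image_mono)
          also have "\<dots> = (\<lambda>x. l *\<^sub>R x + (L0 z + d0 - l *\<^sub>R d0)) ` M'"
            unfolding M'_def T_def image_image by (simp add: linear_add[OF L0(1)] linear_scale[OF L0(1)] algebra_simps)
          finally show ?thesis .
        qed
        have l1: "l \<ge> 1" by (rule homothety_ge_1[OF M'(1) order_trans[OF s1 s2] N(5)])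
        have l2: "l \<le> 2" using N(6) True by simp
        have "\<bar>support_fun (normal_form N') t - support_fun M' t\<bar> \<le> C1 * \<delta>" for t
        proof -
          have "\<bar>support_fun (normal_form N') t - support_fun M' t\<bar> \<le> C1 * (l - 1)"
            unfolding C1_def by (rule support_fun_normal_form_stable[OF M' rR(1) w MR rR(2) N'(1) s1 s2 l1 l2])
          also have "\<dots> \<le> C1 * \<delta>" using C1 N(6) by (intro mult_left_mono) auto
          finally show ?thesis .
        qed
        then have "cmod (fourier_coeff k (support_fun (normal_form N')) - fourier_coeff k (support_fun M')) \<le> \<eta>"
          unfolding \<eta>_def using planar_body_compact[OF normal_form_props(1)[OF N'(1)]] Mc
          by (intro fourier_coeff_diff_bound continuous_support_fun) auto
        then show ?thesis using N'(2) by (simp add: Phi_def)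
      qed
      define \<tau> where "\<tau> = C2 * sqrt \<delta>"
      have near: "\<bar>support_fun M' t - integral {0..2*pi} (support_fun M') / (2 * pi)\<bar> \<le> \<tau>" for t
      proof -
        have sd: "sqrt \<delta> > 0" using \<delta> by simp
        have sdd: "sqrt \<delta> * sqrt \<delta> = \<delta>" using \<delta> by simp
        have "sqrt (real m) \<le> sqrt (2 / \<delta>)" using m1 d1 by simp
        also have "\<dots> = sqrt 2 / sqrt \<delta>" by (simp add: real_sqrt_divide)
        finally have "\<eta> * sqrt (real m) \<le> \<eta> * (sqrt 2 / sqrt \<delta>)" using C1 \<delta> by (intro mult_left_mono) (auto simp: \<eta>_def)
        also have "\<dots> = 2 * pi * C1 * sqrt 2 * (sqrt \<delta> * sqrt \<delta> / sqrt \<delta>)" 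
          unfolding sdd \<eta>_def by (simp only: times_divide_eq_right times_divide_eq_left mult_ac)
        also have "sqrt \<delta> * sqrt \<delta> / sqrt \<delta> = sqrt \<delta>" using \<delta> by (simp add: real_div_sqrt)
        finally have 1: "\<eta> * sqrt (real m) \<le> 2 * pi * C1 * sqrt 2 * sqrt \<delta>" .
        have "sqrt (1 / \<delta>) \<le> sqrt (real m)" using m1 by simp
        then have "1 / sqrt \<delta> \<le> sqrt (real m)" by (simp add: real_sqrt_divide)
        then have "1 / sqrt (real m) \<le> sqrt \<delta>" using sd m by (simp add: field_simps)
        then have "4 * R * (1 / sqrt (real m)) \<le> 4 * R * sqrt \<delta>" using rR by (intro mult_left_mono) auto
        then have 2: "4 * R / sqrt (real m) \<le> 4 * R * sqrt \<delta>" by simp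
        have "\<bar>support_fun M' t - integral {0..2*pi} (support_fun M') / (2 * pi)\<bar> \<le> \<eta> * sqrt (real m) + 4 * R / sqrt (real m)"
          using rR small m
          by (intro near_constant_of_small_fourier_coeffs continuous_support_fun[OF Mc(1,3)] support_fun_periodic
              support_fun_lipschitz[OF Mc(1,3) MR]) auto
        also have "\<dots> \<le> \<tau>" using 1 2 by (simp add: \<tau>_def C2_def algebra_simps)
        finally show ?thesis .
      qed
      have t4: "4 * \<tau> \<le> r" using True by (simp add: \<tau>_def)
      obtain \<rho> where rho: "\<rho> > 0" "cball 0 \<rho> \<subseteq> M'" "M' \<subseteq> cball 0 (\<rho> * (1 + 4 * \<tau> / r))"
        using nearly_disc_of_nearly_constant_support[OF Mc(1,2) rR(1) w near t4] by blast
      have "4 * \<tau> / r = 4 * C2 / r * sqrt \<delta>" by (simp add: \<tau>_def)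
      also have "\<dots> \<le> C * sqrt \<delta>" using C \<delta> by (intro mult_right_mono) auto
      finally have "\<rho> * (1 + 4 * \<tau> / r) \<le> \<rho> * (1 + C * sqrt \<delta>)" using rho(1) by (intro mult_left_mono) auto
      then have "M' \<subseteq> cball 0 (\<rho> * (1 + C * sqrt \<delta>))" using rho(3) by (meson order_trans subset_cball)
      then show ?thesis using rho by blast
    qed
    then obtain c \<rho> where c: "\<rho> > 0" "cball c \<rho> \<subseteq> M'" "M' \<subseteq> cball c (\<rho> * (1 + C * sqrt \<delta>))" by blast
    \<comment> \<open>The inverse of the linear part of \<open>T\<close> pulls the two concentric
      discs back to ellipses; \<open>d0 - c\<close> becomes the offset
      \<open>\<zeta>\<close>.\<close>
    obtain G where G: "linear G" "\<And>x. G (L0 x) = x" "\<And>x. L0 (G x) = x"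
      using linear_injective_isomorphism[OF L0] by metis
    have mem: "A \<in> M \<longleftrightarrow> T A \<in> M'" for A
      unfolding M'_def T_def by (auto dest!: injD[OF L0(2)])
    show "\<exists>(A :: complex \<Rightarrow> complex) \<zeta>. linear A \<and> inj A \<and> (\<forall>w. norm (w + \<zeta>) \<le> 1 \<longrightarrow> A w \<in> M) \<and>
        (\<forall>w. A w \<in> M \<longrightarrow> norm (w + \<zeta>) \<le> 1 + C * sqrt \<delta>)"
    proof (intro exI[of _ "\<lambda>w. G (\<rho> *\<^sub>R w)"] exI[of _ "(1/\<rho>) *\<^sub>R (d0 - c)"] conjI allI impI)
      have TG: "T (G (\<rho> *\<^sub>R w)) = c + \<rho> *\<^sub>R (w + (1/\<rho>) *\<^sub>R (d0 - c))" for w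
        using c(1) by (simp add: T_def G(3) scaleR_right_distrib)
      show "linear (\<lambda>w. G (\<rho> *\<^sub>R w))" using G(1) by (intro linearI) (simp_all add: linear_add linear_scale scaleR_right_distrib mult.commute)
      show "inj (\<lambda>w. G (\<rho> *\<^sub>R w))"
      proof (rule injI)
        fix x y assume "G (\<rho> *\<^sub>R x) = G (\<rho> *\<^sub>R y)"
        then have "L0 (G (\<rho> *\<^sub>R x)) = L0 (G (\<rho> *\<^sub>R y))" by simp
        then show "x = y" using c(1) by (simp add: G(3))
      qed
      show "G (\<rho> *\<^sub>R w) \<in> M" if "norm (w + (1/\<rho>) *\<^sub>R (d0 - c)) \<le> 1" for w
      proof -
        have "norm (\<rho> *\<^sub>R (w + (1/\<rho>) *\<^sub>R (d0 - c))) \<le> \<rho>" unfolding norm_scaleR using that c(1) by simp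
        then have "T (G (\<rho> *\<^sub>R w)) \<in> cball c \<rho>" unfolding TG by (simp add: dist_norm)
        then show ?thesis unfolding mem using c(2) by blast
      qed
      show "norm (w + (1/\<rho>) *\<^sub>R (d0 - c)) \<le> 1 + C * sqrt \<delta>" if "G (\<rho> *\<^sub>R w) \<in> M" for w
      proof -
        have "c + \<rho> *\<^sub>R (w + (1/\<rho>) *\<^sub>R (d0 - c)) \<in> cball c (\<rho> * (1 + C * sqrt \<delta>))"
          using that c(3) unfolding mem TG by blast
        then have "norm (\<rho> *\<^sub>R (w + (1/\<rho>) *\<^sub>R (d0 - c))) \<le> \<rho> * (1 + C * sqrt \<delta>)" by (simp only: mem_cball dist_norm) (simp add: norm_minus_commute)
        then show ?thesis unfolding norm_scaleR using c(1) by simp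
      qed
    qed
  qed
qed

section \<open>Sections on which a Fourier coefficient vanishes\<close>

lemma variance_eq:
  assumes M: "planar_body M"
  shows "variance M = mean M (\<lambda>z. (cmod z)\<^sup>2) - (cmod (centroid M))\<^sup>2"
proof -
  let ?g = "centroid M"
  have "(cmod (z - ?g))\<^sup>2 = (cmod z)\<^sup>2 + ((-2) * (?g \<bullet> z) + (cmod ?g)\<^sup>2)" for z
    by (simp add: power2_norm_eq_inner inner_diff_left inner_diff_right inner_commute)
  then have "variance M = mean M (\<lambda>z. (cmod z)\<^sup>2 + ((-2) * (?g \<bullet> z) + (cmod ?g)\<^sup>2))" by (simp only: variance_def)
  also have "\<dots> = mean M (\<lambda>z. (cmod z)\<^sup>2) + mean M (\<lambda>z. (-2) * (?g \<bullet> z) + (cmod ?g)\<^sup>2)"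
    by (intro mean_add M continuous_intros)
  also have "mean M (\<lambda>z. (-2) * (?g \<bullet> z) + (cmod ?g)\<^sup>2) = mean M (\<lambda>z. (-2) * (?g \<bullet> z)) + mean M (\<lambda>z. (cmod ?g)\<^sup>2)"
    by (intro mean_add M continuous_intros)
  also have "mean M (\<lambda>z. (-2) * (?g \<bullet> z)) = (-2) * mean M (\<lambda>z. ?g \<bullet> z)"
    by (intro mean_mult_real M continuous_intros)
  also have "mean M (\<lambda>z. ?g \<bullet> z) = ?g \<bullet> mean M (\<lambda>z. z)"
    by (rule mean_bounded_linear[OF M continuous_on_id bounded_linear_inner_right])
  also have "mean M (\<lambda>z. z) = ?g" by (simp add: centroid_def)
  finally show ?thesis by (simp add: mean_const[OF M] power2_norm_eq_inner)
qed

text \<open>A continuity statement for a body \<open>M\<close> that is not normalized. The moments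
  converge, hence so do the normalizing maps, uniformly on bounded sets; \<open>e\<close> collects
  their displacement and bounds the distance of the support functions.\<close>

lemma tendsto_Phi:
  fixes N :: "nat \<Rightarrow> complex set"
  assumes M: "planar_body M" and N: "\<And>j. planar_body (N j)"
    and sub: "\<And>j. M \<subseteq> N j" "\<And>j. N j \<subseteq> (\<lambda>x. l j *\<^sub>R x) ` M" and l1: "\<And>j. l j \<ge> 1" and lim: "l \<longlonglongrightarrow> 1"
  shows "(\<lambda>j. Phi k (N j)) \<longlonglongrightarrow> Phi k M"
proof -
  obtain R where "\<forall>z\<in>M. norm z \<le> R" using compact_imp_bounded[OF conjunct1[OF planar_body_compact[OF M]]] by (auto simp: bounded_iff)
  then have R: "\<And>z. z \<in> M \<Longrightarrow> cmod z \<le> R" by auto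
  obtain x0 where "x0 \<in> M" using planar_body_compact[OF M] by blast
  then have R0: "R \<ge> 0" using R[of x0] norm_ge_zero[of x0] by linarith
  have ev2: "eventually (\<lambda>j. l j \<le> 2) sequentially"
    using order_tendstoD(2)[OF lim, of 2] by (auto elim: eventually_mono)
  have NR: "cmod x \<le> 2 * R" if x: "x \<in> N j" "l j \<le> 2" for x j
  proof -
    obtain y where y: "y \<in> M" "x = l j *\<^sub>R y" using x(1) sub(2) by blast
    have "cmod x = l j * cmod y" using y(2) l1[of j] by simp
    also have "\<dots> \<le> 2 * R" using R[OF y(1)] l1[of j] x(2) R0 by (intro mult_mono) auto
    finally show ?thesis .
  qed
  have mean_lim: "(\<lambda>j. mean (N j) \<phi>) \<longlonglongrightarrow> mean M \<phi>" if \<phi>: "continuous_on UNIV \<phi>" for \<phi> :: "complex \<Rightarrow> 'b::euclidean_space"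
  proof -
    have "compact (\<phi> ` cball 0 (2 * R))" by (intro compact_continuous_image continuous_on_subset[OF \<phi>]) auto
    then obtain B where "\<forall>y\<in>\<phi> ` cball 0 (2 * R). norm y \<le> B" using compact_imp_bounded bounded_iff by blast
    then have B: "norm (\<phi> z) \<le> B" if "cmod z \<le> 2 * R" for z using that by auto
    have ev: "eventually (\<lambda>j. norm (mean (N j) \<phi> - mean M \<phi>) \<le> 6 * B * (l j - 1)) sequentially"
      using ev2
    proof (rule eventually_mono)
      fix j assume j: "l j \<le> 2"
      have s: "N j \<subseteq> (\<lambda>x. l j *\<^sub>R x + 0) ` M" using sub(2)[of j] by simp
      show "norm (mean (N j) \<phi> - mean M \<phi>) \<le> 6 * B * (l j - 1)"
        by (rule mean_diff_bound[OF M N sub(1) s l1 j \<phi>]) (rule B[OF NR[OF _ j]])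
    qed
    have "(\<lambda>j. 6 * B * (l j - 1)) \<longlonglongrightarrow> 6 * B * (1 - 1)" by (intro tendsto_intros lim)
    then have "(\<lambda>j. 6 * B * (l j - 1)) \<longlonglongrightarrow> 0" by simp
    then show ?thesis by (rule LIM_zero_cancel[OF Lim_null_comparison[OF ev]])
  qed
  have g: "(\<lambda>j. centroid (N j)) \<longlonglongrightarrow> centroid M" unfolding centroid_def by (intro mean_lim continuous_intros)
  have v: "(\<lambda>j. variance (N j)) \<longlonglongrightarrow> variance M" unfolding variance_eq[OF N] variance_eq[OF M]
    by (intro tendsto_diff mean_lim tendsto_power tendsto_norm g continuous_intros)
  have p: "(\<lambda>j. pseudovariance (N j)) \<longlonglongrightarrow> pseudovariance M" unfolding pseudovariance_eq[OF N] pseudovariance_eq[OF M]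
    by (intro tendsto_diff mean_lim tendsto_power g continuous_intros)
  have b: "(\<lambda>j. shear (N j)) \<longlonglongrightarrow> shear M" unfolding shear_def
  proof (intro tendsto_divide p tendsto_of_real tendsto_add v tendsto_real_sqrt tendsto_diff tendsto_power tendsto_norm)
    have "variance M > 0" using pseudovariance_less_variance[OF M] norm_ge_zero order_le_less_trans by blast
    moreover have "sqrt ((variance M)\<^sup>2 - (cmod (pseudovariance M))\<^sup>2) \<ge> 0"
      using pseudovariance_less_variance[OF M] by (simp add: power_mono)
    ultimately have "variance M + sqrt ((variance M)\<^sup>2 - (cmod (pseudovariance M))\<^sup>2) > 0" by linarith
    then show "complex_of_real (variance M + sqrt ((variance M)\<^sup>2 - (cmod (pseudovariance M))\<^sup>2)) \<noteq> 0"
      unfolding of_real_eq_0_iff by linarith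
  qed
  define e where "e = (\<lambda>j. cmod (centroid (N j) - centroid M) + cmod (shear (N j) - shear M) * (2 * R + cmod (centroid (N j)))
     + cmod (shear M) * cmod (centroid (N j) - centroid M) + (1 + cmod (shear M)) * (R * (l j - 1)))"
  have e0: "e \<longlonglongrightarrow> cmod (centroid M - centroid M) + cmod (shear M - shear M) * (2 * R + cmod (centroid M))
     + cmod (shear M) * cmod (centroid M - centroid M) + (1 + cmod (shear M)) * (R * (1 - 1))"
    unfolding e_def by (intro tendsto_intros g b lim)
  have tri: "cmod (a - b - c - d + f) \<le> cmod a + cmod b + cmod c + cmod d + cmod f" for a b c d f
    using norm_triangle_ineq[of "a - b - c - d" f] norm_triangle_ineq4[of "a - b - c" d] norm_triangle_ineq4[of "a - b" c]
      norm_triangle_ineq4[of a b] by linarith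
  have ptwise: "cmod (normalize_pt (N j) x - normalize_pt M y) \<le> e j" if x: "cmod x \<le> 2 * R" and xy: "cmod (x - y) \<le> R * (l j - 1)" for x y j
  proof -
    let ?g = "centroid (N j)" and ?b = "shear (N j)"
    have "normalize_pt (N j) x - normalize_pt M y =
       (x - y) - (?g - centroid M) - (?b - shear M) * cnj (x - ?g) - shear M * cnj (x - y) + shear M * cnj (?g - centroid M)"
      by (simp add: normalize_pt_def algebra_simps)
    also have "cmod \<dots> \<le> cmod (x - y) + cmod (?g - centroid M) + cmod (?b - shear M) * cmod (x - ?g)
         + cmod (shear M) * cmod (x - y) + cmod (shear M) * cmod (?g - centroid M)"
      using tri[of "x - y" "?g - centroid M" "(?b - shear M) * cnj (x - ?g)" "shear M * cnj (x - y)" "shear M * cnj (?g - centroid M)"]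
      by (simp only: norm_mult complex_mod_cnj)
    also have "\<dots> \<le> R * (l j - 1) + cmod (?g - centroid M) + cmod (?b - shear M) * (2 * R + cmod ?g)
         + cmod (shear M) * (R * (l j - 1)) + cmod (shear M) * cmod (?g - centroid M)"
      using x xy norm_triangle_ineq4[of x ?g] by (intro add_mono mult_left_mono) auto
    also have "\<dots> = e j" by (simp add: e_def algebra_simps)
    finally show ?thesis .
  qed
  have ev: "eventually (\<lambda>j. norm (Phi k (N j) - Phi k M) \<le> 2 * pi * e j) sequentially"
    using ev2
  proof (rule eventually_mono)
    fix j assume j: "l j \<le> 2"
    have c: "compact (normal_form (N j)) \<and> normal_form (N j) \<noteq> {}" "compact (normal_form M) \<and> normal_form M \<noteq> {}"
      by (intro planar_body_compact normal_form_props N M)+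
    have "\<bar>support_fun (normal_form (N j)) t - support_fun (normal_form M) t\<bar> \<le> e j" for t
    proof (rule support_fun_hausdorff)
      fix u assume "u \<in> normal_form (N j)"
      then obtain x where x: "x \<in> N j" "u = normalize_pt (N j) x" by (auto simp: normal_form_def)
      obtain y where y: "y \<in> M" "x = l j *\<^sub>R y" using x(1) sub(2) by blast
      have "x - y = (l j - 1) *\<^sub>R y" using y(2) by (simp add: algebra_simps)
      then have "cmod (x - y) = (l j - 1) * cmod y" using l1[of j] by (simp only: norm_scaleR)
      also have "\<dots> \<le> R * (l j - 1)" using R[OF y(1)] l1[of j] by (simp add: mult.commute[of R] mult_left_mono)
      finally show "\<exists>w\<in>normal_form M. cmod (u - w) \<le> e j"
        using ptwise[OF NR[OF x(1) j], of y] y(1) x(2) by (auto simp: normal_form_def)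
    next
      fix u assume "u \<in> normal_form M"
      then obtain y where y: "y \<in> M" "u = normalize_pt M y" by (auto simp: normal_form_def)
      have "cmod (normalize_pt (N j) y - normalize_pt M y) \<le> e j"
        using R[OF y(1)] R0 l1[of j] by (intro ptwise) auto
      then show "\<exists>w\<in>normal_form (N j). cmod (u - w) \<le> e j"
        using y sub(1) by (auto simp: normal_form_def norm_minus_commute intro!: bexI[of _ y])
    qed (use c in auto)
    then show "norm (Phi k (N j) - Phi k M) \<le> 2 * pi * e j"
      unfolding Phi_def using c by (intro fourier_coeff_diff_bound continuous_support_fun) auto
  qed
  have "e \<longlonglongrightarrow> 0" using e0 by simp
  then have "(\<lambda>j. 2 * pi * e j) \<longlonglongrightarrow> 2 * pi * 0" by (intro tendsto_mult tendsto_const)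
  then have "(\<lambda>j. 2 * pi * e j) \<longlonglongrightarrow> 0" by simp
  then show ?thesis by (rule LIM_zero_cancel[OF Lim_null_comparison[OF ev]])
qed

text \<open>The values lie in the integer multiples of 2 pi i, which are separated by 2 pi.\<close>

lemma exp_one_constant:
  fixes f :: "'a::topological_space \<Rightarrow> complex"
  assumes S: "connected S" and f: "continuous_on S f" "\<And>x. x \<in> S \<Longrightarrow> exp (f x) = 1" and ab: "a \<in> S" "b \<in> S"
  shows "f a = f b"
proof -
  have "f constant_on S"
  proof (rule continuous_discrete_range_constant[OF S f(1)])
    fix x assume x: "x \<in> S"
    have "2 * pi \<le> cmod (f y - f x)" if y: "y \<in> S" "f y \<noteq> f x" for y
    proof (rule ccontr)
      assume "\<not> ?thesis"
      then have "\<bar>Im (f y) - Im (f x)\<bar> < 2 * pi" using abs_Im_le_cmod[of "f y - f x"] by simp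
      then have "f y = f x" by (rule exp_complex_eqI) (simp add: f(2) x y(1))
      then show False using y by simp
    qed
    then show "\<exists>e>0. \<forall>y. y \<in> S \<and> f y \<noteq> f x \<longrightarrow> e \<le> cmod (f y - f x)"
      by (intro exI[of _ "2 * pi"]) auto
  qed
  then show ?thesis using ab by (auto simp: constant_on_def)
qed

text \<open>A continuous logarithm of \<open>v\<close> would change by \<open>- 2 pi \<i> k\<close> along one edge and by \<open>2 pi \<i> k\<close> along the
  opposite one, while this change is constant in \<open>s\<close>.\<close>
lemma winding_zero:
  fixes v :: "real \<times> real \<Rightarrow> complex"
  assumes v: "continuous_on ({0..2*pi} \<times> {0..pi}) v" and k: "k \<ge> (1::nat)"
    and bot: "\<And>\<theta>. v (\<theta>, 0) = cis (- real k * \<theta>) * v (0, 0)"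
    and top: "\<And>\<theta>. v (\<theta>, pi) = cis (real k * \<theta>) * v (0, pi)"
    and side: "\<And>s. v (2 * pi, s) = v (0, s)"
  shows "\<exists>x\<in>{0..2*pi} \<times> {0..pi}. v x = 0"
proof (rule ccontr)
  assume "\<not> ?thesis"
  then have nz: "v x \<noteq> 0" if "x \<in> {0..2*pi} \<times> {0..pi}" for x using that by blast
  have "contractible ({0..2*pi} \<times> {0..pi::real})" by (intro convex_imp_contractible convex_Times) auto
  then obtain g where g: "continuous_on ({0..2*pi} \<times> {0..pi}) g" and eg: "\<And>x. x \<in> {0..2*pi} \<times> {0..pi} \<Longrightarrow> v x = exp (g x)"
    using continuous_logarithm_on_contractible[OF v] nz by blast
  have const: "f a = f b" if "continuous_on {0..c} f" "\<And>x. x \<in> {0..c} \<Longrightarrow> exp (f x) = 1" "a \<in> {0..c}" "b \<in> {0..c}" for f :: "real \<Rightarrow> complex" and a b c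
    using that exp_one_constant[of "{0..c}" f a b] by simp
  have gc: "continuous_on {0..2*pi} (\<lambda>\<theta>. g (\<theta>, s))" if "s \<in> {0..pi}" for s
    using that by (intro continuous_on_compose2[OF g] continuous_on_Pair continuous_on_id continuous_on_const) auto
  have gd: "continuous_on {0..pi} (\<lambda>s. g (\<theta>, s))" if "\<theta> \<in> {0..2*pi}" for \<theta>
    using that by (intro continuous_on_compose2[OF g] continuous_on_Pair continuous_on_id continuous_on_const) auto
  \<comment> \<open>After subtraction of the explicit phase \<open>a * \<theta>\<close> the
    logarithm has constant exponential along the edge, so it is constant.\<close>
  have edge: "g (2 * pi, s) - g (0, s) = \<i> * of_real (a * (2 * pi))"
    if s: "s \<in> {0..pi}" and va: "\<And>\<theta>. v (\<theta>, s) = cis (a * \<theta>) * v (0, s)" for s a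
  proof -
    let ?f = "\<lambda>\<theta>. g (\<theta>, s) - g (0, s) - \<i> * of_real (a * \<theta>)"
    have "?f (2 * pi) = ?f 0"
    proof (rule const[of "2 * pi"])
      show "continuous_on {0..2*pi} ?f" by (intro continuous_intros gc s)
      fix \<theta> assume t: "\<theta> \<in> {0..2*pi}"
      have "exp (g (\<theta>, s)) = cis (a * \<theta>) * exp (g (0, s))" using va[of \<theta>] t s by (simp flip: eg)
      then show "exp (?f \<theta>) = 1" by (simp add: exp_diff cis_conv_exp)
    qed auto
    then show ?thesis by simp
  qed
  have "g (2 * pi, 0) - g (0, 0) = g (2 * pi, pi) - g (0, pi)"
  proof (rule const[of pi])
    show "continuous_on {0..pi} (\<lambda>s. g (2 * pi, s) - g (0, s))" by (intro continuous_intros gd) auto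
    show "exp (g (2 * pi, s) - g (0, s)) = 1" if "s \<in> {0..pi}" for s
      using side[of s] that by (simp add: exp_diff flip: eg) (use nz in auto)
  qed auto
  moreover have "g (2 * pi, 0) - g (0, 0) = \<i> * of_real (- real k * (2 * pi))" by (rule edge[OF _ bot]) simp
  moreover have "g (2 * pi, pi) - g (0, pi) = \<i> * of_real (real k * (2 * pi))" by (rule edge[OF _ top]) simp
  ultimately have "complex_of_real (- real k * (2 * pi)) = of_real (real k * (2 * pi))" by simp
  then have "- real k * (2 * pi) = real k * (2 * pi)" by (simp only: of_real_eq_iff)
  then have "real k * pi = 0" by simp
  then show False using k by simp
qed

section \<open>Sections parametrized by orthonormal frames\<close>

lemma inj_linear_bounded_below:
  fixes A :: "complex \<Rightarrow> 'a::real_normed_vector"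
  assumes A: "linear A" "inj A"
  shows "\<exists>B>0. \<forall>z. B * norm z \<le> norm (A z)"
proof -
  have "continuous_on (sphere 0 1) (\<lambda>z. norm (A z))"
    using A(1) by (intro continuous_on_norm linear_continuous_on) (simp add: linear_linear)
  moreover have "sphere 0 1 \<noteq> ({} :: complex set)" by simp
  ultimately have "\<exists>w\<in>sphere 0 1. \<forall>z\<in>sphere 0 1. norm (A w) \<le> norm (A z)" by (intro continuous_attains_inf compact_sphere)
  then obtain w where w: "w \<in> sphere 0 1" "\<And>z. z \<in> sphere 0 1 \<Longrightarrow> norm (A w) \<le> norm (A z)" by blast
  have "A w \<noteq> 0" using w(1) linear_injective_0[OF A(1)] A(2) by auto
  moreover have "norm (A w) * norm z \<le> norm (A z)" for z
  proof (cases "z = 0")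
    case False
    then have "norm (A w) \<le> norm (A ((1 / norm z) *\<^sub>R z))" by (intro w(2)) simp
    also have "\<dots> = norm (A z) / norm z" by (simp only: linear_scale[OF A(1)] norm_scaleR) simp
    finally show ?thesis using False by (simp add: field_simps)
  qed simp
  ultimately show ?thesis by (intro exI[of _ "norm (A w)"]) auto
qed

lemma linear_section_planar_body:
  fixes A :: "complex \<Rightarrow> 'a::real_normed_vector"
  assumes A: "linear A" "inj A" "\<And>z. A z \<in> V" and K: "compact K" "convex K" "e > 0" "cball 0 e \<inter> V \<subseteq> K"
  shows "planar_body {z. A z \<in> K}"
proof -
  have bl: "bounded_linear A" using A(1) by (simp add: linear_linear)
  obtain B where B: "B > 0" "\<And>x. B * norm x \<le> norm (A x)" using inj_linear_bounded_below[OF A(1,2)] by blast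
  obtain R where R: "\<forall>y\<in>K. norm y \<le> R" using compact_imp_bounded[OF K(1)] by (auto simp: bounded_iff)
  have "cmod z \<le> R / B" if "A z \<in> K" for z
    using R B(2)[of z] that B(1) by (force simp: pos_le_divide_eq mult.commute)
  then have "bounded {z. A z \<in> K}" by (auto simp: bounded_iff)
  moreover have "closed {z. A z \<in> K}"
    using continuous_closed_vimage[OF compact_imp_closed[OF K(1)], of A] linear_continuous_at[OF bl] by (simp add: vimage_def)
  ultimately have cp: "compact {z. A z \<in> K}" by (simp add: compact_eq_bounded_closed)
  have cv: "convex {z. A z \<in> K}" using convex_linear_vimage[OF A(1) K(2)] by (simp add: vimage_def)
  obtain C where C: "C > 0" "\<And>x. norm (A x) \<le> norm x * C" using bounded_linear.pos_bounded[OF bl] by blast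
  have "ball 0 (e / C) \<subseteq> {z. A z \<in> K}"
  proof
    fix z :: complex assume "z \<in> ball 0 (e / C)"
    then have "norm (A z) \<le> e" using C(2)[of z] C(1) by (simp add: pos_less_divide_eq)
    then show "z \<in> {z. A z \<in> K}" using K(4) A(3)[of z] by auto
  qed
  then have "ball 0 (e / C) \<subseteq> interior {z. A z \<in> K}" by (rule interior_maximal) simp
  moreover have "0 \<in> ball (0 :: complex) (e / C)" using K(3) C(1) by simp
  ultimately have "interior {z. A z \<in> K} \<noteq> {}" by blast
  then show ?thesis using cp cv by (simp add: planar_body_def)
qed

text \<open>\<open>Arg\<close> is the principal value and differs from \<open>t\<close> by a
  multiple of 2 pi, which an integer frequency ignores.\<close>

lemma cis_minus_nat_Arg_cis: "cis (- real k * Arg (cis t)) = cis (- real k * t)"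
proof -
  have c: "cis (- real k * s) = inverse (cis s) ^ k" for s by (simp add: Complex.DeMoivre)
  have "cis (Arg (cis t)) = cis t" using cis_Arg[of "cis t"] by (simp add: sgn_div_norm)
  then show ?thesis by (simp only: c)
qed

text \<open>For \<open>p = (\<theta>, s)\<close> this is \<open>z \<mapsto> Re z u + Im z w\<close> with the orthonormal vectors
  \<open>u = (-sin \<theta>, cos \<theta>, 0)\<close> and \<open>w = (cos s cos \<theta>, cos s sin \<theta>, -sin s)\<close>.\<close>
definition frame :: "real \<times> real \<Rightarrow> complex \<Rightarrow> nat \<Rightarrow>\<^sub>0 real" where
  "frame p z = (Im z * cos (snd p) * cos (fst p) - Re z * sin (fst p)) *\<^sub>R unit_pm 0
     + (Re z * cos (fst p) + Im z * cos (snd p) * sin (fst p)) *\<^sub>R unit_pm 1 + (- (Im z * sin (snd p))) *\<^sub>R unit_pm 2"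

lemma linear_frame: "linear (frame p)"
  by (intro linearI) (simp_all add: frame_def algebra_simps)

lemma frame_Rn: "n \<ge> 3 \<Longrightarrow> frame p z \<in> Rn n"
  unfolding frame_def by (intro subspace_add subspace_scale subspace_Rn unit_pm_Rn) auto

text \<open>By orthonormality the squares of the three coordinates add up to
  \<open>(cmod z)\<^sup>2\<close>; each coordinate is at most the norm, and 3 is rounded up to 4.
  The constant does not depend on \<open>p\<close>, so all sections are uniformly bounded.\<close>

lemma norm_le_frame: "cmod z \<le> 2 * norm (frame p z)"
proof -
  define a b c where "a = Im z * cos (snd p) * cos (fst p) - Re z * sin (fst p)"
    and "b = Re z * cos (fst p) + Im z * cos (snd p) * sin (fst p)" and "c = - (Im z * sin (snd p))"
  have f: "frame p z = a *\<^sub>R unit_pm 0 + b *\<^sub>R unit_pm 1 + c *\<^sub>R unit_pm 2" by (simp add: frame_def a_def b_def c_def)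
  have "\<bar>a\<bar> \<le> norm (frame p z)" "\<bar>b\<bar> \<le> norm (frame p z)" "\<bar>c\<bar> \<le> norm (frame p z)"
    using abs_lookup_le_norm[of "frame p z" 0] abs_lookup_le_norm[of "frame p z" 1] abs_lookup_le_norm[of "frame p z" 2]
    unfolding f by (simp_all add: lookup_add lookup_scaleR_pm lookup_single lookup_one when_def)
  then have "a\<^sup>2 \<le> (norm (frame p z))\<^sup>2" "b\<^sup>2 \<le> (norm (frame p z))\<^sup>2" "c\<^sup>2 \<le> (norm (frame p z))\<^sup>2"
    by (metis abs_ge_zero power2_abs power_mono)+
  moreover have "(cos (fst p))\<^sup>2 + (sin (fst p))\<^sup>2 = 1" "(cos (snd p))\<^sup>2 + (sin (snd p))\<^sup>2 = 1" by simp_all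
  then have "a\<^sup>2 + b\<^sup>2 + c\<^sup>2 = (Re z)\<^sup>2 + (Im z)\<^sup>2" unfolding a_def b_def c_def by algebra
  ultimately have "(cmod z)\<^sup>2 \<le> 3 * (norm (frame p z))\<^sup>2" by (simp add: cmod_power2)
  also have "\<dots> \<le> (2 * norm (frame p z))\<^sup>2" by (simp add: power_mult_distrib)
  finally show ?thesis by (rule power2_le_imp_le) simp
qed

lemma inj_frame: "inj (frame p)"
  unfolding linear_injective_0[OF linear_frame]
proof (intro allI impI)
  show "z = 0" if "frame p z = 0" for z using norm_le_frame[of z p] that by simp
qed

text \<open>At \<open>s = 0\<close> and \<open>s = pi\<close> the frame spans a fixed plane and turns in opposite senses.\<close>
lemma frame_bot: "frame (t, 0) z = frame (0, 0) (cis (- t) * z)"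
  and frame_top: "frame (t, pi) z = frame (0, pi) (cis t * z)"
  and frame_side: "frame (2 * pi, s) z = frame (0, s) z"
  by (simp_all add: frame_def algebra_simps)

lemma continuous_frame_at:
  assumes "p \<longlonglongrightarrow> q"
  shows "\<exists>h. h \<longlonglongrightarrow> 0 \<and> (\<forall>j z. norm (frame (p j) z - frame q z) \<le> h j * cmod z)"
proof -
  define h where "h = (\<lambda>j. norm (frame (p j) 1 - frame q 1) + norm (frame (p j) \<i> - frame q \<i>))"
  have "h \<longlonglongrightarrow> norm (frame q 1 - frame q 1) + norm (frame q \<i> - frame q \<i>)"
    unfolding h_def frame_def by (intro tendsto_intros assms)
  then have "h \<longlonglongrightarrow> 0" by simp
  moreover have "norm (frame (p j) z - frame q z) \<le> h j * cmod z" for j z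
  proof -
    have "z = Re z *\<^sub>R 1 + Im z *\<^sub>R \<i>" by (simp add: complex_eq_iff)
    then have e: "frame r z = Re z *\<^sub>R frame r 1 + Im z *\<^sub>R frame r \<i>" for r
      by (metis linear_add[OF linear_frame] linear_scale[OF linear_frame])
    have "frame (p j) z - frame q z = Re z *\<^sub>R (frame (p j) 1 - frame q 1) + Im z *\<^sub>R (frame (p j) \<i> - frame q \<i>)"
      unfolding e[of "p j"] e[of q] by (simp add: algebra_simps)
    also have "norm \<dots> \<le> \<bar>Re z\<bar> * norm (frame (p j) 1 - frame q 1) + \<bar>Im z\<bar> * norm (frame (p j) \<i> - frame q \<i>)"
      by (intro order_trans[OF norm_triangle_ineq]) simp
    also have "\<dots> \<le> cmod z * norm (frame (p j) 1 - frame q 1) + cmod z * norm (frame (p j) \<i> - frame q \<i>)"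
      by (intro add_mono mult_right_mono abs_Re_le_cmod abs_Im_le_cmod) auto
    finally show ?thesis by (simp add: h_def algebra_simps)
  qed
  ultimately show ?thesis by blast
qed

lemma Phi_mult_real:
  assumes "planar_body M" "a > 0"
  shows "Phi k ((\<lambda>z. a *\<^sub>R z) ` M) = of_real a * Phi k M"
  using Phi_mult[OF assms(1), of "of_real a" k] assms(2) by (simp add: scaleR_conv_of_real Arg_of_real)

text \<open>Nearby sections are comparable up to a factor near 1, because \<open>0\<close> is an interior point of \<open>K\<close>.\<close>
lemma continuous_Phi_frame:
  assumes n: "n \<ge> 3" and K: "K \<subseteq> Rn n" "compact K" "convex K" "e > 0" "cball 0 e \<inter> Rn n \<subseteq> K"
  shows "continuous_on S (\<lambda>p. Phi k {z. frame p z \<in> K})"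
  unfolding continuous_on_sequentially comp_def
proof (intro allI ballI impI)
  fix p q assume "q \<in> S" and "(\<forall>j. p j \<in> S) \<and> p \<longlonglongrightarrow> q"
  then obtain h where h: "h \<longlonglongrightarrow> 0" "\<And>j z. norm (frame (p j) z - frame q z) \<le> h j * cmod z"
    using continuous_frame_at[of p q] by blast
  define M where "M = (\<lambda>p. {z. frame p z \<in> K})"
  have body: "planar_body (M p)" for p unfolding M_def
    by (rule linear_section_planar_body[OF linear_frame inj_frame frame_Rn[OF n] K(2-5)])
  obtain R where R: "\<forall>y\<in>K. norm y \<le> R" using compact_imp_bounded[OF K(2)] by (auto simp: bounded_iff)
  have MR: "cmod z \<le> 2 * R" if "z \<in> M p" for z p using R norm_le_frame[of z p] that by (force simp: M_def)
  have "0 \<in> K" using K(4,5) subspace_0[OF subspace_Rn] by auto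
  then have R0: "R \<ge> 0" using R by force
  have h0: "h j \<ge> 0" for j using order_trans[OF norm_ge_zero h(2)[of j 1]] by simp
  \<comment> \<open>A change of frame moves points of a section by at most
    \<open>h j * (2 * R)\<close>. Since the ball of radius \<open>e\<close> lies in
    \<open>K\<close>, this displacement is \<open>\<eta> j\<close> times a point of
    \<open>K\<close>.\<close>
  define \<eta> where "\<eta> = (\<lambda>j. h j * (2 * R) / e)"
  have eta: "\<eta> \<longlonglongrightarrow> 0 * (2 * R) / e" "\<eta> j \<ge> 0" for j
  proof -
    show "\<eta> \<longlonglongrightarrow> 0 * (2 * R) / e" unfolding \<eta>_def using K(4) by (intro tendsto_intros h) auto
    show "\<eta> j \<ge> 0" unfolding \<eta>_def using h0[of j] R0 K(4) by (intro divide_nonneg_pos mult_nonneg_nonneg) auto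
  qed
  have shift: "x \<in> (\<lambda>z. (1 + \<eta> j) *\<^sub>R z) ` M r'" if x: "x \<in> M r" and d: "norm (frame r x - frame r' x) \<le> h j * cmod x" for x r r' j
  proof -
    let ?y = "frame r' x - frame r x"
    have "norm ?y \<le> h j * (2 * R)" using d mult_left_mono[OF MR[OF x] h0[of j]] by (simp add: norm_minus_commute)
    then have "\<exists>y\<in>K. ?y = \<eta> j *\<^sub>R y"
    proof (cases "\<eta> j = 0")
      case True
      then have "h j * (2 * R) = 0" using K(4) by (simp add: \<eta>_def)
      then show ?thesis using \<open>norm ?y \<le> h j * (2 * R)\<close> \<open>0 \<in> K\<close> by auto
    next
      case False
      then have ep: "\<eta> j > 0" using eta(2)[of j] by simp
      have "norm ?y \<le> e * \<eta> j" using \<open>norm ?y \<le> h j * (2 * R)\<close> K(4) by (simp add: \<eta>_def)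
      then have "norm ((1 / \<eta> j) *\<^sub>R ?y) \<le> e" using ep by (simp add: pos_divide_le_eq)
      moreover have "(1 / \<eta> j) *\<^sub>R ?y \<in> Rn n" by (intro subspace_scale subspace_diff subspace_Rn frame_Rn n)
      ultimately have "(1 / \<eta> j) *\<^sub>R ?y \<in> K" using K(5) by auto
      then show ?thesis using ep by (intro bexI[of _ "(1 / \<eta> j) *\<^sub>R ?y"]) auto
    qed
    then obtain y where y: "y \<in> K" "?y = \<eta> j *\<^sub>R y" by blast
    have p: "1 + \<eta> j > 0" using eta(2)[of j] by linarith
    have "(1 / (1 + \<eta> j)) *\<^sub>R frame r x + (\<eta> j / (1 + \<eta> j)) *\<^sub>R y \<in> K"
      using x y p eta(2)[of j] by (intro convexD[OF K(3)]) (auto simp: M_def add_divide_distrib[symmetric])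
    also have "(1 / (1 + \<eta> j)) *\<^sub>R frame r x + (\<eta> j / (1 + \<eta> j)) *\<^sub>R y = (1 / (1 + \<eta> j)) *\<^sub>R (frame r x + \<eta> j *\<^sub>R y)"
      by (simp add: scaleR_right_distrib)
    also have "frame r x + \<eta> j *\<^sub>R y = frame r' x" unfolding y(2)[symmetric] by simp
    also have "(1 / (1 + \<eta> j)) *\<^sub>R frame r' x = frame r' ((1 / (1 + \<eta> j)) *\<^sub>R x)" by (rule linear_scale[OF linear_frame, symmetric])
    finally have "(1 / (1 + \<eta> j)) *\<^sub>R x \<in> M r'" by (simp add: M_def)
    then show ?thesis using p by (intro image_eqI[of _ _ "(1 / (1 + \<eta> j)) *\<^sub>R x"]) auto
  qed
  \<comment> \<open>The nearby section is enlarged so that it contains \<open>M q\<close>, as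
    \<open>tendsto_Phi\<close> requires; it still lies in \<open>(1 + \<eta> j)\<^sup>2\<close>
    times \<open>M q\<close>. The factor is removed afterwards by
    \<open>Phi_mult_real\<close>.\<close>
  define N where "N = (\<lambda>j. (\<lambda>z. (1 + \<eta> j) *\<^sub>R z) ` M (p j))"
  have pos: "1 + \<eta> j > 0" for j using eta(2)[of j] by linarith
  have "(\<lambda>j. Phi k (N j)) \<longlonglongrightarrow> Phi k (M q)"
  proof (rule tendsto_Phi[OF body])
    show "planar_body (N j)" for j
      unfolding N_def using planar_body_affine[of "\<lambda>z. (1 + \<eta> j) *\<^sub>R z" "M (p j)" 0] pos[of j] body[of "p j"]
      by (auto simp: inj_def intro!: linearI scaleR_right_distrib)
    show "M q \<subseteq> N j" for j unfolding N_def using shift[of _ q "p j" j] h(2)[of j] by (auto simp: norm_minus_commute)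
    show "N j \<subseteq> (\<lambda>x. ((1 + \<eta> j) * (1 + \<eta> j)) *\<^sub>R x) ` M q" for j
    proof
      fix x assume "x \<in> N j"
      then obtain y where y: "y \<in> M (p j)" "x = (1 + \<eta> j) *\<^sub>R y" by (auto simp: N_def)
      obtain z where z: "z \<in> M q" "y = (1 + \<eta> j) *\<^sub>R z" using shift[OF y(1) h(2)] by blast
      show "x \<in> (\<lambda>x. ((1 + \<eta> j) * (1 + \<eta> j)) *\<^sub>R x) ` M q" using y z by (intro image_eqI[of _ _ z]) auto
    qed
    show "1 \<le> (1 + \<eta> j) * (1 + \<eta> j)" for j using eta(2)[of j] by (simp add: algebra_simps)
    have "(\<lambda>j. (1 + \<eta> j) * (1 + \<eta> j)) \<longlonglongrightarrow> (1 + 0 * (2 * R) / e) * (1 + 0 * (2 * R) / e)" by (intro tendsto_intros eta)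
    then show "(\<lambda>j. (1 + \<eta> j) * (1 + \<eta> j)) \<longlonglongrightarrow> 1" by simp
  qed
  moreover have "(\<lambda>j. complex_of_real (1 + \<eta> j)) \<longlonglongrightarrow> of_real (1 + 0 * (2 * R) / e)" by (intro tendsto_intros eta)
  ultimately have "(\<lambda>j. Phi k (N j) / of_real (1 + \<eta> j)) \<longlonglongrightarrow> Phi k (M q) / of_real (1 + 0 * (2 * R) / e)"
    by (rule tendsto_divide) simp
  moreover have "Phi k (N j) / of_real (1 + \<eta> j) = Phi k (M (p j))" for j
  proof -
    have "Phi k (N j) = of_real (1 + \<eta> j) * Phi k (M (p j))" unfolding N_def by (rule Phi_mult_real[OF body pos])
    moreover have "complex_of_real (1 + \<eta> j) \<noteq> 0" unfolding of_real_eq_0_iff using pos[of j] by linarith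
    ultimately show ?thesis by (metis nonzero_mult_div_cancel_left)
  qed
  ultimately have "(\<lambda>j. Phi k (M (p j))) \<longlonglongrightarrow> Phi k (M q)" by simp
  then show "(\<lambda>j. Phi k {z. frame (p j) z \<in> K}) \<longlonglongrightarrow> Phi k {z. frame q z \<in> K}" by (simp add: M_def)
qed

theorem exists_Phi_zero_section:
  assumes n: "n \<ge> 3" and K: "K \<subseteq> Rn n" "compact K" "convex K" "e > 0" "cball 0 e \<inter> Rn n \<subseteq> K" and k: "k \<ge> 1"
  shows "\<exists>p. Phi k {z. frame p z \<in> K} = 0"
proof -
  define v where "v = (\<lambda>p. Phi k {z. frame p z \<in> K})"
  have body: "planar_body {z. frame p z \<in> K}" for p
    by (rule linear_section_planar_body[OF linear_frame inj_frame frame_Rn[OF n] K(2-5)])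
  \<comment> \<open>Turning the parameter by \<open>cis t\<close> turns the section by
    \<open>cis (- t)\<close>. On the two horizontal edges this yields opposite phases.\<close>
  have turn: "Phi k {z. frame p (cis t * z) \<in> K} = cis (real k * t) * v p" for p t
  proof -
    have "{z. frame p (cis t * z) \<in> K} = (\<lambda>z. cis (- t) * z) ` {z. frame p z \<in> K}"
    proof (intro equalityI subsetI)
      fix z assume "z \<in> {z. frame p (cis t * z) \<in> K}"
      then show "z \<in> (\<lambda>z. cis (- t) * z) ` {z. frame p z \<in> K}"
        by (intro image_eqI[of _ _ "cis t * z"]) (auto simp: cis_mult mult.assoc[symmetric])
    qed (auto simp: cis_mult mult.assoc[symmetric])
    then show ?thesis unfolding v_def using Phi_mult[OF body[of p], of "cis (- t)" k]
      by (simp only: cis_minus_nat_Arg_cis) simp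
  qed
  have "\<exists>x\<in>{0..2*pi} \<times> {0..pi}. v x = 0"
  proof (rule winding_zero[OF _ k])
    show "continuous_on ({0..2*pi} \<times> {0..pi}) v" unfolding v_def by (rule continuous_Phi_frame[OF n K])
    show "v (t, 0) = cis (- real k * t) * v (0, 0)" for t using turn[of "(0,0)" "- t"] by (simp add: v_def frame_bot[of t])
    show "v (t, pi) = cis (real k * t) * v (0, pi)" for t using turn[of "(0,pi)" t] by (simp add: v_def frame_top[of t])
    show "v (2 * pi, s) = v (0, s)" for s by (simp add: v_def frame_side)
  qed
  then show ?thesis by (auto simp: v_def)
qed

section \<open>From the Banach-Mazur distance of sections to planar bodies\<close>

lemma pair_parametrization:
  fixes b c :: "'a::real_vector"
  assumes b: "b \<noteq> 0" and c: "\<And>k. c \<noteq> k *\<^sub>R b"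
  shows "linear (\<lambda>z. Re z *\<^sub>R b + Im z *\<^sub>R c)" and "inj (\<lambda>z. Re z *\<^sub>R b + Im z *\<^sub>R c)"
proof -
  show L: "linear (\<lambda>z. Re z *\<^sub>R b + Im z *\<^sub>R c)" by (intro linearI) (simp_all add: algebra_simps)
  show "inj (\<lambda>z. Re z *\<^sub>R b + Im z *\<^sub>R c)" unfolding linear_injective_0[OF L]
  proof (intro allI impI)
    fix z assume z: "Re z *\<^sub>R b + Im z *\<^sub>R c = 0"
    have I: "Im z = 0"
    proof (rule ccontr)
      assume i: "Im z \<noteq> 0"
      have "c = (1 / Im z) *\<^sub>R (Im z *\<^sub>R c)" using i by simp
      also have "Im z *\<^sub>R c = - (Re z *\<^sub>R b)" using z by (simp add: eq_neg_iff_add_eq_0 add.commute)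
      finally have "c = (- (Re z / Im z)) *\<^sub>R b" by simp
      then show False using c by blast
    qed
    then have "Re z = 0" using z b by simp
    then show "z = 0" using I by (simp add: complex_eq_iff)
  qed
qed

text \<open>In the degenerate cases, \<open>x = 0\<close> or \<open>y\<close> parallel to
  \<open>x\<close>, a unit vector replaces the missing direction; two unit vectors cannot both be
  multiples of \<open>b\<close>.\<close>

lemma plane_through:
  assumes n: "n \<ge> 2" and x: "x \<in> Rn n" and y: "y \<in> Rn n"
  shows "\<exists>A :: complex \<Rightarrow> _. linear A \<and> inj A \<and> range A \<subseteq> Rn n \<and> x \<in> range A \<and> y \<in> range A"
proof -
  have u: "unit_pm 0 \<in> Rn n" "unit_pm 1 \<in> Rn n" by (rule unit_pm_Rn; use n in linarith)+
  have u0: "unit_pm 0 \<noteq> 0" by (metis lookup_single_eq lookup_zero zero_neq_one)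
  define b where "b = (if x \<noteq> 0 then x else unit_pm 0)"
  have b: "b \<noteq> 0" "b \<in> Rn n" using u u0 x by (auto simp: b_def)
  have xb: "\<exists>k. x = k *\<^sub>R b"
  proof (cases "x = 0")
    case True then show ?thesis by (intro exI[of _ 0]) simp
  next
    case False then show ?thesis by (intro exI[of _ 1]) (simp add: b_def)
  qed
  have "\<exists>c\<in>Rn n. (\<forall>k. c \<noteq> k *\<^sub>R b) \<and> ((\<exists>k. y = k *\<^sub>R b) \<or> y = c)"
  proof (cases "\<exists>k. y = k *\<^sub>R b")
    case True
    have "\<exists>c\<in>Rn n. \<forall>k. c \<noteq> k *\<^sub>R b"
    proof (rule ccontr)
      assume "\<not> ?thesis"
      then obtain k l where kl: "unit_pm 0 = k *\<^sub>R b" "unit_pm 1 = l *\<^sub>R b" using u by meson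
      then have "1 = k * Poly_Mapping.lookup b 0" "0 = l * Poly_Mapping.lookup b 0" "1 = l * Poly_Mapping.lookup b 1"
        by (metis lookup_scaleR_pm lookup_single_eq, metis lookup_scaleR_pm lookup_single_not_eq zero_neq_one, metis lookup_scaleR_pm lookup_single_eq)
      then show False by (metis mult_eq_0_iff zero_neq_one)
    qed
    then show ?thesis using True by blast
  next
    case False then show ?thesis using y by blast
  qed
  then obtain c where c: "c \<in> Rn n" "\<And>k. c \<noteq> k *\<^sub>R b" "(\<exists>k. y = k *\<^sub>R b) \<or> y = c" by blast
  let ?A = "\<lambda>z. Re z *\<^sub>R b + Im z *\<^sub>R c"
  have k: "k *\<^sub>R b \<in> range ?A" for k by (rule range_eqI[of _ _ "of_real k"]) simp
  have "c \<in> range ?A" by (rule range_eqI[of _ _ \<i>]) simp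
  then have "y \<in> range ?A" using c(3) k by metis
  moreover have "x \<in> range ?A" using xb k by metis
  moreover have "range ?A \<subseteq> Rn n" by (auto intro!: subspace_add subspace_scale subspace_Rn b c)
  ultimately show ?thesis using pair_parametrization[OF b(1) c(2)] by (intro exI[of _ ?A]) simp
qed

lemma subspace_dim_range:
  fixes A :: "complex \<Rightarrow> 'a::real_vector"
  assumes A: "linear A" "inj A"
  shows "subspace (range A)" and "dim (range A) = 2"
proof -
  show "subspace (range A)" by (rule linear_subspace_image[OF A(1) subspace_UNIV])
  have "dim (A ` UNIV) = dim (UNIV :: complex set)"
    by (rule dim_image_eq[OF A(1)]) (use A(2) in auto)
  then show "dim (range A) = 2" by simp
qed

lemma linear_of_affine:
  fixes f :: "'a::real_vector \<Rightarrow> 'b::real_vector"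
  assumes f: "\<And>x y t. f ((1 - t) *\<^sub>R x + t *\<^sub>R y) = (1 - t) *\<^sub>R f x + t *\<^sub>R f y" and 0: "f 0 = 0"
  shows "linear f"
proof (rule linearI)
  show s: "f (t *\<^sub>R x) = t *\<^sub>R f x" for t x using f[of t 0 x] 0 by simp
  show "f (x + y) = f x + f y" for x y
    using f[of "1/2" "2 *\<^sub>R x" "2 *\<^sub>R y"] by (simp add: s)
qed

lemma linear_inj_of_image_superset:
  fixes L :: "complex \<Rightarrow> complex"
  assumes M: "planar_body M" and L: "linear L" and sub: "M \<subseteq> (\<lambda>x. L x + d) ` N"
  shows "inj L"
proof -
  obtain w r R where r: "r > 0" "cball w r \<subseteq> M" "M \<subseteq> cball 0 R" using planar_body_balls[OF M] .
  have range: "e \<in> range L" if "cmod e = 1" for e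
  proof -
    have "w \<in> M" "w + of_real r * e \<in> M" using r that by (auto intro!: subsetD[OF r(2)] simp: dist_norm norm_mult)
    then obtain a b where ab: "w = L a + d" "w + of_real r * e = L b + d" using sub by (meson imageE subsetD)
    then have "r *\<^sub>R e = L b - L a" by (simp add: scaleR_conv_of_real algebra_simps)
    then have "(1 / r) *\<^sub>R (r *\<^sub>R e) = (1 / r) *\<^sub>R L (b - a)" by (simp only: linear_diff[OF L])
    then have "e = (1 / r) *\<^sub>R L (b - a)" using r(1) by simp
    also have "\<dots> = L ((1 / r) *\<^sub>R (b - a))" by (rule linear_scale[OF L, symmetric])
    finally show ?thesis by blast
  qed
  obtain a b where ab: "1 = L a" "\<i> = L b" using range[of 1] range[of \<i>] by auto
  have "surj L"
  proof (rule surjI)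
    show "L (Re z *\<^sub>R a + Im z *\<^sub>R b) = z" for z
      by (simp add: linear_add[OF L] linear_scale[OF L] complex_eq_iff flip: ab)
  qed
  then show ?thesis using linear_surjective_imp_injective[OF L] by simp
qed

lemma planar_comparison_of_banach_mazur_dist:
  fixes A B :: "complex \<Rightarrow> 'a::real_normed_vector"
  assumes A: "linear A" "inj A" "range A \<subseteq> V" and B: "linear B" "inj B" "range B \<subseteq> V"
    and K: "compact K" "convex K" "e > 0" "cball 0 e \<inter> V \<subseteq> K"
    and dist: "banach_mazur_dist (range A) (K \<inter> range A) (range B) (K \<inter> range B) < 1 + \<delta>"
  shows "\<exists>L d l z. linear L \<and> inj L \<and> 0 < l \<and> l < 1 + \<delta> \<and>
    {z. A z \<in> K} \<subseteq> (\<lambda>x. L x + d) ` {z. B z \<in> K} \<and> (\<lambda>x. L x + d) ` {z. B z \<in> K} \<subseteq> (\<lambda>x. l *\<^sub>R x + z) ` {z. A z \<in> K}"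
proof -
  define M where "M = {z. A z \<in> K}"
  define N where "N = {z. B z \<in> K}"
  have body: "planar_body M" "planar_body N" unfolding M_def N_def
    using linear_section_planar_body[OF A(1,2) _ K] linear_section_planar_body[OF B(1,2) _ K] A(3) B(3) by blast+
  have AM: "K \<inter> range A = A ` M" and BN: "K \<inter> range B = B ` N" by (auto simp: M_def N_def)
  have iA: "inv A (A x) = x" for x using A(2) by simp
  have iB: "inv B (B x) = x" for x using B(2) by simp
  define S where "S = {l. l > 0 \<and> (\<exists>T z. affine_map_between (range B) (range A) T \<and> z \<in> range A \<and>
    K \<inter> range A \<subseteq> T ` (K \<inter> range B) \<and> T ` (K \<inter> range B) \<subseteq> (\<lambda>x. l *\<^sub>R x + z) ` (K \<inter> range A))}"
  \<comment> \<open>A bound on \<open>Inf S\<close> yields a member of \<open>S\<close> only if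
    \<open>S\<close> is nonempty. Both sections lie between discs of radii \<open>r\<close> and
    \<open>R\<close> about 0, so scaling by \<open>R / r\<close> in plane coordinates is a
    witness.\<close>
  have "S \<noteq> {}"
  proof -
    have round: "\<exists>r>0. cball 0 r \<subseteq> {z. G z \<in> K}" if G: "linear G" "range G \<subseteq> V" for G :: "complex \<Rightarrow> 'a"
    proof -
      obtain C where C: "C > 0" "\<And>x. norm (G x) \<le> norm x * C"
        using bounded_linear.pos_bounded[of G] G(1) by (auto simp: linear_linear)
      have "G z \<in> K" if "cmod z \<le> e / C" for z
      proof -
        have "norm (G z) \<le> e" using C(2)[of z] that C(1) by (simp add: pos_le_divide_eq)
        then show ?thesis using K(4) G(2) by (auto simp: image_subset_iff)
      qed
      then show ?thesis using C(1) K(3) by (intro exI[of _ "e / C"]) auto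
    qed
    obtain r1 r2 where r12: "r1 > 0" "cball 0 r1 \<subseteq> M" "r2 > 0" "cball 0 r2 \<subseteq> N"
      using round[OF A(1,3)] round[OF B(1,3)] unfolding M_def N_def by blast
    define r where "r = min r1 r2"
    have r: "r > 0" "cball 0 r \<subseteq> M" "cball 0 r \<subseteq> N" using r12 by (auto simp: r_def)
    obtain w1 s1 R1 w2 s2 R2 where "M \<subseteq> cball 0 R1" "N \<subseteq> cball 0 R2"
      using planar_body_balls[OF body(1)] planar_body_balls[OF body(2)] by metis
    define R where "R = max 1 (max R1 R2)"
    have R: "M \<subseteq> cball 0 R" "N \<subseteq> cball 0 R" "R > 0"
      using \<open>M \<subseteq> cball 0 R1\<close> \<open>N \<subseteq> cball 0 R2\<close> by (auto simp: R_def)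
    define t where "t = R / r"
    have t: "t > 0" using r R by (simp add: t_def)
    have big: "(1 / t) *\<^sub>R x \<in> cball 0 r" if "cmod x \<le> R" for x :: complex
      using that R(3) r(1) by (simp add: t_def field_simps)
    define T where "T = (\<lambda>x. A (t *\<^sub>R inv B x))"
    have TB: "T (B x) = A (t *\<^sub>R x)" for x by (simp add: T_def iB)
    have "affine_map_between (range B) (range A) T" unfolding affine_map_between_def
    proof (intro conjI ballI allI)
      show "T ` range B \<subseteq> range A" by (auto simp: T_def)
      fix x y s assume "x \<in> range B" "y \<in> range B"
      then obtain a b where ab: "x = B a" "y = B b" by blast
      have "(1 - s) *\<^sub>R x + s *\<^sub>R y = B ((1 - s) *\<^sub>R a + s *\<^sub>R b)" unfolding ab by (simp add: linear_add[OF B(1)] linear_scale[OF B(1)])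
      then have "T ((1 - s) *\<^sub>R x + s *\<^sub>R y) = A (t *\<^sub>R ((1 - s) *\<^sub>R a + s *\<^sub>R b))" by (simp only: TB)
      also have "\<dots> = (1 - s) *\<^sub>R T x + s *\<^sub>R T y"
        unfolding ab TB by (simp add: linear_add[OF A(1)] linear_scale[OF A(1)] scaleR_right_distrib mult.commute)
      finally show "T ((1 - s) *\<^sub>R x + s *\<^sub>R y) = (1 - s) *\<^sub>R T x + s *\<^sub>R T y" .
    qed
    moreover have "K \<inter> range A \<subseteq> T ` (K \<inter> range B)" unfolding AM BN
    proof
      fix y assume "y \<in> A ` M"
      then obtain x where x: "x \<in> M" "y = A x" by blast
      have "cmod x \<le> R" using R(1) x(1) by auto
      then have "(1 / t) *\<^sub>R x \<in> N" using big r(3) by blast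
      moreover have "y = T (B ((1 / t) *\<^sub>R x))" using t x(2) by (simp add: TB)
      ultimately show "y \<in> T ` B ` N" by blast
    qed
    moreover have "T ` (K \<inter> range B) \<subseteq> (\<lambda>x. (t * t) *\<^sub>R x + 0) ` (K \<inter> range A)" unfolding AM BN
    proof
      fix y assume "y \<in> T ` B ` N"
      then obtain x where x: "x \<in> N" "y = A (t *\<^sub>R x)" by (auto simp: TB)
      have "cmod x \<le> R" using R(2) x(1) by auto
      then have "(1 / t) *\<^sub>R x \<in> M" using big r(2) by blast
      moreover have "y = (t * t) *\<^sub>R A ((1 / t) *\<^sub>R x) + 0" using t x(2) by (simp add: linear_scale[OF A(1)])
      ultimately show "y \<in> (\<lambda>x. (t * t) *\<^sub>R x + 0) ` A ` M" by blast
    qed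
    moreover have "0 \<in> range A" using linear_0[OF A(1)] by (metis rangeI)
    ultimately have "t * t \<in> S" using t unfolding S_def mem_Collect_eq by (intro conjI exI[of _ T] exI[of _ 0]) auto
    then show ?thesis by blast
  qed
  moreover have "Inf S < 1 + \<delta>" using dist by (simp add: banach_mazur_dist_def S_def)
  ultimately obtain l where l: "l \<in> S" "l < 1 + \<delta>" by (rule cInf_lessD[elim_format]) blast
  obtain T z where l0: "l > 0" and T: "affine_map_between (range B) (range A) T" and z: "z \<in> range A"
    and s1: "A ` M \<subseteq> T ` B ` N" and s2: "T ` B ` N \<subseteq> (\<lambda>x. l *\<^sub>R x + z) ` A ` M"
    using l(1) unfolding S_def AM BN by blast
  obtain z' where z': "z = A z'" using z by blast
  \<comment> \<open>The affine map between the two planes, read in the parametrizations;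
    \<open>A\<close> is injective, so the inclusions carry over.\<close>
  define P where "P = (\<lambda>x. inv A (T (B x)))"
  have AP: "A (P x) = T (B x)" for x
    unfolding P_def by (rule f_inv_into_f) (use T in \<open>auto simp: affine_map_between_def\<close>)
  have P: "P ((1 - t) *\<^sub>R x + t *\<^sub>R y) = (1 - t) *\<^sub>R P x + t *\<^sub>R P y" for x y t
  proof (rule injD[OF A(2)])
    have "A (P ((1 - t) *\<^sub>R x + t *\<^sub>R y)) = T ((1 - t) *\<^sub>R B x + t *\<^sub>R B y)"
      unfolding AP by (simp add: linear_add[OF B(1)] linear_scale[OF B(1)])
    also have "\<dots> = (1 - t) *\<^sub>R T (B x) + t *\<^sub>R T (B y)" using T by (simp add: affine_map_between_def)
    also have "\<dots> = A ((1 - t) *\<^sub>R P x + t *\<^sub>R P y)" by (simp add: linear_add[OF A(1)] linear_scale[OF A(1)] AP)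
    finally show "A (P ((1 - t) *\<^sub>R x + t *\<^sub>R y)) = A ((1 - t) *\<^sub>R P x + t *\<^sub>R P y)" .
  qed
  define L where "L = (\<lambda>x. P x - P 0)"
  have L: "linear L"
    by (rule linear_of_affine) (simp_all only: L_def P, simp_all add: algebra_simps)
  have Peq: "L x + P 0 = P x" for x by (simp add: L_def)
  have 1: "M \<subseteq> (\<lambda>x. L x + P 0) ` N"
  proof
    fix x assume "x \<in> M"
    then obtain y where y: "y \<in> N" "A x = T (B y)" using s1 by blast
    then have "x = P y" using injD[OF A(2)] by (simp flip: AP)
    then show "x \<in> (\<lambda>x. L x + P 0) ` N" using y(1) unfolding Peq by blast
  qed
  have 2: "(\<lambda>x. L x + P 0) ` N \<subseteq> (\<lambda>x. l *\<^sub>R x + z') ` M"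
  proof
    fix x assume "x \<in> (\<lambda>x. L x + P 0) ` N"
    then obtain y where y: "y \<in> N" "x = P y" unfolding Peq by blast
    then have "T (B y) \<in> (\<lambda>x. l *\<^sub>R x + z) ` A ` M" using s2 by blast
    then obtain u where u: "u \<in> M" "A x = l *\<^sub>R A u + z" using y(2) by (auto simp: AP)
    have "A x = A (l *\<^sub>R u + z')" unfolding u(2) z' by (simp add: linear_add[OF A(1)] linear_scale[OF A(1)])
    then have "x = l *\<^sub>R u + z'" by (rule injD[OF A(2)])
    then show "x \<in> (\<lambda>x. l *\<^sub>R x + z') ` M" using u(1) by blast
  qed
  have "inj L" by (rule linear_inj_of_image_superset[OF body(1) L 1])
  then show ?thesis using L l0 l(2) 1 2 unfolding M_def N_def by blast
qed

text \<open>For \<open>n \<le> B\<close> the constant \<open>B ^ B\<close> suffices; for larger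
  \<open>n\<close>, \<open>B ^ n \<le> n ^ n\<close>, which is below the superexponential
  factor.\<close>

lemma power_le_const_mult_self_power:
  assumes "B \<ge> (1::nat)" "n \<ge> (1::nat)"
  shows "real B ^ n \<le> real B ^ B * real n ^ (2 * n\<^sup>2)"
proof (cases "n \<le> B")
  case True
  have "real B ^ n \<le> real B ^ B" using True assms by (intro power_increasing) auto
  also have "\<dots> \<le> real B ^ B * real n ^ (2 * n\<^sup>2)" using assms by (simp add: mult_le_cancel_left1)
  finally show ?thesis .
next
  case False
  have "real B ^ n \<le> real n ^ n" using False by (intro power_mono) auto
  also have "\<dots> \<le> real n ^ (2 * n\<^sup>2)" using assms by (intro power_increasing) (auto simp: power2_eq_square)
  also have "\<dots> \<le> real B ^ B * real n ^ (2 * n\<^sup>2)" using assms by (simp add: mult_le_cancel_right1)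
  finally show ?thesis .
qed

lemma constant_bound:
  "\<exists>D>0. \<forall>n\<ge>1. 10^9 * (4 * (real n)\<^sup>2 * 2 ^ n) ^ 6 * real n * 18 ^ n \<le> D * real n ^ (2 * n\<^sup>2)"
proof -
  \<comment> \<open>The 13 factors n, twelve from the sixth power of n^2 and one more, are each
    bounded by \<open>2 ^ n\<close>; with the six factors \<open>2 ^ n\<close> already present this
    makes 19.\<close>
  define B :: nat where "B = 2 ^ 19 * 18"
  have B: "B \<ge> 1" by (simp add: B_def)
  define D where "D = 10^9 * 4^6 * real B ^ B"
  have "D > 0" unfolding D_def using B by (intro mult_pos_pos zero_less_power) auto
  moreover have "10^9 * (4 * (real n)\<^sup>2 * 2 ^ n) ^ 6 * real n * 18 ^ n \<le> D * real n ^ (2 * n\<^sup>2)" if n: "n \<ge> 1" for n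
  proof -
    have "real n \<le> 2 ^ n" using of_nat_mono[OF less_imp_le[OF less_exp[of n]], where 'a = real] by simp
    then have n13: "real n ^ 13 \<le> (2 ^ n) ^ 13" by (intro power_mono) auto
    have "10^9 * (4 * (real n)\<^sup>2 * 2 ^ n) ^ 6 * real n * 18 ^ n = 10^9 * 4^6 * (real n ^ 13 * (2 ^ n) ^ 6 * 18 ^ n)"
      by (simp add: power_mult_distrib eval_nat_numeral)
    also have "\<dots> \<le> 10^9 * 4^6 * ((2 ^ n) ^ 13 * (2 ^ n) ^ 6 * 18 ^ n)"
      using n13 by (intro mult_left_mono mult_right_mono) auto
    also have "(2 ^ n :: real) ^ 13 * (2 ^ n) ^ 6 * 18 ^ n = (2 ^ 19) ^ n * 18 ^ n"
      by (simp only: power_add[symmetric] power_mult[symmetric]) (simp add: mult.commute)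
    also have "\<dots> = real B ^ n" by (simp add: B_def flip: power_mult_distrib)
    also have "10^9 * 4^6 * real B ^ n \<le> 10^9 * 4^6 * (real B ^ B * real n ^ (2 * n\<^sup>2))"
      using power_le_const_mult_self_power[OF B n] by (intro mult_left_mono) auto
    also have "\<dots> = D * real n ^ (2 * n\<^sup>2)" by (simp only: D_def mult.assoc)
    finally show ?thesis .
  qed
  ultimately show ?thesis by blast
qed

theorem theorem1p8:
  shows "\<exists>c::real. c > 0 \<and>
    (\<forall>(n::nat) (\<delta>::real) (K :: (nat \<Rightarrow>\<^sub>0 real) set).
       n \<ge> 3 \<longrightarrow> \<delta> > 0 \<longrightarrow>
       convex_body_in (Rn n) K \<longrightarrow> 0 \<in> interior_in (Rn n) K \<longrightarrow>
       (\<forall>E F. subspace E \<and> E \<subseteq> Rn n \<and> dim E = 2 \<and> subspace F \<and> F \<subseteq> Rn n \<and> dim F = 2 \<longrightarrow>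
          banach_mazur_dist E (K \<inter> E) F (K \<inter> F) < 1 + \<delta>) \<longrightarrow>
       banach_mazur_dist (Rn n) K (Rn n) (euclidean_unit_ball n)
         < 1 + c * real n ^ (2 * n\<^sup>2) * \<delta> powr (1/6))"
proof -
  obtain C where C: "C > 0" and planar: "\<And>M \<delta>. planar_body M \<Longrightarrow> \<delta> > 0 \<Longrightarrow>
     (\<forall>k\<ge>1. \<exists>N L d l z. planar_body N \<and> Phi k N = 0 \<and> linear L \<and> inj L \<and> 0 < l \<and> l < 1 + \<delta> \<and>
        M \<subseteq> (\<lambda>x. L x + d) ` N \<and> (\<lambda>x. L x + d) ` N \<subseteq> (\<lambda>x. l *\<^sub>R x + z) ` M) \<Longrightarrow>
     (\<exists>(A :: complex \<Rightarrow> complex) \<zeta>. linear A \<and> inj A \<and> (\<forall>w. norm (w + \<zeta>) \<le> 1 \<longrightarrow> A w \<in> M) \<and>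
        (\<forall>w. A w \<in> M \<longrightarrow> norm (w + \<zeta>) \<le> 1 + C * sqrt \<delta>))"
    using nearly_elliptic_of_Phi_zeros by blast
  obtain D where D: "D > 0" "\<And>n. n \<ge> 1 \<Longrightarrow> 10^9 * (4 * (real n)\<^sup>2 * 2 ^ n) ^ 6 * real n * 18 ^ n \<le> D * real n ^ (2 * n\<^sup>2)"
    using constant_bound by blast
  define C' where "C' = C powr (1/3)"
  have C': "C' > 0" using C by (simp add: C'_def)
  \<comment> \<open>The additional 1 makes the final inequality strict.\<close>
  define c where "c = D * C' + 1"
  have "c > 0" using D C' by (simp add: c_def add_pos_pos)
  moreover have "banach_mazur_dist (Rn n) K (Rn n) (euclidean_unit_ball n) < 1 + c * real n ^ (2 * n\<^sup>2) * \<delta> powr (1/6)"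
    if n: "n \<ge> 3" and \<delta>: "\<delta> > 0" and K: "convex_body_in (Rn n) K" and 0: "0 \<in> interior_in (Rn n) K"
      and H: "\<forall>E F. subspace E \<and> E \<subseteq> Rn n \<and> dim E = 2 \<and> subspace F \<and> F \<subseteq> Rn n \<and> dim F = 2 \<longrightarrow>
          banach_mazur_dist E (K \<inter> E) F (K \<inter> F) < 1 + \<delta>" for n \<delta> and K :: "(nat \<Rightarrow>\<^sub>0 real) set"
  proof -
    have K': "K \<subseteq> Rn n" "compact K" "convex K" using K by (auto simp: convex_body_in_def)
    obtain r where r: "r > 0" "cball 0 r \<inter> Rn n \<subseteq> K" using zero_interior_ball[OF 0] by blast
    \<comment> \<open>Chosen so that \<open>e ^ 3\<close> is the planar error
      \<open>C * sqrt \<delta>\<close>; this is where the sixth root appears.\<close>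
    define e where "e = C' * \<delta> powr (1/6)"
    have e: "e > 0" using C' \<delta> by (simp add: e_def)
    have e3: "e ^ 3 = C * sqrt \<delta>"
    proof -
      have "C' ^ 3 = C" unfolding C'_def using C by (simp add: powr_power)
      moreover have "(\<delta> powr (1/6)) ^ 3 = sqrt \<delta>" using \<delta> by (simp add: powr_power powr_half_sqrt)
      ultimately show ?thesis by (simp add: e_def power_mult_distrib)
    qed
    have "nearly_elliptic_sections n K (e ^ 3)" unfolding nearly_elliptic_sections_def
    proof (intro ballI)
      fix x y assume "x \<in> Rn n" "y \<in> Rn n"
      then obtain A :: "complex \<Rightarrow> _" where A: "linear A" "inj A" "range A \<subseteq> Rn n" "x \<in> range A" "y \<in> range A"
        using plane_through[of n x y] n by auto
      have body: "planar_body {z. G z \<in> K}" if "linear G" "inj G" "range G \<subseteq> Rn n" for G :: "complex \<Rightarrow> _"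
        using linear_section_planar_body[OF that(1,2) _ K'(2,3) r] that(3) by blast
      have "\<exists>(A0 :: complex \<Rightarrow> complex) \<zeta>. linear A0 \<and> inj A0 \<and> (\<forall>w. norm (w + \<zeta>) \<le> 1 \<longrightarrow> A0 w \<in> {z. A z \<in> K}) \<and>
        (\<forall>w. A0 w \<in> {z. A z \<in> K} \<longrightarrow> norm (w + \<zeta>) \<le> 1 + C * sqrt \<delta>)"
      proof (rule planar[OF body[OF A(1-3)] \<delta>], intro allI impI)
        fix k :: nat assume "k \<ge> 1"
        then obtain p where p: "Phi k {z. frame p z \<in> K} = 0" using exists_Phi_zero_section[OF n K' r] by blast
        have fr: "range (frame p) \<subseteq> Rn n" using frame_Rn[OF n] by blast
        have "banach_mazur_dist (range A) (K \<inter> range A) (range (frame p)) (K \<inter> range (frame p)) < 1 + \<delta>"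
          using H A(3) fr subspace_dim_range[OF A(1,2)] subspace_dim_range[OF linear_frame inj_frame] by blast
        from planar_comparison_of_banach_mazur_dist[OF A(1-3) linear_frame inj_frame fr K'(2,3) r this]
        show "\<exists>N L d l z. planar_body N \<and> Phi k N = 0 \<and> linear L \<and> inj L \<and> 0 < l \<and> l < 1 + \<delta> \<and>
          {z. A z \<in> K} \<subseteq> (\<lambda>x. L x + d) ` N \<and> (\<lambda>x. L x + d) ` N \<subseteq> (\<lambda>x. l *\<^sub>R x + z) ` {z. A z \<in> K}"
          using body[OF linear_frame inj_frame fr] p by blast
      qed
      then obtain A0 :: "complex \<Rightarrow> complex" and \<zeta> where A0: "linear A0" "inj A0"
        "\<And>w. norm (w + \<zeta>) \<le> 1 \<Longrightarrow> A (A0 w) \<in> K" "\<And>w. A (A0 w) \<in> K \<Longrightarrow> norm (w + \<zeta>) \<le> 1 + C * sqrt \<delta>"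
        by auto
      \<comment> \<open>Precomposition with a bijection of the plane moves the ellipse to a unit
        disc without changing the range, which must still contain \<open>x\<close> and
        \<open>y\<close>.\<close>
      have "surj A0" using linear_injective_imp_surjective[OF A0(1,2)] by simp
      then have "range (A \<circ> A0) = range A" by (metis image_comp)
      then show "\<exists>(A :: complex \<Rightarrow> _) \<zeta>. linear A \<and> inj A \<and> range A \<subseteq> Rn n \<and> x \<in> range A \<and> y \<in> range A \<and>
          (\<forall>w. norm (w + \<zeta>) \<le> 1 \<longrightarrow> A w \<in> K) \<and> (\<forall>w. A w \<in> K \<longrightarrow> norm (w + \<zeta>) \<le> 1 + e ^ 3)"
        using A A0 linear_compose[OF A0(1) A(1)] inj_compose[OF A(2) A0(2)] unfolding e3
        by (intro exI[of _ "A \<circ> A0"] exI[of _ \<zeta>]) simp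
    qed
    then have "banach_mazur_dist (Rn n) K (Rn n) (euclidean_unit_ball n)
        \<le> 1 + 10^9 * (4 * (real n)\<^sup>2 * 2 ^ n) ^ 6 * real n * 18 ^ n * e"
      using n K' r e by (intro banach_mazur_dist_of_nearly_elliptic_sections) auto
    also have "\<dots> \<le> 1 + D * real n ^ (2 * n\<^sup>2) * e" using D(2)[of n] n e by simp
    also have "\<dots> = 1 + D * C' * (real n ^ (2 * n\<^sup>2) * \<delta> powr (1/6))" by (simp add: e_def)
    also have "\<dots> < 1 + c * (real n ^ (2 * n\<^sup>2) * \<delta> powr (1/6))"
      unfolding c_def using n \<delta> by (intro add_strict_left_mono mult_strict_right_mono mult_pos_pos) auto
    finally show ?thesis by (simp add: mult.assoc)
  qed
  ultimately show ?thesis by blast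
qed

end
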